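(* Let $N\ge 1$ be an integer, let $1<p<\infty$ satisfy $\frac{2N}{N+2}<p<\infty$, let $0<\Lambda_0\le\Lambda_1<\infty$, and set $\varepsilon_0:=\frac{4}{N+2}$. There exists a constant $\mathbf{C}=\mathbf{C}(N,p,\Lambda_0,\Lambda_1)$, depending only on $N,p,\Lambda_0,\Lambda_1$, such that the following holds. Let $\Omega\subset\mathbb{R}^N$ be open, let $T>0$, and let $u$ be a non-negative weak solution of $$u_t-\operatorname{div}\mathcal{A}(x,t,\nabla u)=0\quad\text{in }\Omega\times(-T,T),$$ where $\mathcal{A}$ satisfies the structure conditions with exponent $p$ and constants $\Lambda_0,\Lambda_1$ (see context). Let $\sigma\in(0,1)$ and let $\rho,\theta\in(0,\infty)$ be such that $\overline{B_\rho}\times[-\theta,\theta]\subset\Omega\times(-T,T)$. Then $$\sup_{Q_{\sigma\rho,\sigma\theta}}u\;\le\;\max\left\{\mathbf{C}\,\frac{\mathbb{A}^{\frac{p(N+2)}{2(p(N+2)-2N)}}}{(1-\sigma)^{\frac{p(N+p)(N+2)}{2(p(N+2)-2N)}}}\left(\frac{1}{|Q_{\rho,\theta}|}\iint_{Q_{\rho,\theta}}|u|^{p+\varepsilon_0}\,dx\,dt\right)^{\frac{p(N+2)}{2(p(N+2)-2N)}},\;1\right\},$$ where $$\mathbb{A}:=\frac{\theta}{\rho^p}+\left(\frac{\rho^p}{\theta}\right)^{\frac{N}{p}}.$$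
   Context: Notation: $B_r\subset\mathbb{R}^N$ is the open ball of radius $r$ centered at the origin; $Q_{r,s}:=B_r\times[-s,s]$; $|Q_{r,s}|$ is its $(N+1)$-dimensional Lebesgue measure; $\sup$ denotes the essential supremum; non-negative means $u\ge 0$ a.e. Structure conditions: $\mathcal{A}:\Omega\times(-T,T)\times\mathbb{R}^N\to\mathbb{R}^N$ is such that $(x,t)\mapsto\mathcal{A}(x,t,\nabla u(x,t))$ is measurable and, for a.e. $(x,t)\in\Omega\times(-T,T)$, $$\langle\mathcal{A}(x,t,\nabla u),\nabla u\rangle\ge\Lambda_0|\nabla u|^p,\qquad|\mathcal{A}(x,t,\nabla u)|\le\Lambda_1|\nabla u|^{p-1}.$$ Steklov average: for $h\in(0,2T)$, $[v]_h(\cdot,t):=\frac1h\int_t^{t+h}v(\cdot,\tau)\,d\tau$ if $t\in(-T,T-h)$, and $[v]_h(\cdot,t):=0$ otherwise. Weak solution: $u\in C^0(-T,T;L^2_{\mathrm{loc}}(\Omega))\cap L^p(-T,T;W^{1,p}_{\mathrm{loc}}(\Omega))$ is a weak solution if for every $h\in(0,2T)$, every $\phi\in C_c^\infty(\Omega)$ and every $t\in(-T,T-h)$, $$\int_{\Omega\times\{t\}}\left\{\frac{d[u]_h}{dt}\,\phi+\langle[\mathcal{A}(x,t,\nabla u)]_h,\nabla\phi\rangle\right\}dx=0.$$ Here "loc" means that the corresponding property holds on every open set compactly contained in $\Omega$. *)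

theory Defs
  imports "HOL-Probability.Essential_Supremum"
begin

section \<open>Lebesgue spaces\<close>

text \<open>Intended for positive exponents only, so the value at infinity is infinity.\<close>

definition ennpowr :: "ennreal \<Rightarrow> real \<Rightarrow> ennreal" where
  "ennpowr x a = (if x = top then top else ennreal (enn2real x powr a))"

definition Lp_norm :: "real \<Rightarrow> 'a::euclidean_space set \<Rightarrow> ('a \<Rightarrow> 'b::real_normed_vector) \<Rightarrow> ennreal" where
  "Lp_norm p S f = ennpowr (\<integral>\<^sup>+ x. ennreal (norm (f x) powr p) \<partial>lebesgue_on S) (1 / p)"

definition Lp_space :: "real \<Rightarrow> 'a::euclidean_space set \<Rightarrow> ('a \<Rightarrow> 'b::real_normed_vector) set" where
  "Lp_space p S = {f \<in> borel_measurable (lebesgue_on S). Lp_norm p S f < top}"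

definition compactly_contained :: "'a::euclidean_space set \<Rightarrow> 'a set \<Rightarrow> bool"
    (infix \<open>\<subset>\<subset>\<close> 50) where
  "S \<subset>\<subset> \<Omega> \<longleftrightarrow> open S \<and> compact (closure S) \<and> closure S \<subseteq> \<Omega>"

section \<open>Test functions and weak gradients\<close>

definition partial_deriv :: "'n \<Rightarrow> (real ^ 'n::finite \<Rightarrow> real) \<Rightarrow> real ^ 'n \<Rightarrow> real" where
  "partial_deriv i f x = frechet_derivative f (at x) (axis i 1)"

definition grad :: "(real ^ 'n::finite \<Rightarrow> real) \<Rightarrow> real ^ 'n \<Rightarrow> real ^ 'n" where
  "grad f x = (\<chi> i. partial_deriv i f x)"

primrec C_k :: "nat \<Rightarrow> (real ^ 'n::finite \<Rightarrow> real) \<Rightarrow> bool" where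
  "C_k 0 f \<longleftrightarrow> continuous_on UNIV f"
| "C_k (Suc k) f \<longleftrightarrow> (\<forall>x. f differentiable (at x)) \<and> (\<forall>i. C_k k (partial_deriv i f))"

text \<open>Test functions on \<open>\<Omega>\<close> are extended by zero to the whole space.\<close>

definition test_functions :: "(real ^ 'n::finite) set \<Rightarrow> (real ^ 'n \<Rightarrow> real) set" where
  "test_functions \<Omega> = {\<phi>. (\<forall>k. C_k k \<phi>) \<and> compact (closure {x. \<phi> x \<noteq> 0})
                          \<and> closure {x. \<phi> x \<noteq> 0} \<subseteq> \<Omega>}"

definition locally_integrable :: "'a::euclidean_space set \<Rightarrow> ('a \<Rightarrow> 'b::{banach, second_countable_topology}) \<Rightarrow> bool" where
  "locally_integrable \<Omega> f \<longleftrightarrow> (\<forall>K. compact K \<and> K \<subseteq> \<Omega> \<longrightarrow> set_integrable lebesgue K f)"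

definition has_weak_gradient ::
    "(real ^ 'n::finite) set \<Rightarrow> (real ^ 'n \<Rightarrow> real) \<Rightarrow> (real ^ 'n \<Rightarrow> real ^ 'n) \<Rightarrow> bool" where
  "has_weak_gradient \<Omega> v g \<longleftrightarrow>
     locally_integrable \<Omega> v \<and> locally_integrable \<Omega> g \<and>
     (\<forall>\<phi> \<in> test_functions \<Omega>.
        (LINT x|lebesgue_on \<Omega>. v x *\<^sub>R grad \<phi> x) = - (LINT x|lebesgue_on \<Omega>. \<phi> x *\<^sub>R g x))"

text \<open>A Sobolev function \<open>v\<close> is represented by the map \<open>x \<mapsto> (v x, \<nabla>v x)\<close>, which is
  determined by \<open>v\<close> up to null sets.\<close>

definition sobolev_space :: "real \<Rightarrow> (real ^ 'n::finite) set \<Rightarrow> (real ^ 'n \<Rightarrow> real \<times> (real ^ 'n)) set" where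
  "sobolev_space p \<Omega> = {F. (\<lambda>x. fst (F x)) \<in> Lp_space p \<Omega> \<and> (\<lambda>x. snd (F x)) \<in> Lp_space p \<Omega>
                          \<and> has_weak_gradient \<Omega> (\<lambda>x. fst (F x)) (\<lambda>x. snd (F x))}"

definition sobolev_norm :: "real \<Rightarrow> (real ^ 'n::finite) set \<Rightarrow> (real ^ 'n \<Rightarrow> real \<times> (real ^ 'n)) \<Rightarrow> ennreal" where
  "sobolev_norm p \<Omega> F =
     ennpowr ((\<integral>\<^sup>+ x. ennreal (norm (fst (F x)) powr p) \<partial>lebesgue_on \<Omega>)
            + (\<integral>\<^sup>+ x. ennreal (norm (snd (F x)) powr p) \<partial>lebesgue_on \<Omega>)) (1 / p)"

section \<open>Functions of time with values in a function space\<close>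

text \<open>Here \<open>X\<close> is a space of functions (not of equivalence classes) and \<open>nrm\<close> its seminorm.
  Strong measurability is almost everywhere approximation by simple functions.\<close>

definition strongly_measurable ::
    "real set \<Rightarrow> ('a \<Rightarrow> 'b::real_normed_vector) set \<Rightarrow> (('a \<Rightarrow> 'b) \<Rightarrow> ennreal) \<Rightarrow> (real \<Rightarrow> 'a \<Rightarrow> 'b) \<Rightarrow> bool" where
  "strongly_measurable I X nrm f \<longleftrightarrow>
     (\<exists>s :: nat \<Rightarrow> real \<Rightarrow> 'a \<Rightarrow> 'b.
        (\<forall>k. finite (s k ` I) \<and> s k ` I \<subseteq> X \<and> (\<forall>y. {t \<in> I. s k t = y} \<in> sets lebesgue)) \<and>
        (AE t in lebesgue_on I. (\<lambda>k. nrm (\<lambda>x. s k t x - f t x)) \<longlonglongrightarrow> 0))"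

definition bochner_Lp ::
    "real \<Rightarrow> real set \<Rightarrow> ('a \<Rightarrow> 'b::real_normed_vector) set \<Rightarrow> (('a \<Rightarrow> 'b) \<Rightarrow> ennreal) \<Rightarrow> (real \<Rightarrow> 'a \<Rightarrow> 'b) set" where
  "bochner_Lp p I X nrm =
     {f. (AE t in lebesgue_on I. f t \<in> X) \<and> strongly_measurable I X nrm f \<and>
         (\<integral>\<^sup>+ t. ennpowr (nrm (f t)) p \<partial>lebesgue_on I) < top}"

definition in_C0_L2loc :: "'a::euclidean_space set \<Rightarrow> real \<Rightarrow> ('a \<Rightarrow> real \<Rightarrow> real) \<Rightarrow> bool" where
  "in_C0_L2loc \<Omega> T u \<longleftrightarrow>
     (\<forall>S. S \<subset>\<subset> \<Omega> \<longrightarrow> (\<forall>t \<in> {-T<..<T}.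
        (\<lambda>x. u x t) \<in> Lp_space 2 S \<and>
        ((\<lambda>s. Lp_norm 2 S (\<lambda>x. u x s - u x t)) \<longlongrightarrow> 0) (at t within {-T<..<T})))"

text \<open>Membership of \<open>u\<close> in the space \<open>L\<^sup>p(-T,T; W\<^sup>1\<^sup>,\<^sup>p\<^sub>l\<^sub>o\<^sub>c(\<Omega>))\<close>, with spatial gradient \<open>Du\<close>.\<close>

definition in_Lp_W1ploc ::
    "real \<Rightarrow> (real ^ 'n::finite) set \<Rightarrow> real \<Rightarrow> (real ^ 'n \<Rightarrow> real \<Rightarrow> real) \<Rightarrow> (real ^ 'n \<Rightarrow> real \<Rightarrow> real ^ 'n) \<Rightarrow> bool" where
  "in_Lp_W1ploc p \<Omega> T u Du \<longleftrightarrow>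
     (\<forall>S. S \<subset>\<subset> \<Omega> \<longrightarrow>
        (\<lambda>t x. (u x t, Du x t)) \<in> bochner_Lp p {-T<..<T} (sobolev_space p S) (sobolev_norm p S))"

section \<open>Parabolic equations\<close>

definition structure_conditions ::
    "(real ^ 'n::finite) set \<Rightarrow> real \<Rightarrow> real \<Rightarrow> real \<Rightarrow> real
      \<Rightarrow> (real ^ 'n \<Rightarrow> real \<Rightarrow> real ^ 'n \<Rightarrow> real ^ 'n) \<Rightarrow> (real ^ 'n \<Rightarrow> real \<Rightarrow> real ^ 'n) \<Rightarrow> bool" where
  "structure_conditions \<Omega> T p \<Lambda>\<^sub>0 \<Lambda>\<^sub>1 A Du \<longleftrightarrow>
     (\<lambda>(x, t). A x t (Du x t)) \<in> borel_measurable (lebesgue_on (\<Omega> \<times> {-T<..<T})) \<and>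
     (AE (x, t) in lebesgue_on (\<Omega> \<times> {-T<..<T}).
        A x t (Du x t) \<bullet> Du x t \<ge> \<Lambda>\<^sub>0 * norm (Du x t) powr p \<and>
        norm (A x t (Du x t)) \<le> \<Lambda>\<^sub>1 * norm (Du x t) powr (p - 1))"

definition steklov :: "real \<Rightarrow> real \<Rightarrow> ('a \<Rightarrow> real \<Rightarrow> 'b::{banach, second_countable_topology}) \<Rightarrow> 'a \<Rightarrow> real \<Rightarrow> 'b" where
  "steklov T h v x t =
     (if t \<in> {-T<..<T - h} then (1 / h) *\<^sub>R (LINT \<tau>|lebesgue_on {t..t + h}. v x \<tau>) else 0)"

text \<open>The weak formulation is required at every time \<open>t\<close>. For fixed \<open>t\<close> the pointwise time
  derivative of a Steklov average need not exist for almost every \<open>x\<close>, so the derivative is that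
  of a map from the time interval into \<open>L\<^sup>2\<^sub>l\<^sub>o\<^sub>c(\<Omega>)\<close>.\<close>

definition has_L2loc_time_derivative ::
    "'a::euclidean_space set \<Rightarrow> ('a \<Rightarrow> real \<Rightarrow> real) \<Rightarrow> ('a \<Rightarrow> real) \<Rightarrow> real \<Rightarrow> bool" where
  "has_L2loc_time_derivative \<Omega> v w t \<longleftrightarrow>
     (\<forall>S. S \<subset>\<subset> \<Omega> \<longrightarrow> w \<in> Lp_space 2 S \<and>
        ((\<lambda>s. Lp_norm 2 S (\<lambda>x. (v x s - v x t) / (s - t) - w x)) \<longlongrightarrow> 0) (at t))"

text \<open>Joint measurability of \<open>u\<close> and \<open>Du\<close> selects representatives for which the essential
  supremum, double integrals and Steklov averages make sense.\<close>

definition weak_solution ::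
    "(real ^ 'n::finite) set \<Rightarrow> real \<Rightarrow> real \<Rightarrow> (real ^ 'n \<Rightarrow> real \<Rightarrow> real ^ 'n \<Rightarrow> real ^ 'n)
      \<Rightarrow> (real ^ 'n \<Rightarrow> real \<Rightarrow> real) \<Rightarrow> (real ^ 'n \<Rightarrow> real \<Rightarrow> real ^ 'n) \<Rightarrow> bool" where
  "weak_solution \<Omega> T p A u Du \<longleftrightarrow>
     (\<lambda>(x, t). u x t) \<in> borel_measurable (lebesgue_on (\<Omega> \<times> {-T<..<T})) \<and>
     (\<lambda>(x, t). Du x t) \<in> borel_measurable (lebesgue_on (\<Omega> \<times> {-T<..<T})) \<and>
     in_C0_L2loc \<Omega> T u \<and> in_Lp_W1ploc p \<Omega> T u Du \<and>
     (\<forall>h \<in> {0<..<2 * T}. \<forall>\<phi> \<in> test_functions \<Omega>. \<forall>t \<in> {-T<..<T - h}.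
        \<exists>w. has_L2loc_time_derivative \<Omega> (steklov T h u) w t \<and>
            (LINT x|lebesgue_on \<Omega>.
               w x * \<phi> x + steklov T h (\<lambda>x \<tau>. A x \<tau> (Du x \<tau>)) x t \<bullet> grad \<phi> x) = 0)"

definition cylinder :: "real \<Rightarrow> real \<Rightarrow> ('a::euclidean_space \<times> real) set" where
  "cylinder r s = ball 0 r \<times> {-s..s}"

end

theory Submission
  imports Defs
begin

text \<open>The proof is De Giorgi's iteration on the truncations \<open>(u - k)\<^sup>+\<close>, run with the exponent
  \<open>r = p + 4 / (N + 2)\<close>. It lies above \<open>p\<close> and, because \<open>p > 2 N / (N + 2)\<close>, also above \<open>2\<close> and below
  the parabolic Sobolev exponent \<open>q = p + 2 p / N\<close>.

  A weak solution is differentiable in time only after averaging, and its gradient is only a weak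
  gradient. Both defects disappear under convolution with the product of the uniform density on a
  time interval \<open>[0, e]\<close> and a smooth bump in space: time averages are Steklov averages and
  translates of the bump are test functions, so the equation holds pointwise for the mollified
  solution and the mollified flux (\<open>dt_U\<close>, \<open>grad_U\<close>). Testing with a truncation times a power of a
  cutoff is then a calculation with continuously differentiable functions (\<open>energy_identity\<close>). The
  structure conditions are nonlinear and do not survive mollification. They enter after the limit
  \<open>e \<rightarrow> 0\<close> has been taken in the energy density (\<open>energy_density_bound\<close>). That limit is justified
  because, by Jensen's inequality, all terms are dominated by mollifications of one fixed integrable
  function, and these converge in \<open>L\<^sup>1\<close> by continuity of translations.

  With \<open>v\<close> a truncation times a power of a cutoff, the energy inequality bounds the integral of \<open>v\<^sup>2\<close>
  over every time slice of an approximation and the space-time integral of \<open>|\<nabla>v|\<^sup>p\<close>. On each slice a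
  Gagliardo--Nirenberg inequality of weak type turns this into a bound for the measure of
  \<open>{|v| > l}\<close> of order \<open>l\<close> to the power \<open>-q\<close> (\<open>weak_gagliardo_nirenberg\<close>, \<open>level_set_estimate\<close>). The
  weak type inequality has a short proof by averaging over balls, and it is as good as the strong one
  here: since \<open>r < q\<close>, integrating over the levels gives the full \<open>L\<^sup>r\<close> norm
  (\<open>powr_integral_of_weak_type\<close>).

  In the iteration the levels increase to \<open>k \<ge> 1\<close> while the cylinders shrink, both geometrically. As
  \<open>k \<ge> 1\<close>, the gap between consecutive levels is at least a power of \<open>1 / 2\<close>, so the energies with
  exponents \<open>p\<close> and \<open>2\<close> are controlled by the one with exponent \<open>r\<close>; this is where the bound \<open>1\<close> in the
  maximum comes from. Writing \<open>Y\<^sub>n\<close> for the integrals of the \<open>r\<close>-th powers, one step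
  (\<open>de_giorgi_step\<close>) gives
  \<open>Y\<^sub>n\<^sub>+\<^sub>1 \<le> C B\<^sup>n k powr (- \<beta> / \<alpha>) H powr (\<beta> (N + p) / p) Y\<^sub>n powr (1 + \<beta>)\<close>
  with \<open>\<beta> = r / (N + 2)\<close>, \<open>\<alpha> = p (N + 2) / (2 (p (N + 2) - 2 N))\<close> and
  \<open>H = (1 - \<sigma>) powr (- p) (\<rho> powr (- p) + 1 / \<theta>)\<close>. The sequence tends to zero, that is \<open>u \<le> k\<close> on the inner
  cylinder, as soon as \<open>k powr (1 / \<alpha>)\<close> exceeds a constant times \<open>H powr ((N + p) / p) Y\<^sub>0\<close>
  (\<open>de_giorgi_iteration\<close>). This explains the exponent \<open>\<alpha>\<close> of the mean value in the theorem, and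
  \<open>intrinsic_factor_le\<close> compares \<open>H powr ((N + p) / p)\<close> times the measure of the cylinder with
  \<open>\<theta> / \<rho>\<^sup>p + (\<rho>\<^sup>p / \<theta>) powr (N / p)\<close>.\<close>

section \<open>Continuity of translations\<close>

lemma nn_integral_lborel_translate:
  fixes f :: "'a::euclidean_space \<Rightarrow> ennreal"
  assumes [measurable]: "f \<in> borel_measurable borel"
  shows "(\<integral>\<^sup>+x. f (x + a) \<partial>lborel) = (\<integral>\<^sup>+x. f x \<partial>lborel)"
proof -
  have "(\<integral>\<^sup>+x. f x \<partial>lborel) = (\<integral>\<^sup>+x. f x \<partial>(distr lborel borel ((+) a)))"
    by (simp add: lborel_distr_plus)
  also have "\<dots> = (\<integral>\<^sup>+x. f (x + a) \<partial>lborel)"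
    by (subst nn_integral_distr) (auto simp: add.commute)
  finally show ?thesis by simp
qed

lemma integrable_lborel_translate:
  fixes f :: "'a::euclidean_space \<Rightarrow> 'b::{banach, second_countable_topology}"
  assumes "integrable lborel f"
  shows "integrable lborel (\<lambda>x. f (x + a))"
proof -
  have "integrable (distr lborel borel ((+) a)) f"
    using assms by (simp add: lborel_distr_plus)
  then show ?thesis
    by (subst (asm) integrable_distr_eq) (use assms in \<open>auto simp: add.commute\<close>)
qed

lemma integral_lborel_translate:
  fixes f :: "'a::euclidean_space \<Rightarrow> 'b::{banach, second_countable_topology}"
  assumes [measurable]: "f \<in> borel_measurable borel"
  shows "(\<integral>x. f (x + a) \<partial>lborel) = (\<integral>x. f x \<partial>lborel)"
proof -
  have "(\<integral>x. f x \<partial>lborel) = (\<integral>x. f x \<partial>(distr lborel borel ((+) a)))"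
    by (simp add: lborel_distr_plus)
  also have "\<dots> = (\<integral>x. f (x + a) \<partial>lborel)"
    by (subst integral_distr) (auto simp: add.commute)
  finally show ?thesis by simp
qed

text \<open>By regularity the set lies between a compact and an open set of nearly equal measure. A shift
  shorter than their distance keeps the compact set inside the open one, so the two indicators can
  only differ on the thin region between them or on its translate.\<close>

lemma translation_continuous_indicator:
  fixes A :: "'a::euclidean_space set"
  assumes A: "A \<in> sets borel" and e: "0 < e" and fin: "emeasure lborel A < \<infinity>"
  shows "\<exists>d>0. \<forall>z. norm z < d \<longrightarrow>
     (\<integral>\<^sup>+x. ennreal \<bar>indicator A (x + z) - indicator A x\<bar> \<partial>lborel) \<le> ennreal e"
proof -
  obtain U where U: "open U" "A \<subseteq> U" "emeasure lborel (U - A) < ennreal (e/4)"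
    using outer_regular_lborel[OF A, of "e/4"] e by auto
  have "A \<in> sets lebesgue" using A by simp
  moreover have "0 < e/8" using e by simp
  ultimately obtain F where F: "closed F" "F \<subseteq> A" "emeasure lebesgue (A - F) < ennreal (e/8)"
    using sets_lebesgue_inner_closed by metis
  have [measurable]: "F \<in> sets borel" "U \<in> sets borel" "A \<in> sets borel" using F U A by auto
  \<comment> \<open>bounded, hence compact, subsets of \<open>F\<close> exhaust \<open>A\<close> up to a small error\<close>
  define B where "B n = F - ball 0 (real n)" for n
  have [measurable]: "B n \<in> sets borel" for n by (auto simp: B_def)
  have "(\<lambda>n. emeasure lborel (B n)) \<longlonglongrightarrow> emeasure lborel (\<Inter>n. B n)"
  proof (rule Lim_emeasure_decseq)
    show "decseq B" unfolding B_def decseq_def by auto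
    show "emeasure lborel (B i) \<noteq> \<infinity>" for i
    proof -
      have "emeasure lborel (B i) \<le> emeasure lborel A" by (rule emeasure_mono) (auto simp: B_def F(2)[THEN subsetD])
      then show ?thesis using fin by (auto simp: top_unique)
    qed
  qed (auto simp: B_def)
  moreover have "(\<Inter>n. B n) = {}"
    using reals_Archimedean2 by (fastforce simp: B_def)
  ultimately have "(\<lambda>n. emeasure lborel (B n)) \<longlonglongrightarrow> 0" by simp
  then have "eventually (\<lambda>n. emeasure lborel (B n) < ennreal (e/8)) sequentially"
    by (rule order_tendstoD) (use e in auto)
  then obtain n where n: "emeasure lborel (B n) < ennreal (e/8)"
    by (auto simp: eventually_sequentially)
  define K where "K = F \<inter> cball 0 (real n)"
  have K: "compact K" "K \<subseteq> A" using F by (auto simp: K_def closed_Int_compact)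
  have [measurable]: "K \<in> sets borel" using F by (auto simp: K_def)
  have "emeasure lborel (A - K) \<le> emeasure lborel ((A - F) \<union> B n)"
    by (rule emeasure_mono) (auto simp: K_def B_def)
  also have "\<dots> \<le> emeasure lborel (A - F) + emeasure lborel (B n)"
    by (rule emeasure_subadditive) auto
  also have "\<dots> \<le> ennreal (e/8) + ennreal (e/8)"
    using n F(3) by (intro add_mono) auto
  also have "\<dots> = ennreal (e/4)" using e by (subst ennreal_plus[symmetric]) auto
  finally have AK: "emeasure lborel (A - K) \<le> ennreal (e/4)" .
  have "emeasure lborel (U - K) \<le> emeasure lborel ((U - A) \<union> (A - K))"
    by (rule emeasure_mono) auto
  also have "\<dots> \<le> emeasure lborel (U - A) + emeasure lborel (A - K)"
    by (rule emeasure_subadditive) auto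
  also have "\<dots> \<le> ennreal (e/4) + ennreal (e/4)" using AK U(3) by (intro add_mono) auto
  also have "\<dots> = ennreal (e/2)" using e by (subst ennreal_plus[symmetric]) auto
  finally have UK: "emeasure lborel (U - K) \<le> ennreal (e/2)" .
  obtain d where d: "d > 0" "\<And>x. x \<in> K \<Longrightarrow> ball x d \<subseteq> U"
  proof -
    have "K \<subseteq> U" using K U by auto
    then show thesis using compact_subset_open_imp_ball_epsilon_subset[OF K(1) U(1)] that
      by (smt (verit) UN_subset_iff)
  qed
  have "(\<integral>\<^sup>+x. ennreal \<bar>indicator A (x + z) - indicator A x\<bar> \<partial>lborel) \<le> ennreal e" if z: "norm z < d" for z
  proof -
    have pt: "ennreal \<bar>indicator A (x + z) - indicator A x\<bar> \<le> indicator (U - K) x + indicator (U - K) (x + z)" for x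
    proof -
      have 1: "x \<in> K \<Longrightarrow> x + z \<in> U" using d(2)[of x] z by (auto simp: dist_norm)
      have 2: "x + z \<in> K \<Longrightarrow> x \<in> U" using d(2)[of "x + z"] z by (auto simp: dist_norm)
      show ?thesis using 1 2 K U by (auto simp: indicator_def)
    qed
    have "(\<integral>\<^sup>+x. ennreal \<bar>indicator A (x + z) - indicator A x\<bar> \<partial>lborel)
       \<le> (\<integral>\<^sup>+x. indicator (U - K) x + indicator (U - K) (x + z) \<partial>lborel)"
      by (intro nn_integral_mono pt)
    also have "\<dots> = (\<integral>\<^sup>+x. indicator (U - K) x \<partial>lborel) + (\<integral>\<^sup>+x. indicator (U - K) (x + z) \<partial>lborel)"
      by (rule nn_integral_add) auto
    also have "(\<integral>\<^sup>+x. indicator (U - K) (x + z) \<partial>lborel) = (\<integral>\<^sup>+x. indicator (U - K) x \<partial>lborel :: ennreal)"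
      by (rule nn_integral_lborel_translate) auto
    also have "(\<integral>\<^sup>+x. indicator (U - K) x \<partial>lborel) = emeasure lborel (U - K)"
      by (rule nn_integral_indicator) auto
    also have "emeasure lborel (U - K) + emeasure lborel (U - K) \<le> ennreal (e/2) + ennreal (e/2)"
      by (intro add_mono UK)
    also have "\<dots> = ennreal e" using e by (subst ennreal_plus[symmetric]) auto
    finally show ?thesis .
  qed
  then show ?thesis using d(1) by blast
qed

text \<open>Indicators generate all integrable functions, and the property passes to sums and, translation
  being an isometry of \<open>L\<^sup>1\<close>, to \<open>L\<^sup>1\<close> limits.\<close>

proposition translation_continuous_L1:
  fixes f :: "'a::euclidean_space \<Rightarrow> 'b::{banach, second_countable_topology}"
  assumes "integrable lborel f" and "0 < e"
  shows "\<exists>d>0. \<forall>z. norm z < d \<longrightarrow> (\<integral>\<^sup>+x. ennreal (norm (f (x + z) - f x)) \<partial>lborel) \<le> ennreal e"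
  using assms
proof (induction arbitrary: e rule: integrable_induct)
  case (base A c)
  have A[measurable]: "A \<in> sets borel" using base by simp
  have e': "0 < e / (norm c + 1)" using base(3) by (smt (verit) divide_pos_pos norm_ge_zero)
  from translation_continuous_indicator[OF A e' base(2)]
  obtain d where d: "d > 0" "\<And>z. norm z < d \<Longrightarrow>
     (\<integral>\<^sup>+x. ennreal \<bar>indicator A (x + z) - indicator A x\<bar> \<partial>lborel) \<le> ennreal (e / (norm c + 1))"
    by auto
  have "(\<integral>\<^sup>+x. ennreal (norm (indicator A (x + z) *\<^sub>R c - indicator A x *\<^sub>R c)) \<partial>lborel) \<le> ennreal e" if "norm z < d" for z
  proof -
    have "(\<integral>\<^sup>+x. ennreal (norm (indicator A (x + z) *\<^sub>R c - indicator A x *\<^sub>R c)) \<partial>lborel)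
       = (\<integral>\<^sup>+x. ennreal (norm c) * ennreal \<bar>indicator A (x + z) - indicator A x\<bar> \<partial>lborel)"
      by (intro nn_integral_cong) (simp add: scaleR_diff_left[symmetric] ennreal_mult'[symmetric] mult.commute)
    also have "\<dots> = ennreal (norm c) * (\<integral>\<^sup>+x. ennreal \<bar>indicator A (x + z) - indicator A x\<bar> \<partial>lborel)"
      using A by (intro nn_integral_cmult) measurable
    also have "\<dots> \<le> ennreal (norm c) * ennreal (e / (norm c + 1))"
      by (intro mult_left_mono d that) auto
    also have "\<dots> = ennreal (norm c * (e / (norm c + 1)))"
      by (rule ennreal_mult[symmetric]) (use e' in auto)
    also have "\<dots> \<le> ennreal e"
    proof (rule ennreal_leI)
      have "norm c * e \<le> e * (norm c + 1)" using base(3) by (simp add: algebra_simps)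
      then show "norm c * (e / (norm c + 1)) \<le> e"
        by (smt (verit) e' divide_le_eq norm_ge_zero times_divide_eq_right)
    qed
    finally show ?thesis .
  qed
  then show ?case using d(1) by blast
next
  case (add f g)
  note [measurable] = borel_measurable_integrable[OF add.hyps(1)] borel_measurable_integrable[OF add.hyps(2)]
  have [measurable]: "f \<in> borel_measurable borel" "g \<in> borel_measurable borel"
    using add.hyps by (auto dest!: borel_measurable_integrable)
  have e2: "0 < e/2" using add.prems by simp
  from add.IH(1)[OF e2] obtain d where d1: "d > 0"
    "\<And>z. norm z < d \<Longrightarrow> (\<integral>\<^sup>+x. ennreal (norm (f (x + z) - f x)) \<partial>lborel) \<le> ennreal (e/2)"
    by blast
  from add.IH(2)[OF e2] obtain d' where d2: "d' > 0"
    "\<And>z. norm z < d' \<Longrightarrow> (\<integral>\<^sup>+x. ennreal (norm (g (x + z) - g x)) \<partial>lborel) \<le> ennreal (e/2)"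
    by blast
  note d = d1 d2
  have "(\<integral>\<^sup>+x. ennreal (norm ((f (x + z) + g (x + z)) - (f x + g x))) \<partial>lborel) \<le> ennreal e" if z: "norm z < min d d'" for z
  proof -
    have "(\<integral>\<^sup>+x. ennreal (norm ((f (x + z) + g (x + z)) - (f x + g x))) \<partial>lborel)
       \<le> (\<integral>\<^sup>+x. ennreal (norm (f (x + z) - f x)) + ennreal (norm (g (x + z) - g x)) \<partial>lborel)"
    proof (intro nn_integral_mono)
      fix x
      have "norm ((f (x + z) + g (x + z)) - (f x + g x)) \<le> norm (f (x + z) - f x) + norm (g (x + z) - g x)"
        by (metis add_diff_add norm_triangle_ineq)
      then show "ennreal (norm ((f (x + z) + g (x + z)) - (f x + g x))) \<le> ennreal (norm (f (x + z) - f x)) + ennreal (norm (g (x + z) - g x))"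
        by (simp add: ennreal_plus[symmetric] del: ennreal_plus)
    qed
    also have "\<dots> = (\<integral>\<^sup>+x. ennreal (norm (f (x + z) - f x)) \<partial>lborel) + (\<integral>\<^sup>+x. ennreal (norm (g (x + z) - g x)) \<partial>lborel)"
      by (rule nn_integral_add) measurable
    also have "\<dots> \<le> ennreal (e/2) + ennreal (e/2)" using z by (intro add_mono d) auto
    also have "\<dots> = ennreal e" using add.prems by (subst ennreal_plus[symmetric]) auto
    finally show ?thesis .
  qed
  then show ?case using d1(1) d2(1) by (intro exI[of _ "min d d'"]) auto
next
  case (lim f s)
  have [measurable]: "f \<in> borel_measurable borel" "\<And>i. s i \<in> borel_measurable borel"
    using lim.hyps by (auto dest!: borel_measurable_integrable)
  have "(\<lambda>i. \<integral>\<^sup>+x. ennreal (norm (f x - s i x)) \<partial>lborel) \<longlonglongrightarrow> 0"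
  proof (rule nn_integral_dominated_convergence_norm[where w="\<lambda>x. 2 * norm (f x)"])
    show "(\<integral>\<^sup>+x. ennreal (2 * norm (f x)) \<partial>lborel) < \<infinity>"
      using integrable_norm[OF lim.hyps(4)]
      by (subst nn_integral_eq_integral) auto
  qed (use lim.hyps in auto)
  moreover have e3: "0 < e/3" using lim.prems by simp
  ultimately have "eventually (\<lambda>i. (\<integral>\<^sup>+x. ennreal (norm (f x - s i x)) \<partial>lborel) < ennreal (e/3)) sequentially"
    by (intro order_tendstoD) auto
  then obtain i where i: "(\<integral>\<^sup>+x. ennreal (norm (f x - s i x)) \<partial>lborel) < ennreal (e/3)"
    by (auto simp: eventually_sequentially)
  from lim.IH[OF e3, of i] obtain d where d: "d > 0"
    "\<And>z. norm z < d \<Longrightarrow> (\<integral>\<^sup>+x. ennreal (norm (s i (x + z) - s i x)) \<partial>lborel) \<le> ennreal (e/3)" by auto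
  have "(\<integral>\<^sup>+x. ennreal (norm (f (x + z) - f x)) \<partial>lborel) \<le> ennreal e" if z: "norm z < d" for z
  proof -
    have "(\<integral>\<^sup>+x. ennreal (norm (f (x + z) - f x)) \<partial>lborel)
       \<le> (\<integral>\<^sup>+x. ennreal (norm (f (x + z) - s i (x + z))) + (ennreal (norm (s i (x + z) - s i x)) + ennreal (norm (f x - s i x))) \<partial>lborel)"
    proof (intro nn_integral_mono)
      fix x
      have "f (x + z) - f x = (f (x + z) - s i (x + z)) + ((s i (x + z) - s i x) - (f x - s i x))" by simp
      then have "norm (f (x + z) - f x) \<le> norm (f (x + z) - s i (x + z)) + norm ((s i (x + z) - s i x) - (f x - s i x))"
        by (metis norm_triangle_ineq)
      then have "norm (f (x + z) - f x) \<le> norm (f (x + z) - s i (x + z)) + (norm (s i (x + z) - s i x) + norm (f x - s i x))"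
        using norm_triangle_ineq4[of "s i (x + z) - s i x" "f x - s i x"] by linarith
      then show "ennreal (norm (f (x + z) - f x)) \<le> ennreal (norm (f (x + z) - s i (x + z))) + (ennreal (norm (s i (x + z) - s i x)) + ennreal (norm (f x - s i x)))"
        by (simp add: ennreal_plus[symmetric] del: ennreal_plus)
    qed
    also have "\<dots> = (\<integral>\<^sup>+x. ennreal (norm (f (x + z) - s i (x + z))) \<partial>lborel) + ((\<integral>\<^sup>+x. ennreal (norm (s i (x + z) - s i x)) \<partial>lborel) + (\<integral>\<^sup>+x. ennreal (norm (f x - s i x)) \<partial>lborel))"
      by (subst nn_integral_add; (subst nn_integral_add)?; measurable)
    also have "(\<integral>\<^sup>+x. ennreal (norm (f (x + z) - s i (x + z))) \<partial>lborel) = (\<integral>\<^sup>+x. ennreal (norm (f x - s i x)) \<partial>lborel)"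
      using nn_integral_lborel_translate[of "\<lambda>x. ennreal (norm (f x - s i x))" z] by simp
    also have "(\<integral>\<^sup>+x. ennreal (norm (f x - s i x)) \<partial>lborel) + ((\<integral>\<^sup>+x. ennreal (norm (s i (x + z) - s i x)) \<partial>lborel) + (\<integral>\<^sup>+x. ennreal (norm (f x - s i x)) \<partial>lborel)) \<le> ennreal (e/3) + (ennreal (e/3) + ennreal (e/3))"
      using i z by (intro add_mono d) auto
    also have "\<dots> = ennreal e" using lim.prems by (simp add: ennreal_plus[symmetric] del: ennreal_plus)
    finally show ?thesis .
  qed
  then show ?case using d(1) by blast
qed

section \<open>Mollification\<close>

text \<open>The average looks forward, over points \<open>w + \<xi>\<close> instead of \<open>\<xi> - w\<close>, so that a kernel which is uniform on
  \<open>[0, h]\<close> in time produces exactly the Steklov average.\<close>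

definition mollify :: "('a::euclidean_space \<Rightarrow> real) \<Rightarrow> ('a \<Rightarrow> 'b) \<Rightarrow> 'a \<Rightarrow> 'b::{banach, second_countable_topology}" where
  "mollify K f \<xi> = (\<integral>w. K w *\<^sub>R f (w + \<xi>) \<partial>lborel)"

text \<open>A probability density supported in the ball of radius \<open>\<delta>\<close>. It is bounded but need not be
  continuous: the time factor of the kernel below jumps.\<close>

definition mollifier :: "real \<Rightarrow> ('a::euclidean_space \<Rightarrow> real) \<Rightarrow> bool" where
  "mollifier \<delta> K \<longleftrightarrow> K \<in> borel_measurable borel \<and> (\<forall>w. 0 \<le> K w) \<and> (\<exists>M. \<forall>w. K w \<le> M) \<and>
     (\<forall>w. \<delta> \<le> norm w \<longrightarrow> K w = 0) \<and> (\<integral>\<^sup>+w. ennreal (K w) \<partial>lborel) = 1"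

lemma integrable_bounded_scaleR:
  fixes f :: "'a::euclidean_space \<Rightarrow> 'b::{banach, second_countable_topology}"
  assumes "integrable lborel f" and [measurable]: "K \<in> borel_measurable borel" and K: "\<And>w. \<bar>K w\<bar> \<le> M"
  shows "integrable lborel (\<lambda>w. K w *\<^sub>R f w)"
proof (rule Bochner_Integration.integrable_bound)
  show "integrable lborel (\<lambda>w. M * norm (f w))" using assms(1) by simp
  show "(\<lambda>w. K w *\<^sub>R f w) \<in> borel_measurable lborel"
    using borel_measurable_integrable[OF assms(1)] by measurable
  show "AE w in lborel. norm (K w *\<^sub>R f w) \<le> norm (M * norm (f w))"
  proof (rule AE_I2)
    fix w
    have "\<bar>K w\<bar> * norm (f w) \<le> M * norm (f w)" by (intro mult_right_mono K) auto
    then show "norm (K w *\<^sub>R f w) \<le> norm (M * norm (f w))" by simp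
  qed
qed

lemma mollify_eq_shifted_kernel:
  assumes [measurable]: "f \<in> borel_measurable borel" "K \<in> borel_measurable borel"
  shows "mollify K f \<xi> = (\<integral>w. K (w - \<xi>) *\<^sub>R f w \<partial>lborel)"
  unfolding mollify_def
  using integral_lborel_translate[of "\<lambda>w. K (w - \<xi>) *\<^sub>R f w" \<xi>] by simp

lemma integrable_mollify_integrand:
  fixes f :: "'a::euclidean_space \<Rightarrow> 'b::{banach, second_countable_topology}"
  assumes f: "integrable lborel f" and K: "mollifier \<delta> K"
  shows "integrable lborel (\<lambda>w. K w *\<^sub>R f (w + \<xi>))"
proof -
  obtain M where M: "\<And>w. K w \<le> M" using K by (auto simp: mollifier_def)
  show ?thesis
    by (rule integrable_bounded_scaleR[where M=M, OF integrable_lborel_translate[OF f]])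
      (use K M in \<open>auto simp: mollifier_def\<close>)
qed

lemma integrable_mollifier: "mollifier \<delta> K \<Longrightarrow> integrable lborel K"
  by (rule integrableI_bounded) (auto simp: mollifier_def)

lemma integral_mollifier:
  assumes "mollifier \<delta> K" shows "(\<integral>w. K w \<partial>lborel) = 1"
  using assms by (subst integral_eq_nn_integral) (auto simp: mollifier_def)

text \<open>Continuity is inherited from translations of \<open>f\<close>, the kernel being merely bounded.\<close>

lemma mollify_continuous:
  fixes f :: "'a::euclidean_space \<Rightarrow> 'b::{banach, second_countable_topology}"
  assumes f: "integrable lborel f" and K: "K \<in> borel_measurable borel" "\<And>w. \<bar>K w\<bar> \<le> M"
  shows "continuous_on UNIV (mollify K f)"
  unfolding continuous_on_iff
proof (intro ballI allI impI)
  fix x :: 'a and e :: real assume e: "0 < e"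
  note [measurable] = K(1)
  have [measurable]: "f \<in> borel_measurable borel" using f by auto
  have M: "0 \<le> M" using K(2)[of 0] by linarith
  have e': "0 < e / (2 * (M + 1))" using e M by simp
  from translation_continuous_L1[OF f e'] obtain d where d: "d > 0"
    "\<And>z. norm z < d \<Longrightarrow> (\<integral>\<^sup>+x. ennreal (norm (f (x + z) - f x)) \<partial>lborel) \<le> ennreal (e / (2 * (M + 1)))"
    by blast
  have "dist (mollify K f x') (mollify K f x) < e" if "dist x' x < d" for x'
  proof -
    have i: "integrable lborel (\<lambda>w. K w *\<^sub>R f (w + y))" for y
      by (intro integrable_bounded_scaleR[where M=M] integrable_lborel_translate f K)
    have "mollify K f x' - mollify K f x = (\<integral>w. K w *\<^sub>R f (w + x') - K w *\<^sub>R f (w + x) \<partial>lborel)"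
      unfolding mollify_def by (rule Bochner_Integration.integral_diff[symmetric]) (rule i)+
    then have "ennreal (norm (mollify K f x' - mollify K f x)) \<le> (\<integral>\<^sup>+w. ennreal (norm (K w *\<^sub>R f (w + x') - K w *\<^sub>R f (w + x))) \<partial>lborel)"
      using integral_norm_bound_ennreal[OF Bochner_Integration.integrable_diff[OF i[of x'] i[of x]]] by simp
    also have "\<dots> \<le> (\<integral>\<^sup>+w. ennreal M * ennreal (norm (f (w + x') - f (w + x))) \<partial>lborel)"
    proof (intro nn_integral_mono)
      fix w
      have "norm (K w *\<^sub>R f (w + x') - K w *\<^sub>R f (w + x)) = \<bar>K w\<bar> * norm (f (w + x') - f (w + x))"
        by (simp add: scaleR_diff_right[symmetric])
      also have "\<dots> \<le> M * norm (f (w + x') - f (w + x))" by (intro mult_right_mono K) auto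
      finally show "ennreal (norm (K w *\<^sub>R f (w + x') - K w *\<^sub>R f (w + x))) \<le> ennreal M * ennreal (norm (f (w + x') - f (w + x)))"
        using M by (simp add: ennreal_mult[symmetric] ennreal_leI)
    qed
    also have "\<dots> = ennreal M * (\<integral>\<^sup>+w. ennreal (norm (f (w + x') - f (w + x))) \<partial>lborel)"
      by (rule nn_integral_cmult) measurable
    also have "(\<integral>\<^sup>+w. ennreal (norm (f (w + x') - f (w + x))) \<partial>lborel) = (\<integral>\<^sup>+w. ennreal (norm (f (w + (x' - x)) - f w)) \<partial>lborel)"
      using nn_integral_lborel_translate[of "\<lambda>w. ennreal (norm (f (w + (x' - x)) - f w))" x] by (simp add: algebra_simps)
    also have "ennreal M * \<dots> \<le> ennreal M * ennreal (e / (2 * (M + 1)))"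
      by (intro mult_left_mono d(2)) (use that in \<open>auto simp: dist_norm\<close>)
    also have "\<dots> = ennreal (M * (e / (2 * (M + 1))))" using M by (subst ennreal_mult) (use e in auto)
    finally have "norm (mollify K f x' - mollify K f x) \<le> M * (e / (2 * (M + 1)))"
      by (subst (asm) ennreal_le_iff) (use M e in auto)
    also have "\<dots> < e"
    proof -
      have "M * e < e * (2 * (M + 1))" using M e by (simp add: algebra_simps add_nonneg_pos)
      then show ?thesis using M by (simp add: divide_less_eq)
    qed
    finally show ?thesis by (simp add: dist_norm)
  qed
  then show "\<exists>d>0. \<forall>x'\<in>UNIV. dist x' x < d \<longrightarrow> dist (mollify K f x') (mollify K f x) < e" using d(1) by auto
qed

lemma borel_measurable_mollify:
  fixes f :: "'a::euclidean_space \<Rightarrow> 'b::{banach, second_countable_topology}"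
  assumes f: "integrable lborel f" and K: "mollifier \<delta> K"
  shows "mollify K f \<in> borel_measurable borel"
proof -
  obtain M where "\<And>w. \<bar>K w\<bar> \<le> M" using K by (auto simp: mollifier_def)
  then show ?thesis
    using mollify_continuous[OF f, of K M] K by (auto simp: mollifier_def intro: borel_measurable_continuous_onI)
qed

text \<open>The mollification error is an average, with weights \<open>K\<close>, of the errors made by translations
  of length less than \<open>\<delta>\<close>.\<close>

proposition mollify_L1_error:
  fixes f :: "'a::euclidean_space \<Rightarrow> 'b::{banach, second_countable_topology}"
  assumes f: "integrable lborel f" and K: "mollifier \<delta> K"
    and d: "\<And>z. norm z < \<delta> \<Longrightarrow> (\<integral>\<^sup>+x. ennreal (norm (f (x + z) - f x)) \<partial>lborel) \<le> ennreal e"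
  shows "(\<integral>\<^sup>+x. ennreal (norm (mollify K f x - f x)) \<partial>lborel) \<le> ennreal e"
proof -
  have [measurable]: "f \<in> borel_measurable borel" "K \<in> borel_measurable borel" using f K by (auto simp: mollifier_def)
  have K0: "\<And>w. 0 \<le> K w" using K by (auto simp: mollifier_def)
  have [measurable]: "mollify K f \<in> borel_measurable borel" by (rule borel_measurable_mollify[OF f K])
  have "(\<integral>\<^sup>+x. ennreal (norm (mollify K f x - f x)) \<partial>lborel)
     \<le> (\<integral>\<^sup>+x. (\<integral>\<^sup>+w. ennreal (K w) * ennreal (norm (f (x + w) - f x)) \<partial>lborel) \<partial>lborel)"
  proof (intro nn_integral_mono)
    fix x
    have i: "integrable lborel (\<lambda>w. K w *\<^sub>R f (w + x))" by (rule integrable_mollify_integrand[OF f K])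
    have i2: "integrable lborel (\<lambda>w. K w *\<^sub>R f x)" using integrable_mollifier[OF K] by simp
    have "mollify K f x - f x = (\<integral>w. K w *\<^sub>R f (w + x) - K w *\<^sub>R f x \<partial>lborel)"
      unfolding mollify_def
      by (subst Bochner_Integration.integral_diff[OF i i2]) (use integrable_mollifier[OF K] integral_mollifier[OF K] in auto)
    then have "ennreal (norm (mollify K f x - f x)) \<le> (\<integral>\<^sup>+w. ennreal (norm (K w *\<^sub>R f (w + x) - K w *\<^sub>R f x)) \<partial>lborel)"
      using integral_norm_bound_ennreal[OF Bochner_Integration.integrable_diff[OF i i2]] by simp
    also have "\<dots> = (\<integral>\<^sup>+w. ennreal (K w) * ennreal (norm (f (x + w) - f x)) \<partial>lborel)"
    proof (intro nn_integral_cong)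
      fix w
      have "norm (K w *\<^sub>R f (w + x) - K w *\<^sub>R f x) = K w * norm (f (x + w) - f x)"
        using K0[of w] by (simp add: scaleR_diff_right[symmetric] add.commute)
      then show "ennreal (norm (K w *\<^sub>R f (w + x) - K w *\<^sub>R f x)) = ennreal (K w) * ennreal (norm (f (x + w) - f x))"
        using K0[of w] by (simp add: ennreal_mult)
    qed
    finally show "ennreal (norm (mollify K f x - f x)) \<le> (\<integral>\<^sup>+w. ennreal (K w) * ennreal (norm (f (x + w) - f x)) \<partial>lborel)" .
  qed
  also have "\<dots> = (\<integral>\<^sup>+w. (\<integral>\<^sup>+x. ennreal (K w) * ennreal (norm (f (x + w) - f x)) \<partial>lborel) \<partial>lborel)"
    by (rule lborel_pair.Fubini') measurable
  also have "\<dots> = (\<integral>\<^sup>+w. ennreal (K w) * (\<integral>\<^sup>+x. ennreal (norm (f (x + w) - f x)) \<partial>lborel) \<partial>lborel)"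
    by (intro nn_integral_cong nn_integral_cmult) measurable
  also have "\<dots> \<le> (\<integral>\<^sup>+w. ennreal (K w) * ennreal e \<partial>lborel)"
  proof (intro nn_integral_mono)
    fix w :: 'a
    show "ennreal (K w) * (\<integral>\<^sup>+x. ennreal (norm (f (x + w) - f x)) \<partial>lborel) \<le> ennreal (K w) * ennreal e"
    proof (cases "norm w < \<delta>")
      case True then show ?thesis by (intro mult_left_mono d) auto
    next
      case False then have "K w = 0" using K by (auto simp: mollifier_def)
      then show ?thesis by simp
    qed
  qed
  also have "\<dots> = (\<integral>\<^sup>+w. ennreal (K w) \<partial>lborel) * ennreal e"
    by (rule nn_integral_multc) measurable
  also have "\<dots> = ennreal e" using K by (simp add: mollifier_def)
  finally show ?thesis .
qed

lemma integrable_mollify: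
  fixes f :: "'a::euclidean_space \<Rightarrow> 'b::{banach, second_countable_topology}"
  assumes f: "integrable lborel f" and K: "mollifier \<delta> K"
    and e: "(\<integral>\<^sup>+x. ennreal (norm (mollify K f x - f x)) \<partial>lborel) \<le> ennreal e"
  shows "integrable lborel (mollify K f)"
proof -
  have [measurable]: "f \<in> borel_measurable borel" "mollify K f \<in> borel_measurable borel"
    using f borel_measurable_mollify[OF f K] by auto
  have "integrable lborel (\<lambda>x. mollify K f x - f x)"
    by (rule integrableI_bounded) (use e in \<open>auto intro: le_less_trans\<close>)
  from Bochner_Integration.integrable_add[OF this f] show ?thesis by simp
qed

text \<open>A convex function lies above its tangent at \<open>c\<close>; for powers this is Young's inequality.\<close>

lemma powr_tangent:
  fixes p :: real
  assumes p: "1 < p" and "0 \<le> s" "0 \<le> c"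
  shows "c powr p + p * c powr (p - 1) * (s - c) \<le> s powr p"
proof -
  have q: "p / (p - 1) > 1" "1/p + 1/(p / (p - 1)) = 1" using p by (auto simp: field_simps)
  have "s * c powr (p - 1) \<le> s powr p / p + (c powr (p - 1)) powr (p / (p - 1)) / (p / (p - 1))"
    using Youngs_inequality[of p "p / (p - 1)" s "c powr (p - 1)"] q p assms by auto
  moreover have "(c powr (p - 1)) powr (p / (p - 1)) = c powr p" using p by (simp add: powr_powr)
  ultimately have "p * (s * c powr (p - 1)) \<le> p * (s powr p / p + c powr p / (p / (p - 1)))"
    using p by (intro mult_left_mono) auto
  also have "\<dots> = s powr p + (p - 1) * c powr p" using p by (simp add: field_simps)
  finally have 1: "p * s * c powr (p - 1) \<le> s powr p + (p - 1) * c powr p" by simp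
  have 2: "c * c powr (p - 1) = c powr p"
    using p assms(3) powr_mult_base[of c "p - 1"] by simp
  have "p * c powr (p - 1) * (s - c) = p * s * c powr (p - 1) - p * (c * c powr (p - 1))"
    by (simp add: algebra_simps)
  then show ?thesis using 1 2 by (simp add: algebra_simps)
qed

text \<open>The tangent inequality at the mean value, integrated.\<close>

lemma jensen_powr:
  fixes g :: "'a \<Rightarrow> real" and k :: "'a \<Rightarrow> real"
  assumes p: "1 < p" and k: "\<And>w. 0 \<le> k w" "integrable M k" "(\<integral>w. k w \<partial>M) = 1"
    and g: "\<And>w. 0 \<le> g w" "integrable M (\<lambda>w. k w * g w)" "integrable M (\<lambda>w. k w * g w powr p)"
  shows "(\<integral>w. k w * g w \<partial>M) powr p \<le> (\<integral>w. k w * g w powr p \<partial>M)"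
proof -
  define c where "c = (\<integral>w. k w * g w \<partial>M)"
  have c: "0 \<le> c" unfolding c_def by (intro integral_nonneg_AE AE_I2) (use k g in auto)
  have i: "integrable M (\<lambda>w. c powr p * k w + p * c powr (p - 1) * (k w * g w - c * k w))"
    using k g by (intro Bochner_Integration.integrable_add integrable_mult_right Bochner_Integration.integrable_diff) auto
  have "(\<integral>w. c powr p * k w + p * c powr (p - 1) * (k w * g w - c * k w) \<partial>M) = c powr p * 1 + p * c powr (p - 1) * (c - c * 1)"
    using k g by (subst Bochner_Integration.integral_add) (auto simp: c_def)
  also have "\<dots> = c powr p" by simp
  finally have "c powr p = (\<integral>w. c powr p * k w + p * c powr (p - 1) * (k w * g w - c * k w) \<partial>M)" by simp
  also have "\<dots> \<le> (\<integral>w. k w * g w powr p \<partial>M)"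
  proof (rule integral_mono[OF i g(3)])
    fix w
    have "k w * (c powr p + p * c powr (p - 1) * (g w - c)) \<le> k w * g w powr p"
      by (intro mult_left_mono powr_tangent p g c k)
    then show "c powr p * k w + p * c powr (p - 1) * (k w * g w - c * k w) \<le> k w * g w powr p"
      by (simp add: algebra_simps)
  qed
  finally show ?thesis by (simp add: c_def)
qed

text \<open>This makes the powers of mollified functions equi-integrable: the right-hand sides converge in
  \<open>L\<^sup>1\<close> when the support of the kernel shrinks.\<close>

lemma norm_mollify_powr_le:
  fixes f :: "'a::euclidean_space \<Rightarrow> 'b::{banach, second_countable_topology}"
  assumes f: "integrable lborel f" and K: "mollifier \<delta> K" and p: "1 < p"
    and fp: "integrable lborel (\<lambda>w. norm (f w) powr p)"
  shows "norm (mollify K f \<xi>) powr p \<le> mollify K (\<lambda>w. norm (f w) powr p) \<xi>"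
proof -
  have K0: "\<And>w. 0 \<le> K w" using K by (auto simp: mollifier_def)
  have "norm (mollify K f \<xi>) \<le> (\<integral>w. norm (K w *\<^sub>R f (w + \<xi>)) \<partial>lborel)"
    unfolding mollify_def by (rule integral_norm_bound)
  also have "\<dots> = (\<integral>w. K w * norm (f (w + \<xi>)) \<partial>lborel)" using K0 by simp
  finally have "norm (mollify K f \<xi>) powr p \<le> (\<integral>w. K w * norm (f (w + \<xi>)) \<partial>lborel) powr p"
    using p by (intro powr_mono2) auto
  also have "\<dots> \<le> (\<integral>w. K w * norm (f (w + \<xi>)) powr p \<partial>lborel)"
  proof (rule jensen_powr[OF p K0])
    show "integrable lborel (\<lambda>w. K w * norm (f (w + \<xi>)))"
      using integrable_mollify_integrand[OF integrable_norm[OF f] K, of \<xi>] by simp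
    show "integrable lborel (\<lambda>w. K w * norm (f (w + \<xi>)) powr p)"
      using integrable_mollify_integrand[OF fp K, of \<xi>] by simp
  qed (use integrable_mollifier[OF K] integral_mollifier[OF K] in auto)
  finally show ?thesis by (simp add: mollify_def)
qed

lemma mollify_inner:
  fixes f :: "'a::euclidean_space \<Rightarrow> 'b::euclidean_space"
  assumes "integrable lborel f" "mollifier \<delta> K"
  shows "mollify K (\<lambda>w. f w \<bullet> z) \<xi> = mollify K f \<xi> \<bullet> z"
proof -
  have "integrable lborel (\<lambda>w. K w *\<^sub>R f (w + \<xi>))" using assms by (rule integrable_mollify_integrand)
  then show ?thesis unfolding mollify_def by (subst integral_inner_left[symmetric]) auto
qed

text \<open>If the \<open>L\<^sup>1\<close> errors are summable, then the pointwise errors are summable almost everywhere, and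
  no subsequence has to be extracted.\<close>

lemma AE_tendsto_of_fast_L1:
  fixes f :: "nat \<Rightarrow> 'a \<Rightarrow> 'b::{banach, second_countable_topology}"
  assumes [measurable]: "\<And>n. f n \<in> borel_measurable M" "g \<in> borel_measurable M"
    and fast: "\<And>n. (\<integral>\<^sup>+x. ennreal (norm (f n x - g x)) \<partial>M) \<le> ennreal ((1/2) ^ n)"
  shows "AE x in M. (\<lambda>n. f n x) \<longlonglongrightarrow> g x"
proof -
  have "(\<integral>\<^sup>+x. (\<Sum>n. ennreal (norm (f n x - g x))) \<partial>M) = (\<Sum>n. \<integral>\<^sup>+x. ennreal (norm (f n x - g x)) \<partial>M)"
    by (rule nn_integral_suminf) measurable
  also have "\<dots> \<le> (\<Sum>n. ennreal ((1/2) ^ n))" by (intro suminf_le fast) auto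
  also have "\<dots> = ennreal (\<Sum>n. (1/2) ^ n)" by (intro suminf_ennreal2) auto
  also have "\<dots> < \<infinity>" by simp
  finally have "AE x in M. (\<Sum>n. ennreal (norm (f n x - g x))) \<noteq> \<infinity>"
    by (intro nn_integral_PInf_AE) auto
  then show ?thesis
  proof eventually_elim
    case (elim x)
    have "summable (\<lambda>n. norm (f n x - g x))"
      by (rule summable_suminf_not_top) (use elim in auto)
    then have "(\<lambda>n. norm (f n x - g x)) \<longlonglongrightarrow> 0" by (rule summable_LIMSEQ_zero)
    then show ?case using LIM_zero_cancel tendsto_norm_zero_iff by blast
  qed
qed

text \<open>The majorants \<open>G n\<close> are mollifications of \<open>G0\<close> and depend on \<open>n\<close>. What exceeds \<open>2 * \<bar>G0 x\<bar>\<close> in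
  the error is at most \<open>\<bar>G n x - G0 x\<bar>\<close>, which tends to zero in \<open>L\<^sup>1\<close>; the rest has a fixed majorant.\<close>

lemma generalized_dominated_convergence:
  fixes f :: "nat \<Rightarrow> 'a \<Rightarrow> real"
  assumes [measurable]: "\<And>n. f n \<in> borel_measurable M" "g \<in> borel_measurable M"
    "\<And>n. G n \<in> borel_measurable M" and Gi: "integrable M G0"
    and dom: "\<And>n. AE x in M. \<bar>f n x\<bar> \<le> G n x"
    and GL: "(\<lambda>n. \<integral>\<^sup>+x. ennreal \<bar>G n x - G0 x\<bar> \<partial>M) \<longlonglongrightarrow> 0"
    and Glim: "AE x in M. (\<lambda>n. G n x) \<longlonglongrightarrow> G0 x"
    and lim: "AE x in M. (\<lambda>n. f n x) \<longlonglongrightarrow> g x"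
  shows "(\<lambda>n. \<integral>\<^sup>+x. ennreal \<bar>f n x - g x\<bar> \<partial>M) \<longlonglongrightarrow> 0"
    and "integrable M g"
proof -
  have [measurable]: "G0 \<in> borel_measurable M" using Gi by auto
  have alldom: "AE x in M. \<forall>n. \<bar>f n x\<bar> \<le> G n x" using dom by (simp add: AE_all_countable)
  have g: "AE x in M. \<bar>g x\<bar> \<le> G0 x"
    using alldom Glim lim
  proof eventually_elim
    case (elim x)
    have "(\<lambda>n. \<bar>f n x\<bar>) \<longlonglongrightarrow> \<bar>g x\<bar>" using elim by (intro tendsto_rabs)
    then show ?case using elim by (meson LIMSEQ_le)
  qed
  show gi: "integrable M g"
    by (rule Bochner_Integration.integrable_bound[OF Gi]) (use g in \<open>auto elim!: eventually_mono\<close>)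
  define h where "h n x = min \<bar>f n x - g x\<bar> (2 * \<bar>G0 x\<bar>)" for n x
  have [measurable]: "h n \<in> borel_measurable M" for n unfolding h_def by measurable
  have "(\<lambda>n. \<integral>\<^sup>+x. ennreal (norm (0 - h n x)) \<partial>M) \<longlonglongrightarrow> 0"
  proof (rule nn_integral_dominated_convergence_norm[where w="\<lambda>x. 2 * \<bar>G0 x\<bar>"])
    show "AE x in M. norm (h j x) \<le> 2 * \<bar>G0 x\<bar>" for j by (auto simp: h_def)
    show "(\<integral>\<^sup>+x. ennreal (2 * \<bar>G0 x\<bar>) \<partial>M) < \<infinity>"
    proof -
      have "integrable M (\<lambda>x. 2 * \<bar>G0 x\<bar>)" using Gi by auto
      then show ?thesis by (subst nn_integral_eq_integral) auto
    qed
    show "AE x in M. (\<lambda>i. h i x) \<longlonglongrightarrow> 0"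
      using lim
    proof eventually_elim
      case (elim x)
      have "(\<lambda>n. f n x - g x) \<longlonglongrightarrow> 0" using elim by (rule LIM_zero)
      then have "(\<lambda>n. \<bar>f n x - g x\<bar>) \<longlonglongrightarrow> 0" by (rule tendsto_rabs_zero)
      from tendsto_min[OF this tendsto_const[of "2 * \<bar>G0 x\<bar>"]] show ?case by (simp add: h_def)
    qed
  qed auto
  then have h0: "(\<lambda>n. \<integral>\<^sup>+x. ennreal (h n x) \<partial>M) \<longlonglongrightarrow> 0" by (simp add: h_def)
  have le: "(\<integral>\<^sup>+x. ennreal \<bar>f n x - g x\<bar> \<partial>M) \<le> (\<integral>\<^sup>+x. ennreal (h n x) \<partial>M) + (\<integral>\<^sup>+x. ennreal \<bar>G n x - G0 x\<bar> \<partial>M)" for n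
  proof -
    have "(\<integral>\<^sup>+x. ennreal \<bar>f n x - g x\<bar> \<partial>M) \<le> (\<integral>\<^sup>+x. ennreal (h n x) + ennreal \<bar>G n x - G0 x\<bar> \<partial>M)"
    proof (rule nn_integral_mono_AE)
      show "AE x in M. ennreal \<bar>f n x - g x\<bar> \<le> ennreal (h n x) + ennreal \<bar>G n x - G0 x\<bar>"
        using dom[of n] g
      proof eventually_elim
        case (elim x)
        have "\<bar>f n x - g x\<bar> \<le> h n x + \<bar>G n x - G0 x\<bar>"
          using elim unfolding h_def by linarith
        moreover have "0 \<le> h n x" by (simp add: h_def)
        ultimately show ?case by (simp add: ennreal_plus[symmetric] ennreal_leI del: ennreal_plus)
      qed
    qed
    also have "\<dots> = (\<integral>\<^sup>+x. ennreal (h n x) \<partial>M) + (\<integral>\<^sup>+x. ennreal \<bar>G n x - G0 x\<bar> \<partial>M)"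
      by (rule nn_integral_add) measurable
    finally show ?thesis .
  qed
  have "(\<lambda>n. (\<integral>\<^sup>+x. ennreal (h n x) \<partial>M) + (\<integral>\<^sup>+x. ennreal \<bar>G n x - G0 x\<bar> \<partial>M)) \<longlonglongrightarrow> 0 + 0"
    by (intro tendsto_add h0 GL)
  then have "(\<lambda>n. (\<integral>\<^sup>+x. ennreal (h n x) \<partial>M) + (\<integral>\<^sup>+x. ennreal \<bar>G n x - G0 x\<bar> \<partial>M)) \<longlonglongrightarrow> 0" by simp
  then show "(\<lambda>n. \<integral>\<^sup>+x. ennreal \<bar>f n x - g x\<bar> \<partial>M) \<longlonglongrightarrow> 0"
    by (rule tendsto_sandwich[OF always_eventually always_eventually tendsto_const, rotated 2]) (use le in auto)
qed

section \<open>Smooth bumps and the space-time kernel\<close>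

lemma C_k_Suc_imp: "C_k (Suc k) f \<Longrightarrow> C_k k f"
proof (induction k arbitrary: f)
  case 0
  then show ?case
    by (auto simp: continuous_on_eq_continuous_at intro: differentiable_imp_continuous_within)
next
  case (Suc k)
  then show ?case by (metis C_k.simps(2))
qed

lemma partial_deriv_has_derivative:
  "(f has_derivative f') (at x) \<Longrightarrow> partial_deriv i f x = f' (axis i 1)"
  unfolding partial_deriv_def by (metis frechet_derivative_at)

lemma C_k_const: "C_k k (\<lambda>x. c)"
proof (induction k arbitrary: c)
  case (Suc k)
  have "partial_deriv i (\<lambda>x. c) = (\<lambda>x. 0)" for i :: 'a
    by (rule ext, subst partial_deriv_has_derivative) (auto intro: has_derivative_const)
  then show ?case using Suc by simp
qed simp

lemma C_k_add: "C_k k f \<Longrightarrow> C_k k g \<Longrightarrow> C_k k (\<lambda>x. f x + g x)"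
proof (induction k arbitrary: f g)
  case 0 then show ?case by (auto intro: continuous_on_add)
next
  case (Suc k)
  have "partial_deriv i (\<lambda>x. f x + g x) = (\<lambda>x. partial_deriv i f x + partial_deriv i g x)" for i
  proof
    fix x
    have "(f has_derivative frechet_derivative f (at x)) (at x)" "(g has_derivative frechet_derivative g (at x)) (at x)"
      using Suc.prems by (auto simp: frechet_derivative_works)
    from has_derivative_add[OF this] show "partial_deriv i (\<lambda>x. f x + g x) x = partial_deriv i f x + partial_deriv i g x"
      by (subst partial_deriv_has_derivative) (auto simp: partial_deriv_def)
  qed
  then show ?case using Suc by (auto intro: differentiable_add)
qed

lemma C_k_mult: "C_k k f \<Longrightarrow> C_k k g \<Longrightarrow> C_k k (\<lambda>x. f x * g x)"
proof (induction k arbitrary: f g)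
  case 0 then show ?case by (auto intro: continuous_on_mult)
next
  case (Suc k)
  have "partial_deriv i (\<lambda>x. f x * g x) = (\<lambda>x. f x * partial_deriv i g x + partial_deriv i f x * g x)" for i
  proof
    fix x
    have "(f has_derivative frechet_derivative f (at x)) (at x)" "(g has_derivative frechet_derivative g (at x)) (at x)"
      using Suc.prems by (auto simp: frechet_derivative_works)
    from has_derivative_mult[OF this] show "partial_deriv i (\<lambda>x. f x * g x) x = f x * partial_deriv i g x + partial_deriv i f x * g x"
      by (subst partial_deriv_has_derivative) (auto simp: partial_deriv_def)
  qed
  moreover have "C_k k f" "C_k k g" using Suc.prems by (auto intro: C_k_Suc_imp simp del: C_k.simps)
  ultimately show ?case using Suc by (auto intro!: differentiable_mult C_k_add)
qed

lemma C_k_coord: "C_k k (\<lambda>x. (x - c) $ j)"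
proof (cases k)
  case 0 then show ?thesis by (auto intro!: continuous_intros)
next
  case (Suc m)
  have d: "((\<lambda>x. (x - c) $ j) has_derivative (\<lambda>h. h $ j)) (at x)" for x
    using has_derivative_diff[OF bounded_linear_imp_has_derivative[OF bounded_linear_vec_nth[of j]] has_derivative_const[of "c $ j"]] by simp
  have "partial_deriv i (\<lambda>x. (x - c) $ j) = (\<lambda>x. axis i 1 $ j)" for i
    using partial_deriv_has_derivative[OF d] by blast
  then show ?thesis using Suc d C_k_const by (auto simp: differentiable_def simp del: vector_minus_component)
qed

text \<open>For \<open>j = 0\<close> this is the classical flat function \<open>exp (- 1 / s)\<close>. The derivative of a member of the
  family is a linear combination of two others, so that smoothness can be proved by one induction on
  the order for all members at once.\<close>

definition flat :: "nat \<Rightarrow> real \<Rightarrow> real" where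
  "flat j s = (if 0 < s then exp (- 1 / s) / s ^ j else 0)"

lemma power_le_fact_mult_exp:
  fixes y :: real assumes "0 \<le> y" shows "y ^ m \<le> fact m * exp y"
proof -
  have "(\<Sum>n\<in>{m}. y ^ n /\<^sub>R fact n) \<le> (\<Sum>n. y ^ n /\<^sub>R fact n)"
    by (rule sum_le_suminf) (use summable_exp_generic[of y] assms in auto)
  then have "y ^ m / fact m \<le> exp y" by (simp add: exp_def field_simps)
  then show ?thesis by (simp add: field_simps)
qed

text \<open>Quadratic decay at the origin gives the vanishing derivative there.\<close>

lemma flat_le_square: "\<bar>flat j s\<bar> \<le> fact (j + 2) * s\<^sup>2"
proof (cases "0 < s")
  case True
  have "(1 / s) ^ (j + 2) \<le> fact (j + 2) * exp (1 / s)"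
    using True by (intro power_le_fact_mult_exp) auto
  then have "exp (- 1 / s) \<le> fact (j + 2) * s ^ (j + 2)"
    using True by (simp add: exp_minus field_simps power_one_over)
  then show ?thesis using True by (simp add: flat_def divide_le_eq power_add mult_ac power2_eq_square)
qed (simp add: flat_def)

lemma has_real_derivative_flat:
  "(flat j has_real_derivative (flat (j + 2) s - real j * flat (j + 1) s)) (at s)"
proof (cases s "0::real" rule: linorder_cases)
  case greater
  have "((\<lambda>s. exp (- 1 / s) / s ^ j) has_real_derivative (flat (j + 2) s - real j * flat (j + 1) s)) (at s)"
  proof -
    have e: "((\<lambda>s. exp (- 1 / s)) has_real_derivative exp (- 1 / s) * (1 / s\<^sup>2)) (at s)"
      using greater by (auto intro!: derivative_eq_intros simp: power2_eq_square)
    have "(exp (- 1 / s) * (1 / s\<^sup>2) * s ^ j - exp (- 1 / s) * (real j * s ^ (j - Suc 0))) / (s ^ j * s ^ j)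
       = flat (j + 2) s - real j * flat (j + 1) s"
      using greater by (cases j) (simp_all add: flat_def field_simps power2_eq_square)
    then show ?thesis
      using DERIV_divide[OF e DERIV_pow[of j s]] greater by simp
  qed
  then show ?thesis
    by (rule has_field_derivative_transform_within_open[where S="{0<..}"]) (use greater in \<open>auto simp: flat_def\<close>)
next
  case less
  have "((\<lambda>s. 0) has_real_derivative 0) (at s)" by simp
  then have "(flat j has_real_derivative 0) (at s)"
    by (rule has_field_derivative_transform_within_open[where S="{..<0}"]) (use less in \<open>auto simp: flat_def\<close>)
  then show ?thesis using less by (simp add: flat_def)
next
  case equal
  have "(\<lambda>y. (flat j y - flat j 0) / (y - 0)) \<midarrow>0\<rightarrow> 0"
  proof (rule Lim_null_comparison)
    show "\<forall>\<^sub>F y in at 0. norm ((flat j y - flat j 0) / (y - 0)) \<le> fact (j + 2) * \<bar>y\<bar>"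
    proof (rule always_eventually, rule allI)
      fix y :: real
      have "\<bar>flat j y\<bar> / \<bar>y\<bar> \<le> fact (j + 2) * y\<^sup>2 / \<bar>y\<bar>" by (intro divide_right_mono flat_le_square) auto
      also have "\<dots> = fact (j + 2) * \<bar>y\<bar>"
        by (metis (no_types) power2_abs power2_eq_square nonzero_mult_div_cancel_right times_divide_eq_right abs_zero div_by_0 mult_zero_right abs_eq_0)
      finally show "norm ((flat j y - flat j 0) / (y - 0)) \<le> fact (j + 2) * \<bar>y\<bar>"
        by (simp add: flat_def)
    qed
    show "(\<lambda>y. fact (j + 2) * \<bar>y\<bar>) \<midarrow>0\<rightarrow> (0::real)"
      by (auto intro!: tendsto_eq_intros)
  qed
  then have "(flat j has_real_derivative 0) (at 0)"
    by (simp add: has_field_derivative_iff)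
  then show ?thesis using equal by (simp add: flat_def)
qed

lemma continuous_flat: "continuous_on UNIV (flat j)"
  using has_real_derivative_flat by (metis DERIV_isCont continuous_at_imp_continuous_on)

lemma flat_nonneg: "0 \<le> flat j s" by (simp add: flat_def)

lemma flat_pos_iff: "0 < flat j s \<longleftrightarrow> 0 < s" by (auto simp: flat_def)

lemma has_derivative_flat_radial:
  "((\<lambda>y. flat j (e\<^sup>2 - (norm (y - c))\<^sup>2)) has_derivative
     (\<lambda>h. (flat (j + 2) (e\<^sup>2 - (norm (y - c))\<^sup>2) - real j * flat (j + 1) (e\<^sup>2 - (norm (y - c))\<^sup>2)) * (- 2 * ((y - c) \<bullet> h)))) (at y)"
proof -
  have 1: "((\<lambda>y. e\<^sup>2 - (norm (y - c))\<^sup>2) has_derivative (\<lambda>h. - 2 * ((y - c) \<bullet> h))) (at y)"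
    unfolding power2_norm_eq_inner by (auto intro!: derivative_eq_intros simp: inner_commute)
  show ?thesis
    using has_derivative_compose[OF 1 has_real_derivative_flat[of j "e\<^sup>2 - (norm (y - c))\<^sup>2", unfolded has_field_derivative_def]]
    by simp
qed

lemma C_k_flat_radial: "C_k k (\<lambda>y. flat j (e\<^sup>2 - (norm (y - c))\<^sup>2))"
proof (induction k arbitrary: j)
  case 0
  have "continuous_on UNIV (\<lambda>y. flat j (e\<^sup>2 - (norm (y - c))\<^sup>2))"
    by (rule continuous_on_compose2[OF continuous_flat]) (auto intro!: continuous_intros)
  then show ?case by simp
next
  case (Suc k)
  have "partial_deriv i (\<lambda>y. flat j (e\<^sup>2 - (norm (y - c))\<^sup>2)) =
     (\<lambda>y. (flat (j + 2) (e\<^sup>2 - (norm (y - c))\<^sup>2) + (- real j) * flat (j + 1) (e\<^sup>2 - (norm (y - c))\<^sup>2)) * (- 2 * (y - c) $ i))" for i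
    by (rule ext, subst partial_deriv_has_derivative[OF has_derivative_flat_radial]) (simp add: inner_axis)
  moreover have "C_k k (\<lambda>y. (flat (j + 2) (e\<^sup>2 - (norm (y - c))\<^sup>2) + (- real j) * flat (j + 1) (e\<^sup>2 - (norm (y - c))\<^sup>2)) * (- 2 * (y - c) $ i))" for i
    by (intro C_k_mult C_k_add C_k_const C_k_coord Suc)
  moreover have "(\<lambda>y. flat j (e\<^sup>2 - (norm (y - c))\<^sup>2)) differentiable (at x)" for x
    unfolding differentiable_def using has_derivative_flat_radial by blast
  ultimately show ?case by simp
qed

definition bump_mass :: "real \<Rightarrow> 'a::euclidean_space itself \<Rightarrow> real" where
  "bump_mass e TYPE('a) = (\<integral>z. flat 0 (e\<^sup>2 - (norm (z::'a))\<^sup>2) \<partial>lborel)"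

definition bump :: "real \<Rightarrow> 'a::euclidean_space \<Rightarrow> real" where
  "bump e y = flat 0 (e\<^sup>2 - (norm y)\<^sup>2) / bump_mass e TYPE('a)"

text \<open>The function \<open>flat 2\<close> is the derivative of \<open>flat 0\<close>.\<close>

definition bump_grad :: "real \<Rightarrow> 'a::euclidean_space \<Rightarrow> 'a" where
  "bump_grad e y = (- 2 * flat 2 (e\<^sup>2 - (norm y)\<^sup>2) / bump_mass e TYPE('a)) *\<^sub>R y"

lemma continuous_flat_radial:
  "continuous_on UNIV (\<lambda>y::'a::euclidean_space. flat j (e\<^sup>2 - (norm y)\<^sup>2))"
  by (rule continuous_on_compose2[OF continuous_flat]) (auto intro!: continuous_intros)

lemma flat_radial_eq_0: "0 < e \<Longrightarrow> e \<le> norm y \<Longrightarrow> flat j (e\<^sup>2 - (norm y)\<^sup>2) = 0"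
proof -
  assume "0 < e" "e \<le> norm y"
  then have "e\<^sup>2 \<le> (norm y)\<^sup>2" by (intro power_mono) auto
  then have "\<not> 0 < e\<^sup>2 - (norm y)\<^sup>2" by linarith
  then show ?thesis unfolding flat_def by (rule if_not_P)
qed

lemma bounded_of_compact_support:
  fixes f :: "'a::euclidean_space \<Rightarrow> 'b::real_normed_vector"
  assumes "continuous_on UNIV f" and "\<And>x. R \<le> norm x \<Longrightarrow> f x = 0"
  shows "\<exists>M. \<forall>x. norm (f x) \<le> M"
proof -
  have "compact (f ` cball 0 R)"
    by (rule compact_continuous_image) (use assms(1) in \<open>auto intro: continuous_on_subset\<close>)
  then obtain M where M: "\<And>y. y \<in> f ` cball 0 R \<Longrightarrow> norm y \<le> M"
    by (meson bounded_iff compact_imp_bounded)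
  have "norm (f x) \<le> max M 0" for x
  proof (cases "norm x \<le> R")
    case True then have "f x \<in> f ` cball 0 R" by auto
    then show ?thesis using M by fastforce
  next
    case False then show ?thesis using assms(2)[of x] by simp
  qed
  then show ?thesis by blast
qed

lemma integrable_of_compact_support:
  fixes f :: "'a::euclidean_space \<Rightarrow> 'b::{banach, second_countable_topology}"
  assumes f: "continuous_on UNIV f" and z: "\<And>x. R \<le> norm x \<Longrightarrow> f x = 0"
  shows "integrable lborel f"
proof -
  obtain M where M: "\<And>x. norm (f x) \<le> M" using bounded_of_compact_support[OF f z] by blast
  have "integrable lborel (\<lambda>x. M * indicator (cball 0 R) x :: real)"
    using emeasure_lborel_cball_finite[of 0 R] by (intro integrable_mult_right integrable_real_indicator) auto
  then show ?thesis
  proof (rule Bochner_Integration.integrable_bound)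
    show "f \<in> borel_measurable lborel" using f by (auto intro: borel_measurable_continuous_onI)
    have "norm (f x) \<le> norm (M * indicator (cball 0 R) x :: real)" for x
      using M[of x] z[of x] by (auto simp: indicator_def)
    then show "AE x in lborel. norm (f x) \<le> norm (M * indicator (cball 0 R) x :: real)" by simp
  qed
qed

lemma bump_mass_pos: assumes "0 < e" shows "0 < bump_mass e TYPE('a::euclidean_space)"
proof -
  let ?f = "\<lambda>z::'a. flat 0 (e\<^sup>2 - (norm z)\<^sup>2)"
  have i: "integrable lborel ?f"
    by (rule integrable_of_compact_support[OF continuous_flat_radial]) (rule flat_radial_eq_0[OF assms])
  have "bump_mass e TYPE('a) \<noteq> 0"
  proof
    assume "bump_mass e TYPE('a) = 0"
    then have "AE z in lborel. ?f z = 0"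
      unfolding bump_mass_def using i by (subst (asm) integral_nonneg_eq_0_iff_AE) (auto simp: flat_nonneg)
    then have "AE z in lborel. z \<notin> ball (0::'a) e"
    proof eventually_elim
      case (elim z)
      then have "\<not> 0 < e\<^sup>2 - (norm z)\<^sup>2" using flat_pos_iff[of 0 "e\<^sup>2 - (norm z)\<^sup>2"] by simp
      then show ?case using assms by (auto simp: power_strict_mono)
    qed
    then have "emeasure lborel (ball (0::'a) e) = 0"
      by (subst (asm) AE_iff_measurable[where N="ball 0 e"]) auto
    moreover have "ball (0::'a) e \<notin> null_sets lebesgue"
      using open_not_negligible[of "ball (0::'a) e"] assms by (simp add: negligible_iff_null_sets)
    moreover have "ball (0::'a) e \<in> null_sets lborel \<Longrightarrow> ball (0::'a) e \<in> null_sets lebesgue"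
      by (rule null_sets_completionI)
    ultimately show False by (auto simp: null_sets_def)
  qed
  moreover have "0 \<le> bump_mass e TYPE('a)" unfolding bump_mass_def by (intro integral_nonneg_AE AE_I2) (simp add: flat_nonneg)
  ultimately show ?thesis by simp
qed

lemma bump_nonneg: "0 < e \<Longrightarrow> 0 \<le> bump e y"
  by (simp add: bump_def flat_nonneg bump_mass_pos less_imp_le)

lemma bump_eq_0: "0 < e \<Longrightarrow> e \<le> norm y \<Longrightarrow> bump e y = 0"
  by (simp add: bump_def flat_radial_eq_0)

lemma bump_grad_eq_0: "0 < e \<Longrightarrow> e \<le> norm y \<Longrightarrow> bump_grad e y = 0"
  by (simp add: bump_grad_def flat_radial_eq_0)

lemma continuous_bump: "0 < e \<Longrightarrow> continuous_on UNIV (bump e :: 'a::euclidean_space \<Rightarrow> real)"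
  unfolding bump_def using continuous_flat_radial[of 0 e] bump_mass_pos[of e, where 'a='a]
  by (intro continuous_on_divide) auto

lemma continuous_bump_grad: "0 < e \<Longrightarrow> continuous_on UNIV (bump_grad e :: 'a::euclidean_space \<Rightarrow> 'a)"
  unfolding bump_grad_def using continuous_flat_radial[of 2 e] bump_mass_pos[of e, where 'a='a]
  by (intro continuous_on_scaleR continuous_on_divide continuous_on_mult continuous_intros) auto

lemma integrable_bump: "0 < e \<Longrightarrow> integrable lborel (bump e :: 'a::euclidean_space \<Rightarrow> real)"
  by (rule integrable_of_compact_support[OF continuous_bump]) (auto intro: bump_eq_0)

lemma integral_bump: assumes "0 < e" shows "(\<integral>y. bump e (y::'a::euclidean_space) \<partial>lborel) = 1"
  unfolding bump_def using bump_mass_pos[OF assms, where 'a='a]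
  by (simp add: bump_mass_def)

lemma bounded_bump: assumes e: "0 < e" shows "\<exists>M. \<forall>y::'a::euclidean_space. \<bar>bump e y\<bar> \<le> M"
  using bounded_of_compact_support[OF continuous_bump[OF e] bump_eq_0[OF e]] by simp

lemma bounded_bump_grad: assumes e: "0 < e" shows "\<exists>M. \<forall>y::'a::euclidean_space. norm (bump_grad e y) \<le> M"
  by (rule bounded_of_compact_support[OF continuous_bump_grad[OF e], where R=e]) (rule bump_grad_eq_0[OF e])

lemma has_derivative_bump:
  assumes "0 < e"
  shows "((\<lambda>y. bump e (y - c)) has_derivative (\<lambda>h. bump_grad e (y - c) \<bullet> h)) (at (y::'a::euclidean_space))"
proof -
  have grad: "(\<lambda>h. bump_grad e (y - c) \<bullet> h) = (\<lambda>h. (1 / bump_mass e TYPE('a)) *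
      ((flat (0 + 2) (e\<^sup>2 - (norm (y - c))\<^sup>2) - real 0 * flat (0 + 1) (e\<^sup>2 - (norm (y - c))\<^sup>2)) * (- 2 * ((y - c) \<bullet> h))))"
    unfolding bump_grad_def inner_scaleR_left by (simp add: fun_eq_iff numeral_2_eq_2)
  have fn: "(\<lambda>y. bump e (y - c)) = (\<lambda>y. (1 / bump_mass e TYPE('a)) * flat 0 (e\<^sup>2 - (norm (y - c))\<^sup>2))"
    by (simp add: bump_def fun_eq_iff)
  show ?thesis
    unfolding grad fn by (rule has_derivative_mult_right[OF has_derivative_flat_radial])
qed

lemma onorm_inner_le:
  fixes g :: "'a::real_inner"
  assumes "norm g \<le> M" shows "onorm (\<lambda>h. g \<bullet> h) \<le> M"
proof (rule onorm_bound)
  show "0 \<le> M" using assms norm_ge_zero order_trans by blast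
  fix h
  have "\<bar>g \<bullet> h\<bar> \<le> norm g * norm h" by (rule Cauchy_Schwarz_ineq2)
  also have "\<dots> \<le> M * norm h" by (intro mult_right_mono assms norm_ge_zero)
  finally show "norm (g \<bullet> h) \<le> M * norm h" by simp
qed

lemma bump_Lipschitz:
  assumes "0 < e"
  shows "\<exists>L. \<forall>y y'::'a::euclidean_space. \<bar>bump e y - bump e y'\<bar> \<le> L * norm (y - y')"
proof -
  obtain M where M: "\<And>y::'a. norm (bump_grad e y) \<le> M" using bounded_bump_grad[OF assms] by blast
  have "norm (bump e y - bump e y') \<le> M * norm (y - y')" for y y' :: 'a
  proof (rule differentiable_bound[OF convex_UNIV])
    fix x :: 'a
    show "(bump e has_derivative (\<lambda>h. bump_grad e x \<bullet> h)) (at x within UNIV)"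
      using has_derivative_bump[OF assms, of 0 x] by simp
    show "onorm (\<lambda>h. bump_grad e x \<bullet> h) \<le> M"
      by (rule onorm_inner_le[OF M])
  qed auto
  then show ?thesis by auto
qed

lemma bump_test_function:
  fixes x :: "real ^ 'n::finite"
  assumes e: "0 < e" and sub: "cball x e \<subseteq> \<Omega>"
  shows "(\<lambda>y. bump e (y - x)) \<in> test_functions \<Omega>"
proof -
  have 1: "C_k k (\<lambda>y. bump e (y - x))" for k
    unfolding bump_def divide_inverse by (intro C_k_mult C_k_const C_k_flat_radial)
  have 2: "{y. bump e (y - x) \<noteq> 0} \<subseteq> cball x e"
    using bump_eq_0[OF e] by (force simp: dist_norm norm_minus_commute)
  have 3: "closure {y. bump e (y - x) \<noteq> 0} \<subseteq> cball x e"
    using 2 by (simp add: closure_minimal)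
  then have 4: "compact (closure {y. bump e (y - x) \<noteq> 0})"
    by (meson bounded_cball bounded_subset closed_closure compact_eq_bounded_closed)
  show ?thesis using 1 3 4 sub by (auto simp: test_functions_def)
qed

lemma grad_bump:
  fixes x y :: "real ^ 'n::finite"
  assumes e: "0 < e"
  shows "grad (\<lambda>y. bump e (y - x)) y = bump_grad e (y - x)"
  unfolding grad_def
  using partial_deriv_has_derivative[OF has_derivative_bump[OF e, of x y]]
  by (simp add: vec_eq_iff inner_axis)

text \<open>The uniform density on \<open>[0, e]\<close> turns averaging in time into a Steklov average, and the smooth
  bump turns averaging in space into pairing with a test function.\<close>

definition st_kernel :: "real \<Rightarrow> 'a::euclidean_space \<times> real \<Rightarrow> real" where
  "st_kernel e w = bump e (fst w) * (indicator {0..e} (snd w) / e)"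

lemma mollifier_st_kernel:
  assumes e: "0 < e"
  shows "mollifier (2 * e) (st_kernel e :: 'a::euclidean_space \<times> real \<Rightarrow> real)"
  unfolding mollifier_def
proof (intro conjI allI impI)
  have [measurable]: "(bump e :: 'a \<Rightarrow> real) \<in> borel_measurable borel"
    using continuous_bump[OF e] by (rule borel_measurable_continuous_onI)
  show m: "(st_kernel e :: 'a \<times> real \<Rightarrow> real) \<in> borel_measurable borel"
    unfolding st_kernel_def borel_prod[symmetric] by measurable
  show "0 \<le> st_kernel e w" for w :: "'a \<times> real"
    using e by (auto simp: st_kernel_def bump_nonneg)
  obtain M where M: "\<And>y::'a. \<bar>bump e y\<bar> \<le> M" using bounded_bump[OF e] by blast
  have "st_kernel e w \<le> M * (1 / e)" for w :: "'a \<times> real"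
    unfolding st_kernel_def using e M[of "fst w"] bump_nonneg[OF e, of "fst w"]
    by (intro mult_mono) (auto simp: indicator_def divide_right_mono)
  then show "\<exists>M. \<forall>w. (st_kernel e :: 'a \<times> real \<Rightarrow> real) w \<le> M" by blast
  show "st_kernel e w = 0" if "2 * e \<le> norm w" for w :: "'a \<times> real"
  proof (rule ccontr)
    assume *: "st_kernel e w \<noteq> 0"
    have "norm (fst w) < e" using * bump_eq_0[OF e, of "fst w"] by (auto simp: st_kernel_def not_less[symmetric])
    moreover have "\<bar>snd w\<bar> \<le> e" using * by (auto simp: st_kernel_def indicator_def split: if_splits)
    ultimately have "norm w < 2 * e" using norm_Pair_le[of "fst w" "snd w"] by simp
    then show False using that by simp
  qed
  have "(\<integral>\<^sup>+w. ennreal (st_kernel e (w :: 'a \<times> real)) \<partial>lborel) = (\<integral>\<^sup>+w. ennreal (st_kernel e (w :: 'a \<times> real)) \<partial>(lborel \<Otimes>\<^sub>M lborel))"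
    by (simp add: lborel_prod)
  also have "\<dots> = (\<integral>\<^sup>+x. (\<integral>\<^sup>+\<tau>. ennreal (st_kernel e (x::'a, \<tau>)) \<partial>lborel) \<partial>lborel)"
    by (rule lborel.nn_integral_fst[symmetric]) (use m in \<open>simp add: lborel_prod\<close>)
  also have "\<dots> = (\<integral>\<^sup>+x. ennreal (bump e (x::'a)) \<partial>lborel)"
  proof (intro nn_integral_cong)
    fix x :: 'a
    have "(\<integral>\<^sup>+\<tau>. ennreal (st_kernel e (x, \<tau>)) \<partial>lborel) = (\<integral>\<^sup>+\<tau>. ennreal (bump e x / e) * indicator {0..e} \<tau> \<partial>lborel)"
      by (intro nn_integral_cong) (auto simp: st_kernel_def indicator_def)
    also have "\<dots> = ennreal (bump e x / e) * ennreal e" using e by (subst nn_integral_cmult_indicator) auto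
    also have "\<dots> = ennreal (bump e x)" using e bump_nonneg[OF e, of x] by (subst ennreal_mult[symmetric]) auto
    finally show "(\<integral>\<^sup>+\<tau>. ennreal (st_kernel e (x, \<tau>)) \<partial>lborel) = ennreal (bump e x)" .
  qed
  also have "\<dots> = ennreal (\<integral>x. bump e (x::'a) \<partial>lborel)"
    by (rule nn_integral_eq_integral[OF integrable_bump[OF e]]) (simp add: bump_nonneg[OF e])
  finally show "(\<integral>\<^sup>+w. ennreal (st_kernel e (w :: 'a \<times> real)) \<partial>lborel) = 1" by (simp add: integral_bump[OF e])
qed

text \<open>Formulated as an eventual statement about the radius, so that finitely many functions can be
  approximated with a common radius.\<close>

lemma eventually_mollify_error_le:
  fixes f :: "'a::euclidean_space \<times> real \<Rightarrow> 'b::{banach, second_countable_topology}"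
  assumes f: "integrable lborel f" and \<epsilon>: "0 < \<epsilon>"
  shows "\<forall>\<^sub>F e in at_right 0. (\<integral>\<^sup>+w. ennreal (norm (mollify (st_kernel e) f w - f w)) \<partial>lborel) \<le> ennreal \<epsilon>"
proof -
  from translation_continuous_L1[OF f \<epsilon>] obtain d where d: "0 < d"
    "\<And>z. norm z < d \<Longrightarrow> (\<integral>\<^sup>+x. ennreal (norm (f (x + z) - f x)) \<partial>lborel) \<le> ennreal \<epsilon>" by blast
  have "\<forall>\<^sub>F e in at_right 0. e \<in> {0<..<d / 2}" using d(1) by (intro eventually_at_right_real) simp
  then show ?thesis
  proof eventually_elim
    case (elim e)
    then have e: "0 < e" "2 * e < d" by auto
    show ?case by (rule mollify_L1_error[OF f mollifier_st_kernel[OF e(1)]], rule d(2)) (use e in simp)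
  qed
qed

section \<open>Differentiation of mollified functions and integration by parts\<close>

text \<open>Differentiation under the integral sign: the remainders of the first order expansion of \<open>\<kappa>\<close> are
  bounded by \<open>2 * L\<close> because \<open>\<kappa>\<close> is Lipschitz. The map \<open>\<pi>\<close> will be the projection of space-time onto
  space.\<close>

lemma has_derivative_integral_shifted_kernel:
  fixes \<kappa> :: "'a::euclidean_space \<Rightarrow> real" and \<kappa>' :: "'a \<Rightarrow> 'a" and \<phi> :: "'w \<Rightarrow> real"
  assumes \<phi>: "integrable M \<phi>" and \<pi>[measurable]: "\<pi> \<in> measurable M borel"
    and c: "continuous_on UNIV \<kappa>" "continuous_on UNIV \<kappa>'"
    and b: "\<And>y. \<bar>\<kappa> y\<bar> \<le> B" "\<And>y. norm (\<kappa>' y) \<le> L"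
    and Lip: "\<And>y y'. \<bar>\<kappa> y - \<kappa> y'\<bar> \<le> L * norm (y - y')"
    and d: "\<And>y. (\<kappa> has_derivative (\<lambda>h. \<kappa>' y \<bullet> h)) (at y)"
  shows "((\<lambda>x. \<integral>w. \<kappa> (\<pi> w - x) * \<phi> w \<partial>M) has_derivative (\<lambda>h. (- (\<integral>w. \<phi> w *\<^sub>R \<kappa>' (\<pi> w - x) \<partial>M)) \<bullet> h)) (at x)"
proof -
  have [measurable]: "\<kappa> \<in> borel_measurable borel" "\<kappa>' \<in> borel_measurable borel" "\<phi> \<in> borel_measurable M"
    using c \<phi> by (auto intro: borel_measurable_continuous_onI)
  have i1: "integrable M (\<lambda>w. \<kappa> (\<pi> w - x) * \<phi> w)" for x
  proof (rule Bochner_Integration.integrable_bound[of M "\<lambda>w. B * \<phi> w"])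
    have "\<bar>\<kappa> (\<pi> w - x)\<bar> * \<bar>\<phi> w\<bar> \<le> \<bar>B\<bar> * \<bar>\<phi> w\<bar>" for w
      using b(1)[of "\<pi> w - x"] by (intro mult_right_mono) auto
    then show "AE w in M. norm (\<kappa> (\<pi> w - x) * \<phi> w) \<le> norm (B * \<phi> w)"
      by (simp add: abs_mult)
  qed (use \<phi> in auto)
  have i2: "integrable M (\<lambda>w. \<phi> w *\<^sub>R \<kappa>' (\<pi> w - x))" for x
  proof (rule Bochner_Integration.integrable_bound[of M "\<lambda>w. L * \<phi> w"])
    have "\<bar>\<phi> w\<bar> * norm (\<kappa>' (\<pi> w - x)) \<le> \<bar>L\<bar> * \<bar>\<phi> w\<bar>" for w
      using b(2)[of "\<pi> w - x"] by (subst mult.commute) (intro mult_right_mono, auto)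
    then show "AE w in M. norm (\<phi> w *\<^sub>R \<kappa>' (\<pi> w - x)) \<le> norm (L * \<phi> w)"
      by (simp add: abs_mult)
  qed (use \<phi> in auto)
  define D where "D = - (\<integral>w. \<phi> w *\<^sub>R \<kappa>' (\<pi> w - x) \<partial>M)"
  define F where "F x = (\<integral>w. \<kappa> (\<pi> w - x) * \<phi> w \<partial>M)" for x
  define r where "r h w = (\<kappa> (\<pi> w - (x + h)) - \<kappa> (\<pi> w - x) + \<kappa>' (\<pi> w - x) \<bullet> h) / norm h" for h w
  have L0: "0 \<le> L" using b(2)[of 0] norm_ge_zero order_trans by blast
  have rb: "\<bar>r h w\<bar> \<le> 2 * L" for h w
  proof (cases "h = 0")
    case False
    have "\<bar>\<kappa> (\<pi> w - (x + h)) - \<kappa> (\<pi> w - x)\<bar> \<le> L * norm h"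
      using Lip[of "\<pi> w - (x + h)" "\<pi> w - x"] by (simp add: algebra_simps)
    moreover have "\<bar>\<kappa>' (\<pi> w - x) \<bullet> h\<bar> \<le> L * norm h"
      using Cauchy_Schwarz_ineq2[of "\<kappa>' (\<pi> w - x)" h] b(2)[of "\<pi> w - x"]
      by (meson mult_right_mono norm_ge_zero order_trans)
    ultimately have "\<bar>\<kappa> (\<pi> w - (x + h)) - \<kappa> (\<pi> w - x) + \<kappa>' (\<pi> w - x) \<bullet> h\<bar> \<le> 2 * L * norm h" by linarith
    then show ?thesis using False by (simp add: r_def divide_le_eq)
  qed (use L0 in \<open>simp add: r_def\<close>)
  have rl: "((\<lambda>h. r h w) \<longlongrightarrow> 0) (at 0)" for w
  proof -
    have 1: "((\<lambda>h. \<pi> w - (x + h)) has_derivative (\<lambda>h. - h)) (at 0)"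
      by (auto intro!: derivative_eq_intros)
    have "((\<lambda>h. \<kappa> (\<pi> w - (x + h))) has_derivative (\<lambda>h. \<kappa>' (\<pi> w - x) \<bullet> (- h))) (at 0)"
      using has_derivative_compose[OF 1, of \<kappa> "\<lambda>h. \<kappa>' (\<pi> w - x) \<bullet> h"] d[of "\<pi> w - x"] by simp
    then have "((\<lambda>h. (\<kappa> (\<pi> w - (x + h)) - \<kappa> (\<pi> w - x) - \<kappa>' (\<pi> w - x) \<bullet> (- h)) /\<^sub>R norm h) \<longlongrightarrow> 0) (at 0)"
      by (simp add: has_derivative_at_within)
    then show ?thesis by (simp add: r_def divide_inverse mult.commute)
  qed
  have eq: "(F (x + h) - F x - D \<bullet> h) /\<^sub>R norm h = (\<integral>w. r h w * \<phi> w \<partial>M)" for h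
  proof -
    have "D \<bullet> h = - (\<integral>w. (\<phi> w *\<^sub>R \<kappa>' (\<pi> w - x)) \<bullet> h \<partial>M)"
      unfolding D_def by (subst integral_inner_left[OF i2]) simp
    then have "F (x + h) - F x - D \<bullet> h = (\<integral>w. (\<kappa> (\<pi> w - (x + h)) * \<phi> w - \<kappa> (\<pi> w - x) * \<phi> w) + (\<phi> w *\<^sub>R \<kappa>' (\<pi> w - x)) \<bullet> h \<partial>M)"
      unfolding F_def
      using i1[of "x + h"] i1[of x] integrable_inner_left[OF i2[of x], of h]
      by (subst Bochner_Integration.integral_add) auto
    also have "\<dots> /\<^sub>R norm h = (\<integral>w. r h w * \<phi> w \<partial>M)"
    proof -
      have "(\<lambda>w. r h w * \<phi> w) = (\<lambda>w. inverse (norm h) *\<^sub>R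
          ((\<kappa> (\<pi> w - (x + h)) * \<phi> w - \<kappa> (\<pi> w - x) * \<phi> w) + (\<phi> w *\<^sub>R \<kappa>' (\<pi> w - x)) \<bullet> h))"
        unfolding r_def inner_scaleR_left by (rule ext) (simp only: divide_inverse real_scaleR_def ring_distribs mult_ac)
      then show ?thesis by (simp only: integral_scaleR_right)
    qed
    finally show ?thesis .
  qed
  have "((\<lambda>h. \<integral>w. r h w * \<phi> w \<partial>M) \<longlongrightarrow> 0) (at 0)"
    unfolding tendsto_at_iff_sequentially comp_def
  proof (intro allI impI)
    fix X :: "nat \<Rightarrow> 'a" assume X: "\<forall>i. X i \<in> UNIV - {0}" "X \<longlonglongrightarrow> 0"
    have "(\<lambda>i. \<integral>w. r (X i) w * \<phi> w \<partial>M) \<longlonglongrightarrow> (\<integral>w. 0 \<partial>M)"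
    proof (rule integral_dominated_convergence[where w="\<lambda>w. 2 * L * \<bar>\<phi> w\<bar>"])
      show "(\<lambda>w. r (X i) w * \<phi> w) \<in> borel_measurable M" for i unfolding r_def by measurable
      have "(\<lambda>i. r (X i) w) \<longlonglongrightarrow> 0" for w
        using rl[of w] X unfolding tendsto_at_iff_sequentially comp_def by auto
      then show "AE w in M. (\<lambda>i. r (X i) w * \<phi> w) \<longlonglongrightarrow> 0"
        by (intro AE_I2 tendsto_mult_left_zero)
      show "AE w in M. norm (r (X i) w * \<phi> w) \<le> 2 * L * \<bar>\<phi> w\<bar>" for i
        using rb by (auto simp: abs_mult intro!: mult_right_mono)
    qed (use \<phi> in auto)
    then show "(\<lambda>i. \<integral>w. r (X i) w * \<phi> w \<partial>M) \<longlonglongrightarrow> 0" by simp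
  qed
  then have "((\<lambda>h. (F (x + h) - F x - D \<bullet> h) /\<^sub>R norm h) \<longlongrightarrow> 0) (at 0)" by (simp only: eq)
  then have "(F has_derivative (\<lambda>h. D \<bullet> h)) (at x)"
  proof -
    assume *: "((\<lambda>h. (F (x + h) - F x - D \<bullet> h) /\<^sub>R norm h) \<longlongrightarrow> 0) (at 0)"
    have "norm ((F (x + h) - F x - D \<bullet> h) /\<^sub>R norm h) = norm (F (x + h) - F x - D \<bullet> h) / norm h" for h
      by (simp add: divide_inverse mult.commute abs_mult)
    with tendsto_norm_zero[OF *] have "((\<lambda>h. norm (F (x + h) - F x - D \<bullet> h) / norm h) \<longlongrightarrow> 0) (at 0)"
      by simp
    then show ?thesis by (simp add: has_derivative_at bounded_linear_inner_right)
  qed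
  then show ?thesis unfolding F_def[abs_def] D_def .
qed

text \<open>The spatial gradient of \<open>mollify (st_kernel e) f\<close>, with the derivative thrown onto the bump.\<close>

definition mollify_grad :: "real \<Rightarrow> ('a::euclidean_space \<times> real \<Rightarrow> real) \<Rightarrow> 'a \<times> real \<Rightarrow> 'a" where
  "mollify_grad e f \<xi> = - (\<integral>w. (indicator {0..e} (snd w - snd \<xi>) / e * f w) *\<^sub>R bump_grad e (fst w - fst \<xi>) \<partial>lborel)"

lemma integrable_time_window:
  assumes e: "0 < e" and f: "integrable lborel (f :: 'a::euclidean_space \<times> real \<Rightarrow> real)"
  shows "integrable lborel (\<lambda>w. indicator {0..e} (snd w - t) / e * f w)"
proof -
  have [measurable]: "(\<lambda>w. indicator {0..e} (snd w - t) / e) \<in> borel_measurable (borel :: ('a \<times> real) measure)"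
    unfolding borel_prod[symmetric] by measurable
  have "integrable lborel (\<lambda>w. (indicator {0..e} (snd w - t) / e) *\<^sub>R f w)"
  proof (rule integrable_bounded_scaleR[OF f, where M="1/e"])
    show "\<bar>indicator {0..e} (snd w - t) / e\<bar> \<le> 1 / e" for w :: "'a \<times> real"
      using e by (simp add: indicator_def)
  qed measurable
  then show ?thesis by simp
qed

lemma has_derivative_mollify:
  fixes f :: "'a::euclidean_space \<times> real \<Rightarrow> real"
  assumes e: "0 < e" and f: "integrable lborel f"
  shows "((\<lambda>x. mollify (st_kernel e) f (x, t)) has_derivative (\<lambda>h. mollify_grad e f (x, t) \<bullet> h)) (at x)"
proof -
  obtain B where B: "\<And>y::'a. \<bar>bump e y\<bar> \<le> B" using bounded_bump[OF e] by blast
  obtain L1 where L1: "\<And>y::'a. norm (bump_grad e y) \<le> L1" using bounded_bump_grad[OF e] by blast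
  obtain L2 where L2: "\<And>y y'::'a. \<bar>bump e y - bump e y'\<bar> \<le> L2 * norm (y - y')" using bump_Lipschitz[OF e] by blast
  have L: "norm (bump_grad e y) \<le> max L1 L2" for y :: 'a using L1[of y] by simp
  have L': "\<bar>bump e y - bump e y'\<bar> \<le> max L1 L2 * norm (y - y')" for y y' :: 'a
    using L2[of y y'] by (meson max.cobounded2 mult_right_mono norm_ge_zero order_trans)
  have fm: "f \<in> borel_measurable borel" using f by auto
  have km: "st_kernel e \<in> borel_measurable (borel :: ('a \<times> real) measure)"
    using mollifier_st_kernel[OF e, where 'a='a] by (auto simp: mollifier_def)
  have "((\<lambda>x. \<integral>w. bump e (fst w - x) * (indicator {0..e} (snd w - t) / e * f w) \<partial>lborel) has_derivative
     (\<lambda>h. (- (\<integral>w. (indicator {0..e} (snd w - t) / e * f w) *\<^sub>R bump_grad e (fst w - x) \<partial>lborel)) \<bullet> h)) (at x)"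
  proof (rule has_derivative_integral_shifted_kernel)
    show "(fst :: 'a \<times> real \<Rightarrow> 'a) \<in> borel_measurable lborel" unfolding lborel_prod[symmetric] by measurable
    show "(bump e has_derivative (\<lambda>h. bump_grad e y \<bullet> h)) (at y)" for y :: 'a
      using has_derivative_bump[OF e, of 0 y] by simp
  qed (use continuous_bump[OF e] continuous_bump_grad[OF e] B L L' integrable_time_window[OF e f] in auto)
  moreover have "mollify (st_kernel e) f (x, t) = (\<integral>w. bump e (fst w - x) * (indicator {0..e} (snd w - t) / e * f w) \<partial>lborel)" for x
    unfolding mollify_eq_shifted_kernel[OF fm km] by (simp add: st_kernel_def mult.assoc)
  ultimately show ?thesis by (simp add: mollify_grad_def)
qed

text \<open>Every component is itself a mollification, with a component of the gradient of the bump in place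
  of the bump.\<close>

lemma continuous_mollify_grad:
  fixes f :: "'a::euclidean_space \<times> real \<Rightarrow> real"
  assumes e: "0 < e" and f: "integrable lborel f"
  shows "continuous_on UNIV (mollify_grad e f)"
proof (subst continuous_on_componentwise, intro ballI)
  fix i :: 'a assume "i \<in> Basis"
  obtain L where L: "\<And>y::'a. norm (bump_grad e y) \<le> L" using bounded_bump_grad[OF e] by blast
  define K where "K w = - (bump_grad e (fst w) \<bullet> i) * (indicator {0..e} (snd w) / e)" for w :: "'a \<times> real"
  have [measurable]: "(bump_grad e :: 'a \<Rightarrow> 'a) \<in> borel_measurable borel"
    using continuous_bump_grad[OF e] by (rule borel_measurable_continuous_onI)
  have Km[measurable]: "K \<in> borel_measurable borel" unfolding K_def borel_prod[symmetric] by measurable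
  have Kb: "\<bar>K w\<bar> \<le> L * norm i * (1 / e)" for w
  proof -
    have "\<bar>bump_grad e (fst w) \<bullet> i\<bar> \<le> L * norm i"
      using Cauchy_Schwarz_ineq2[of "bump_grad e (fst w)" i] L[of "fst w"]
      by (meson mult_right_mono norm_ge_zero order_trans)
    then have "\<bar>bump_grad e (fst w) \<bullet> i\<bar> * \<bar>indicator {0..e} (snd w) / e\<bar> \<le> L * norm i * (1 / e)"
      using e by (intro mult_mono) (auto simp: indicator_def intro: order_trans[OF abs_ge_zero])
    then show ?thesis by (simp add: K_def abs_mult)
  qed
  have fm[measurable]: "f \<in> borel_measurable borel" using f by auto
  have "mollify_grad e f \<xi> \<bullet> i = mollify K f \<xi>" for \<xi>
  proof -
    have m: "(\<lambda>w. bump_grad e (fst w - fst \<xi>)) \<in> borel_measurable (borel :: ('a \<times> real) measure)"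
      unfolding borel_prod[symmetric] by measurable
    have "integrable lborel (\<lambda>w. (indicator {0..e} (snd w - snd \<xi>) / e * f w) *\<^sub>R bump_grad e (fst w - fst \<xi>))"
    proof (rule Bochner_Integration.integrable_bound[OF integrable_mult_right[OF integrable_time_window[OF e f, of "snd \<xi>"], of L]])
      show "(\<lambda>w. (indicator {0..e} (snd w - snd \<xi>) / e * f w) *\<^sub>R bump_grad e (fst w - fst \<xi>)) \<in> borel_measurable lborel"
        using integrable_time_window[OF e f, of "snd \<xi>"] m by auto
      show "AE w in lborel. norm ((indicator {0..e} (snd w - snd \<xi>) / e * f w) *\<^sub>R bump_grad e (fst w - fst \<xi>))
          \<le> norm (L * (indicator {0..e} (snd w - snd \<xi>) / e * f w))"
      proof (rule AE_I2)
        fix w :: "'a \<times> real"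
        have "\<bar>c\<bar> * norm (bump_grad e (fst w - fst \<xi>)) \<le> \<bar>L\<bar> * \<bar>c\<bar>" for c
          using L[of "fst w - fst \<xi>"] by (subst mult.commute) (intro mult_right_mono, auto)
        then show "norm ((indicator {0..e} (snd w - snd \<xi>) / e * f w) *\<^sub>R bump_grad e (fst w - fst \<xi>))
          \<le> norm (L * (indicator {0..e} (snd w - snd \<xi>) / e * f w))"
          by (simp only: norm_scaleR real_norm_def abs_mult[of L])
      qed
    qed
    then show ?thesis
      unfolding mollify_grad_def mollify_eq_shifted_kernel[OF fm Km]
      by (simp add: integral_inner_left[symmetric] K_def mult_ac)
  qed
  then show "continuous_on UNIV (\<lambda>\<xi>. mollify_grad e f \<xi> \<bullet> i)"
    using mollify_continuous[OF f Km Kb] by simp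
qed

text \<open>A form of the divergence theorem. By translation invariance the integral of every difference
  quotient of \<open>F\<close> vanishes, and the difference quotients converge boundedly on a fixed ball.\<close>

proposition integral_gradient_eq_0:
  fixes F :: "'a::euclidean_space \<Rightarrow> real"
  assumes d: "\<And>x. (F has_derivative (\<lambda>h. G x \<bullet> h)) (at x)"
    and G: "continuous_on UNIV G" and z: "\<And>x. R \<le> norm x \<Longrightarrow> F x = 0" "\<And>x. R \<le> norm x \<Longrightarrow> G x = 0"
  shows "(\<integral>x. G x \<bullet> z \<partial>lborel) = 0"
proof -
  have F: "continuous_on UNIV F" using d by (meson has_derivative_continuous continuous_at_imp_continuous_on)
  have [measurable]: "F \<in> borel_measurable borel" "G \<in> borel_measurable borel"
    using F G by (auto intro: borel_measurable_continuous_onI)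
  have Fi: "integrable lborel F" using F z by (intro integrable_of_compact_support)
  obtain M where M: "\<And>x. norm (G x) \<le> M" using bounded_of_compact_support[OF G z(2)] by blast
  have Lip: "\<bar>F (x + h) - F x\<bar> \<le> M * norm h" for x h
  proof -
    have "norm (F (x + h) - F x) \<le> M * norm ((x + h) - x)"
    proof (rule differentiable_bound[OF convex_UNIV])
      fix x :: 'a
      show "(F has_derivative (\<lambda>h. G x \<bullet> h)) (at x within UNIV)" using d by simp
      show "onorm (\<lambda>h. G x \<bullet> h) \<le> M"
        by (rule onorm_inner_le[OF M])
    qed auto
    then show ?thesis by simp
  qed
  define s where "s n = inverse (real (Suc n))" for n
  have s: "0 < s n" "s n \<le> 1" for n by (auto simp: s_def field_simps)
  have lim: "(\<lambda>n. \<integral>x. (F (x + s n *\<^sub>R z) - F x) / s n \<partial>lborel) \<longlonglongrightarrow> (\<integral>x. G x \<bullet> z \<partial>lborel)"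
  proof (rule integral_dominated_convergence[where w="\<lambda>x. M * norm z * indicator (cball 0 (R + norm z)) x"])
    show "integrable lborel (\<lambda>x. M * norm z * indicator (cball (0::'a) (R + norm z)) x :: real)"
      using emeasure_lborel_cball_finite[of "0::'a" "R + norm z"] by (intro integrable_mult_right integrable_real_indicator) auto
    show "AE x in lborel. (\<lambda>n. (F (x + s n *\<^sub>R z) - F x) / s n) \<longlonglongrightarrow> G x \<bullet> z"
    proof (rule AE_I2)
      fix x
      have 1: "((\<lambda>c. x + c *\<^sub>R z) has_derivative (\<lambda>c. c *\<^sub>R z)) (at (0::real))"
        by (auto intro!: derivative_eq_intros)
      have "((\<lambda>c. F (x + c *\<^sub>R z)) has_derivative (\<lambda>c. G x \<bullet> (c *\<^sub>R z))) (at 0)"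
        using has_derivative_compose[OF 1, of F "\<lambda>h. G x \<bullet> h"] d[of x] by simp
      moreover have "(\<lambda>c. G x \<bullet> (c *\<^sub>R z)) = (*) (G x \<bullet> z)" by (rule ext) simp
      ultimately have "((\<lambda>c. F (x + c *\<^sub>R z)) has_real_derivative (G x \<bullet> z)) (at 0)"
        by (simp only: has_field_derivative_def)
      then have *: "((\<lambda>c. (F (x + c *\<^sub>R z) - F x) / c) \<longlongrightarrow> G x \<bullet> z) (at 0)"
        by (simp add: has_field_derivative_iff)
      have "s \<longlonglongrightarrow> 0" unfolding s_def by (rule LIMSEQ_inverse_real_of_nat)
      moreover have "\<forall>i. s i \<in> UNIV - {0}" using s by (metis DiffI UNIV_I less_irrefl singletonD)
      ultimately show "(\<lambda>n. (F (x + s n *\<^sub>R z) - F x) / s n) \<longlonglongrightarrow> G x \<bullet> z"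
        using * unfolding tendsto_at_iff_sequentially comp_def by blast
    qed
    show "AE x in lborel. norm ((F (x + s n *\<^sub>R z) - F x) / s n) \<le> M * norm z * indicator (cball 0 (R + norm z)) x" for n
    proof (rule AE_I2)
      fix x
      show "norm ((F (x + s n *\<^sub>R z) - F x) / s n) \<le> M * norm z * indicator (cball 0 (R + norm z)) x"
      proof (cases "norm x \<le> R + norm z")
        case True
        have "\<bar>F (x + s n *\<^sub>R z) - F x\<bar> \<le> M * norm z * s n" using Lip[of x "s n *\<^sub>R z"] s[of n] by (simp add: mult_ac)
        then show ?thesis using True s[of n] by (simp add: divide_le_eq)
      next
        case False
        have "norm (s n *\<^sub>R z) \<le> norm z" using s[of n] by (simp add: mult_left_le_one_le)
        then have "R \<le> norm (x + s n *\<^sub>R z)" "R \<le> norm x" using False norm_diff_ineq[of x "s n *\<^sub>R z"] norm_ge_zero[of z] by linarith+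
        then show ?thesis using z by (simp add: False)
      qed
    qed
  qed auto
  have quotient: "(\<integral>x. (F (x + s n *\<^sub>R z) - F x) / s n \<partial>lborel) = 0" for n
    using integral_lborel_translate[of F "s n *\<^sub>R z"] Fi integrable_lborel_translate[OF Fi, of "s n *\<^sub>R z"] by simp
  have "(\<lambda>n::nat. 0::real) \<longlonglongrightarrow> (\<integral>x. G x \<bullet> z \<partial>lborel)"
    using lim by (simp only: quotient)
  then show ?thesis by (simp add: LIMSEQ_const_iff)
qed

text \<open>Integration by parts; the boundary terms are absent because \<open>\<psi>\<close> has compact support.\<close>

lemma integral_divergence_mult:
  fixes a :: "'a::euclidean_space \<Rightarrow> 'a" and \<psi> :: "'a \<Rightarrow> real"
  assumes da: "\<And>x i. i \<in> Basis \<Longrightarrow> ((\<lambda>x. a x \<bullet> i) has_derivative (\<lambda>h. Da i x \<bullet> h)) (at x)"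
    and Da: "\<And>i. i \<in> Basis \<Longrightarrow> continuous_on UNIV (Da i)"
    and dp: "\<And>x. (\<psi> has_derivative (\<lambda>h. D\<psi> x \<bullet> h)) (at x)" and Dp: "continuous_on UNIV D\<psi>"
    and z: "\<And>x. R \<le> norm x \<Longrightarrow> \<psi> x = 0" "\<And>x. R \<le> norm x \<Longrightarrow> D\<psi> x = 0"
  shows "(\<integral>x. (\<Sum>i\<in>Basis. Da i x \<bullet> i) * \<psi> x \<partial>lborel) = - (\<integral>x. a x \<bullet> D\<psi> x \<partial>lborel)"
proof -
  have ca: "continuous_on UNIV (\<lambda>x. a x \<bullet> i)" if "i \<in> Basis" for i
    using da[OF that] by (meson has_derivative_continuous continuous_at_imp_continuous_on)
  have cp: "continuous_on UNIV \<psi>"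
    using dp by (meson has_derivative_continuous continuous_at_imp_continuous_on)
  have i1: "integrable lborel (\<lambda>x. (Da i x \<bullet> i) * \<psi> x)" if "i \<in> Basis" for i
    using that by (intro integrable_of_compact_support[where R=R] continuous_intros Da cp) (auto simp: z)
  have i2: "integrable lborel (\<lambda>x. (a x \<bullet> i) * (D\<psi> x \<bullet> i))" if "i \<in> Basis" for i
    using that by (intro integrable_of_compact_support[where R=R] continuous_intros ca Dp) (auto simp: z)
  have "(\<integral>x. (Da i x \<bullet> i) * \<psi> x + (a x \<bullet> i) * (D\<psi> x \<bullet> i) \<partial>lborel) = 0" if i: "i \<in> Basis" for i
  proof -
    have "(\<integral>x. (\<psi> x *\<^sub>R Da i x + (a x \<bullet> i) *\<^sub>R D\<psi> x) \<bullet> i \<partial>lborel) = 0"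
    proof (rule integral_gradient_eq_0[where F="\<lambda>x. (a x \<bullet> i) * \<psi> x" and R=R])
      fix x
      show "((\<lambda>x. (a x \<bullet> i) * \<psi> x) has_derivative (\<lambda>h. (\<psi> x *\<^sub>R Da i x + (a x \<bullet> i) *\<^sub>R D\<psi> x) \<bullet> h)) (at x)"
        using has_derivative_mult[OF da[OF i, of x] dp[of x]] by (simp add: inner_add_left algebra_simps)
    qed (use z in \<open>auto intro!: continuous_intros Da cp ca i Dp\<close>)
    then show ?thesis by (simp add: inner_add_left algebra_simps)
  qed
  then have *: "(\<integral>x. (Da i x \<bullet> i) * \<psi> x \<partial>lborel) = - (\<integral>x. (a x \<bullet> i) * (D\<psi> x \<bullet> i) \<partial>lborel)" if "i \<in> Basis" for i
    using that Bochner_Integration.integral_add[OF i1[OF that] i2[OF that]] by simp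
  have "(\<integral>x. (\<Sum>i\<in>Basis. Da i x \<bullet> i) * \<psi> x \<partial>lborel) = (\<integral>x. (\<Sum>i\<in>Basis. (Da i x \<bullet> i) * \<psi> x) \<partial>lborel)"
    by (simp only: sum_distrib_right)
  also have "\<dots> = (\<Sum>i\<in>Basis. (\<integral>x. (Da i x \<bullet> i) * \<psi> x \<partial>lborel))"
    by (rule Bochner_Integration.integral_sum[OF i1])
  also have "\<dots> = (\<Sum>i\<in>Basis. - (\<integral>x. (a x \<bullet> i) * (D\<psi> x \<bullet> i) \<partial>lborel))"
    by (rule sum.cong[OF refl *])
  also have "\<dots> = - (\<integral>x. (\<Sum>i\<in>Basis. (a x \<bullet> i) * (D\<psi> x \<bullet> i)) \<partial>lborel)"
    by (simp only: sum_negf Bochner_Integration.integral_sum[OF i2])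
  also have "(\<lambda>x. \<Sum>i\<in>Basis. (a x \<bullet> i) * (D\<psi> x \<bullet> i)) = (\<lambda>x. a x \<bullet> D\<psi> x)"
    by (rule ext) (rule euclidean_inner[symmetric])
  finally show ?thesis .
qed

section \<open>A Gagliardo--Nirenberg inequality of weak type\<close>

text \<open>The difference is the integral of the gradient along the segment from \<open>x\<close> to \<open>x + z\<close>. Jensen's
  inequality moves the power inside, and each point of the segment contributes the same amount by
  translation invariance.\<close>

lemma nn_integral_translate_diff_powr_le:
  fixes v :: "'a::euclidean_space \<Rightarrow> real" and G :: "'a \<Rightarrow> 'a"
  assumes p: "1 < p" and d: "\<And>x. (v has_derivative (\<lambda>h. G x \<bullet> h)) (at x)" and G: "continuous_on UNIV G"
  shows "(\<integral>\<^sup>+x. ennreal (\<bar>v (x + z) - v x\<bar> powr p) \<partial>lborel) \<le> ennreal (norm z powr p) * (\<integral>\<^sup>+x. ennreal (norm (G x) powr p) \<partial>lborel)"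
proof -
  have [measurable]: "G \<in> borel_measurable borel" using G by (rule borel_measurable_continuous_onI)
  have pt: "ennreal (\<bar>v (x + z) - v x\<bar> powr p) \<le> (\<integral>\<^sup>+s. ennreal (norm z powr p) * ennreal (indicator {0..1} s * norm (G (x + s *\<^sub>R z)) powr p) \<partial>lborel)" for x
  proof -
    have cG: "continuous_on S (\<lambda>s. G (x + s *\<^sub>R z))" for S :: "real set"
      by (rule continuous_on_compose2[OF G]) (auto intro!: continuous_intros)
    \<comment> \<open>the restriction of \<open>v\<close> to the segment\<close>
    have vd: "((\<lambda>s. v (x + s *\<^sub>R z)) has_vector_derivative G (x + s *\<^sub>R z) \<bullet> z) (at s within S)" for s S
    proof -
      have 1: "((\<lambda>s. x + s *\<^sub>R z) has_derivative (\<lambda>c. c *\<^sub>R z)) (at s within S)"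
        by (auto intro!: derivative_eq_intros)
      have "((\<lambda>s. v (x + s *\<^sub>R z)) has_derivative (\<lambda>c. G (x + s *\<^sub>R z) \<bullet> (c *\<^sub>R z))) (at s within S)"
        by (rule has_derivative_compose[OF 1 d])
      then show ?thesis by (simp add: has_vector_derivative_def)
    qed
    have "(\<integral>s. indicator {0..1} s *\<^sub>R (G (x + s *\<^sub>R z) \<bullet> z) \<partial>lborel) = v (x + 1 *\<^sub>R z) - v (x + 0 *\<^sub>R z)"
      by (rule integral_FTC_Icc[OF zero_le_one vd]) (intro continuous_intros cG)
    then have eq: "v (x + z) - v x = (\<integral>s. indicator {0..1} s *\<^sub>R (G (x + s *\<^sub>R z) \<bullet> z) \<partial>lborel)" by simp
    have i0: "integrable lborel (\<lambda>s. indicator {0..1::real} s *\<^sub>R f s)" if "continuous_on {0..1} f" for f :: "real \<Rightarrow> real"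
      using borel_integrable_compact[OF compact_Icc that] by (simp add: set_integrable_def)
    have "\<bar>v (x + z) - v x\<bar> \<le> (\<integral>s. norm (indicator {0..1} s *\<^sub>R (G (x + s *\<^sub>R z) \<bullet> z)) \<partial>lborel)"
      unfolding eq real_norm_def[symmetric] by (rule integral_norm_bound)
    also have "\<dots> \<le> (\<integral>s. indicator {0..1} s * (norm (G (x + s *\<^sub>R z)) * norm z) \<partial>lborel)"
    proof (rule integral_mono)
      show "integrable lborel (\<lambda>s. norm (indicator {0..1::real} s *\<^sub>R (G (x + s *\<^sub>R z) \<bullet> z)))"
        by (intro integrable_norm i0 continuous_intros cG)
      show "integrable lborel (\<lambda>s. indicator {0..1::real} s * (norm (G (x + s *\<^sub>R z)) * norm z))"
        using i0[of "\<lambda>s. norm (G (x + s *\<^sub>R z)) * norm z"] by (simp add: continuous_intros cG)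
      show "norm (indicator {0..1} s *\<^sub>R (G (x + s *\<^sub>R z) \<bullet> z)) \<le> indicator {0..1} s * (norm (G (x + s *\<^sub>R z)) * norm z)" for s
        by (auto simp: indicator_def Cauchy_Schwarz_ineq2)
    qed
    finally have "\<bar>v (x + z) - v x\<bar> powr p \<le> (\<integral>s. indicator {0..1} s * (norm (G (x + s *\<^sub>R z)) * norm z) \<partial>lborel) powr p"
      using p by (intro powr_mono2) auto
    also have "\<dots> \<le> (\<integral>s. indicator {0..1} s * (norm (G (x + s *\<^sub>R z)) * norm z) powr p \<partial>lborel)"
    proof (rule jensen_powr[OF p])
      show "integrable lborel (\<lambda>s. indicator {0..1::real} s * (norm (G (x + s *\<^sub>R z)) * norm z))"
        using i0[of "\<lambda>s. norm (G (x + s *\<^sub>R z)) * norm z"] by (simp add: continuous_intros cG)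
      show "integrable lborel (\<lambda>s. indicator {0..1::real} s * (norm (G (x + s *\<^sub>R z)) * norm z) powr p)"
      proof -
        have "continuous_on {0..1} (\<lambda>s. (norm (G (x + s *\<^sub>R z)) * norm z) powr p)"
          using p by (intro continuous_on_powr' continuous_intros cG) auto
        from i0[OF this] show ?thesis by simp
      qed
    qed auto
    finally have *: "\<bar>v (x + z) - v x\<bar> powr p \<le> (\<integral>s. indicator {0..1} s * (norm (G (x + s *\<^sub>R z)) * norm z) powr p \<partial>lborel)" .
    have c2: "continuous_on {0..1} (\<lambda>s. (norm (G (x + s *\<^sub>R z)) * norm z) powr p)"
      using p by (intro continuous_on_powr' continuous_intros cG) auto
    have "ennreal (\<bar>v (x + z) - v x\<bar> powr p) \<le> ennreal (\<integral>s. indicator {0..1} s * (norm (G (x + s *\<^sub>R z)) * norm z) powr p \<partial>lborel)"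
      by (rule ennreal_leI[OF *])
    also have "\<dots> = (\<integral>\<^sup>+s. ennreal (indicator {0..1} s * (norm (G (x + s *\<^sub>R z)) * norm z) powr p) \<partial>lborel)"
      using i0[OF c2] by (subst nn_integral_eq_integral) auto
    also have "\<dots> = (\<integral>\<^sup>+s. ennreal (norm z powr p) * ennreal (indicator {0..1} s * norm (G (x + s *\<^sub>R z)) powr p) \<partial>lborel)"
      by (intro nn_integral_cong) (simp add: ennreal_mult[symmetric] powr_mult mult_ac)
    finally show ?thesis .
  qed
  have "(\<integral>\<^sup>+x. ennreal (\<bar>v (x + z) - v x\<bar> powr p) \<partial>lborel)
     \<le> (\<integral>\<^sup>+x. (\<integral>\<^sup>+s. ennreal (norm z powr p) * ennreal (indicator {0..1} s * norm (G (x + s *\<^sub>R z)) powr p) \<partial>lborel) \<partial>lborel)"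
    by (intro nn_integral_mono pt)
  also have "\<dots> = (\<integral>\<^sup>+s. (\<integral>\<^sup>+x. ennreal (norm z powr p) * ennreal (indicator {0..1} s * norm (G (x + s *\<^sub>R z)) powr p) \<partial>lborel) \<partial>lborel)"
    by (rule lborel_pair.Fubini') measurable
  also have "\<dots> = (\<integral>\<^sup>+s. (ennreal (norm z powr p) * (\<integral>\<^sup>+x. ennreal (norm (G x) powr p) \<partial>lborel)) * indicator {0..1::real} s \<partial>lborel)"
  proof (intro nn_integral_cong)
    fix s :: real
    have "(\<integral>\<^sup>+x. ennreal (norm z powr p) * ennreal (indicator {0..1} s * norm (G (x + s *\<^sub>R z)) powr p) \<partial>lborel)
       = (\<integral>\<^sup>+x. (ennreal (norm z powr p) * indicator {0..1} s) * ennreal (norm (G (x + s *\<^sub>R z)) powr p) \<partial>lborel)"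
      by (intro nn_integral_cong) (auto simp: indicator_def)
    also have "\<dots> = (ennreal (norm z powr p) * indicator {0..1} s) * (\<integral>\<^sup>+x. ennreal (norm (G (x + s *\<^sub>R z)) powr p) \<partial>lborel)"
      by (rule nn_integral_cmult) measurable
    also have "(\<integral>\<^sup>+x. ennreal (norm (G (x + s *\<^sub>R z)) powr p) \<partial>lborel) = (\<integral>\<^sup>+x. ennreal (norm (G x) powr p) \<partial>lborel)"
      by (rule nn_integral_lborel_translate[of "\<lambda>x. ennreal (norm (G x) powr p)"]) measurable
    finally show "(\<integral>\<^sup>+x. ennreal (norm z powr p) * ennreal (indicator {0..1} s * norm (G (x + s *\<^sub>R z)) powr p) \<partial>lborel)
       = (ennreal (norm z powr p) * (\<integral>\<^sup>+x. ennreal (norm (G x) powr p) \<partial>lborel)) * indicator {0..1} s"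
      by (simp add: mult_ac)
  qed
  also have "\<dots> = ennreal (norm z powr p) * (\<integral>\<^sup>+x. ennreal (norm (G x) powr p) \<partial>lborel)"
    by (subst nn_integral_cmult_indicator) auto
  finally show ?thesis .
qed

text \<open>Fix a ball of measure \<open>8 * A / l\<^sup>2\<close>. By Chebyshev's inequality \<open>\<bar>v\<bar>\<close> can be at least \<open>l / 2\<close> on at
  most half of its measure. Hence a point \<open>x\<close> with \<open>\<bar>v x\<bar> > l\<close> sees, in at least half of the ball
  around it, points where \<open>v\<close> differs from \<open>v x\<close> by \<open>l / 2\<close> or more. Integrating
  \<open>\<bar>v (x + z) - v x\<bar> powr p\<close> over the ball and over \<open>x\<close>, and bounding it with the radius of the ball and
  the gradient, yields the claim.\<close>

proposition weak_gagliardo_nirenberg: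
  fixes v :: "'a::euclidean_space \<Rightarrow> real" and G :: "'a \<Rightarrow> 'a"
  assumes p: "1 < p" and d: "\<And>x. (v has_derivative (\<lambda>h. G x \<bullet> h)) (at x)" and G: "continuous_on UNIV G"
    and A: "(\<integral>\<^sup>+x. ennreal ((v x)\<^sup>2) \<partial>lborel) \<le> ennreal A" "0 < A" and l: "0 < l"
  shows "emeasure lborel {x. l < \<bar>v x\<bar>} \<le>
     ennreal (2 * (2 / l) powr p * (8 * A / (l\<^sup>2 * unit_ball_vol DIM('a))) powr (p / DIM('a))) * (\<integral>\<^sup>+x. ennreal (norm (G x) powr p) \<partial>lborel)"
proof -
  have v: "continuous_on UNIV v" using d by (meson has_derivative_continuous continuous_at_imp_continuous_on)
  have [measurable]: "v \<in> borel_measurable borel" "G \<in> borel_measurable borel"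
    using v G by (auto intro: borel_measurable_continuous_onI)
  define \<omega> where "\<omega> = unit_ball_vol (real DIM('a))"
  have \<omega>: "0 < \<omega>" by (simp add: \<omega>_def)
  \<comment> \<open>the radius \<open>R\<close> is chosen so that the ball has measure \<open>V\<close>\<close>
  define V where "V = 8 * A / l\<^sup>2"
  have V: "0 < V" using A l by (simp add: V_def)
  define R where "R = (V / \<omega>) powr (1 / DIM('a))"
  have R: "0 < R" using V \<omega> by (simp add: R_def)
  have "R ^ DIM('a) = R powr DIM('a)" using R by (simp add: powr_realpow)
  also have "\<dots> = V / \<omega>" using V \<omega> by (simp add: R_def powr_powr)
  finally have RN: "\<omega> * R ^ DIM('a) = V" using \<omega> by simp
  have Rp: "R powr p = (8 * A / (l\<^sup>2 * \<omega>)) powr (p / DIM('a))"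
    by (simp add: R_def V_def powr_powr)
  have ball: "emeasure lborel (ball (0::'a) R) = ennreal V"
    using R RN by (simp add: emeasure_ball \<omega>_def)
  define B where "B = (\<integral>\<^sup>+x. ennreal (norm (G x) powr p) \<partial>lborel)"
  define I where "I = (indicator (ball (0::'a) R) :: 'a \<Rightarrow> ennreal)"
  have I[measurable]: "I \<in> borel_measurable borel" unfolding I_def by (rule borel_measurable_indicator) simp
  have key: "ennreal (V / 2) * indicator {x. l < \<bar>v x\<bar>} x \<le>
      (\<integral>\<^sup>+z. (ennreal ((2 / l) powr p) * indicator (ball 0 R) z) * ennreal (\<bar>v (x + z) - v x\<bar> powr p) \<partial>lborel)" for x
  proof (cases "l < \<bar>v x\<bar>")
    case True
    define T where "T = {z. l / 2 \<le> \<bar>v (x + z)\<bar>}"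
    define S where "S = {z \<in> ball 0 R. l / 2 \<le> \<bar>v (x + z) - v x\<bar>}"
    have [measurable]: "T \<in> sets borel" "S \<in> sets borel" unfolding T_def S_def by measurable
    have "ennreal ((l / 2)\<^sup>2) * emeasure lborel T = (\<integral>\<^sup>+z. ennreal ((l / 2)\<^sup>2) * indicator T z \<partial>lborel)"
      by (rule nn_integral_cmult_indicator[symmetric]) auto
    also have "\<dots> \<le> (\<integral>\<^sup>+z. ennreal ((v (z + x))\<^sup>2) \<partial>lborel)"
    proof (intro nn_integral_mono)
      fix z
      have "(l / 2)\<^sup>2 \<le> (v (z + x))\<^sup>2" if "z \<in> T"
        using that l by (metis T_def abs_le_square_iff abs_of_pos add.commute half_gt_zero mem_Collect_eq)
      then show "ennreal ((l / 2)\<^sup>2) * indicator T z \<le> ennreal ((v (z + x))\<^sup>2)"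
        by (auto simp: indicator_def intro: ennreal_leI)
    qed
    also have "\<dots> = (\<integral>\<^sup>+z. ennreal ((v z)\<^sup>2) \<partial>lborel)" by (rule nn_integral_lborel_translate[of "\<lambda>z. ennreal ((v z)\<^sup>2)"]) measurable
    also have "\<dots> \<le> ennreal A" by (rule A)
    also have "\<dots> = ennreal ((l / 2)\<^sup>2) * ennreal (V / 2)"
      using l A by (subst ennreal_mult[symmetric]) (auto simp: V_def power2_eq_square)
    finally have T: "emeasure lborel T \<le> ennreal (V / 2)"
      by (subst (asm) ennreal_mult_le_mult_iff) (use l in auto)
    have "ball 0 R \<subseteq> T \<union> S"
    proof
      fix z :: 'a assume z: "z \<in> ball 0 R"
      have "\<bar>v x\<bar> - \<bar>v (x + z)\<bar> \<le> \<bar>v (x + z) - v x\<bar>"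
        using abs_triangle_ineq2[of "v x" "v (x + z)"] by (simp add: abs_minus_commute)
      then have "l / 2 \<le> \<bar>v (x + z)\<bar> \<or> l / 2 \<le> \<bar>v (x + z) - v x\<bar>" using True by linarith
      then show "z \<in> T \<union> S" using z by (auto simp: T_def S_def)
    qed
    then have "emeasure lborel (ball (0::'a) R) \<le> emeasure lborel (T \<union> S)" by (intro emeasure_mono) auto
    also have "\<dots> \<le> emeasure lborel T + emeasure lborel S" by (rule emeasure_subadditive) auto
    also have "\<dots> \<le> ennreal (V / 2) + emeasure lborel S" by (intro add_right_mono T)
    finally have "ennreal (V / 2) + ennreal (V / 2) \<le> ennreal (V / 2) + emeasure lborel S"
      using V by (simp add: ball ennreal_plus[symmetric] del: ennreal_plus)
    then have S: "ennreal (V / 2) \<le> emeasure lborel S" by (simp add: ennreal_add_left_cancel_le)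
    also have "emeasure lborel S = (\<integral>\<^sup>+z. indicator S z \<partial>lborel)" by simp
    also have "\<dots> \<le> (\<integral>\<^sup>+z. (ennreal ((2 / l) powr p) * indicator (ball 0 R) z) * ennreal (\<bar>v (x + z) - v x\<bar> powr p) \<partial>lborel)"
    proof (intro nn_integral_mono)
      fix z
      show "indicator S z \<le> (ennreal ((2 / l) powr p) * indicator (ball 0 R) z) * ennreal (\<bar>v (x + z) - v x\<bar> powr p)"
      proof (cases "z \<in> S")
        case zS: True
        have "1 = (2 / l) powr p * (l / 2) powr p" using l by (subst powr_mult[symmetric]) auto
        also have "\<dots> \<le> (2 / l) powr p * \<bar>v (x + z) - v x\<bar> powr p"
          using zS l p by (intro mult_left_mono powr_mono2) (auto simp: S_def)
        finally have "ennreal 1 \<le> ennreal ((2 / l) powr p * \<bar>v (x + z) - v x\<bar> powr p)" by (rule ennreal_leI)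
        then show ?thesis using zS by (simp add: S_def ennreal_mult)
      qed auto
    qed
    finally show ?thesis using True by simp
  qed simp
  have "ennreal (V / 2) * emeasure lborel {x. l < \<bar>v x\<bar>} = (\<integral>\<^sup>+x. ennreal (V / 2) * indicator {x. l < \<bar>v x\<bar>} x \<partial>lborel)"
    by (rule nn_integral_cmult_indicator[symmetric]) measurable
  also have "\<dots> \<le> (\<integral>\<^sup>+x. (\<integral>\<^sup>+z. (ennreal ((2 / l) powr p) * I z) * ennreal (\<bar>v (x + z) - v x\<bar> powr p) \<partial>lborel) \<partial>lborel)"
    unfolding I_def by (intro nn_integral_mono key)
  also have "\<dots> = (\<integral>\<^sup>+z. (\<integral>\<^sup>+x. (ennreal ((2 / l) powr p) * I z) * ennreal (\<bar>v (x + z) - v x\<bar> powr p) \<partial>lborel) \<partial>lborel)"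
    by (rule lborel_pair.Fubini') measurable
  also have "\<dots> \<le> (\<integral>\<^sup>+z. (ennreal ((2 / l) powr p) * (ennreal (R powr p) * B)) * I z \<partial>lborel)"
  proof (intro nn_integral_mono)
    fix z :: 'a
    have "(\<integral>\<^sup>+x. (ennreal ((2 / l) powr p) * I z) * ennreal (\<bar>v (x + z) - v x\<bar> powr p) \<partial>lborel)
       = (ennreal ((2 / l) powr p) * I z) * (\<integral>\<^sup>+x. ennreal (\<bar>v (x + z) - v x\<bar> powr p) \<partial>lborel)"
      by (rule nn_integral_cmult) measurable
    also have "\<dots> \<le> (ennreal ((2 / l) powr p) * I z) * (ennreal (R powr p) * B)"
    proof (cases "z \<in> ball 0 R")
      case True
      have "(\<integral>\<^sup>+x. ennreal (\<bar>v (x + z) - v x\<bar> powr p) \<partial>lborel) \<le> ennreal (norm z powr p) * B"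
        unfolding B_def by (rule nn_integral_translate_diff_powr_le[OF p d G])
      also have "\<dots> \<le> ennreal (R powr p) * B"
        using True p by (intro mult_right_mono ennreal_leI powr_mono2) auto
      finally show ?thesis by (intro mult_left_mono) auto
    qed (simp add: I_def)
    finally show "(\<integral>\<^sup>+x. (ennreal ((2 / l) powr p) * I z) * ennreal (\<bar>v (x + z) - v x\<bar> powr p) \<partial>lborel)
      \<le> (ennreal ((2 / l) powr p) * (ennreal (R powr p) * B)) * I z" by (simp add: mult_ac)
  qed
  also have "\<dots> = (ennreal ((2 / l) powr p) * (ennreal (R powr p) * B)) * ennreal V"
    unfolding I_def by (subst nn_integral_cmult_indicator) (auto simp: ball)
  also have "\<dots> = ennreal (V / 2) * (ennreal (2 * (2 / l) powr p * R powr p) * B)"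
  proof -
    have "ennreal (2 * (2 / l) powr p * R powr p) = 2 * (ennreal ((2 / l) powr p) * ennreal (R powr p))"
      by (simp add: ennreal_mult mult_ac)
    moreover have "ennreal V = ennreal (V / 2) * 2" using V by (simp add: ennreal_mult'[symmetric] flip: ennreal_numeral)
    ultimately show ?thesis by (simp add: mult_ac)
  qed
  finally have "emeasure lborel {x. l < \<bar>v x\<bar>} \<le> ennreal (2 * (2 / l) powr p * R powr p) * B"
    by (subst (asm) ennreal_mult_le_mult_iff) (use V in auto)
  then show ?thesis by (simp add: Rp B_def \<omega>_def)
qed

section \<open>Borel representatives and local solutions\<close>

text \<open>Weak solutions are measurable with respect to the completed measure, whereas mollification and
  Fubini's theorem are applied to Borel functions. The following lemmas pass from one to the other.\<close>

lemma borel_measurable_lebesgue_AE: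
  fixes f g :: "'a::euclidean_space \<Rightarrow> 'b::topological_space"
  assumes g: "g \<in> borel_measurable borel" and ae: "AE x in lborel. f x = g x"
  shows "f \<in> borel_measurable lebesgue"
proof (rule measurableI)
  fix A :: "'b set" assume A: "A \<in> sets borel"
  from ae obtain N where N: "N \<in> null_sets lborel" "{x. f x \<noteq> g x} \<subseteq> N"
    by (auto elim!: AE_E simp: null_sets_def)
  have "g -` A \<in> sets lborel" using measurable_sets[OF g A] by simp
  then have 1: "g -` A \<in> sets lebesgue" by (rule sets_completionI_sets)
  have sub: "B \<subseteq> N \<Longrightarrow> B \<in> sets lebesgue" for B
    using N(1) null_sets_completion_subset[of B N lborel] null_sets_completionI[OF N(1)] by (auto simp: null_sets_def)
  have "f -` A = (g -` A - (g -` A - f -` A)) \<union> (f -` A - g -` A)" by auto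
  moreover have "g -` A - f -` A \<in> sets lebesgue" "f -` A - g -` A \<in> sets lebesgue"
    using N(2) by (auto intro!: sub)
  ultimately show "f -` A \<inter> space lebesgue \<in> sets lebesgue"
    using 1 by (metis Int_UNIV_right sets.Diff sets.Un space_completion space_lborel space_borel)
qed simp

lemma integral_lebesgue_eq_lborel:
  fixes f g :: "'a::euclidean_space \<Rightarrow> 'b::{banach, second_countable_topology}"
  assumes g: "g \<in> borel_measurable borel" and ae: "AE x in lborel. f x = g x"
  shows "integral\<^sup>L lebesgue f = integral\<^sup>L lborel g"
proof -
  have "integral\<^sup>L lebesgue f = integral\<^sup>L lebesgue g"
  proof (rule integral_cong_AE)
    show "f \<in> borel_measurable lebesgue" by (rule borel_measurable_lebesgue_AE[OF g ae])
    show "g \<in> borel_measurable lebesgue" using g by (intro measurable_completion) simp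
    show "AE x in lebesgue. f x = g x" by (rule AE_completion[OF ae])
  qed
  also have "\<dots> = integral\<^sup>L lborel g" using g by (intro integral_completion) simp
  finally show ?thesis .
qed

text \<open>The representative vanishes outside \<open>Q\<close>, which makes global integrals out of integrals
  over \<open>Q\<close>.\<close>

lemma ex_borel_representative:
  fixes f :: "'a::euclidean_space \<Rightarrow> 'b::euclidean_space"
  assumes f: "f \<in> borel_measurable (lebesgue_on S)" and Q: "Q \<subseteq> S" "Q \<in> sets borel"
  shows "\<exists>g\<in>borel_measurable borel. (\<forall>w. w \<notin> Q \<longrightarrow> g w = 0) \<and> (AE w in lborel. w \<in> Q \<longrightarrow> g w = f w)"
proof -
  have "f \<in> borel_measurable (lebesgue_on Q)" by (rule measurable_restrict_mono[OF f Q(1)])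
  then have h: "(\<lambda>x. if x \<in> Q then f x else 0) \<in> borel_measurable lebesgue"
    using Q(2) by (intro borel_measurable_if_I) auto
  have "\<exists>g\<in>borel_measurable lborel. AE x in lborel. (if x \<in> Q then f x else 0) \<bullet> i = g x" for i
  proof (rule completion_ex_borel_measurable_real)
    show "(\<lambda>x. (if x \<in> Q then f x else 0) \<bullet> i) \<in> borel_measurable lebesgue"
      using h by (rule borel_measurable_inner) simp
  qed
  then obtain g where g: "\<And>i. g i \<in> borel_measurable lborel" "\<And>i. AE x in lborel. (if x \<in> Q then f x else 0) \<bullet> i = g i x"
    by metis
  define g' where "g' x = (\<Sum>i\<in>Basis. (indicator Q x * g i x) *\<^sub>R i)" for x
  have [measurable]: "g i \<in> borel_measurable borel" for i using g(1)[of i] by simp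
  have "g' \<in> borel_measurable borel" unfolding g'_def using Q(2) by measurable
  moreover have "\<forall>w. w \<notin> Q \<longrightarrow> g' w = 0" by (simp add: g'_def)
  moreover have "AE w in lborel. w \<in> Q \<longrightarrow> g' w = f w"
  proof -
    have "AE x in lborel. \<forall>i\<in>Basis. (if x \<in> Q then f x else 0) \<bullet> i = g i x"
      using g(2) by (intro AE_finite_allI) auto
    then show ?thesis
    proof eventually_elim
      case (elim x)
      show ?case
      proof
        assume x: "x \<in> Q"
        have "g' x = (\<Sum>i\<in>Basis. (f x \<bullet> i) *\<^sub>R i)"
          unfolding g'_def using elim x by (intro sum.cong) auto
        then show "g' x = f x" by (simp add: euclidean_representation)
      qed
    qed
  qed
  ultimately show ?thesis by blast
qed

text \<open>Almost every slice of a null set is a null set, in either direction.\<close>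

lemma AE_lborel_pair:
  assumes "AE w in (lborel :: ('a::euclidean_space \<times> 'b::euclidean_space) measure). P w"
  shows "AE x in lborel. AE t in lborel. P (x, t)" and "AE t in lborel. AE x in lborel. P (x, t)"
proof -
  from assms obtain N where N: "N \<in> sets lborel" "emeasure lborel N = 0" "{w. \<not> P w} \<subseteq> N"
    by (auto elim!: AE_E)
  have "AE w in lborel. w \<notin> N" using N by (intro AE_not_in) auto
  then have *: "AE w in (lborel \<Otimes>\<^sub>M lborel :: ('a \<times> 'b) measure). w \<notin> N"
    unfolding lborel_prod .
  have Ns: "N \<in> sets (lborel \<Otimes>\<^sub>M lborel)" unfolding lborel_prod by (rule N(1))
  have 1: "AE x in lborel. AE t in lborel. (x, t) \<notin> N" by (rule lborel_pair.AE_pair[OF *])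
  then show "AE x in lborel. AE t in lborel. P (x, t)"
    using N(3) by (auto elim!: eventually_mono)
  have "AE t in lborel. AE x in lborel. (x, t) \<notin> N"
  proof (subst lborel_pair.AE_commute[symmetric])
    have "{w \<in> space (lborel \<Otimes>\<^sub>M lborel :: ('a \<times> 'b) measure). (fst w, snd w) \<notin> N} = space (lborel \<Otimes>\<^sub>M lborel) - N" by auto
    then show "{w \<in> space (lborel \<Otimes>\<^sub>M lborel :: ('a \<times> 'b) measure). (fst w, snd w) \<notin> N} \<in> sets (lborel \<Otimes>\<^sub>M lborel)"
      using sets.compl_sets[OF Ns] by (simp only:)
  qed (rule 1)
  then show "AE t in lborel. AE x in lborel. P (x, t)"
    using N(3) by (auto elim!: eventually_mono)
qed

lemma test_function_grad_facts:
  fixes \<phi> :: "real ^ 'n::finite \<Rightarrow> real"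
  assumes "\<phi> \<in> test_functions S"
  shows "continuous_on UNIV \<phi>" "continuous_on UNIV (grad \<phi>)"
    "\<And>x. x \<notin> S \<Longrightarrow> \<phi> x = 0" "\<And>x. x \<notin> S \<Longrightarrow> grad \<phi> x = 0"
    "\<exists>M. \<forall>x. \<bar>\<phi> x\<bar> \<le> M" "\<exists>M. \<forall>x. norm (grad \<phi> x) \<le> M"
proof -
  have Ck: "C_k k \<phi>" for k using assms by (auto simp: test_functions_def)
  show c: "continuous_on UNIV \<phi>" using Ck[of 0] by simp
  have "continuous_on UNIV (partial_deriv i \<phi>)" for i using Ck[of "Suc 0"] by simp
  then show c': "continuous_on UNIV (grad \<phi>)" unfolding grad_def by (intro continuous_on_vec_lambda)
  let ?K = "closure {x. \<phi> x \<noteq> 0}"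
  have K: "compact ?K" "?K \<subseteq> S" using assms by (auto simp: test_functions_def)
  have z: "\<phi> x = 0" if "x \<notin> ?K" for x using that closure_subset[of "{x. \<phi> x \<noteq> 0}"] by auto
  have z': "grad \<phi> x = 0" if x: "x \<notin> ?K" for x
  proof -
    have "((\<lambda>_. 0) has_derivative (\<lambda>_. 0)) (at x)" by simp
    then have "(\<phi> has_derivative (\<lambda>_. 0)) (at x)"
    proof (rule has_derivative_transform_within_open[where s="- ?K"])
      show "open (- ?K)" by (rule open_Compl[OF closed_closure])
      show "x \<in> - ?K" using x by simp
      show "0 = \<phi> y" if "y \<in> - ?K" for y using z[of y] that by (metis ComplD)
    qed
    then show ?thesis unfolding grad_def by (simp add: partial_deriv_has_derivative vec_eq_iff)
  qed
  show "\<And>x. x \<notin> S \<Longrightarrow> \<phi> x = 0" "\<And>x. x \<notin> S \<Longrightarrow> grad \<phi> x = 0" using z z' K(2) by blast+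
  obtain R where R: "\<And>x. x \<in> ?K \<Longrightarrow> norm x \<le> R" using compact_imp_bounded[OF K(1)] by (auto simp: bounded_iff)
  have "R + 1 \<le> norm x \<Longrightarrow> \<phi> x = 0" "R + 1 \<le> norm x \<Longrightarrow> grad \<phi> x = 0" for x
    using z[of x] z'[of x] R[of x] by linarith+
  then show "\<exists>M. \<forall>x. \<bar>\<phi> x\<bar> \<le> M" "\<exists>M. \<forall>x. norm (grad \<phi> x) \<le> M"
    using bounded_of_compact_support[OF c, of "R + 1"] bounded_of_compact_support[OF c', of "R + 1"] by auto
qed

text \<open>The functions \<open>u\<close>, \<open>D\<close> and \<open>a\<close> are the solution, its spatial gradient and the flux, extended by
  zero outside the cylinder. The two identities say that \<open>D\<close> is the weak gradient of \<open>u\<close> and that the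
  equation holds, both for integrals over the time window \<open>[t, t + h]\<close>, which are \<open>h\<close> times Steklov
  averages. Windows are restricted to the cylinder, where the extension is harmless.\<close>

definition local_solution ::
  "real \<Rightarrow> real \<Rightarrow> ((real ^ 'n::finite) \<times> real \<Rightarrow> real) \<Rightarrow> ((real ^ 'n) \<times> real \<Rightarrow> real ^ 'n) \<Rightarrow> ((real ^ 'n) \<times> real \<Rightarrow> real ^ 'n) \<Rightarrow> bool"
where
  "local_solution \<rho> \<theta> u D a \<longleftrightarrow>
     integrable lborel u \<and> integrable lborel D \<and> integrable lborel a \<and>
     (\<forall>w. w \<notin> cylinder \<rho> \<theta> \<longrightarrow> u w = 0 \<and> D w = 0 \<and> a w = 0) \<and>
     (\<forall>\<phi>\<in>test_functions (ball 0 \<rho>). \<forall>t h. 0 < h \<and> - \<theta> < t \<and> t + h < \<theta> \<longrightarrow>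
        (\<integral>w. (indicator {0..h} (snd w - t) * u w) *\<^sub>R grad \<phi> (fst w) \<partial>lborel)
          = - (\<integral>w. (indicator {0..h} (snd w - t) * \<phi> (fst w)) *\<^sub>R D w \<partial>lborel) \<and>
        ((\<lambda>s. \<integral>w. indicator {0..h} (snd w - s) * u w * \<phi> (fst w) \<partial>lborel) has_real_derivative
          - (\<integral>w. indicator {0..h} (snd w - t) * (a w \<bullet> grad \<phi> (fst w)) \<partial>lborel)) (at t))"

lemma lborel_Fubini:
  fixes f :: "'a::euclidean_space \<times> 'b::euclidean_space \<Rightarrow> 'c::{banach, second_countable_topology}"
  assumes f: "integrable lborel f"
  shows "(\<integral>w. f w \<partial>lborel) = (\<integral>x. (\<integral>t. f (x, t) \<partial>lborel) \<partial>lborel)"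
    "(\<integral>w. f w \<partial>lborel) = (\<integral>t. (\<integral>x. f (x, t) \<partial>lborel) \<partial>lborel)"
    "integrable lborel (\<lambda>x. \<integral>t. f (x, t) \<partial>lborel)" "integrable lborel (\<lambda>t. \<integral>x. f (x, t) \<partial>lborel)"
    "AE x in lborel. integrable lborel (\<lambda>t. f (x, t))" "AE t in lborel. integrable lborel (\<lambda>x. f (x, t))"
proof -
  have i: "integrable (lborel \<Otimes>\<^sub>M lborel) (\<lambda>(x, t). f (x, t))" using f by (simp add: lborel_prod)
  show "(\<integral>w. f w \<partial>lborel) = (\<integral>x. (\<integral>t. f (x, t) \<partial>lborel) \<partial>lborel)"
    using lborel_pair.integral_fst[OF i] by (simp add: lborel_prod)
  show "(\<integral>w. f w \<partial>lborel) = (\<integral>t. (\<integral>x. f (x, t) \<partial>lborel) \<partial>lborel)"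
    using lborel_pair.integral_snd[OF i] by (simp add: lborel_prod)
  show "integrable lborel (\<lambda>x. \<integral>t. f (x, t) \<partial>lborel)" using lborel_pair.integrable_fst[OF i] .
  show "integrable lborel (\<lambda>t. \<integral>x. f (x, t) \<partial>lborel)" using lborel_pair.integrable_snd[OF i] .
  show "AE x in lborel. integrable lborel (\<lambda>t. f (x, t))" using lborel_pair.AE_integrable_fst[OF i] .
  show "AE t in lborel. integrable lborel (\<lambda>x. f (x, t))" using lborel_pair.AE_integrable_snd[OF i] .
qed

lemma nn_integral_lborel_snd:
  fixes f :: "'a::euclidean_space \<times> 'b::euclidean_space \<Rightarrow> ennreal"
  assumes "f \<in> borel_measurable borel"
  shows "(\<integral>\<^sup>+w. f w \<partial>lborel) = (\<integral>\<^sup>+t. (\<integral>\<^sup>+x. f (x, t) \<partial>lborel) \<partial>lborel)"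
  using lborel_pair.nn_integral_snd[of f] assms by (simp add: lborel_prod)

lemma integral_lebesgue_on_eq_lborel:
  fixes f g :: "'a::euclidean_space \<Rightarrow> 'b::{banach, second_countable_topology}"
  assumes S: "S \<in> sets borel" and g: "g \<in> borel_measurable borel"
    and ae: "AE x in lborel. indicator S x *\<^sub>R f x = g x"
  shows "integral\<^sup>L (lebesgue_on S) f = integral\<^sup>L lborel g"
  using S integral_lebesgue_eq_lborel[OF g ae] by (subst integral_restrict_space) auto

lemma nn_integral_lebesgue_on:
  fixes f :: "'a::euclidean_space \<Rightarrow> ennreal"
  assumes "S \<in> sets borel"
  shows "(\<integral>\<^sup>+x. f x \<partial>lebesgue_on S) = (\<integral>\<^sup>+x. f x * indicator S x \<partial>lborel)"
  using assms by (subst nn_integral_restrict_space) (auto simp: nn_integral_completion)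

lemma AE_lebesgue_on_iff:
  assumes "S \<in> sets borel"
  shows "(AE x in lebesgue_on S. P x) \<longleftrightarrow> (AE x in lborel. x \<in> S \<longrightarrow> P x)"
  using assms by (subst AE_restrict_space_iff) (auto simp: AE_completion_iff)

lemma ennpowr_powr_inverse: "0 < p \<Longrightarrow> ennpowr (ennpowr x (1 / p)) p = x"
  by (cases "x = top") (auto simp: ennpowr_def powr_powr less_top)

lemma cylinder_facts:
  "(cylinder \<rho> \<theta> :: ('a::euclidean_space \<times> real) set) \<in> sets borel"
  "emeasure lborel (cylinder \<rho> \<theta> :: ('a::euclidean_space \<times> real) set) < \<infinity>"
  "(x, t) \<in> cylinder \<rho> \<theta> \<longleftrightarrow> norm x < \<rho> \<and> \<bar>t\<bar> \<le> \<theta>"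
proof -
  show "(cylinder \<rho> \<theta> :: ('a \<times> real) set) \<in> sets borel"
    unfolding cylinder_def by (intro borel_Times) auto
  have "bounded (cylinder \<rho> \<theta> :: ('a \<times> real) set)"
    unfolding cylinder_def by (intro bounded_Times) auto
  then show "emeasure lborel (cylinder \<rho> \<theta> :: ('a \<times> real) set) < \<infinity>"
    by (rule emeasure_bounded_finite)
  show "(x, t) \<in> cylinder \<rho> \<theta> \<longleftrightarrow> norm x < \<rho> \<and> \<bar>t\<bar> \<le> \<theta>"
    by (auto simp: cylinder_def dist_norm)
qed

section \<open>Truncations and cutoff functions\<close>

lemma integrable_scaleR_bounded:
  fixes f :: "'a::euclidean_space \<Rightarrow> real" and b :: "'a \<Rightarrow> 'b::{banach, second_countable_topology}"
  assumes f: "integrable lborel f" and [measurable]: "b \<in> borel_measurable borel" and b: "\<And>w. norm (b w) \<le> M"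
  shows "integrable lborel (\<lambda>w. f w *\<^sub>R b w)"
proof (rule Bochner_Integration.integrable_bound)
  show "integrable lborel (\<lambda>w. M * \<bar>f w\<bar>)" using f by simp
  show "(\<lambda>w. f w *\<^sub>R b w) \<in> borel_measurable lborel"
    using borel_measurable_integrable[OF f] by measurable
  show "AE w in lborel. norm (f w *\<^sub>R b w) \<le> norm (M * \<bar>f w\<bar>)"
  proof (rule AE_I2)
    fix w
    have "\<bar>f w\<bar> * norm (b w) \<le> \<bar>f w\<bar> * \<bar>M\<bar>" using b[of w] by (intro mult_left_mono) auto
    then show "norm (f w *\<^sub>R b w) \<le> norm (M * \<bar>f w\<bar>)" by (simp add: abs_mult mult.commute)
  qed
qed

lemma integrable_inner_bounded:
  fixes f b :: "'a::euclidean_space \<Rightarrow> 'b::euclidean_space"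
  assumes f: "integrable lborel f" and [measurable]: "b \<in> borel_measurable borel" and b: "\<And>w. norm (b w) \<le> M"
  shows "integrable lborel (\<lambda>w. f w \<bullet> b w)"
proof (rule Bochner_Integration.integrable_bound)
  show "integrable lborel (\<lambda>w. M * norm (f w))" using f by simp
  show "(\<lambda>w. f w \<bullet> b w) \<in> borel_measurable lborel"
    using borel_measurable_integrable[OF f] by measurable
  show "AE w in lborel. norm (f w \<bullet> b w) \<le> norm (M * norm (f w))"
  proof (rule AE_I2)
    fix w
    have "\<bar>f w \<bullet> b w\<bar> \<le> norm (f w) * norm (b w)" by (rule Cauchy_Schwarz_ineq2)
    also have "\<dots> \<le> norm (f w) * \<bar>M\<bar>" using b[of w] by (intro mult_left_mono) auto
    finally show "norm (f w \<bullet> b w) \<le> norm (M * norm (f w))" by (simp add: abs_mult mult.commute)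
  qed
qed

lemma has_real_derivative_pos_part_power:
  "((\<lambda>s. (max (s - k) 0) ^ Suc (Suc n)) has_real_derivative (real (n + 2) * (max (s - k) 0) ^ Suc n)) (at (s::real))"
proof (cases s k rule: linorder_cases)
  case less
  have "((\<lambda>s. 0) has_real_derivative 0) (at s)" by simp
  then have "((\<lambda>s. (max (s - k) 0) ^ Suc (Suc n)) has_real_derivative 0) (at s)"
    by (rule has_field_derivative_transform_within_open[where S="{..<k}"]) (use less in auto)
  then show ?thesis using less by simp
next
  case greater
  have "((\<lambda>s. (s - k) ^ Suc (Suc n)) has_real_derivative (real (n + 2) * (s - k) ^ Suc n)) (at s)"
  proof -
    have "((\<lambda>s. s - k) has_real_derivative 1) (at s)" by (auto intro!: derivative_eq_intros)
    from DERIV_chain2[OF DERIV_pow this, of "Suc (Suc n)"] show ?thesis by (simp add: mult.commute)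
  qed
  then have "((\<lambda>s. (max (s - k) 0) ^ Suc (Suc n)) has_real_derivative (real (n + 2) * (s - k) ^ Suc n)) (at s)"
    by (rule has_field_derivative_transform_within_open[where S="{k<..}"]) (use greater in auto)
  then show ?thesis using greater by simp
next
  case equal
  have "(\<lambda>y. ((max (y - k) 0) ^ Suc (Suc n) - 0) / (y - k)) \<midarrow>k\<rightarrow> 0"
  proof (rule Lim_null_comparison)
    show "\<forall>\<^sub>F y in at k. norm (((max (y - k) 0) ^ Suc (Suc n) - 0) / (y - k)) \<le> (max (y - k) 0) ^ Suc n"
    proof (rule always_eventually, rule allI)
      fix y
      show "norm (((max (y - k) 0) ^ Suc (Suc n) - 0) / (y - k)) \<le> (max (y - k) 0) ^ Suc n"
        by (cases "y > k") (auto simp: max_def)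
    qed
    have "((\<lambda>y. (max (y - k) 0) ^ Suc n) \<longlongrightarrow> (max (k - k) 0) ^ Suc n) (at k)"
      by (intro tendsto_intros)
    then show "(\<lambda>y. (max (y - k) 0) ^ Suc n) \<midarrow>k\<rightarrow> 0" by simp
  qed
  then show ?thesis using equal by (simp add: has_field_derivative_iff)
qed

text \<open>The function \<open>trunc k d\<close> is a continuously differentiable variant of \<open>s \<mapsto> (s - k)\<^sup>+\<close>, quadratic on
  \<open>[k, k + d]\<close> and of slope one above; it allows the classical chain rule. Its primitive and its
  derivative are differences of powers of positive parts as well.\<close>

definition trunc_prim :: "real \<Rightarrow> real \<Rightarrow> real \<Rightarrow> real" where
  "trunc_prim k d s = ((max (s - k) 0) ^ 3 - (max (s - (k + d)) 0) ^ 3) / (6 * d)"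
definition trunc :: "real \<Rightarrow> real \<Rightarrow> real \<Rightarrow> real" where
  "trunc k d s = ((max (s - k) 0)\<^sup>2 - (max (s - (k + d)) 0)\<^sup>2) / (2 * d)"
definition trunc_deriv :: "real \<Rightarrow> real \<Rightarrow> real \<Rightarrow> real" where
  "trunc_deriv k d s = (max (s - k) 0 - max (s - (k + d)) 0) / d"

lemma has_real_derivative_trunc_prim: "0 < d \<Longrightarrow> (trunc_prim k d has_real_derivative trunc k d s) (at s)"
proof -
  assume d: "0 < d"
  have "((\<lambda>s. ((max (s - k) 0) ^ 3 - (max (s - (k + d)) 0) ^ 3) / (6 * d)) has_real_derivative
     (3 * (max (s - k) 0)\<^sup>2 - 3 * (max (s - (k + d)) 0)\<^sup>2) / (6 * d)) (at s)"
    using has_real_derivative_pos_part_power[of k 1 s] has_real_derivative_pos_part_power[of "k + d" 1 s]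
    by (intro DERIV_cdivide DERIV_diff) (simp_all add: numeral_3_eq_3 numeral_2_eq_2)
  moreover have "(3 * (max (s - k) 0)\<^sup>2 - 3 * (max (s - (k + d)) 0)\<^sup>2) / (6 * d) = trunc k d s"
    using d by (simp add: trunc_def field_simps)
  ultimately show ?thesis by (simp add: trunc_prim_def[abs_def])
qed

lemma has_real_derivative_trunc: "0 < d \<Longrightarrow> (trunc k d has_real_derivative trunc_deriv k d s) (at s)"
proof -
  assume d: "0 < d"
  have "((\<lambda>s. ((max (s - k) 0)\<^sup>2 - (max (s - (k + d)) 0)\<^sup>2) / (2 * d)) has_real_derivative
     (2 * (max (s - k) 0) - 2 * (max (s - (k + d)) 0)) / (2 * d)) (at s)"
    using has_real_derivative_pos_part_power[of k 0 s] has_real_derivative_pos_part_power[of "k + d" 0 s]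
    by (intro DERIV_cdivide DERIV_diff) (simp_all add: numeral_2_eq_2)
  moreover have "(2 * (max (s - k) 0) - 2 * (max (s - (k + d)) 0)) / (2 * d) = trunc_deriv k d s"
    using d by (simp add: trunc_deriv_def field_simps)
  ultimately show ?thesis by (simp add: trunc_def[abs_def])
qed

lemma continuous_on_trunc:
  "continuous_on S (trunc_deriv k d)" "0 < d \<Longrightarrow> continuous_on S (trunc k d)" "0 < d \<Longrightarrow> continuous_on S (trunc_prim k d)"
  unfolding trunc_deriv_def[abs_def] trunc_def[abs_def] trunc_prim_def[abs_def] by (cases "d = 0"; auto intro!: continuous_intros)+

text \<open>The inequality between the square of \<open>trunc\<close> and its primitive lets the energy control the \<open>L\<^sup>2\<close>
  norm of slices. The bound by \<open>max (s - k) 0 * trunc_deriv k d s\<close> allows the terms with the gradient of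
  the cutoff to be absorbed, and the bound from below recovers the plain truncation at the level
  \<open>k + d\<close>.\<close>

lemma trunc_bounds:
  assumes d: "0 < d"
  shows "0 \<le> trunc_deriv k d s" "trunc_deriv k d s \<le> 1" "0 \<le> trunc k d s" "trunc k d s \<le> max (s - k) 0 * trunc_deriv k d s"
    "(trunc k d s)\<^sup>2 \<le> 2 * trunc_prim k d s" "2 * trunc_prim k d s \<le> (max (s - k) 0)\<^sup>2" "s - (k + d) \<le> trunc k d s" "0 \<le> trunc_prim k d s"
proof -
  define r where "r = s - k"
  have s: "s - k = r" "s - (k + d) = r - d" by (auto simp: r_def)
  have "0 \<le> trunc_deriv k d s \<and> trunc_deriv k d s \<le> 1 \<and> 0 \<le> trunc k d s \<and> trunc k d s \<le> max (s - k) 0 * trunc_deriv k d s \<and>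
    (trunc k d s)\<^sup>2 \<le> 2 * trunc_prim k d s \<and> 2 * trunc_prim k d s \<le> (max (s - k) 0)\<^sup>2 \<and> s - (k + d) \<le> trunc k d s"
  proof -
    consider "r \<le> 0" | "0 < r" "r \<le> d" | "d < r" by linarith
    then show ?thesis
    proof cases
      case 1
      then show ?thesis using d by (simp add: trunc_deriv_def trunc_def trunc_prim_def s)
    next
      case 2
      have g: "trunc k d s = r\<^sup>2 / (2 * d)" "trunc_deriv k d s = r / d" "trunc_prim k d s = r ^ 3 / (6 * d)"
        using 2 by (simp_all add: trunc_deriv_def trunc_def trunc_prim_def s)
      have "r ^ 4 * 3 \<le> 4 * d * r ^ 3"
      proof -
        have "r ^ 3 * (3 * r) \<le> r ^ 3 * (4 * d)" using 2 by (intro mult_left_mono) auto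
        then show ?thesis by (simp add: power_numeral_reduce mult_ac)
      qed
      then have 5: "(r\<^sup>2 / (2 * d))\<^sup>2 \<le> 2 * (r ^ 3 / (6 * d))"
        using d by (simp add: field_simps power_numeral_reduce)
      have "r ^ 3 \<le> 3 * d * r\<^sup>2"
      proof -
        have "r\<^sup>2 * r \<le> r\<^sup>2 * (3 * d)" using 2 by (intro mult_left_mono) auto
        then show ?thesis by (simp add: power_numeral_reduce mult_ac)
      qed
      then have 6: "2 * (r ^ 3 / (6 * d)) \<le> r\<^sup>2" using d by (simp add: field_simps)
      have 7: "r - d \<le> r\<^sup>2 / (2 * d)" using 2 d by (smt (verit) divide_nonneg_pos zero_le_power2)
      have c: "r\<^sup>2 / (2 * d) \<le> r * (r / d)" using d by (simp add: power2_eq_square field_simps)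
      show ?thesis using 2 d 5 6 7 c by (simp add: g s)
    next
      case 3
      have g: "trunc k d s = r - d / 2" "trunc_deriv k d s = 1" "trunc_prim k d s = (3 * r\<^sup>2 - 3 * r * d + d\<^sup>2) / 6"
      proof -
        have mx: "max (s - k) 0 = r" "max (s - (k + d)) 0 = r - d" using 3 d s by auto
        show "trunc k d s = r - d / 2" "trunc_deriv k d s = 1" "trunc_prim k d s = (3 * r\<^sup>2 - 3 * r * d + d\<^sup>2) / 6"
          using d unfolding trunc_deriv_def trunc_def trunc_prim_def mx by (simp_all add: field_simps power_numeral_reduce)
      qed
      have 5: "(r - d / 2)\<^sup>2 \<le> 2 * ((3 * r\<^sup>2 - 3 * r * d + d\<^sup>2) / 6)"
      proof -
        have "2 * ((3 * r\<^sup>2 - 3 * r * d + d\<^sup>2) / 6) - (r - d / 2)\<^sup>2 = d\<^sup>2 / 12"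
          by (simp add: power2_eq_square field_simps)
        then show ?thesis by (smt (verit) divide_nonneg_pos zero_le_power2)
      qed
      have "d * d \<le> 3 * (r * d)" using 3 d by (smt (verit) mult_right_mono mult_pos_pos)
      then have 6: "2 * ((3 * r\<^sup>2 - 3 * r * d + d\<^sup>2) / 6) \<le> r\<^sup>2" by (simp add: power2_eq_square field_simps)
      show ?thesis using 3 d 5 6 by (simp add: g s)
    qed
  qed
  then show "0 \<le> trunc_deriv k d s" "trunc_deriv k d s \<le> 1" "0 \<le> trunc k d s" "trunc k d s \<le> max (s - k) 0 * trunc_deriv k d s"
    "(trunc k d s)\<^sup>2 \<le> 2 * trunc_prim k d s" "2 * trunc_prim k d s \<le> (max (s - k) 0)\<^sup>2" "s - (k + d) \<le> trunc k d s" by auto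
  then show "0 \<le> trunc_prim k d s" by (smt (verit) zero_le_power2)
qed

lemma trunc_le:
  assumes d: "0 < d" and k: "0 \<le> k"
  shows "trunc k d s \<le> max (s - k) 0" "trunc k d s \<le> \<bar>s\<bar>" "trunc_prim k d s \<le> s\<^sup>2"
proof -
  have "max (s - k) 0 * trunc_deriv k d s \<le> max (s - k) 0"
    using mult_left_mono[OF trunc_bounds(2)[OF d, of k s], of "max (s - k) 0"] by simp
  with trunc_bounds(4)[OF d, of k s] show 1: "trunc k d s \<le> max (s - k) 0" by (rule order_trans)
  have 2: "max (s - k) 0 \<le> \<bar>s\<bar>" using k by linarith
  show "trunc k d s \<le> \<bar>s\<bar>" using 1 2 by linarith
  have "(max (s - k) 0)\<^sup>2 \<le> s\<^sup>2" using power_mono[OF 2, of 2] by simp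
  then show "trunc_prim k d s \<le> s\<^sup>2" using trunc_bounds(6,8)[OF d, of k s] by linarith
qed

text \<open>Two parabolas joined at \<open>1 / 2\<close>, rising from zero at \<open>0\<close> to one at \<open>1\<close>. One continuous derivative
  suffices for the cutoffs.\<close>

definition smoothstep :: "real \<Rightarrow> real" where
  "smoothstep s = 2 * (max (s - 0) 0)\<^sup>2 - 4 * (max (s - 1/2) 0)\<^sup>2 + 2 * (max (s - 1) 0)\<^sup>2"
definition smoothstep_deriv :: "real \<Rightarrow> real" where
  "smoothstep_deriv s = 4 * max (s - 0) 0 - 8 * max (s - 1/2) 0 + 4 * max (s - 1) 0"

lemma has_real_derivative_smoothstep: "(smoothstep has_real_derivative smoothstep_deriv s) (at s)"
proof -
  have *: "((\<lambda>s. (max (s - k) 0)\<^sup>2) has_real_derivative 2 * max (s - k) 0) (at s)" for k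
    using has_real_derivative_pos_part_power[of k 0 s] by (simp add: numeral_2_eq_2)
  have "((\<lambda>s. 2 * (max (s - 0) 0)\<^sup>2 - 4 * (max (s - 1/2) 0)\<^sup>2 + 2 * (max (s - 1) 0)\<^sup>2) has_real_derivative
     (2 * (2 * max (s - 0) 0) - 4 * (2 * max (s - 1/2) 0) + 2 * (2 * max (s - 1) 0))) (at s)"
    by (intro DERIV_add DERIV_diff DERIV_cmult *)
  then show ?thesis by (simp add: smoothstep_def[abs_def] smoothstep_deriv_def)
qed

lemma smoothstep_facts: "0 \<le> smoothstep s" "smoothstep s \<le> 1" "s \<le> 0 \<Longrightarrow> smoothstep s = 0" "1 \<le> s \<Longrightarrow> smoothstep s = 1" "\<bar>smoothstep_deriv s\<bar> \<le> 2" "s \<le> 0 \<Longrightarrow> smoothstep_deriv s = 0"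
proof -
  have "0 \<le> smoothstep s \<and> smoothstep s \<le> 1 \<and> (1 \<le> s \<longrightarrow> smoothstep s = 1)"
  proof -
    consider "s \<le> 0" | "0 < s" "s \<le> 1/2" | "1/2 < s" "s \<le> 1" | "1 < s" by linarith
    then show ?thesis
    proof cases
      case 2
      have "s\<^sup>2 \<le> (1/2)\<^sup>2" using 2 by (intro power_mono) auto
      then show ?thesis using 2 by (simp add: smoothstep_def power2_eq_square)
    next
      case 3
      have e: "smoothstep s = 1 - 2 * (1 - s)\<^sup>2" using 3 by (simp add: smoothstep_def power2_eq_square algebra_simps)
      have "(1 - s)\<^sup>2 \<le> (1/2)\<^sup>2" using 3 by (intro power_mono) auto
      then show ?thesis using 3 unfolding e by (auto simp: power2_eq_square)
    qed (auto simp: smoothstep_def power2_eq_square algebra_simps)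
  qed
  then show "0 \<le> smoothstep s" "smoothstep s \<le> 1" "1 \<le> s \<Longrightarrow> smoothstep s = 1" by auto
  show "s \<le> 0 \<Longrightarrow> smoothstep s = 0" "s \<le> 0 \<Longrightarrow> smoothstep_deriv s = 0" by (auto simp: smoothstep_def smoothstep_deriv_def)
  show "\<bar>smoothstep_deriv s\<bar> \<le> 2" by (auto simp: smoothstep_deriv_def max_def)
qed

definition is_cutoff ::
  "real \<Rightarrow> real \<Rightarrow> real \<Rightarrow> real \<Rightarrow> ('a::euclidean_space \<times> real \<Rightarrow> real) \<Rightarrow> ('a \<times> real \<Rightarrow> 'a) \<Rightarrow> ('a \<times> real \<Rightarrow> real) \<Rightarrow> bool"
where
  "is_cutoff R S L1 L2 \<zeta> D\<zeta> \<zeta>t \<longleftrightarrow>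
     continuous_on UNIV \<zeta> \<and> continuous_on UNIV D\<zeta> \<and> continuous_on UNIV \<zeta>t \<and>
     (\<forall>x t. ((\<lambda>x. \<zeta> (x, t)) has_derivative (\<lambda>h. D\<zeta> (x, t) \<bullet> h)) (at x) \<and> ((\<lambda>t. \<zeta> (x, t)) has_real_derivative \<zeta>t (x, t)) (at t)) \<and>
     (\<forall>w. 0 \<le> \<zeta> w \<and> \<zeta> w \<le> 1 \<and> norm (D\<zeta> w) \<le> L1 \<and> \<bar>\<zeta>t w\<bar> \<le> L2 \<and>
        (R \<le> norm (fst w) \<or> S \<le> \<bar>snd w\<bar> \<longrightarrow> \<zeta> w = 0 \<and> D\<zeta> w = 0 \<and> \<zeta>t w = 0))"

text \<open>The step is applied to a quadratic function of the distance, which is smooth at the centre. The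
  factor \<open>4\<close> combines \<open>\<bar>smoothstep_deriv s\<bar> \<le> 2\<close> with \<open>R\<^sup>2 - r\<^sup>2 = (R - r) * (R + r)\<close>.\<close>

lemma cutoff_exists:
  assumes R: "0 < r" "r < R" and S: "0 < s" "s < S"
  obtains \<zeta> D\<zeta> \<zeta>t where "is_cutoff R S (4 / (R - r)) (4 / (S - s)) (\<zeta> :: 'a::euclidean_space \<times> real \<Rightarrow> real) D\<zeta> \<zeta>t"
    "\<And>w. norm (fst w) \<le> r \<Longrightarrow> \<bar>snd w\<bar> \<le> s \<Longrightarrow> \<zeta> w = 1"
proof
  define q where "q x = (R\<^sup>2 - (norm x)\<^sup>2) / (R\<^sup>2 - r\<^sup>2)" for x :: 'a
  define l where "l t = (S\<^sup>2 - t\<^sup>2) / (S\<^sup>2 - s\<^sup>2)" for t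
  have Rr: "0 < R\<^sup>2 - r\<^sup>2" using R by (simp add: power_strict_mono)
  have Ss: "0 < S\<^sup>2 - s\<^sup>2" using S by (simp add: power_strict_mono)
  define \<zeta> where "\<zeta> w = smoothstep (q (fst w)) * smoothstep (l (snd w))" for w :: "'a \<times> real"
  define D\<zeta> where "D\<zeta> w = (smoothstep_deriv (q (fst w)) * (- 2 / (R\<^sup>2 - r\<^sup>2)) * smoothstep (l (snd w))) *\<^sub>R fst w" for w :: "'a \<times> real"
  define \<zeta>t where "\<zeta>t w = smoothstep (q (fst w)) * (smoothstep_deriv (l (snd w)) * (- 2 * snd w / (S\<^sup>2 - s\<^sup>2)))" for w :: "'a \<times> real"
  have cs: "continuous_on A smoothstep" "continuous_on A smoothstep_deriv" for A
    unfolding smoothstep_def[abs_def] smoothstep_deriv_def[abs_def] by (intro continuous_intros)+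
  have cq: "continuous_on UNIV (\<lambda>w::'a \<times> real. q (fst w))" "continuous_on UNIV (\<lambda>w::'a \<times> real. l (snd w))"
    unfolding q_def l_def using Rr Ss by (auto intro!: continuous_intros)
  have cc: "continuous_on UNIV (\<lambda>w::'a \<times> real. smoothstep (q (fst w)))" "continuous_on UNIV (\<lambda>w::'a \<times> real. smoothstep (l (snd w)))"
    "continuous_on UNIV (\<lambda>w::'a \<times> real. smoothstep_deriv (q (fst w)))" "continuous_on UNIV (\<lambda>w::'a \<times> real. smoothstep_deriv (l (snd w)))"
    using continuous_on_compose2[OF cs(1)[of UNIV] cq(1)] continuous_on_compose2[OF cs(1)[of UNIV] cq(2)]
      continuous_on_compose2[OF cs(2)[of UNIV] cq(1)] continuous_on_compose2[OF cs(2)[of UNIV] cq(2)] by simp_all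
  have q0: "q x \<le> 0" if "R \<le> norm x" for x
    using that R power_mono[of R "norm x" 2] Rr by (auto simp: q_def divide_nonpos_pos)
  have l0: "l t \<le> 0" if "S \<le> \<bar>t\<bar>" for t
    using that S power_mono[of S "\<bar>t\<bar>" 2] Ss by (auto simp: l_def divide_nonpos_pos)
  have Db: "norm (D\<zeta> w) \<le> 4 / (R - r)" for w
  proof (cases "R \<le> norm (fst w)")
    case True
    then show ?thesis using q0 smoothstep_facts(6) R by (simp add: D\<zeta>_def)
  next
    case False
    have "norm (D\<zeta> w) = \<bar>smoothstep_deriv (q (fst w))\<bar> * (2 * norm (fst w) / (R\<^sup>2 - r\<^sup>2)) * \<bar>smoothstep (l (snd w))\<bar>"
      using Rr by (simp add: D\<zeta>_def abs_mult)
    also have "\<dots> \<le> 2 * (2 * R / (R\<^sup>2 - r\<^sup>2)) * 1"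
      using smoothstep_facts(5)[of "q (fst w)"] smoothstep_facts(1,2)[of "l (snd w)"] False Rr R
      by (intro mult_mono divide_right_mono) auto
    also have "\<dots> \<le> 4 / (R - r)"
    proof -
      have "R\<^sup>2 - r\<^sup>2 = (R - r) * (R + r)" by (simp add: power2_eq_square algebra_simps)
      then have "2 * (2 * R / (R\<^sup>2 - r\<^sup>2)) * 1 = (4 / (R - r)) * (R / (R + r))" by simp
      also have "\<dots> \<le> (4 / (R - r)) * 1" using R by (intro mult_left_mono) (auto simp: field_simps)
      finally show ?thesis by simp
    qed
    finally show ?thesis .
  qed
  have tb: "\<bar>\<zeta>t w\<bar> \<le> 4 / (S - s)" for w
  proof (cases "S \<le> \<bar>snd w\<bar>")
    case True
    then show ?thesis using l0 smoothstep_facts(6) S by (simp add: \<zeta>t_def)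
  next
    case False
    have "\<bar>\<zeta>t w\<bar> = \<bar>smoothstep (q (fst w))\<bar> * (\<bar>smoothstep_deriv (l (snd w))\<bar> * (2 * \<bar>snd w\<bar> / (S\<^sup>2 - s\<^sup>2)))"
      using Ss by (simp add: \<zeta>t_def abs_mult)
    also have "\<dots> \<le> 1 * (2 * (2 * S / (S\<^sup>2 - s\<^sup>2)))"
      using smoothstep_facts(5)[of "l (snd w)"] smoothstep_facts(1,2)[of "q (fst w)"] False Ss S
      by (intro mult_mono divide_right_mono) auto
    also have "\<dots> \<le> 4 / (S - s)"
    proof -
      have "S\<^sup>2 - s\<^sup>2 = (S - s) * (S + s)" by (simp add: power2_eq_square algebra_simps)
      then have "1 * (2 * (2 * S / (S\<^sup>2 - s\<^sup>2))) = (4 / (S - s)) * (S / (S + s))" by simp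
      also have "\<dots> \<le> (4 / (S - s)) * 1" using S by (intro mult_left_mono) (auto simp: field_simps)
      finally show ?thesis by simp
    qed
    finally show ?thesis .
  qed
  have dq: "(q has_derivative (\<lambda>h. (- 2 / (R\<^sup>2 - r\<^sup>2)) * (x \<bullet> h))) (at x)" for x
    unfolding q_def power2_norm_eq_inner using Rr by (auto intro!: derivative_eq_intros simp: inner_commute)
  have dl: "(l has_real_derivative (- 2 * t / (S\<^sup>2 - s\<^sup>2))) (at t)" for t
    unfolding l_def using Ss by (auto intro!: derivative_eq_intros)
  have dx: "((\<lambda>x. \<zeta> (x, t)) has_derivative (\<lambda>h. D\<zeta> (x, t) \<bullet> h)) (at x)" for x t
  proof -
    have "((\<lambda>x. smoothstep (q x)) has_derivative (\<lambda>h. smoothstep_deriv (q x) * ((- 2 / (R\<^sup>2 - r\<^sup>2)) * (x \<bullet> h)))) (at x)"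
      by (rule has_derivative_compose[OF dq has_real_derivative_smoothstep[unfolded has_field_derivative_def]])
    from has_derivative_mult_left[OF this, of "smoothstep (l t)"] show ?thesis
      by (simp add: \<zeta>_def D\<zeta>_def mult_ac)
  qed
  have dt: "((\<lambda>t. \<zeta> (x, t)) has_real_derivative \<zeta>t (x, t)) (at t)" for x t
  proof -
    have "((\<lambda>t. smoothstep (l t)) has_real_derivative smoothstep_deriv (l t) * (- 2 * t / (S\<^sup>2 - s\<^sup>2))) (at t)"
      by (rule DERIV_chain2[OF has_real_derivative_smoothstep dl])
    from DERIV_cmult[OF this, of "smoothstep (q x)"] show ?thesis by (simp add: \<zeta>_def \<zeta>t_def)
  qed
  show "is_cutoff R S (4 / (R - r)) (4 / (S - s)) \<zeta> D\<zeta> \<zeta>t"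
    unfolding is_cutoff_def
  proof (intro conjI allI impI)
    show "continuous_on UNIV \<zeta>" unfolding \<zeta>_def[abs_def] by (intro continuous_intros cc)
    show "continuous_on UNIV D\<zeta>" unfolding D\<zeta>_def[abs_def] by (intro continuous_intros cc)
    show "continuous_on UNIV \<zeta>t" unfolding \<zeta>t_def[abs_def] using Ss by (auto intro!: continuous_intros cc)
    show "0 \<le> \<zeta> w" "\<zeta> w \<le> 1" for w
      using smoothstep_facts(1,2)[of "q (fst w)"] smoothstep_facts(1,2)[of "l (snd w)"] by (auto simp: \<zeta>_def mult_le_one)
    show "\<zeta> w = 0" "D\<zeta> w = 0" "\<zeta>t w = 0" if "R \<le> norm (fst w) \<or> S \<le> \<bar>snd w\<bar>" for w
      using that q0 l0 smoothstep_facts(3,6) by (auto simp: \<zeta>_def D\<zeta>_def \<zeta>t_def)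
  qed (use dx dt Db tb in auto)
  show "\<zeta> w = 1" if "norm (fst w) \<le> r" "\<bar>snd w\<bar> \<le> s" for w
  proof -
    have "(norm (fst w))\<^sup>2 \<le> r\<^sup>2" using that by (intro power_mono) auto
    then have "1 \<le> q (fst w)" using Rr by (simp add: q_def)
    moreover have "(snd w)\<^sup>2 \<le> s\<^sup>2" using that S power_mono[of "\<bar>snd w\<bar>" s 2] by simp
    then have "1 \<le> l (snd w)" using Ss by (simp add: l_def)
    ultimately show ?thesis using smoothstep_facts(4) by (simp add: \<zeta>_def)
  qed
qed

section \<open>From weak solutions to local solutions\<close>

lemma integrable_of_powr:
  fixes f :: "'a::euclidean_space \<Rightarrow> 'b::{banach, second_countable_topology}"
  assumes [measurable]: "f \<in> borel_measurable borel" "Q \<in> sets borel" and Q: "emeasure lborel Q < \<infinity>"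
    and z: "\<And>w. w \<notin> Q \<Longrightarrow> f w = 0" and p: "1 < p"
    and fin: "(\<integral>\<^sup>+w. ennreal (norm (f w) powr p) \<partial>lborel) < \<infinity>"
  shows "integrable lborel f" "integrable lborel (\<lambda>w. norm (f w) powr p)"
proof -
  show i: "integrable lborel (\<lambda>w. norm (f w) powr p)"
    by (rule integrableI_bounded) (use fin in auto)
  have iQ: "integrable lborel (indicator Q :: 'a \<Rightarrow> real)" using Q by (intro integrable_real_indicator) auto
  show "integrable lborel f"
  proof (rule Bochner_Integration.integrable_bound[OF Bochner_Integration.integrable_add[OF iQ i]])
    show "AE w in lborel. norm (f w) \<le> norm (indicator Q w + norm (f w) powr p)"
    proof (rule AE_I2)
      fix w
      show "norm (f w) \<le> norm (indicator Q w + norm (f w) powr p)"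
      proof (cases "1 \<le> norm (f w)")
        case True
        then have "norm (f w) powr 1 \<le> norm (f w) powr p" using p by (intro powr_mono) auto
        then show ?thesis using True by (auto simp: indicator_def)
      next
        case False
        then show ?thesis using z[of w] by (cases "w \<in> Q") (auto simp: indicator_def intro!: add_increasing2)
      qed
    qed
  qed simp
qed

text \<open>By the Cauchy--Schwarz inequality, convergence to zero in \<open>L\<^sup>2\<close> of a set of finite measure passes
  to integrals against a bounded function.\<close>

lemma tendsto_integral_of_L2_limit:
  fixes E :: "real \<Rightarrow> 'a::euclidean_space \<Rightarrow> real"
  assumes [measurable]: "\<And>s. E s \<in> borel_measurable borel" "\<phi> \<in> borel_measurable borel" "B \<in> sets borel"
    and B: "emeasure lborel B < \<infinity>" and z: "\<And>s x. x \<notin> B \<Longrightarrow> E s x = 0" and M: "\<And>x. \<bar>\<phi> x\<bar> \<le> M"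
    and lim: "((\<lambda>s. ennpowr (\<integral>\<^sup>+x. ennreal ((E s x)\<^sup>2) \<partial>lborel) (1/2)) \<longlongrightarrow> 0) F"
  shows "((\<lambda>s. \<integral>x. \<phi> x * E s x \<partial>lborel) \<longlongrightarrow> 0) F"
proof (rule tendstoI)
  fix e :: real assume e: "0 < e"
  have M0: "0 \<le> M" using M[of undefined] by linarith
  define b where "b = enn2real (emeasure lborel B)"
  have b: "emeasure lborel B = ennreal b" "0 \<le> b" using B by (auto simp: b_def)
  define \<eta> where "\<eta> = e / (2 * ((M + 1) * (sqrt b + 1)))"
  have \<eta>: "0 < \<eta>" using e M0 b by (auto simp: \<eta>_def intro!: divide_pos_pos mult_pos_pos add_nonneg_pos)
  have "eventually (\<lambda>s. ennpowr (\<integral>\<^sup>+x. ennreal ((E s x)\<^sup>2) \<partial>lborel) (1/2) < ennreal \<eta>) F"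
    using lim \<eta> by (intro order_tendstoD) auto
  then show "eventually (\<lambda>s. dist (\<integral>x. \<phi> x * E s x \<partial>lborel) 0 < e) F"
  proof eventually_elim
    case (elim s)
    define Z where "Z = (\<integral>\<^sup>+x. ennreal ((E s x)\<^sup>2) \<partial>lborel)"
    have Zt: "Z \<noteq> top" using elim by (auto simp: ennpowr_def Z_def)
    define z where "z = enn2real Z"
    have Zz: "Z = ennreal z" "0 \<le> z" using Zt by (auto simp: z_def less_top)
    have "ennreal (z powr (1/2)) < ennreal \<eta>" using elim Zt by (simp add: ennpowr_def Z_def[symmetric] z_def)
    then have "sqrt z < \<eta>" using Zz \<eta> by (simp add: ennreal_less_iff powr_half_sqrt)
    then have z\<eta>: "z \<le> \<eta>\<^sup>2" using Zz(2) \<eta> by (metis less_imp_le real_sqrt_ge_0_iff real_sqrt_pow2 power_mono)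
    define Y where "Y = (\<integral>\<^sup>+x. ennreal \<bar>E s x\<bar> \<partial>lborel)"
    have "Y = (\<integral>\<^sup>+x. indicator B x * ennreal \<bar>E s x\<bar> \<partial>lborel)"
      unfolding Y_def using z by (intro nn_integral_cong) (auto simp: indicator_def)
    then have "Y\<^sup>2 \<le> (\<integral>\<^sup>+x. (indicator B x)\<^sup>2 \<partial>lborel) * (\<integral>\<^sup>+x. (ennreal \<bar>E s x\<bar>)\<^sup>2 \<partial>lborel)"
      using Cauchy_Schwarz_nn_integral[of "indicator B" lborel "\<lambda>x. ennreal \<bar>E s x\<bar>"] by simp
    also have "(\<integral>\<^sup>+x. (indicator B x)\<^sup>2 \<partial>lborel) = (\<integral>\<^sup>+x. indicator B x \<partial>(lborel :: 'a measure))"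
      by (intro nn_integral_cong) (auto simp: indicator_def)
    also have "\<dots> = ennreal b" by (simp add: b(1)[symmetric])
    also have "(\<integral>\<^sup>+x. (ennreal \<bar>E s x\<bar>)\<^sup>2 \<partial>lborel) = Z"
      unfolding Z_def by (intro nn_integral_cong) (simp add: ennreal_power)
    finally have Y2: "Y\<^sup>2 \<le> ennreal (b * z)" using b Zz by (simp add: ennreal_mult)
    then have Yt: "Y \<noteq> top" by (auto simp: power2_eq_square top_unique)
    define y where "y = enn2real Y"
    have Yy: "Y = ennreal y" "0 \<le> y" using Yt by (auto simp: y_def less_top)
    have "y\<^sup>2 \<le> b * z" using Y2 Yy b Zz by (simp add: ennreal_power)
    also have "\<dots> \<le> b * \<eta>\<^sup>2" using b z\<eta> by (intro mult_left_mono) auto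
    also have "\<dots> = (sqrt b * \<eta>)\<^sup>2" using b by (simp add: power_mult_distrib)
    finally have y: "y \<le> sqrt b * \<eta>" using b \<eta> by (meson less_imp_le mult_nonneg_nonneg power2_le_imp_le real_sqrt_ge_zero)
    have "ennreal (norm (\<integral>x. \<phi> x * E s x \<partial>lborel)) \<le> ennreal (M * y)"
    proof (cases "integrable lborel (\<lambda>x. \<phi> x * E s x)")
      case True
      have "ennreal (norm (\<integral>x. \<phi> x * E s x \<partial>lborel)) \<le> (\<integral>\<^sup>+x. ennreal (norm (\<phi> x * E s x)) \<partial>lborel)"
        by (rule integral_norm_bound_ennreal[OF True])
      also have "\<dots> \<le> (\<integral>\<^sup>+x. ennreal M * ennreal \<bar>E s x\<bar> \<partial>lborel)"
        using M M0 by (intro nn_integral_mono) (auto simp: ennreal_mult[symmetric] abs_mult intro!: ennreal_leI mult_right_mono)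
      also have "\<dots> = ennreal M * Y" unfolding Y_def by (rule nn_integral_cmult) measurable
      finally show ?thesis using M0 Yy by (simp add: ennreal_mult)
    qed (simp add: not_integrable_integral_eq)
    then have "\<bar>\<integral>x. \<phi> x * E s x \<partial>lborel\<bar> \<le> M * y" using M0 Yy by (simp add: mult_nonneg_nonneg)
    also have "\<dots> \<le> M * (sqrt b * \<eta>)" using M0 y by (intro mult_left_mono)
    also have "\<dots> \<le> ((M + 1) * (sqrt b + 1)) * \<eta>"
    proof -
      have "M * sqrt b \<le> (M + 1) * (sqrt b + 1)" using M0 b by (intro mult_mono) auto
      then have "(M * sqrt b) * \<eta> \<le> ((M + 1) * (sqrt b + 1)) * \<eta>" using \<eta> by (intro mult_right_mono) auto
      then show ?thesis by (simp add: mult.assoc)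
    qed
    also have "\<dots> = e / 2"
    proof -
      have "(M + 1) * (sqrt b + 1) \<noteq> 0" using M0 b by (smt (verit) mult_pos_pos real_sqrt_ge_zero)
      then show ?thesis by (simp add: \<eta>_def field_simps)
    qed
    also have "\<dots> < e" using e by simp
    finally show ?case by (simp add: dist_norm)
  qed
qed

text \<open>Information about almost every time slice becomes information about space-time by Fubini's
  theorem. For the gradient this concerns the weak gradients of the slices. For the equation, the
  time derivative of the Steklov average exists as a limit in \<open>L\<^sup>2\<close> of the ball, and pairing with a
  test function makes it an ordinary derivative of a real function.\<close>

proposition weak_solution_local_representative:
  fixes \<Omega> :: "(real ^ 'n::finite) set"
  assumes op: "open \<Omega>" and ws: "weak_solution \<Omega> T p A u Du" and sc: "structure_conditions \<Omega> T p \<Lambda>\<^sub>0 \<Lambda>\<^sub>1 A Du"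
    and p: "1 < p" and L: "0 < \<Lambda>\<^sub>1" and pos: "0 < \<rho>" "0 < \<theta>"
    and sub: "closure (ball 0 \<rho>) \<times> {-\<theta>..\<theta>} \<subseteq> \<Omega> \<times> {-T<..<T}"
  obtains u0 D0 a0 where "local_solution \<rho> \<theta> u0 D0 a0"
    "AE w in lborel. w \<in> cylinder \<rho> \<theta> \<longrightarrow> u0 w = u (fst w) (snd w)"
    "AE w in lborel. \<Lambda>\<^sub>0 * norm (D0 w) powr p \<le> a0 w \<bullet> D0 w \<and> norm (a0 w) \<le> \<Lambda>\<^sub>1 * norm (D0 w) powr (p - 1)"
    "integrable lborel (\<lambda>w. norm (D0 w) powr p)"
proof -
  define B where "B = ball (0::real ^ 'n) \<rho>"
  define Q where "Q = (cylinder \<rho> \<theta> :: ((real ^ 'n) \<times> real) set)"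
  have [measurable]: "B \<in> sets borel" "Q \<in> sets borel" by (auto simp: B_def Q_def cylinder_facts)
  have Qfin: "emeasure lborel Q < \<infinity>" unfolding Q_def by (rule cylinder_facts)
  have Bfin: "emeasure lborel B < \<infinity>" unfolding B_def by (rule emeasure_lborel_ball_finite)
  have Qiff: "(x, t) \<in> Q \<longleftrightarrow> x \<in> B \<and> \<bar>t\<bar> \<le> \<theta>" for x t by (simp add: Q_def cylinder_facts B_def dist_norm)
  have T: "\<theta> < T" "closure B \<subseteq> \<Omega>"
  proof -
    have z: "(0::real ^ 'n) \<in> closure B" using closure_subset[of B] pos by (auto simp: B_def)
    have "(0::real ^ 'n, \<theta>) \<in> closure (ball 0 \<rho>) \<times> {-\<theta>..\<theta>}"
      by (rule SigmaI[OF z[unfolded B_def]]) (use pos in simp)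
    then have "(0, \<theta>) \<in> \<Omega> \<times> {-T<..<T}" by (rule subsetD[OF sub])
    then show "\<theta> < T" by simp
    show "closure B \<subseteq> \<Omega>"
    proof
      fix x assume "x \<in> closure B"
      then have "(x, 0) \<in> closure (ball 0 \<rho>) \<times> {-\<theta>..\<theta>}" using pos by (simp add: B_def)
      then have "(x, 0) \<in> \<Omega> \<times> {-T<..<T}" by (rule subsetD[OF sub])
      then show "x \<in> \<Omega>" by simp
    qed
  qed
  have BO: "B \<subseteq> \<Omega>" using T(2) closure_subset by blast
  have QT: "Q \<subseteq> \<Omega> \<times> {-T<..<T}" using BO T(1) by (auto simp: Qiff)
  have cc: "B \<subset>\<subset> \<Omega>" using T(2) by (auto simp: compactly_contained_def B_def)
  have Om: "\<Omega> \<in> sets borel" using op by simp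
  from ws have um: "(\<lambda>(x, t). u x t) \<in> borel_measurable (lebesgue_on (\<Omega> \<times> {-T<..<T}))"
    and Dm: "(\<lambda>(x, t). Du x t) \<in> borel_measurable (lebesgue_on (\<Omega> \<times> {-T<..<T}))"
    and bo: "(\<lambda>t x. (u x t, Du x t)) \<in> bochner_Lp p {-T<..<T} (sobolev_space p B) (sobolev_norm p B)"
    using cc by (auto simp: weak_solution_def in_Lp_W1ploc_def)
  from sc have am: "(\<lambda>(x, t). A x t (Du x t)) \<in> borel_measurable (lebesgue_on (\<Omega> \<times> {-T<..<T}))"
    by (simp add: structure_conditions_def)
  obtain u0 where u0[measurable]: "u0 \<in> borel_measurable borel" "\<And>w. w \<notin> Q \<Longrightarrow> u0 w = 0"
    and u0ae: "AE w in lborel. w \<in> Q \<longrightarrow> u0 w = u (fst w) (snd w)"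
    using ex_borel_representative[OF um QT] by (auto simp: case_prod_unfold)
  obtain D0 where D0[measurable]: "D0 \<in> borel_measurable borel" "\<And>w. w \<notin> Q \<Longrightarrow> D0 w = 0"
    and D0ae: "AE w in lborel. w \<in> Q \<longrightarrow> D0 w = Du (fst w) (snd w)"
    using ex_borel_representative[OF Dm QT] by (auto simp: case_prod_unfold)
  obtain a0 where a0[measurable]: "a0 \<in> borel_measurable borel" "\<And>w. w \<notin> Q \<Longrightarrow> a0 w = 0"
    and a0ae: "AE w in lborel. w \<in> Q \<longrightarrow> a0 w = A (fst w) (snd w) (Du (fst w) (snd w))"
    using ex_borel_representative[OF am QT] by (auto simp: case_prod_unfold)
  have sec[measurable]: "(\<lambda>x. u0 (x, t)) \<in> borel_measurable borel" "(\<lambda>x. D0 (x, t)) \<in> borel_measurable borel"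
     "(\<lambda>x. a0 (x, t)) \<in> borel_measurable borel" "(\<lambda>t. u0 (x, t)) \<in> borel_measurable borel"
     "(\<lambda>t. D0 (x, t)) \<in> borel_measurable borel" "(\<lambda>t. a0 (x, t)) \<in> borel_measurable borel" for x t
    by (rule measurable_compose[OF _ u0(1)] measurable_compose[OF _ D0(1)] measurable_compose[OF _ a0(1)], simp add: borel_prod[symmetric])+
  have sae: "AE w in lborel. \<Lambda>\<^sub>0 * norm (D0 w) powr p \<le> a0 w \<bullet> D0 w \<and> norm (a0 w) \<le> \<Lambda>\<^sub>1 * norm (D0 w) powr (p - 1)"
  proof -
    have s1: "AE w in lborel. w \<in> \<Omega> \<times> {-T<..<T} \<longrightarrow> (\<Lambda>\<^sub>0 * norm (Du (fst w) (snd w)) powr p \<le> A (fst w) (snd w) (Du (fst w) (snd w)) \<bullet> Du (fst w) (snd w) \<and>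
        norm (A (fst w) (snd w) (Du (fst w) (snd w))) \<le> \<Lambda>\<^sub>1 * norm (Du (fst w) (snd w)) powr (p - 1))"
    proof (subst AE_lebesgue_on_iff[symmetric])
      show "\<Omega> \<times> {-T<..<T} \<in> sets borel" using op by (intro borel_Times) auto
    qed (use sc in \<open>simp add: structure_conditions_def case_prod_unfold\<close>)
    show ?thesis using s1 D0ae a0ae
    proof eventually_elim
      case (elim w)
      then show ?case using QT D0(2)[of w] a0(2)[of w] by (cases "w \<in> Q") auto
    qed
  qed
  \<comment> \<open>the Bochner norm controls the space-time integrals\<close>
  have fin: "(\<integral>\<^sup>+t. ((\<integral>\<^sup>+x. ennreal (norm (u x t) powr p) \<partial>lebesgue_on B) + (\<integral>\<^sup>+x. ennreal (norm (Du x t) powr p) \<partial>lebesgue_on B))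
      * indicator {-T<..<T} t \<partial>lborel) < \<infinity>"
  proof -
    have "(\<integral>\<^sup>+t. ennpowr (sobolev_norm p B (\<lambda>x. (u x t, Du x t))) p \<partial>lebesgue_on {-T<..<T}) < top"
      using bo by (simp add: bochner_Lp_def)
    then show ?thesis
      using p by (subst (asm) nn_integral_lebesgue_on) (auto simp: sobolev_norm_def ennpowr_powr_inverse)
  qed
  have secae: "AE t in lborel. AE x in lborel. (x, t) \<in> Q \<longrightarrow> u0 (x, t) = u x t"
    "AE t in lborel. AE x in lborel. (x, t) \<in> Q \<longrightarrow> D0 (x, t) = Du x t"
    using AE_lborel_pair(2)[OF u0ae] AE_lborel_pair(2)[OF D0ae] by auto
  have fin_of_slices: "(\<integral>\<^sup>+w. ennreal (norm (g w) powr p) \<partial>lborel) < \<infinity>"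
    if g[measurable]: "g \<in> borel_measurable borel" and gz: "\<And>w. w \<notin> Q \<Longrightarrow> g w = 0"
      and ae: "AE t in lborel. AE x in lborel. (x, t) \<in> Q \<longrightarrow> g (x, t) = f x t"
      and le: "\<And>t. (\<integral>\<^sup>+x. ennreal (norm (f x t) powr p) \<partial>lebesgue_on B)
        \<le> (\<integral>\<^sup>+x. ennreal (norm (u x t) powr p) \<partial>lebesgue_on B) + (\<integral>\<^sup>+x. ennreal (norm (Du x t) powr p) \<partial>lebesgue_on B)"
    for g :: "(real ^ 'n) \<times> real \<Rightarrow> 'b::euclidean_space" and f
  proof -
    have "(\<integral>\<^sup>+w. ennreal (norm (g w) powr p) \<partial>lborel) = (\<integral>\<^sup>+t. (\<integral>\<^sup>+x. ennreal (norm (g (x, t)) powr p) \<partial>lborel) \<partial>lborel)"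
      by (rule nn_integral_lborel_snd) measurable
    also have "\<dots> \<le> (\<integral>\<^sup>+t. ((\<integral>\<^sup>+x. ennreal (norm (u x t) powr p) \<partial>lebesgue_on B) + (\<integral>\<^sup>+x. ennreal (norm (Du x t) powr p) \<partial>lebesgue_on B)) * indicator {-T<..<T} t \<partial>lborel)"
    proof (rule nn_integral_mono_AE, use ae in eventually_elim)
      case (elim t)
      show ?case
      proof (cases "\<bar>t\<bar> \<le> \<theta>")
        case True
        have "(\<integral>\<^sup>+x. ennreal (norm (g (x, t)) powr p) \<partial>lborel) = (\<integral>\<^sup>+x. ennreal (norm (f x t) powr p) * indicator B x \<partial>lborel)"
        proof (rule nn_integral_cong_AE, use elim in eventually_elim)
          case (elim x)
          then show ?case using True gz[of "(x, t)"] by (cases "x \<in> B") (auto simp: Qiff)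
        qed
        also have "\<dots> = (\<integral>\<^sup>+x. ennreal (norm (f x t) powr p) \<partial>lebesgue_on B)"
          by (rule nn_integral_lebesgue_on[symmetric]) simp
        also note le[of t]
        finally show ?thesis using True T(1) by (simp add: indicator_def abs_le_iff)
      next
        case False
        then show ?thesis using gz by (simp add: Qiff)
      qed
    qed
    finally show ?thesis using fin by auto
  qed
  have up: "(\<integral>\<^sup>+w. ennreal (norm (u0 w) powr p) \<partial>lborel) < \<infinity>"
    by (rule fin_of_slices[OF u0(1,2) secae(1)]) auto
  have Dp: "(\<integral>\<^sup>+w. ennreal (norm (D0 w) powr p) \<partial>lborel) < \<infinity>"
    by (rule fin_of_slices[OF D0(1,2) secae(2)]) auto
  have ui: "integrable lborel u0"
    by (rule integrable_of_powr(1)[where Q=Q and p=p]) (use u0 Qfin p up in auto)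
  have Di: "integrable lborel D0" "integrable lborel (\<lambda>w. norm (D0 w) powr p)"
    by (rule integrable_of_powr[where Q=Q and p=p], use D0 Qfin p Dp in auto)+
  have ai: "integrable lborel a0"
  proof (rule Bochner_Integration.integrable_bound)
    have iQ: "integrable lborel (indicator Q :: _ \<Rightarrow> real)" using Qfin by (intro integrable_real_indicator) auto
    show "integrable lborel (\<lambda>w. \<Lambda>\<^sub>1 * (indicator Q w + norm (D0 w) powr p))"
      by (intro integrable_mult_right Bochner_Integration.integrable_add iQ Di)
    show "AE w in lborel. norm (a0 w) \<le> norm (\<Lambda>\<^sub>1 * (indicator Q w + norm (D0 w) powr p))"
      using sae
    proof eventually_elim
      case (elim w)
      have "norm (D0 w) powr (p - 1) \<le> indicator Q w + norm (D0 w) powr p"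
      proof (cases "1 \<le> norm (D0 w)")
        case True
        then have "norm (D0 w) powr (p - 1) \<le> norm (D0 w) powr p" by (intro powr_mono) auto
        then show ?thesis by (simp add: indicator_def)
      next
        case False
        then have "norm (D0 w) powr (p - 1) \<le> 1 powr (p - 1)" using p by (intro powr_mono2) auto
        then show ?thesis using D0(2)[of w] by (cases "w \<in> Q") (auto simp: indicator_def intro: add_increasing2)
      qed
      then have "norm (a0 w) \<le> \<Lambda>\<^sub>1 * (indicator Q w + norm (D0 w) powr p)"
        using elim L by (meson less_imp_le mult_left_mono order_trans)
      then show ?case by simp
    qed
  qed simp
  have ls: "local_solution \<rho> \<theta> u0 D0 a0"
    unfolding local_solution_def
  proof (intro conjI ballI allI impI)
    show "integrable lborel u0" by (fact ui)
    show "integrable lborel D0" by (fact Di(1))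
    show "integrable lborel a0" by (fact ai)
    show "w \<notin> cylinder \<rho> \<theta> \<Longrightarrow> u0 w = 0" "w \<notin> cylinder \<rho> \<theta> \<Longrightarrow> D0 w = 0" "w \<notin> cylinder \<rho> \<theta> \<Longrightarrow> a0 w = 0" for w
      using u0(2) D0(2) a0(2) by (auto simp: Q_def)
  next
    fix \<phi> :: "real ^ 'n \<Rightarrow> real" and t h :: real
    assume \<phi>: "\<phi> \<in> test_functions (ball 0 \<rho>)" and th: "0 < h \<and> - \<theta> < t \<and> t + h < \<theta>"
    from test_function_grad_facts[OF \<phi>] obtain M1 M2 where
      c\<phi>: "continuous_on UNIV \<phi>" "continuous_on UNIV (grad \<phi>)" and
      z\<phi>: "\<And>x. x \<notin> B \<Longrightarrow> \<phi> x = 0" "\<And>x. x \<notin> B \<Longrightarrow> grad \<phi> x = 0" and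
      b\<phi>: "\<And>x. \<bar>\<phi> x\<bar> \<le> M1" "\<And>x. norm (grad \<phi> x) \<le> M2" by (auto simp: B_def)
    have [measurable]: "\<phi> \<in> borel_measurable borel" "grad \<phi> \<in> borel_measurable borel"
      using c\<phi> by (auto intro: borel_measurable_continuous_onI)
    let ?I = "\<lambda>s \<tau>. indicator {0..h} (\<tau> - s) :: real"
    have Im[measurable]: "(\<lambda>w. ?I s (snd w)) \<in> borel_measurable (borel :: ((real ^ 'n) \<times> real) measure)" for s
      unfolding borel_prod[symmetric] by measurable
    have fm[measurable]: "(\<lambda>w. \<phi> (fst w)) \<in> borel_measurable (borel :: ((real ^ 'n) \<times> real) measure)"
      "(\<lambda>w. grad \<phi> (fst w)) \<in> borel_measurable (borel :: ((real ^ 'n) \<times> real) measure)"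
      unfolding borel_prod[symmetric] by measurable
    have Ib: "\<bar>?I s \<tau>\<bar> \<le> 1" for s \<tau> by (simp add: indicator_def)
    have Iu: "integrable lborel (\<lambda>w. ?I s (snd w) * u0 w)" for s
      using integrable_bounded_scaleR[OF ui Im[of s], where M=1] Ib by simp
    have Ia: "integrable lborel (\<lambda>w. ?I s (snd w) *\<^sub>R a0 w)" for s
      using integrable_bounded_scaleR[OF ai Im[of s], where M=1] Ib by simp
    have I1: "integrable lborel (\<lambda>w. (?I t (snd w) * u0 w) *\<^sub>R grad \<phi> (fst w))"
      by (rule integrable_scaleR_bounded[OF Iu fm(2)]) (rule b\<phi>)
    have I2: "integrable lborel (\<lambda>w. (?I t (snd w) * \<phi> (fst w)) *\<^sub>R D0 w)"
    proof (rule integrable_bounded_scaleR[OF Di(1), where M=M1])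
      show "(\<lambda>w. ?I t (snd w) * \<phi> (fst w)) \<in> borel_measurable borel"
        by (intro borel_measurable_times Im fm)
      show "\<bar>?I t (snd w) * \<phi> (fst w)\<bar> \<le> M1" for w :: "(real ^ 'n) \<times> real"
        using b\<phi>(1)[of "fst w"] by (auto simp: indicator_def)
    qed
    show "(\<integral>w. (?I t (snd w) * u0 w) *\<^sub>R grad \<phi> (fst w) \<partial>lborel) = - (\<integral>w. (?I t (snd w) * \<phi> (fst w)) *\<^sub>R D0 w \<partial>lborel)"
    proof -
      have so: "AE \<tau> in lborel. \<tau> \<in> {-T<..<T} \<longrightarrow> (\<lambda>x. (u x \<tau>, Du x \<tau>)) \<in> sobolev_space p B"
      proof -
        have "AE \<tau> in lebesgue_on {-T<..<T}. (\<lambda>x. (u x \<tau>, Du x \<tau>)) \<in> sobolev_space p B"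
          using bo by (simp add: bochner_Lp_def)
        then show ?thesis by (subst (asm) AE_lebesgue_on_iff) auto
      qed
      have "(\<integral>w. (?I t (snd w) * u0 w) *\<^sub>R grad \<phi> (fst w) \<partial>lborel)
         = (\<integral>\<tau>. (\<integral>x. (?I t \<tau> * u0 (x, \<tau>)) *\<^sub>R grad \<phi> x \<partial>lborel) \<partial>lborel)"
        using lborel_Fubini(2)[OF I1] by simp
      also have "\<dots> = (\<integral>\<tau>. - (\<integral>x. (?I t \<tau> * \<phi> x) *\<^sub>R D0 (x, \<tau>) \<partial>lborel) \<partial>lborel)"
      proof (rule integral_cong_AE)
        show "(\<lambda>\<tau>. \<integral>x. (?I t \<tau> * u0 (x, \<tau>)) *\<^sub>R grad \<phi> x \<partial>lborel) \<in> borel_measurable lborel"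
          using borel_measurable_integrable[OF lborel_Fubini(4)[OF I1]] by simp
        show "(\<lambda>\<tau>. - (\<integral>x. (?I t \<tau> * \<phi> x) *\<^sub>R D0 (x, \<tau>) \<partial>lborel)) \<in> borel_measurable lborel"
          using borel_measurable_integrable[OF lborel_Fubini(4)[OF I2]] by simp
        show "AE \<tau> in lborel. (\<integral>x. (?I t \<tau> * u0 (x, \<tau>)) *\<^sub>R grad \<phi> x \<partial>lborel) = - (\<integral>x. (?I t \<tau> * \<phi> x) *\<^sub>R D0 (x, \<tau>) \<partial>lborel)"
          using so secae
        proof eventually_elim
          case (elim \<tau>)
          show ?case
          proof (cases "\<tau> - t \<in> {0..h}")
            case True
            then have \<tau>: "\<tau> \<in> {-T<..<T}" "\<bar>\<tau>\<bar> \<le> \<theta>" using th T(1) by auto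
            have "(LINT x|lebesgue_on B. u x \<tau> *\<^sub>R grad \<phi> x) = - (LINT x|lebesgue_on B. \<phi> x *\<^sub>R Du x \<tau>)"
              using elim(1) \<tau>(1) \<phi> by (simp add: sobolev_space_def has_weak_gradient_def B_def)
            moreover have "(LINT x|lebesgue_on B. u x \<tau> *\<^sub>R grad \<phi> x) = (\<integral>x. u0 (x, \<tau>) *\<^sub>R grad \<phi> x \<partial>lborel)"
            proof (rule integral_lebesgue_on_eq_lborel)
              show "AE x in lborel. indicator B x *\<^sub>R u x \<tau> *\<^sub>R grad \<phi> x = u0 (x, \<tau>) *\<^sub>R grad \<phi> x"
                using elim(2) by eventually_elim (use \<tau>(2) z\<phi> in \<open>auto simp: Qiff indicator_def\<close>)
            qed measurable
            moreover have "(LINT x|lebesgue_on B. \<phi> x *\<^sub>R Du x \<tau>) = (\<integral>x. \<phi> x *\<^sub>R D0 (x, \<tau>) \<partial>lborel)"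
            proof (rule integral_lebesgue_on_eq_lborel)
              show "AE x in lborel. indicator B x *\<^sub>R \<phi> x *\<^sub>R Du x \<tau> = \<phi> x *\<^sub>R D0 (x, \<tau>)"
                using elim(3) by eventually_elim (use \<tau>(2) z\<phi> in \<open>auto simp: Qiff indicator_def\<close>)
            qed measurable
            ultimately show ?thesis using True by simp
          qed simp
        qed
      qed
      also have "\<dots> = - (\<integral>\<tau>. (\<integral>x. (?I t \<tau> * \<phi> x) *\<^sub>R D0 (x, \<tau>) \<partial>lborel) \<partial>lborel)" by simp
      also have "(\<integral>\<tau>. (\<integral>x. (?I t \<tau> * \<phi> x) *\<^sub>R D0 (x, \<tau>) \<partial>lborel) \<partial>lborel) = (\<integral>w. (?I t (snd w) * \<phi> (fst w)) *\<^sub>R D0 w \<partial>lborel)"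
        using lborel_Fubini(2)[OF I2] by simp
      finally show ?thesis .
    qed
    show "((\<lambda>s. \<integral>w. ?I s (snd w) * u0 w * \<phi> (fst w) \<partial>lborel) has_real_derivative
          - (\<integral>w. ?I t (snd w) * (a0 w \<bullet> grad \<phi> (fst w)) \<partial>lborel)) (at t)"
    proof -
      define \<sigma> where "\<sigma> s x = (\<integral>\<tau>. ?I s \<tau> * u0 (x, \<tau>) \<partial>lborel)" for s x
      define \<alpha> where "\<alpha> x = (\<integral>\<tau>. ?I t \<tau> *\<^sub>R a0 (x, \<tau>) \<partial>lborel)" for x
      define m where "m s = (\<integral>w. ?I s (snd w) * u0 w * \<phi> (fst w) \<partial>lborel)" for s
      have \<sigma>i: "integrable lborel (\<sigma> s)" for s
        using lborel_Fubini(3)[OF Iu[of s]] by (simp add: \<sigma>_def[abs_def])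
      have \<alpha>i: "integrable lborel \<alpha>"
        using lborel_Fubini(3)[OF Ia[of t]] by (simp add: \<alpha>_def[abs_def])
      have [measurable]: "\<sigma> s \<in> borel_measurable borel" "\<alpha> \<in> borel_measurable borel" for s
        using \<sigma>i \<alpha>i by auto
      have \<sigma>\<phi>i: "integrable lborel (\<lambda>x. \<phi> x * \<sigma> s x)" for s
        using integrable_bounded_scaleR[OF \<sigma>i, of \<phi> M1] b\<phi> by simp
      have m: "m s = (\<integral>x. \<phi> x * \<sigma> s x \<partial>lborel)" for s
      proof -
        have "integrable lborel (\<lambda>w. ?I s (snd w) * u0 w * \<phi> (fst w))"
          using integrable_scaleR_bounded[OF Iu[of s] fm(1), of M1] b\<phi> by simp
        from lborel_Fubini(1)[OF this] show ?thesis
          by (simp add: m_def \<sigma>_def mult.commute)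
      qed
      have h: "h \<in> {0<..<2 * T}" and tT: "t \<in> {-T<..<T - h}" using th T(1) by auto
      have \<phi>O: "\<phi> \<in> test_functions \<Omega>" using \<phi> BO by (auto simp: test_functions_def B_def)
      from ws h \<phi>O tT obtain w where
        wd: "has_L2loc_time_derivative \<Omega> (steklov T h u) w t" and
        w0: "(LINT x|lebesgue_on \<Omega>. w x * \<phi> x + steklov T h (\<lambda>x \<tau>. A x \<tau> (Du x \<tau>)) x t \<bullet> grad \<phi> x) = 0"
        unfolding weak_solution_def by blast
      have wL: "w \<in> Lp_space 2 B" and
        wl: "((\<lambda>s. Lp_norm 2 B (\<lambda>x. (steklov T h u x s - steklov T h u x t) / (s - t) - w x)) \<longlongrightarrow> 0) (at t)"
        using wd cc by (auto simp: has_L2loc_time_derivative_def)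
      obtain w' where w'[measurable]: "w' \<in> borel_measurable borel" "\<And>x. x \<notin> B \<Longrightarrow> w' x = 0"
        and w'ae: "AE x in lborel. x \<in> B \<longrightarrow> w' x = w x"
        using ex_borel_representative[of w B B] wL by (auto simp: Lp_space_def)
      have w'i: "integrable lborel w'"
      proof (rule integrable_of_powr(1)[OF w'(1) \<open>B \<in> sets borel\<close> Bfin w'(2), of 2])
        have "(\<integral>\<^sup>+x. ennreal (norm (w x) powr 2) \<partial>lebesgue_on B) \<noteq> top"
          using wL by (auto simp: Lp_space_def Lp_norm_def ennpowr_def)
        moreover have "(\<integral>\<^sup>+x. ennreal (norm (w x) powr 2) \<partial>lebesgue_on B) = (\<integral>\<^sup>+x. ennreal (norm (w' x) powr 2) \<partial>lborel)"
        proof (subst nn_integral_lebesgue_on)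
          show "(\<integral>\<^sup>+x. ennreal (norm (w x) powr 2) * indicator B x \<partial>lborel) = (\<integral>\<^sup>+x. ennreal (norm (w' x) powr 2) \<partial>lborel)"
            by (rule nn_integral_cong_AE, use w'ae in eventually_elim) (use w'(2) in \<open>auto simp: indicator_def\<close>)
        qed simp
        ultimately show "(\<integral>\<^sup>+x. ennreal (norm (w' x) powr 2) \<partial>lborel) < \<infinity>" by (simp add: less_top)
      qed simp_all
      have stek: "AE x in lborel. x \<in> B \<longrightarrow> (\<forall>s. -\<theta> < s \<and> s + h < \<theta> \<longrightarrow> steklov T h u x s = \<sigma> s x / h)"
        using AE_lborel_pair(1)[OF u0ae]
      proof eventually_elim
        case (elim x)
        show ?case
        proof (intro impI allI)
          fix s assume x: "x \<in> B" and s: "-\<theta> < s \<and> s + h < \<theta>"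
          have "(LINT \<tau>|lebesgue_on {s..s + h}. u x \<tau>) = \<sigma> s x"
            unfolding \<sigma>_def
          proof (rule integral_lebesgue_on_eq_lborel)
            show "AE \<tau> in lborel. indicator {s..s + h} \<tau> *\<^sub>R u x \<tau> = ?I s \<tau> * u0 (x, \<tau>)"
              using elim by eventually_elim (use x s in \<open>auto simp: Qiff indicator_def\<close>)
          qed measurable
          then show "steklov T h u x s = \<sigma> s x / h" using s T(1) by (simp add: steklov_def)
        qed
      qed
      have stekA: "AE x in lborel. x \<in> B \<longrightarrow> steklov T h (\<lambda>x \<tau>. A x \<tau> (Du x \<tau>)) x t = (1 / h) *\<^sub>R \<alpha> x"
        using AE_lborel_pair(1)[OF a0ae]
      proof eventually_elim
        case (elim x)
        show ?case
        proof
          assume x: "x \<in> B"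
          have "(LINT \<tau>|lebesgue_on {t..t + h}. A x \<tau> (Du x \<tau>)) = \<alpha> x"
            unfolding \<alpha>_def
          proof (rule integral_lebesgue_on_eq_lborel)
            show "AE \<tau> in lborel. indicator {t..t + h} \<tau> *\<^sub>R A x \<tau> (Du x \<tau>) = ?I t \<tau> *\<^sub>R a0 (x, \<tau>)"
              using elim by eventually_elim (use x th in \<open>auto simp: Qiff indicator_def\<close>)
          qed measurable
          then show "steklov T h (\<lambda>x \<tau>. A x \<tau> (Du x \<tau>)) x t = (1 / h) *\<^sub>R \<alpha> x" using th T(1) by (simp add: steklov_def)
        qed
      qed
      \<comment> \<open>the error of the difference quotient in \<open>L\<^sup>2\<close>, in terms of window integrals instead of Steklov averages\<close>
      define E where "E s x = indicator B x * ((\<sigma> s x - \<sigma> t x) / (h * (s - t)) - w' x)" for s x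
      have near: "eventually (\<lambda>s. -\<theta> < s \<and> s + h < \<theta> \<and> s \<noteq> t) (at t)"
      proof -
        have "eventually (\<lambda>s. s \<in> {-\<theta><..<\<theta> - h}) (at t)"
          using th by (intro eventually_at_in_open') auto
        then show ?thesis by (auto simp: eventually_at_filter elim!: eventually_mono)
      qed
      have "eventually (\<lambda>s. Lp_norm 2 B (\<lambda>x. (steklov T h u x s - steklov T h u x t) / (s - t) - w x)
            = ennpowr (\<integral>\<^sup>+x. ennreal ((E s x)\<^sup>2) \<partial>lborel) (1/2)) (at t)"
        using near
      proof eventually_elim
        case (elim s)
        have "(\<integral>\<^sup>+x. ennreal (norm ((steklov T h u x s - steklov T h u x t) / (s - t) - w x) powr 2) * indicator B x \<partial>lborel)
            = (\<integral>\<^sup>+x. ennreal ((E s x)\<^sup>2) \<partial>lborel)"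
        proof (rule nn_integral_cong_AE, use stek w'ae in eventually_elim)
          case (elim x)
          then show ?case
            using \<open>-\<theta> < s \<and> s + h < \<theta> \<and> s \<noteq> t\<close> th
            by (cases "x \<in> B") (auto simp: E_def diff_divide_distrib)
        qed
        then show ?case unfolding Lp_norm_def by (subst nn_integral_lebesgue_on) auto
      qed
      then have El: "((\<lambda>s. ennpowr (\<integral>\<^sup>+x. ennreal ((E s x)\<^sup>2) \<partial>lborel) (1/2)) \<longlongrightarrow> 0) (at t)"
        using wl by (rule Lim_transform_eventually[rotated])
      have "((\<lambda>s. \<integral>x. \<phi> x * E s x \<partial>lborel) \<longlongrightarrow> 0) (at t)"
        by (rule tendsto_integral_of_L2_limit[OF _ _ \<open>B \<in> sets borel\<close> Bfin _ b\<phi>(1) El]) (auto simp: E_def)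
      moreover have Eeq: "(\<integral>x. \<phi> x * E s x \<partial>lborel) = (m s - m t) / (h * (s - t)) - (\<integral>x. \<phi> x * w' x \<partial>lborel)" for s
      proof -
        have w\<phi>i: "integrable lborel (\<lambda>x. \<phi> x * w' x)"
          using integrable_bounded_scaleR[OF w'i, of \<phi> M1] b\<phi> by simp
        have "\<phi> x * E s x = (\<phi> x * \<sigma> s x - \<phi> x * \<sigma> t x) / (h * (s - t)) - \<phi> x * w' x" for x
          using z\<phi>(1)[of x] by (cases "x \<in> B") (auto simp: E_def algebra_simps diff_divide_distrib)
        then show ?thesis
          using \<sigma>\<phi>i w\<phi>i by (simp add: m)
      qed
      ultimately have "((\<lambda>s. h * ((m s - m t) / (h * (s - t)) - (\<integral>x. \<phi> x * w' x \<partial>lborel)) + h * (\<integral>x. \<phi> x * w' x \<partial>lborel)) \<longlongrightarrow> h * 0 + h * (\<integral>x. \<phi> x * w' x \<partial>lborel)) (at t)"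
        by (intro tendsto_intros) (simp add: Eeq)
      moreover have "h * ((m s - m t) / (h * (s - t)) - c) + h * c = (m s - m t) / (s - t)" for s c
      proof -
        have "h * ((m s - m t) / (h * (s - t))) = (m s - m t) / (s - t)" using th by simp
        moreover have "h * (y - c) + h * c = h * y" for y by (simp add: algebra_simps)
        ultimately show ?thesis by (simp only:)
      qed
      ultimately have dm: "(m has_real_derivative h * (\<integral>x. \<phi> x * w' x \<partial>lborel)) (at t)"
        by (simp add: has_field_derivative_iff)
      have "(LINT x|lebesgue_on \<Omega>. w x * \<phi> x + steklov T h (\<lambda>x \<tau>. A x \<tau> (Du x \<tau>)) x t \<bullet> grad \<phi> x)
         = (\<integral>x. \<phi> x * w' x + (1 / h) * (\<alpha> x \<bullet> grad \<phi> x) \<partial>lborel)"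
      proof (rule integral_lebesgue_on_eq_lborel[OF Om])
        show "AE x in lborel. indicator \<Omega> x *\<^sub>R (w x * \<phi> x + steklov T h (\<lambda>x \<tau>. A x \<tau> (Du x \<tau>)) x t \<bullet> grad \<phi> x)
            = \<phi> x * w' x + (1 / h) * (\<alpha> x \<bullet> grad \<phi> x)"
          using stekA w'ae
        proof eventually_elim
          case (elim x)
          then show ?case using BO z\<phi>[of x] by (cases "x \<in> B") (auto simp: indicator_def)
        qed
      qed measurable
      also have "\<dots> = (\<integral>x. \<phi> x * w' x \<partial>lborel) + (1 / h) * (\<integral>x. \<alpha> x \<bullet> grad \<phi> x \<partial>lborel)"
        using integrable_bounded_scaleR[OF w'i, of \<phi> M1] b\<phi> integrable_inner_bounded[OF \<alpha>i _ b\<phi>(2)]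
        by (subst Bochner_Integration.integral_add) auto
      finally have e1: "h * (\<integral>x. \<phi> x * w' x \<partial>lborel) = - (\<integral>x. \<alpha> x \<bullet> grad \<phi> x \<partial>lborel)"
        using w0 th by (simp add: field_simps)
      have ia: "integrable lborel (\<lambda>w. ?I t (snd w) * (a0 w \<bullet> grad \<phi> (fst w)))"
        using integrable_inner_bounded[OF Ia[of t] fm(2) b\<phi>(2)] by simp
      have "(\<integral>w. ?I t (snd w) * (a0 w \<bullet> grad \<phi> (fst w)) \<partial>lborel) = (\<integral>x. (\<integral>\<tau>. ?I t \<tau> * (a0 (x, \<tau>) \<bullet> grad \<phi> x) \<partial>lborel) \<partial>lborel)"
        using lborel_Fubini(1)[OF ia] by simp
      also have "\<dots> = (\<integral>x. \<alpha> x \<bullet> grad \<phi> x \<partial>lborel)"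
      proof (rule integral_cong_AE)
        show "(\<lambda>x. \<integral>\<tau>. ?I t \<tau> * (a0 (x, \<tau>) \<bullet> grad \<phi> x) \<partial>lborel) \<in> borel_measurable lborel"
          using borel_measurable_integrable[OF lborel_Fubini(3)[OF ia]] by simp
        show "AE x in lborel. (\<integral>\<tau>. ?I t \<tau> * (a0 (x, \<tau>) \<bullet> grad \<phi> x) \<partial>lborel) = \<alpha> x \<bullet> grad \<phi> x"
          using lborel_Fubini(5)[OF Ia[of t]]
        proof eventually_elim
          case (elim x)
          then have "integrable lborel (\<lambda>\<tau>. ?I t \<tau> *\<^sub>R a0 (x, \<tau>))" by simp
          then show ?case unfolding \<alpha>_def by (subst integral_inner_left[symmetric]) auto
        qed
      qed measurable
      finally show ?thesis using dm e1 by (simp add: m_def[abs_def])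
    qed
  qed
  show thesis using that[OF ls] u0ae sae Di(2) by (simp add: Q_def)
qed

section \<open>The energy identity for mollified solutions\<close>

lemma local_solutionD:
  assumes "local_solution \<rho> \<theta> u D a" "\<phi> \<in> test_functions (ball 0 \<rho>)" "0 < h" "- \<theta> < t" "t + h < \<theta>"
  shows "(\<integral>w. (indicator {0..h} (snd w - t) * u w) *\<^sub>R grad \<phi> (fst w) \<partial>lborel)
          = - (\<integral>w. (indicator {0..h} (snd w - t) * \<phi> (fst w)) *\<^sub>R D w \<partial>lborel)"
    and "((\<lambda>s. \<integral>w. indicator {0..h} (snd w - s) * u w * \<phi> (fst w) \<partial>lborel) has_real_derivative
          - (\<integral>w. indicator {0..h} (snd w - t) * (a w \<bullet> grad \<phi> (fst w)) \<partial>lborel)) (at t)"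
  using assms unfolding local_solution_def by blast+

lemma mollifier_bounded: "mollifier \<delta> K \<Longrightarrow> \<exists>M. \<forall>w. \<bar>K w\<bar> \<le> M"
  unfolding mollifier_def by (metis abs_of_nonneg)

lemma is_cutoffD:
  assumes "is_cutoff R S L1 L2 \<zeta> D\<zeta> \<zeta>t"
  shows "continuous_on UNIV \<zeta>" "continuous_on UNIV D\<zeta>" "continuous_on UNIV \<zeta>t"
    "((\<lambda>x. \<zeta> (x, t)) has_derivative (\<lambda>h. D\<zeta> (x, t) \<bullet> h)) (at x)"
    "((\<lambda>t. \<zeta> (x, t)) has_real_derivative \<zeta>t (x, t)) (at t)"
    "0 \<le> \<zeta> w" "\<zeta> w \<le> 1" "norm (D\<zeta> w) \<le> L1" "\<bar>\<zeta>t w\<bar> \<le> L2"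
    "R \<le> norm (fst w) \<or> S \<le> \<bar>snd w\<bar> \<Longrightarrow> \<zeta> w = 0 \<and> D\<zeta> w = 0 \<and> \<zeta>t w = 0"
  using assms unfolding is_cutoff_def by blast+

lemma sum_Basis_scaled_inner:
  fixes x y :: "'a::euclidean_space"
  shows "(\<Sum>i\<in>Basis. ((c * (x \<bullet> i)) *\<^sub>R y) \<bullet> i) = c * (x \<bullet> y)"
  by (simp add: euclidean_inner[of x y] sum_distrib_left mult.assoc)

text \<open>The cutoff lives so far inside the cylinder that mollification at the points of its support does
  not reach outside.\<close>

locale mollified_solution =
  fixes \<rho> \<theta> :: real and u :: "(real ^ 'n::finite) \<times> real \<Rightarrow> real" and D a :: "(real ^ 'n) \<times> real \<Rightarrow> real ^ 'n"
    and e R S L1 L2 :: real and \<zeta> \<zeta>t :: "(real ^ 'n) \<times> real \<Rightarrow> real" and D\<zeta> :: "(real ^ 'n) \<times> real \<Rightarrow> real ^ 'n"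
  assumes sol: "local_solution \<rho> \<theta> u D a"
    and e: "0 < e" and Re: "0 < R" "R + e < \<rho>" and Se: "0 < S" "S + e < \<theta>"
    and cut: "is_cutoff R S L1 L2 \<zeta> D\<zeta> \<zeta>t"
begin

definition U where "U = mollify (st_kernel e) u"
definition DU where "DU = mollify (st_kernel e) D"
definition aU where "aU = mollify (st_kernel e) a"
definition divaU where "divaU \<xi> = (\<Sum>i\<in>Basis. mollify_grad e (\<lambda>w. a w \<bullet> i) \<xi> \<bullet> i)"

lemma integrables: "integrable lborel u" "integrable lborel D" "integrable lborel a" "integrable lborel (\<lambda>w. a w \<bullet> z)"
  using sol by (auto simp: local_solution_def)

lemma measurables: "u \<in> borel_measurable borel" "D \<in> borel_measurable borel" "a \<in> borel_measurable borel"
  "(st_kernel e :: (real ^ 'n) \<times> real \<Rightarrow> real) \<in> borel_measurable borel"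
  using integrables mollifier_st_kernel[OF e, where 'a="real ^ 'n"] by (auto simp: mollifier_def)

text \<open>These are the only test functions ever inserted into the weak formulation.\<close>

lemma test_bump:
  assumes "norm x \<le> R" shows "(\<lambda>y. bump e (y - x)) \<in> test_functions (ball 0 \<rho>)"
proof (rule bump_test_function[OF e], rule subsetI)
  fix y assume "y \<in> cball x e"
  then have "norm y \<le> norm x + e" using norm_triangle_ineq[of x "y - x"] by (simp add: dist_norm norm_minus_commute)
  then show "y \<in> ball 0 \<rho>" using assms Re by simp
qed

text \<open>The weak gradient tested with a bump centred at \<open>x\<close>.\<close>

lemma grad_U:
  assumes x: "norm x \<le> R" and t: "\<bar>t\<bar> \<le> S"
  shows "mollify_grad e u (x, t) = DU (x, t)"
proof -
  let ?I = "\<lambda>w::(real ^ 'n) \<times> real. indicator {0..e} (snd w - t) :: real"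
  have "(\<integral>w. (?I w * u w) *\<^sub>R grad (\<lambda>y. bump e (y - x)) (fst w) \<partial>lborel) = - (\<integral>w. (?I w * bump e (fst w - x)) *\<^sub>R D w \<partial>lborel)"
    by (rule local_solutionD(1)[OF sol test_bump[OF x] e]) (use t Se e in auto)
  then have eq: "(\<integral>w. (?I w * u w) *\<^sub>R bump_grad e (fst w - x) \<partial>lborel) = - (\<integral>w. (?I w * bump e (fst w - x)) *\<^sub>R D w \<partial>lborel)"
    by (simp add: grad_bump[OF e])
  have "mollify_grad e u (x, t) = - (\<integral>w. (1 / e) *\<^sub>R ((?I w * u w) *\<^sub>R bump_grad e (fst w - x)) \<partial>lborel)"
    by (simp add: mollify_grad_def)
  also have "\<dots> = (1 / e) *\<^sub>R (\<integral>w. (?I w * bump e (fst w - x)) *\<^sub>R D w \<partial>lborel)"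
    by (simp only: integral_scaleR_right eq scaleR_minus_right minus_minus)
  also have "\<dots> = (\<integral>w. (1 / e) *\<^sub>R ((?I w * bump e (fst w - x)) *\<^sub>R D w) \<partial>lborel)"
    by (simp only: integral_scaleR_right)
  also have "\<dots> = DU (x, t)"
    unfolding DU_def mollify_eq_shifted_kernel[OF measurables(2,4)] by (simp add: st_kernel_def mult_ac)
  finally show ?thesis .
qed

text \<open>The equation tested with a bump centred at \<open>x\<close>: after mollification it holds pointwise.\<close>

lemma dt_U:
  assumes x: "norm x \<le> R" and t: "\<bar>t\<bar> \<le> S"
  shows "((\<lambda>s. U (x, s)) has_real_derivative divaU (x, t)) (at t)"
proof -
  let ?I = "\<lambda>s w. indicator {0..e} (snd w - s) :: real"
  have "((\<lambda>s. \<integral>w. ?I s w * u w * bump e (fst w - x) \<partial>lborel) has_real_derivative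
     - (\<integral>w. ?I t w * (a w \<bullet> grad (\<lambda>y. bump e (y - x)) (fst w)) \<partial>lborel)) (at t)"
    by (rule local_solutionD(2)[OF sol test_bump[OF x] e]) (use t Se e in auto)
  then have "((\<lambda>s. (1 / e) * (\<integral>w. ?I s w * u w * bump e (fst w - x) \<partial>lborel)) has_real_derivative
     (1 / e) * (- (\<integral>w. ?I t w * (a w \<bullet> bump_grad e (fst w - x)) \<partial>lborel))) (at t)"
    unfolding grad_bump[OF e] by (rule DERIV_cmult)
  moreover have "U (x, s) = (1 / e) * (\<integral>w. ?I s w * u w * bump e (fst w - x) \<partial>lborel)" for s
    unfolding U_def mollify_eq_shifted_kernel[OF measurables(1,4)]
    by (subst integral_mult_right_zero[symmetric]) (simp add: st_kernel_def mult_ac)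
  moreover have "(1 / e) * (- (\<integral>w. ?I t w * (a w \<bullet> bump_grad e (fst w - x)) \<partial>lborel)) = divaU (x, t)"
  proof -
    obtain M where M: "\<And>y::real ^ 'n. norm (bump_grad e y) \<le> M" using bounded_bump_grad[OF e] by blast
    have [measurable]: "(bump_grad e :: real ^ 'n \<Rightarrow> _) \<in> borel_measurable borel"
      using continuous_bump_grad[OF e] by (rule borel_measurable_continuous_onI)
    have m: "(\<lambda>w. bump_grad e (fst w - x)) \<in> borel_measurable (borel :: ((real ^ 'n) \<times> real) measure)"
      unfolding borel_prod[symmetric] by measurable
    have i: "integrable lborel (\<lambda>w. (?I t w / e * (a w \<bullet> i)) *\<^sub>R bump_grad e (fst w - x))" for i
      by (rule integrable_scaleR_bounded[OF integrable_time_window[OF e integrables(4)] m M])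
    have "divaU (x, t) = (\<Sum>i\<in>Basis. - (\<integral>w. ((?I t w / e * (a w \<bullet> i)) *\<^sub>R bump_grad e (fst w - x)) \<bullet> i \<partial>lborel))"
      unfolding divaU_def mollify_grad_def by (intro sum.cong refl) (simp only: fst_conv snd_conv inner_minus_left integral_inner_left[OF i])
    also have "\<dots> = - (\<integral>w. (\<Sum>i\<in>Basis. ((?I t w / e * (a w \<bullet> i)) *\<^sub>R bump_grad e (fst w - x)) \<bullet> i) \<partial>lborel)"
      by (simp only: sum_negf Bochner_Integration.integral_sum[OF integrable_inner_left[OF i]])
    also have "(\<lambda>w. \<Sum>i\<in>Basis. ((?I t w / e * (a w \<bullet> i)) *\<^sub>R bump_grad e (fst w - x)) \<bullet> i)
       = (\<lambda>w. (1 / e) * (?I t w * (a w \<bullet> bump_grad e (fst w - x))))"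
      unfolding sum_Basis_scaled_inner by (simp add: mult_ac)
    also have "- (\<integral>w. (1 / e) * (?I t w * (a w \<bullet> bump_grad e (fst w - x))) \<partial>lborel)
       = (1 / e) * (- (\<integral>w. ?I t w * (a w \<bullet> bump_grad e (fst w - x)) \<partial>lborel))"
      by (simp only: integral_mult_right_zero mult_minus_right)
    finally show ?thesis by simp
  qed
  ultimately show ?thesis by simp
qed

lemma continuous_U: "continuous_on UNIV U" "continuous_on UNIV DU" "continuous_on UNIV aU" "continuous_on UNIV divaU"
proof -
  obtain M where M: "\<And>w::(real ^ 'n) \<times> real. \<bar>st_kernel e w\<bar> \<le> M"
    using mollifier_bounded[OF mollifier_st_kernel[OF e, where 'a="real ^ 'n"]] by blast
  show "continuous_on UNIV U" "continuous_on UNIV DU" "continuous_on UNIV aU"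
    unfolding U_def DU_def aU_def by (intro mollify_continuous[where M=M] integrables measurables M)+
  show "continuous_on UNIV divaU"
    unfolding divaU_def by (intro continuous_intros continuous_mollify_grad e integrables)
qed

lemmas cutoff = is_cutoffD[OF cut]

lemma cutoff_far: "R + S \<le> norm w \<Longrightarrow> \<zeta> w = 0 \<and> D\<zeta> w = 0 \<and> \<zeta>t w = 0"
proof -
  assume "R + S \<le> norm w"
  then have "R + S \<le> norm (fst w) + \<bar>snd w\<bar>" using norm_Pair_le[of "fst w" "snd w"] by simp
  then have "R \<le> norm (fst w) \<or> S \<le> \<bar>snd w\<bar>" by linarith
  then show ?thesis by (rule cutoff(10))
qed

text \<open>By the chain rule, the spatial gradient of \<open>g (U w) * \<zeta> w ^ Suc k\<close>.\<close>

definition V where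
  "V g dg k w = (dg (U w) * \<zeta> w ^ Suc k) *\<^sub>R DU w + (real (Suc k) * \<zeta> w ^ k * g (U w)) *\<^sub>R D\<zeta> w"

context
  fixes g dg :: "real \<Rightarrow> real"
  assumes g: "\<And>s. (g has_real_derivative dg s) (at s)" and cdg: "continuous_on UNIV dg"
begin

lemma continuous_g: "continuous_on UNIV g"
  using g by (meson DERIV_isCont continuous_at_imp_continuous_on)

lemma continuous_gU: "continuous_on A (\<lambda>w. g (U w))" "continuous_on A (\<lambda>w. dg (U w))"
  using continuous_on_compose2[OF continuous_g continuous_U(1)] continuous_on_compose2[OF cdg continuous_U(1)]
  by (auto intro: continuous_on_subset)

lemma continuous_V: "continuous_on UNIV (V g dg k)"
  unfolding V_def[abs_def] by (intro continuous_intros continuous_gU cutoff(1,2) continuous_U)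

lemma V_eq_0: "R \<le> norm (fst w) \<or> S \<le> \<bar>snd w\<bar> \<Longrightarrow> V g dg k w = 0"
  using cutoff(10)[of w] by (simp add: V_def)

lemma slice_has_derivative:
  "((\<lambda>x. g (U (x, t)) * \<zeta> (x, t) ^ Suc k) has_derivative (\<lambda>h. V g dg k (x, t) \<bullet> h)) (at x)"
proof -
  have 1: "((\<lambda>x. U (x, t)) has_derivative (\<lambda>h. mollify_grad e u (x, t) \<bullet> h)) (at x)"
    unfolding U_def by (rule has_derivative_mollify[OF e integrables(1)])
  have 2: "((\<lambda>x. g (U (x, t))) has_derivative (\<lambda>h. dg (U (x, t)) * (mollify_grad e u (x, t) \<bullet> h))) (at x)"
    by (rule has_derivative_compose[OF 1 g[unfolded has_field_derivative_def]])
  have 3: "((\<lambda>x. \<zeta> (x, t) ^ Suc k) has_derivative (\<lambda>h. (real (Suc k) * \<zeta> (x, t) ^ k) * (D\<zeta> (x, t) \<bullet> h))) (at x)"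
    by (rule has_derivative_compose[OF cutoff(4) DERIV_pow[of "Suc k", unfolded has_field_derivative_def diff_Suc_Suc diff_zero]])
  have "dg (U (x, t)) * (mollify_grad e u (x, t) \<bullet> h) * \<zeta> (x, t) ^ Suc k = dg (U (x, t)) * (DU (x, t) \<bullet> h) * \<zeta> (x, t) ^ Suc k" for h
    using grad_U[of x t] cutoff(10)[of "(x, t)"] by (cases "norm x \<le> R \<and> \<bar>t\<bar> \<le> S") auto
  then have "(\<lambda>h. g (U (x, t)) * ((real (Suc k) * \<zeta> (x, t) ^ k) * (D\<zeta> (x, t) \<bullet> h)) + dg (U (x, t)) * (mollify_grad e u (x, t) \<bullet> h) * \<zeta> (x, t) ^ Suc k)
     = (\<lambda>h. V g dg k (x, t) \<bullet> h)"
    by (simp add: fun_eq_iff V_def inner_add_left algebra_simps)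
  with has_derivative_mult[OF 2 3] show ?thesis by simp
qed

text \<open>The pointwise equation multiplied by \<open>g (U w) * \<zeta> w ^ Suc k\<close>. The fundamental theorem of calculus
  in time, applied to \<open>G (U w) * \<zeta> w ^ Suc k\<close>, produces the integral over the slice at time \<open>\<tau>\<close>, and
  integration by parts in space produces the flux term.\<close>

proposition energy_identity:
  assumes G: "\<And>s. (G has_real_derivative g s) (at s)"
  shows "(\<integral>x. G (U (x, \<tau>)) * \<zeta> (x, \<tau>) ^ Suc k \<partial>lborel) =
     (\<integral>w. indicator {..\<tau>} (snd w) * (real (Suc k) * \<zeta> w ^ k * \<zeta>t w * G (U w) - aU w \<bullet> V g dg k w) \<partial>lborel)"
proof -
  define J where "J w = g (U w) * divaU w * \<zeta> w ^ Suc k + G (U w) * (real (Suc k) * \<zeta> w ^ k * \<zeta>t w)" for w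
  define P where "P w = real (Suc k) * \<zeta> w ^ k * \<zeta>t w * G (U w) - aU w \<bullet> V g dg k w" for w
  have cG: "continuous_on UNIV (\<lambda>w. G (U w))"
  proof (rule continuous_on_compose2[OF _ continuous_U(1)])
    show "continuous_on UNIV G" using G by (meson DERIV_isCont continuous_at_imp_continuous_on)
  qed simp
  have cJ: "continuous_on UNIV J" unfolding J_def[abs_def] by (intro continuous_intros continuous_gU continuous_U cutoff cG)
  have cP: "continuous_on UNIV P" unfolding P_def[abs_def] by (intro continuous_intros continuous_V continuous_U cutoff cG)
  have z: "J w = 0" "P w = 0" if "R \<le> norm (fst w) \<or> S \<le> \<bar>snd w\<bar>" for w
    using cutoff(10)[OF that] V_eq_0[OF that] by (auto simp: J_def P_def)
  have z': "J w = 0" "P w = 0" if "R + S \<le> norm w" for w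
    using cutoff_far[OF that] by (auto simp: J_def P_def V_def)
  have Ii: "integrable lborel (\<lambda>w::(real ^ 'n) \<times> real. indicator {..\<tau>} (snd w) * f w)" if "integrable lborel f" for f :: "_ \<Rightarrow> real"
  proof -
    have [measurable]: "(\<lambda>w. indicator {..\<tau>} (snd w)) \<in> borel_measurable (borel :: ((real ^ 'n) \<times> real) measure)"
      unfolding borel_prod[symmetric] by measurable
    show ?thesis using integrable_bounded_scaleR[OF that, of "\<lambda>w. indicator {..\<tau>} (snd w)" 1] by simp
  qed
  have iJ: "integrable lborel (\<lambda>w. indicator {..\<tau>} (snd w) * J w)"
    by (intro Ii integrable_of_compact_support[OF cJ, of "R + S"] z')
  have iP: "integrable lborel (\<lambda>w. indicator {..\<tau>} (snd w) * P w)"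
    by (intro Ii integrable_of_compact_support[OF cP, of "R + S"] z')
  have time: "G (U (x, \<tau>)) * \<zeta> (x, \<tau>) ^ Suc k = (\<integral>t. indicator {..\<tau>} t * J (x, t) \<partial>lborel)" for x
  proof (cases "R \<le> norm x \<or> \<tau> \<le> - S")
    case True
    then have "\<zeta> (x, \<tau>) = 0" using cutoff(10)[of "(x, \<tau>)"] Se by auto
    moreover have "(\<lambda>t. indicator {..\<tau>} t * J (x, t)) = (\<lambda>t. 0)"
    proof
      fix t
      show "indicator {..\<tau>} t * J (x, t) = 0"
        using True z(1)[of "(x, t)"] Se by (cases "t \<le> \<tau>") auto
    qed
    ultimately show ?thesis by simp
  next
    case False
    define b where "b = min \<tau> S"
    have b: "- S \<le> b" "b \<le> S" using False Se by (auto simp: b_def)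
    have x: "norm x \<le> R" using False by simp
    define H where "H t = G (U (x, t)) * \<zeta> (x, t) ^ Suc k" for t
    have dH: "(H has_vector_derivative J (x, t)) (at t within {- S..b})" if "- S \<le> t" "t \<le> b" for t
    proof -
      have t: "\<bar>t\<bar> \<le> S" using that b by auto
      have "((\<lambda>t. G (U (x, t))) has_real_derivative g (U (x, t)) * divaU (x, t)) (at t)"
        by (rule DERIV_chain2[OF G dt_U[OF x t]])
      moreover have "((\<lambda>t. \<zeta> (x, t) ^ Suc k) has_real_derivative (real (Suc k) * \<zeta> (x, t) ^ k) * \<zeta>t (x, t)) (at t)"
        by (rule DERIV_chain2[OF DERIV_pow[of "Suc k", unfolded diff_Suc_Suc diff_zero] cutoff(5)])
      ultimately have "(H has_real_derivative J (x, t)) (at t)"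
        unfolding H_def[abs_def] J_def by (rule DERIV_cong[OF DERIV_mult']) (simp add: algebra_simps)
      then show ?thesis by (simp add: has_real_derivative_iff_has_vector_derivative has_vector_derivative_at_within)
    qed
    have "continuous_on {- S..b} (\<lambda>t. J (x, t))"
      by (rule continuous_on_compose2[OF cJ]) (auto intro!: continuous_intros)
    from integral_FTC_Icc[OF b(1) dH this]
    have "(\<integral>t. indicator {- S..b} t *\<^sub>R J (x, t) \<partial>lborel) = H b - H (- S)" by simp
    moreover have "(\<lambda>t. indicator {- S..b} t *\<^sub>R J (x, t)) = (\<lambda>t. indicator {..\<tau>} t * J (x, t))"
    proof
      fix t
      show "indicator {- S..b} t *\<^sub>R J (x, t) = indicator {..\<tau>} t * J (x, t)"
        using z(1)[of "(x, t)"] b by (cases "S \<le> \<bar>t\<bar>") (auto simp: indicator_def b_def)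
    qed
    moreover have "H (- S) = 0" using cutoff(10)[of "(x, - S)"] Se by (simp add: H_def)
    moreover have "H b = H \<tau>"
    proof (cases "\<tau> \<le> S")
      case False
      then show ?thesis using cutoff(10)[of "(x, \<tau>)"] cutoff(10)[of "(x, S)"] Se by (simp add: H_def b_def)
    qed (simp add: b_def)
    ultimately show ?thesis by (simp add: H_def)
  qed
  have space: "(\<integral>x. J (x, t) \<partial>lborel) = (\<integral>x. P (x, t) \<partial>lborel)" for t
  proof -
    have sl: "continuous_on UNIV (\<lambda>x. f (x, t))" if "continuous_on UNIV f" for f :: "(real ^ 'n) \<times> real \<Rightarrow> 'b::topological_space"
      by (rule continuous_on_compose2[OF that]) (auto intro!: continuous_intros)
    have "(\<integral>x. (\<Sum>i\<in>Basis. mollify_grad e (\<lambda>w. a w \<bullet> i) (x, t) \<bullet> i) * (g (U (x, t)) * \<zeta> (x, t) ^ Suc k) \<partial>lborel)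
       = - (\<integral>x. aU (x, t) \<bullet> V g dg k (x, t) \<partial>lborel)"
    proof (rule integral_divergence_mult[where R=R])
      show "((\<lambda>x. aU (x, t) \<bullet> i) has_derivative (\<lambda>h. mollify_grad e (\<lambda>w. a w \<bullet> i) (x, t) \<bullet> h)) (at x)" for i x
        using has_derivative_mollify[OF e integrables(4), of i t x] mollify_inner[OF integrables(3) mollifier_st_kernel[OF e], of i]
        by (simp add: aU_def)
      show "continuous_on UNIV (\<lambda>x. mollify_grad e (\<lambda>w. a w \<bullet> i) (x, t))" for i
        by (rule sl[OF continuous_mollify_grad[OF e integrables(4)]])
      show "((\<lambda>x. g (U (x, t)) * \<zeta> (x, t) ^ Suc k) has_derivative (\<lambda>h. V g dg k (x, t) \<bullet> h)) (at x)" for x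
        by (rule slice_has_derivative)
      show "continuous_on UNIV (\<lambda>x. V g dg k (x, t))" by (rule sl[OF continuous_V])
      show "g (U (x, t)) * \<zeta> (x, t) ^ Suc k = 0" "V g dg k (x, t) = 0" if "R \<le> norm x" for x
        using that cutoff(10)[of "(x, t)"] V_eq_0[of "(x, t)"] by auto
    qed
    then have 1: "(\<integral>x. g (U (x, t)) * divaU (x, t) * \<zeta> (x, t) ^ Suc k \<partial>lborel) = - (\<integral>x. aU (x, t) \<bullet> V g dg k (x, t) \<partial>lborel)"
      by (simp add: divaU_def mult_ac)
    have i: "integrable lborel (\<lambda>x. g (U (x, t)) * divaU (x, t) * \<zeta> (x, t) ^ Suc k)"
      "integrable lborel (\<lambda>x. aU (x, t) \<bullet> V g dg k (x, t))"
      "integrable lborel (\<lambda>x. real (Suc k) * \<zeta> (x, t) ^ k * \<zeta>t (x, t) * G (U (x, t)))"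
      using cutoff(10)[of "(_, t)"] V_eq_0[of "(_, t)"]
      by (intro integrable_of_compact_support[where R=R] continuous_intros sl[OF continuous_gU(1)] sl[OF continuous_U(4)]
          sl[OF continuous_U(3)] sl[OF continuous_V] sl[OF cutoff(1)] sl[OF cutoff(3)] sl[OF cG]; simp)+
    have "(\<integral>x. J (x, t) \<partial>lborel) = (\<integral>x. g (U (x, t)) * divaU (x, t) * \<zeta> (x, t) ^ Suc k \<partial>lborel) + (\<integral>x. real (Suc k) * \<zeta> (x, t) ^ k * \<zeta>t (x, t) * G (U (x, t)) \<partial>lborel)"
      unfolding J_def using i by (subst Bochner_Integration.integral_add[symmetric]) (auto simp: mult_ac)
    also have "\<dots> = (\<integral>x. P (x, t) \<partial>lborel)"
      unfolding P_def using i 1 by (subst Bochner_Integration.integral_diff) auto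
    finally show ?thesis .
  qed
  have "(\<integral>x. G (U (x, \<tau>)) * \<zeta> (x, \<tau>) ^ Suc k \<partial>lborel) = (\<integral>x. (\<integral>t. indicator {..\<tau>} t * J (x, t) \<partial>lborel) \<partial>lborel)"
    by (simp only: time)
  also have "\<dots> = (\<integral>t. (\<integral>x. indicator {..\<tau>} t * J (x, t) \<partial>lborel) \<partial>lborel)"
    using lborel_Fubini(1,2)[OF iJ] by simp
  also have "\<dots> = (\<integral>t. (\<integral>x. indicator {..\<tau>} t * P (x, t) \<partial>lborel) \<partial>lborel)"
    by (simp only: integral_mult_right_zero space)
  also have "\<dots> = (\<integral>w. indicator {..\<tau>} (snd w) * P w \<partial>lborel)"
    using lborel_Fubini(2)[OF iP] by simp
  finally show ?thesis by (simp add: P_def)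
qed

lemmas energy_identity_mollify = energy_identity[unfolded V_def U_def DU_def aU_def]
lemmas slice_has_derivative_mollify = slice_has_derivative[unfolded V_def U_def DU_def]
lemmas continuous_V_mollify = continuous_V[unfolded V_def U_def DU_def]

end

end

section \<open>Pointwise bounds for the energy density\<close>

lemma powr_add_le:
  fixes x y p :: real
  assumes "0 \<le> x" "0 \<le> y" "1 < p"
  shows "(x + y) powr p \<le> 2 powr p * (x powr p + y powr p)"
proof -
  have "(x + y) powr p \<le> (2 * max x y) powr p" using assms by (intro powr_mono2) auto
  also have "\<dots> = 2 powr p * max x y powr p" using assms by (simp add: powr_mult)
  also have "max x y powr p \<le> x powr p + y powr p" by (simp add: max_def)
  then have "2 powr p * max x y powr p \<le> 2 powr p * (x powr p + y powr p)" by (intro mult_left_mono) auto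
  finally show ?thesis .
qed

text \<open>Young's inequality with the factors \<open>1 / p\<close> and \<open>(p - 1) / p\<close> dropped.\<close>

lemma mult_le_powr_conjugate:
  fixes x y p :: real
  assumes "0 \<le> x" "0 \<le> y" "1 < p"
  shows "x * y \<le> x powr (p / (p - 1)) + y powr p"
proof -
  have q: "p / (p - 1) > 1" "1/(p / (p - 1)) + 1/p = 1" using assms by (auto simp: field_simps)
  have "x * y \<le> x powr (p / (p - 1)) / (p / (p - 1)) + y powr p / p"
    using Youngs_inequality[of "p / (p - 1)" p x y] q assms by auto
  also have "\<dots> \<le> x powr (p / (p - 1)) / 1 + y powr p / 1"
    using q assms by (intro add_mono divide_left_mono) auto
  finally show ?thesis by simp
qed

definition energy_const :: "nat \<Rightarrow> real \<Rightarrow> real \<Rightarrow> real \<Rightarrow> real" where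
  "energy_const k p \<Lambda>\<^sub>0 \<Lambda>\<^sub>1 = real (Suc k) * (1 + \<Lambda>\<^sub>1 * (\<Lambda>\<^sub>0 / (2 * real (Suc k) * \<Lambda>\<^sub>1)) powr (1 - p))"

text \<open>The term in which the flux meets the gradient of the cutoff is split according to the size of
  \<open>Y = norm Z * r\<close>. If \<open>Y\<close> is at most \<open>\<kappa>\<close> times \<open>norm D * z\<close>, then half of the coercive term absorbs it;
  otherwise \<open>norm D * z\<close> is controlled by \<open>Y\<close>, and a multiple of \<open>Y powr p\<close> remains. The second case uses
  \<open>p \<le> Suc k\<close>, which makes the available power of the cutoff at least \<open>z powr (p - 1)\<close>.\<close>

lemma energy_density_bound:
  fixes a D Z :: "'a::euclidean_space"
  assumes p: "1 < p" "p \<le> real (Suc k)" and L: "0 < \<Lambda>\<^sub>0" "0 < \<Lambda>\<^sub>1"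
    and aD: "\<Lambda>\<^sub>0 * norm D powr p \<le> a \<bullet> D" "norm a \<le> \<Lambda>\<^sub>1 * norm D powr (p - 1)"
    and z: "0 \<le> z" "z \<le> 1" and r: "0 \<le> r" and dg: "0 \<le> dg" "dg \<le> 1" and g: "0 \<le> g" "g \<le> r * dg"
    and G: "0 \<le> G" "2 * G \<le> r\<^sup>2"
  shows "real (Suc k) * z ^ k * zt * G - a \<bullet> ((dg * z ^ Suc k) *\<^sub>R D + (real (Suc k) * z ^ k * g) *\<^sub>R Z)
    \<le> energy_const k p \<Lambda>\<^sub>0 \<Lambda>\<^sub>1 * ((norm Z * r) powr p + \<bar>zt\<bar> * r\<^sup>2) - (\<Lambda>\<^sub>0 / 2) * (z ^ Suc k * dg * norm D powr p)"
proof -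
  define m where "m = real (Suc k)"
  define \<kappa> where "\<kappa> = \<Lambda>\<^sub>0 / (2 * m * \<Lambda>\<^sub>1)"
  have m: "1 \<le> m" by (simp add: m_def)
  have \<kappa>: "0 < \<kappa>" using L m by (simp add: \<kappa>_def)
  define X where "X = norm D * z"
  define Y where "Y = norm Z * r"
  have XY: "0 \<le> X" "0 \<le> Y" using z r by (auto simp: X_def Y_def)
  have zk: "0 \<le> z ^ k" "z ^ k \<le> 1" using z by (auto simp: power_le_one)
  have t1: "m * z ^ k * zt * G \<le> m * (\<bar>zt\<bar> * r\<^sup>2)"
  proof -
    have "z ^ k * zt * G \<le> \<bar>zt\<bar> * r\<^sup>2"
    proof -
      have "z ^ k * zt \<le> z ^ k * \<bar>zt\<bar>" using zk by (intro mult_left_mono) auto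
      also have "\<dots> \<le> 1 * \<bar>zt\<bar>" using zk by (intro mult_right_mono) auto
      finally have "z ^ k * zt * G \<le> 1 * \<bar>zt\<bar> * G" using G by (intro mult_right_mono) auto
      also have "\<dots> \<le> \<bar>zt\<bar> * r\<^sup>2" using G by (auto intro!: mult_left_mono)
      finally show ?thesis .
    qed
    then show ?thesis using m by (simp add: mult.assoc mult_left_mono)
  qed
  have t2: "- (dg * z ^ Suc k * (a \<bullet> D)) \<le> - (dg * z ^ Suc k * (\<Lambda>\<^sub>0 * norm D powr p))"
    using aD dg z by (simp add: mult_left_mono)
  have t3: "- (m * z ^ k * g * (a \<bullet> Z)) \<le> (\<Lambda>\<^sub>0 / 2) * (z ^ Suc k * dg * norm D powr p) + m * \<Lambda>\<^sub>1 * \<kappa> powr (1 - p) * Y powr p"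
  proof -
    have "- (a \<bullet> Z) \<le> norm a * norm Z" using Cauchy_Schwarz_ineq2[of a Z] by linarith
    also have "\<dots> \<le> \<Lambda>\<^sub>1 * norm D powr (p - 1) * norm Z" using aD by (intro mult_right_mono) auto
    finally have 1: "- (a \<bullet> Z) \<le> \<Lambda>\<^sub>1 * norm D powr (p - 1) * norm Z" .
    have "m * z ^ k * g * (- (a \<bullet> Z)) \<le> m * z ^ k * g * (\<Lambda>\<^sub>1 * norm D powr (p - 1) * norm Z)"
      using m zk g by (intro mult_left_mono 1) auto
    also have "\<dots> \<le> m * z ^ k * (r * dg) * (\<Lambda>\<^sub>1 * norm D powr (p - 1) * norm Z)"
      using m zk g L by (intro mult_right_mono mult_left_mono) auto
    also have "\<dots> = m * \<Lambda>\<^sub>1 * dg * (z ^ k * norm D powr (p - 1) * Y)" by (simp add: Y_def mult_ac)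
    also have "\<dots> \<le> (\<Lambda>\<^sub>0 / 2) * (z ^ Suc k * dg * norm D powr p) + m * \<Lambda>\<^sub>1 * \<kappa> powr (1 - p) * Y powr p"
    proof (cases "Y \<le> \<kappa> * X")
      case True
      have "z ^ k * norm D powr (p - 1) * Y \<le> z ^ k * norm D powr (p - 1) * (\<kappa> * X)"
        using zk True by (intro mult_left_mono) auto
      also have "\<dots> = \<kappa> * (z ^ Suc k * (norm D * norm D powr (p - 1)))" by (simp add: X_def mult_ac)
      also have "norm D * norm D powr (p - 1) = norm D powr p" using powr_mult_base[of "norm D" "p - 1"] by simp
      finally have "m * \<Lambda>\<^sub>1 * dg * (z ^ k * norm D powr (p - 1) * Y) \<le> m * \<Lambda>\<^sub>1 * dg * (\<kappa> * (z ^ Suc k * norm D powr p))"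
        using m L dg by (intro mult_left_mono) auto
      also have "\<dots> = (m * \<Lambda>\<^sub>1 * \<kappa>) * (z ^ Suc k * dg * norm D powr p)" by (simp add: mult_ac)
      also have "m * \<Lambda>\<^sub>1 * \<kappa> = \<Lambda>\<^sub>0 / 2" using m L by (simp add: \<kappa>_def)
      finally show ?thesis using m L by (smt (verit) mult_nonneg_nonneg powr_ge_zero)
    next
      case False
      have X: "X \<le> Y / \<kappa>" using False \<kappa> by (simp add: pos_le_divide_eq mult.commute)
      have "z ^ k * norm D powr (p - 1) \<le> X powr (p - 1)"
      proof (cases "z = 0")
        case True
        then show ?thesis using p by (cases k) auto
      next
        case False
        have "z ^ k = z powr real k" using z False by (simp add: powr_realpow)
        also have "\<dots> \<le> z powr (p - 1)" using z False p by (intro powr_mono') auto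
        finally have "z ^ k * norm D powr (p - 1) \<le> z powr (p - 1) * norm D powr (p - 1)" by (intro mult_right_mono) auto
        also have "\<dots> = X powr (p - 1)" using z by (simp add: X_def powr_mult mult.commute)
        finally show ?thesis .
      qed
      also have "\<dots> \<le> (Y / \<kappa>) powr (p - 1)" using X XY p by (intro powr_mono2) auto
      also have "\<dots> = \<kappa> powr (1 - p) * Y powr (p - 1)"
        using XY \<kappa> powr_minus_divide[of \<kappa> "p - 1"] by (simp add: powr_divide)
      finally have "z ^ k * norm D powr (p - 1) * Y \<le> \<kappa> powr (1 - p) * Y powr (p - 1) * Y" using XY by (intro mult_right_mono)
      also have "\<dots> = \<kappa> powr (1 - p) * Y powr p" using powr_mult_base[of Y "p - 1"] XY by (simp add: mult_ac)
      finally have "m * \<Lambda>\<^sub>1 * dg * (z ^ k * norm D powr (p - 1) * Y) \<le> m * \<Lambda>\<^sub>1 * dg * (\<kappa> powr (1 - p) * Y powr p)"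
        using m L dg by (intro mult_left_mono) auto
      also have "\<dots> \<le> m * \<Lambda>\<^sub>1 * 1 * (\<kappa> powr (1 - p) * Y powr p)" using m L dg by (intro mult_right_mono mult_left_mono) auto
      finally show ?thesis using z dg L by (smt (verit) mult_nonneg_nonneg powr_ge_zero zero_le_power mult.assoc mult_1_right half_gt_zero)
    qed
    finally show ?thesis by simp
  qed
  have "m * z ^ k * zt * G - a \<bullet> ((dg * z ^ Suc k) *\<^sub>R D + (m * z ^ k * g) *\<^sub>R Z)
    = m * z ^ k * zt * G + - (dg * z ^ Suc k * (a \<bullet> D)) + - (m * z ^ k * g * (a \<bullet> Z))"
    by (simp add: inner_add_right)
  also have "\<dots> \<le> m * (\<bar>zt\<bar> * r\<^sup>2) + - (dg * z ^ Suc k * (\<Lambda>\<^sub>0 * norm D powr p))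
      + ((\<Lambda>\<^sub>0 / 2) * (z ^ Suc k * dg * norm D powr p) + m * \<Lambda>\<^sub>1 * \<kappa> powr (1 - p) * Y powr p)"
    by (intro add_mono t1 t2 t3)
  also have "\<dots> = m * (\<bar>zt\<bar> * r\<^sup>2) + m * \<Lambda>\<^sub>1 * \<kappa> powr (1 - p) * Y powr p - (\<Lambda>\<^sub>0 / 2) * (z ^ Suc k * dg * norm D powr p)"
    by (simp add: algebra_simps)
  also have "m * (\<bar>zt\<bar> * r\<^sup>2) + m * \<Lambda>\<^sub>1 * \<kappa> powr (1 - p) * Y powr p \<le> energy_const k p \<Lambda>\<^sub>0 \<Lambda>\<^sub>1 * (Y powr p + \<bar>zt\<bar> * r\<^sup>2)"
  proof -
    have c: "energy_const k p \<Lambda>\<^sub>0 \<Lambda>\<^sub>1 = m + m * \<Lambda>\<^sub>1 * \<kappa> powr (1 - p)"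
      by (simp add: energy_const_def m_def \<kappa>_def algebra_simps)
    have "0 \<le> m * Y powr p" "0 \<le> m * \<Lambda>\<^sub>1 * \<kappa> powr (1 - p) * (\<bar>zt\<bar> * r\<^sup>2)" using m L by auto
    then show ?thesis unfolding c by (simp add: algebra_simps)
  qed
  finally show ?thesis by (simp add: m_def Y_def)
qed

lemma truncation_gradient_powr_bound:
  fixes D Z :: "'a::euclidean_space"
  assumes p: "1 < p" and z: "0 \<le> z" "z \<le> 1" and r: "0 \<le> r" and dg: "0 \<le> dg" "dg \<le> 1" and g: "0 \<le> g" "g \<le> r"
  shows "norm ((dg * z ^ Suc k) *\<^sub>R D + (real (Suc k) * z ^ k * g) *\<^sub>R Z) powr p
    \<le> 2 powr p * (z ^ Suc k * dg * norm D powr p + real (Suc k) powr p * (norm Z * r) powr p)"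
proof -
  have zk: "0 \<le> z ^ k" "z ^ k \<le> 1" "0 \<le> z ^ Suc k" "z ^ Suc k \<le> 1" using z by (auto simp: power_le_one mult_le_one)
  have "norm ((dg * z ^ Suc k) *\<^sub>R D + (real (Suc k) * z ^ k * g) *\<^sub>R Z)
    \<le> dg * z ^ Suc k * norm D + real (Suc k) * z ^ k * g * norm Z"
    using norm_triangle_ineq[of "(dg * z ^ Suc k) *\<^sub>R D" "(real (Suc k) * z ^ k * g) *\<^sub>R Z"] zk dg g by simp
  also have "real (Suc k) * z ^ k * g * norm Z \<le> real (Suc k) * 1 * r * norm Z"
    using zk g r by (intro mult_right_mono mult_mono) auto
  finally have "norm ((dg * z ^ Suc k) *\<^sub>R D + (real (Suc k) * z ^ k * g) *\<^sub>R Z)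
    \<le> dg * z ^ Suc k * norm D + real (Suc k) * (norm Z * r)" by (simp add: mult_ac)
  then have "norm ((dg * z ^ Suc k) *\<^sub>R D + (real (Suc k) * z ^ k * g) *\<^sub>R Z) powr p
    \<le> (dg * z ^ Suc k * norm D + real (Suc k) * (norm Z * r)) powr p"
    using p by (intro powr_mono2) auto
  also have "\<dots> \<le> 2 powr p * ((dg * z ^ Suc k * norm D) powr p + (real (Suc k) * (norm Z * r)) powr p)"
    using p zk dg r by (intro powr_add_le) auto
  also have "\<dots> \<le> 2 powr p * (z ^ Suc k * dg * norm D powr p + real (Suc k) powr p * (norm Z * r) powr p)"
  proof (intro mult_left_mono add_mono)
    have c: "0 \<le> dg * z ^ Suc k" "dg * z ^ Suc k \<le> 1" using dg zk by (auto intro: mult_le_one)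
    have cp: "(dg * z ^ Suc k) powr p \<le> dg * z ^ Suc k"
    proof (cases "dg * z ^ Suc k = 0")
      case False
      then have "(dg * z ^ Suc k) powr p \<le> (dg * z ^ Suc k) powr 1" using c p by (intro powr_mono') auto
      then show ?thesis using c by simp
    next
      case True
      show ?thesis unfolding True by simp
    qed
    have "(dg * z ^ Suc k * norm D) powr p = (dg * z ^ Suc k) powr p * norm D powr p" by (rule powr_mult)
    also have "\<dots> \<le> (dg * z ^ Suc k) * norm D powr p" by (rule mult_right_mono[OF cp powr_ge_zero])
    finally show "(dg * z ^ Suc k * norm D) powr p \<le> z ^ Suc k * dg * norm D powr p"
      by (simp only: mult.commute[of dg])
    show "(real (Suc k) * (norm Z * r)) powr p \<le> real (Suc k) powr p * (norm Z * r) powr p"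
      using r by (simp add: powr_mult)
  qed auto
  finally show ?thesis .
qed

lemma energy_const_pos: "0 < \<Lambda>\<^sub>1 \<Longrightarrow> 0 < energy_const k p \<Lambda>\<^sub>0 \<Lambda>\<^sub>1"
  unfolding energy_const_def by (intro mult_pos_pos add_pos_nonneg mult_nonneg_nonneg) auto

section \<open>Measure of the superlevel sets\<close>

lemma mollify_mono:
  fixes f g :: "'a::euclidean_space \<Rightarrow> real"
  assumes "mollifier \<delta> K" "integrable lborel f" "integrable lborel g" "\<And>w. f w \<le> g w"
  shows "mollify K f \<xi> \<le> mollify K g \<xi>"
  unfolding mollify_def
proof (rule integral_mono)
  show "integrable lborel (\<lambda>w. K w *\<^sub>R f (w + \<xi>))" "integrable lborel (\<lambda>w. K w *\<^sub>R g (w + \<xi>))"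
    using integrable_mollify_integrand assms by blast+
  show "K w *\<^sub>R f (w + \<xi>) \<le> K w *\<^sub>R g (w + \<xi>)" for w
    using assms by (simp add: mollifier_def mult_left_mono)
qed

text \<open>Fatou's lemma: a strict inequality in the limit holds from some index on.\<close>

lemma emeasure_liminf_superlevel:
  fixes v :: "nat \<Rightarrow> 'a \<Rightarrow> real"
  assumes [measurable]: "\<And>n. v n \<in> borel_measurable M" "w \<in> borel_measurable M"
    and lim: "AE x in M. (\<lambda>n. v n x) \<longlonglongrightarrow> w x"
    and bd: "\<And>n. emeasure M {x\<in>space M. l < v n x} \<le> c n" and c: "c \<longlonglongrightarrow> C"
  shows "emeasure M {x\<in>space M. l < w x} \<le> C"
proof -
  have "emeasure M {x\<in>space M. l < w x} = (\<integral>\<^sup>+x. indicator {x\<in>space M. l < w x} x \<partial>M)" by simp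
  also have "\<dots> \<le> (\<integral>\<^sup>+x. liminf (\<lambda>n. indicator {x\<in>space M. l < v n x} x) \<partial>M)"
  proof (rule nn_integral_mono_AE)
    show "AE x in M. indicator {x\<in>space M. l < w x} x \<le> liminf (\<lambda>n. indicator {x\<in>space M. l < v n x} x :: ennreal)"
      using lim AE_space
    proof eventually_elim
      case (elim x)
      show ?case
      proof (cases "l < w x")
        case True
        have "eventually (\<lambda>n. l < v n x) sequentially" using elim(1) True by (rule order_tendstoD)
        then have "eventually (\<lambda>n. (1::ennreal) \<le> indicator {x\<in>space M. l < v n x} x) sequentially"
          by eventually_elim (use elim in simp)
        then have "1 \<le> liminf (\<lambda>n. indicator {x\<in>space M. l < v n x} x :: ennreal)"
          by (rule Liminf_bounded)
        moreover have "indicator {x\<in>space M. l < w x} x \<le> (1::ennreal)" by (simp add: indicator_def)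
        ultimately show ?thesis by (rule order_trans[rotated])
      qed simp
    qed
  qed
  also have "\<dots> \<le> liminf (\<lambda>n. \<integral>\<^sup>+x. indicator {x\<in>space M. l < v n x} x \<partial>M)"
    by (rule nn_integral_liminf) measurable
  also have "\<dots> = liminf (\<lambda>n. emeasure M {x\<in>space M. l < v n x})" by simp
  also have "\<dots> \<le> liminf c" by (intro Liminf_mono always_eventually allI bd)
  also have "\<dots> = C" using c by (simp add: lim_imp_Liminf)
  finally show ?thesis .
qed

lemma integral_tendsto_of_L1:
  fixes f :: "nat \<Rightarrow> 'a \<Rightarrow> real"
  assumes f: "\<And>n. integrable M (f n)" and g: "integrable M g"
    and lim: "(\<lambda>n. \<integral>\<^sup>+x. ennreal \<bar>f n x - g x\<bar> \<partial>M) \<longlonglongrightarrow> 0"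
  shows "(\<lambda>n. \<integral>x. \<bar>f n x - g x\<bar> \<partial>M) \<longlonglongrightarrow> 0" "(\<lambda>n. \<integral>x. f n x \<partial>M) \<longlonglongrightarrow> (\<integral>x. g x \<partial>M)"
proof -
  have i: "integrable M (\<lambda>x. \<bar>f n x - g x\<bar>)" for n using f g by auto
  have "(\<integral>\<^sup>+x. ennreal \<bar>f n x - g x\<bar> \<partial>M) = ennreal (\<integral>x. \<bar>f n x - g x\<bar> \<partial>M)" for n
    by (rule nn_integral_eq_integral[OF i]) simp
  then have "(\<lambda>n. ennreal (\<integral>x. \<bar>f n x - g x\<bar> \<partial>M)) \<longlonglongrightarrow> ennreal 0" using lim by simp
  then show 1: "(\<lambda>n. \<integral>x. \<bar>f n x - g x\<bar> \<partial>M) \<longlonglongrightarrow> 0"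
    by (subst (asm) tendsto_ennreal_iff) (auto intro!: always_eventually)
  have "norm ((\<integral>x. f n x \<partial>M) - (\<integral>x. g x \<partial>M)) \<le> (\<integral>x. \<bar>f n x - g x\<bar> \<partial>M)" for n
    using f g integral_norm_bound[of M "\<lambda>x. f n x - g x"] by simp
  then have "(\<lambda>n. (\<integral>x. f n x \<partial>M) - (\<integral>x. g x \<partial>M)) \<longlonglongrightarrow> 0"
    by (intro Lim_null_comparison[OF always_eventually 1]) auto
  then show "(\<lambda>n. \<integral>x. f n x \<partial>M) \<longlonglongrightarrow> (\<integral>x. g x \<partial>M)" by (rule LIM_zero_cancel)
qed

definition level_const :: "nat \<Rightarrow> nat \<Rightarrow> real \<Rightarrow> real \<Rightarrow> real \<Rightarrow> real" where
  "level_const N k p \<Lambda>\<^sub>0 \<Lambda>\<^sub>1 = 2 * 2 powr p * (16 * energy_const k p \<Lambda>\<^sub>0 \<Lambda>\<^sub>1 / unit_ball_vol (real N)) powr (p / N)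
      * (2 powr p * (2 / \<Lambda>\<^sub>0 * energy_const k p \<Lambda>\<^sub>0 \<Lambda>\<^sub>1 + real (Suc k) powr p))"

text \<open>The energy inequality is first proved for mollifications \<open>U n\<close>, with an error \<open>er n\<close> that measures
  how far the energy density is from its limit. It bounds the slices of the truncated and localized
  function in \<open>L\<^sup>2\<close> and its gradient in \<open>L\<^sup>p\<close>, so that the weak type inequality applies on every slice
  of \<open>U n\<close>. Integration over time and the limit \<open>n \<rightarrow> \<infinity>\<close> give the claim. Truncating mollified
  functions, and passing to the limit only in measures of superlevel sets and in integrals, avoids
  slices of \<open>u\<close> itself.\<close>

proposition level_set_estimate:
  fixes u :: "(real ^ 'n::finite) \<times> real \<Rightarrow> real" and D a :: "(real ^ 'n) \<times> real \<Rightarrow> real ^ 'n"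
  assumes sol: "local_solution \<rho> \<theta> u D a"
    and p: "1 < p" "p \<le> real (Suc m)" and L: "0 < \<Lambda>\<^sub>0" "0 < \<Lambda>\<^sub>1"
    and str: "AE w in lborel. \<Lambda>\<^sub>0 * norm (D w) powr p \<le> a w \<bullet> D w \<and> norm (a w) \<le> \<Lambda>\<^sub>1 * norm (D w) powr (p - 1)"
    and Dp: "integrable lborel (\<lambda>w. norm (D w) powr p)"
    and up: "integrable lborel (\<lambda>w. \<bar>u w\<bar> powr p)" and u2: "integrable lborel (\<lambda>w. \<bar>u w\<bar> powr 2)"
    and k: "0 \<le> k" and d: "0 < d" and R: "0 < r" "r < R" "R < \<rho>" and S: "0 < s" "s < S" "S < \<theta>"
    and E: "(\<integral>\<^sup>+w. ennreal (indicator (cylinder R S) w * ((4 / (R - r) * max (u w - k) 0) powr p + 4 / (S - s) * (max (u w - k) 0)\<^sup>2)) \<partial>lborel) \<le> ennreal E" "0 < E"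
    and l: "0 < l"
  shows "emeasure lborel {w \<in> cylinder r s. l < trunc k d (u w)}
      \<le> ennreal (level_const CARD('n) m p \<Lambda>\<^sub>0 \<Lambda>\<^sub>1 * E powr (1 + p / CARD('n)) / l powr (p + 2 * p / CARD('n)))"
proof -
  obtain \<zeta> :: "(real ^ 'n) \<times> real \<Rightarrow> real" and D\<zeta> \<zeta>t where cut: "is_cutoff R S (4 / (R - r)) (4 / (S - s)) \<zeta> D\<zeta> \<zeta>t"
    and \<zeta>1: "\<And>w. norm (fst w) \<le> r \<Longrightarrow> \<bar>snd w\<bar> \<le> s \<Longrightarrow> \<zeta> w = 1"
    using cutoff_exists[OF R(1,2) S(1,2)] by metis
  define L1 where "L1 = 4 / (R - r)"
  define L2 where "L2 = 4 / (S - s)"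
  have L12: "0 < L1" "0 < L2" using R S by (auto simp: L1_def L2_def)
  define M where "M = real (Suc m)"
  have M1: "1 \<le> M" by (simp add: M_def)
  define N where "N = real CARD('n)"
  have N: "0 < N" by (simp add: N_def)
  define q where "q = p / (p - 1)"
  have q: "1 < q" using p by (simp add: q_def field_simps)
  have \<zeta>: "continuous_on UNIV \<zeta>" "continuous_on UNIV D\<zeta>" "continuous_on UNIV \<zeta>t"
    "\<And>w. 0 \<le> \<zeta> w" "\<And>w. \<zeta> w \<le> 1" "\<And>w. norm (D\<zeta> w) \<le> L1" "\<And>w. \<bar>\<zeta>t w\<bar> \<le> L2"
    "\<And>w. R \<le> norm (fst w) \<or> S \<le> \<bar>snd w\<bar> \<Longrightarrow> \<zeta> w = 0 \<and> D\<zeta> w = 0 \<and> \<zeta>t w = 0"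
    unfolding L1_def L2_def by (fact is_cutoffD[OF cut])+
  have [measurable]: "\<zeta> \<in> borel_measurable borel" "D\<zeta> \<in> borel_measurable borel" "\<zeta>t \<in> borel_measurable borel"
    using \<zeta> by (auto intro: borel_measurable_continuous_onI)
  have int: "integrable lborel u" "integrable lborel D" "integrable lborel a"
    using sol by (auto simp: local_solution_def)
  have [measurable]: "u \<in> borel_measurable borel" "D \<in> borel_measurable borel" "a \<in> borel_measurable borel"
    using int by auto
  have [measurable]: "trunc k d \<in> borel_measurable borel" "trunc_deriv k d \<in> borel_measurable borel" "trunc_prim k d \<in> borel_measurable borel"
    using d by (auto intro!: borel_measurable_continuous_onI continuous_on_trunc)
  have aq: "integrable lborel (\<lambda>w. norm (a w) powr q)"
  proof (rule Bochner_Integration.integrable_bound[OF integrable_mult_right[OF Dp, of "\<Lambda>\<^sub>1 powr q"]])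
    show "AE w in lborel. norm (norm (a w) powr q) \<le> norm (\<Lambda>\<^sub>1 powr q * norm (D w) powr p)"
      using str
    proof eventually_elim
      case (elim w)
      have "norm (a w) powr q \<le> (\<Lambda>\<^sub>1 * norm (D w) powr (p - 1)) powr q"
        using elim q by (intro powr_mono2) auto
      also have "\<dots> = \<Lambda>\<^sub>1 powr q * norm (D w) powr p" using L p by (simp add: powr_mult powr_powr q_def)
      finally show ?case by simp
    qed
  qed measurable
  \<comment> \<open>one integrable majorant for all powers that occur in the energy\<close>
  define \<Gamma> where "\<Gamma> w = \<bar>u w\<bar> powr p + \<bar>u w\<bar> powr 2 + norm (D w) powr p + norm (a w) powr q" for w
  have \<Gamma>: "integrable lborel \<Gamma>" unfolding \<Gamma>_def[abs_def]
    by (intro Bochner_Integration.integrable_add up u2 Dp aq)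
  have \<Gamma>ge: "\<bar>u w\<bar> powr p \<le> \<Gamma> w" "\<bar>u w\<bar> powr 2 \<le> \<Gamma> w" "norm (D w) powr p \<le> \<Gamma> w" "norm (a w) powr q \<le> \<Gamma> w" for w
    by (simp_all add: \<Gamma>_def add_increasing add_increasing2)
  \<comment> \<open>summable errors, so that the mollifications converge almost everywhere\<close>
  define good where "good n e \<longleftrightarrow> 0 < e \<and> R + e < \<rho> \<and> S + e < \<theta> \<and>
      (\<integral>\<^sup>+w. ennreal (norm (mollify (st_kernel e) u w - u w)) \<partial>lborel) \<le> ennreal ((1/2) ^ n) \<and>
      (\<integral>\<^sup>+w. ennreal (norm (mollify (st_kernel e) D w - D w)) \<partial>lborel) \<le> ennreal ((1/2) ^ n) \<and>
      (\<integral>\<^sup>+w. ennreal (norm (mollify (st_kernel e) a w - a w)) \<partial>lborel) \<le> ennreal ((1/2) ^ n) \<and>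
      (\<integral>\<^sup>+w. ennreal (norm (mollify (st_kernel e) \<Gamma> w - \<Gamma> w)) \<partial>lborel) \<le> ennreal ((1/2) ^ n)" for n e
  have "\<exists>e. good n e" for n
  proof -
    have "\<forall>\<^sub>F e in at_right 0. e \<in> {0<..<min (\<rho> - R) (\<theta> - S)}" using R S by (intro eventually_at_right_real) simp
    then have small: "\<forall>\<^sub>F e in at_right 0. 0 < e \<and> R + e < \<rho> \<and> S + e < \<theta>" by eventually_elim auto
    have "0 < (1/2::real) ^ n" by simp
    note err = eventually_mollify_error_le[OF _ this]
    have "\<forall>\<^sub>F e in at_right 0. good n e"
      using small err[OF int(1)] err[OF int(2)] err[OF int(3)] err[OF \<Gamma>] unfolding good_def by eventually_elim blast
    then show ?thesis by (rule eventually_happens'[rotated]) simp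
  qed
  then obtain e where good: "\<And>n. good n (e n)" by metis
  have e: "\<And>n. 0 < e n" "\<And>n. R + e n < \<rho>" "\<And>n. S + e n < \<theta>"
    using good by (simp_all add: good_def)
  have err: "\<And>n. (\<integral>\<^sup>+w. ennreal (norm (mollify (st_kernel (e n)) u w - u w)) \<partial>lborel) \<le> ennreal ((1/2) ^ n)"
      "\<And>n. (\<integral>\<^sup>+w. ennreal (norm (mollify (st_kernel (e n)) D w - D w)) \<partial>lborel) \<le> ennreal ((1/2) ^ n)"
      "\<And>n. (\<integral>\<^sup>+w. ennreal (norm (mollify (st_kernel (e n)) a w - a w)) \<partial>lborel) \<le> ennreal ((1/2) ^ n)"
      "\<And>n. (\<integral>\<^sup>+w. ennreal (norm (mollify (st_kernel (e n)) \<Gamma> w - \<Gamma> w)) \<partial>lborel) \<le> ennreal ((1/2) ^ n)"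
    using good unfolding good_def by blast+
  define U where "U n = mollify (st_kernel (e n)) u" for n
  define DU where "DU n = mollify (st_kernel (e n)) D" for n
  define aU where "aU n = mollify (st_kernel (e n)) a" for n
  define \<Gamma>U where "\<Gamma>U n = mollify (st_kernel (e n)) \<Gamma>" for n
  note K = mollifier_st_kernel[OF e(1), where 'a="real ^ 'n"]
  have [measurable]: "U n \<in> borel_measurable borel" "DU n \<in> borel_measurable borel" "aU n \<in> borel_measurable borel" "\<Gamma>U n \<in> borel_measurable borel" for n
    unfolding U_def DU_def aU_def \<Gamma>U_def by (rule borel_measurable_mollify[OF _ K], fact int \<Gamma>)+
  have [measurable]: "\<Gamma> \<in> borel_measurable borel" using \<Gamma> by auto
  have lim: "AE w in lborel. (\<lambda>n. U n w) \<longlonglongrightarrow> u w" "AE w in lborel. (\<lambda>n. DU n w) \<longlonglongrightarrow> D w"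
    "AE w in lborel. (\<lambda>n. aU n w) \<longlonglongrightarrow> a w" "AE w in lborel. (\<lambda>n. \<Gamma>U n w) \<longlonglongrightarrow> \<Gamma> w"
    using err by (auto intro!: AE_tendsto_of_fast_L1 simp: U_def[symmetric] DU_def[symmetric] aU_def[symmetric] \<Gamma>U_def[symmetric])
  have \<Gamma>L: "(\<lambda>n. \<integral>\<^sup>+w. ennreal \<bar>\<Gamma>U n w - \<Gamma> w\<bar> \<partial>lborel) \<longlonglongrightarrow> 0"
  proof (rule tendsto_sandwich[OF always_eventually always_eventually tendsto_const])
    have "(\<lambda>n. ennreal ((1/2) ^ n)) \<longlonglongrightarrow> ennreal 0"
      by (intro tendsto_ennrealI LIMSEQ_realpow_zero) auto
    then show "(\<lambda>n. ennreal ((1/2) ^ n)) \<longlonglongrightarrow> 0" by simp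
  qed (use err(4) in \<open>auto simp: \<Gamma>U_def\<close>)
  have dom: "\<bar>U n w\<bar> powr p \<le> \<Gamma>U n w" "\<bar>U n w\<bar> powr 2 \<le> \<Gamma>U n w" "norm (DU n w) powr p \<le> \<Gamma>U n w" "norm (aU n w) powr q \<le> \<Gamma>U n w" for n w
  proof -
    show "\<bar>U n w\<bar> powr p \<le> \<Gamma>U n w"
      using norm_mollify_powr_le[OF int(1) K[of n] p(1), of w] mollify_mono[OF K[of n] up \<Gamma> \<Gamma>ge(1), of w] up by (simp add: U_def \<Gamma>U_def)
    show "\<bar>U n w\<bar> powr 2 \<le> \<Gamma>U n w"
      using norm_mollify_powr_le[OF int(1) K[of n], of 2 w] mollify_mono[OF K[of n] u2 \<Gamma> \<Gamma>ge(2), of w] u2 by (simp add: U_def \<Gamma>U_def)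
    show "norm (DU n w) powr p \<le> \<Gamma>U n w"
      using norm_mollify_powr_le[OF int(2) K[of n] p(1) Dp, of w] mollify_mono[OF K[of n] Dp \<Gamma> \<Gamma>ge(3), of w] by (simp add: DU_def \<Gamma>U_def)
    show "norm (aU n w) powr q \<le> \<Gamma>U n w"
      using norm_mollify_powr_le[OF int(3) K[of n] q aq, of w] mollify_mono[OF K[of n] aq \<Gamma> \<Gamma>ge(4), of w] by (simp add: aU_def \<Gamma>U_def)
  qed
  \<comment> \<open>the gradient of the localized truncation and the energy density, as functions of the values of \<open>u\<close>, of its gradient and of the flux\<close>
  define Vf where "Vf x y w = (trunc_deriv k d x * \<zeta> w ^ Suc m) *\<^sub>R y + (M * \<zeta> w ^ m * trunc k d x) *\<^sub>R D\<zeta> w" for x :: real and y :: "real ^ 'n" and w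
  define If where "If x y b w = M * \<zeta> w ^ m * \<zeta>t w * trunc_prim k d x - b \<bullet> Vf x y w" for x :: real and y b :: "real ^ 'n" and w
  have z01: "0 \<le> \<zeta> w ^ j" "\<zeta> w ^ j \<le> 1" for w j using \<zeta>(4,5)[of w] by (auto simp: power_le_one)
  have Vn: "norm (Vf x y w) \<le> norm y + M * L1 * \<bar>x\<bar>" for x y w
  proof -
    have "norm (Vf x y w) \<le> (trunc_deriv k d x * \<zeta> w ^ Suc m) * norm y + (M * \<zeta> w ^ m * trunc k d x) * norm (D\<zeta> w)"
      unfolding Vf_def using norm_triangle_ineq[of "(trunc_deriv k d x * \<zeta> w ^ Suc m) *\<^sub>R y" "(M * \<zeta> w ^ m * trunc k d x) *\<^sub>R D\<zeta> w"]
        trunc_bounds(1,3)[OF d, of k x] z01[of w m] z01[of w "Suc m"] M1 by simp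
    also have "\<dots> \<le> 1 * norm y + (M * 1 * \<bar>x\<bar>) * L1"
    proof (intro add_mono mult_mono)
      show "trunc_deriv k d x * \<zeta> w ^ Suc m \<le> 1" using trunc_bounds(1,2)[OF d, of k x] z01[of w "Suc m"] by (intro mult_le_one)
      show "trunc k d x \<le> \<bar>x\<bar>" by (rule trunc_le(2)[OF d k])
    qed (use z01[of w m] M1 \<zeta>(6) trunc_bounds(3)[OF d, of k x] in auto)
    finally show ?thesis by (simp add: mult_ac)
  qed
  define cI where "cI = M * L2 + (2 + 2 * (M * L1))"
  have cI: "0 < cI" using M1 L12 by (simp add: cI_def add_pos_nonneg)
  have If_dom: "\<bar>If (U n w) (DU n w) (aU n w) w\<bar> \<le> cI * \<Gamma>U n w" for n w
  proof -
    have a1: "\<bar>M * \<zeta> w ^ m * \<zeta>t w * trunc_prim k d (U n w)\<bar> \<le> M * L2 * \<Gamma>U n w"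
    proof -
      have "\<bar>M * \<zeta> w ^ m * \<zeta>t w * trunc_prim k d (U n w)\<bar> = M * \<zeta> w ^ m * \<bar>\<zeta>t w\<bar> * trunc_prim k d (U n w)"
        using M1 z01[of w m] trunc_bounds(8)[OF d, of k "U n w"] by (simp add: abs_mult)
      also have "\<dots> \<le> M * 1 * L2 * \<Gamma>U n w"
      proof (intro mult_mono)
        have "trunc_prim k d (U n w) \<le> \<bar>U n w\<bar> powr 2" using trunc_le(3)[OF d k, of "U n w"] by simp
        then show "trunc_prim k d (U n w) \<le> \<Gamma>U n w" using dom(2)[where n=n and w=w] by linarith
      qed (use M1 z01[of w m] \<zeta>(7) L12 trunc_bounds(8)[OF d, of k "U n w"] in auto)
      finally show ?thesis by simp
    qed
    have "\<bar>aU n w \<bullet> Vf (U n w) (DU n w) w\<bar> \<le> norm (aU n w) * (norm (DU n w) + M * L1 * \<bar>U n w\<bar>)"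
      by (rule order_trans[OF Cauchy_Schwarz_ineq2 mult_left_mono[OF Vn norm_ge_zero]])
    also have "\<dots> = norm (aU n w) * norm (DU n w) + (M * L1) * (norm (aU n w) * \<bar>U n w\<bar>)" by (simp add: algebra_simps)
    also have "\<dots> \<le> 2 * \<Gamma>U n w + (M * L1) * (2 * \<Gamma>U n w)"
    proof (intro add_mono mult_left_mono)
      show "norm (aU n w) * norm (DU n w) \<le> 2 * \<Gamma>U n w"
        using mult_le_powr_conjugate[of "norm (aU n w)" "norm (DU n w)" p] p dom(3,4)[where n=n and w=w] by (simp add: q_def)
      show "norm (aU n w) * \<bar>U n w\<bar> \<le> 2 * \<Gamma>U n w"
        using mult_le_powr_conjugate[of "norm (aU n w)" "\<bar>U n w\<bar>" p] p dom(1,4)[where n=n and w=w] by (simp add: q_def)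
    qed (use M1 L12 in auto)
    finally have a2: "\<bar>aU n w \<bullet> Vf (U n w) (DU n w) w\<bar> \<le> (2 + 2 * (M * L1)) * \<Gamma>U n w" by (simp add: algebra_simps)
    have "\<bar>If (U n w) (DU n w) (aU n w) w\<bar> \<le> M * L2 * \<Gamma>U n w + (2 + 2 * (M * L1)) * \<Gamma>U n w"
      using a1 a2 unfolding If_def by linarith
    then show ?thesis by (simp add: cI_def algebra_simps)
  qed
  have clim: "(\<lambda>n. Vf (U n w) (DU n w) w) \<longlonglongrightarrow> Vf (u w) (D w) w" "(\<lambda>n. trunc k d (U n w)) \<longlonglongrightarrow> trunc k d (u w)"
     "(\<lambda>n. trunc_prim k d (U n w)) \<longlonglongrightarrow> trunc_prim k d (u w)"
    if "(\<lambda>n. U n w) \<longlonglongrightarrow> u w" "(\<lambda>n. DU n w) \<longlonglongrightarrow> D w" for w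
  proof -
    have c: "(\<lambda>n. f (U n w)) \<longlonglongrightarrow> f (u w)" if "continuous_on UNIV f" for f :: "real \<Rightarrow> real"
      using that \<open>(\<lambda>n. U n w) \<longlonglongrightarrow> u w\<close> by (intro continuous_on_tendsto_compose[OF that]) auto
    show 1: "(\<lambda>n. trunc k d (U n w)) \<longlonglongrightarrow> trunc k d (u w)" "(\<lambda>n. trunc_prim k d (U n w)) \<longlonglongrightarrow> trunc_prim k d (u w)"
      using d by (auto intro!: c continuous_on_trunc)
    have 2: "(\<lambda>n. trunc_deriv k d (U n w)) \<longlonglongrightarrow> trunc_deriv k d (u w)" by (auto intro!: c continuous_on_trunc)
    show "(\<lambda>n. Vf (U n w) (DU n w) w) \<longlonglongrightarrow> Vf (u w) (D w) w"
      unfolding Vf_def by (intro tendsto_intros 1 2 that)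
  qed
  have Ifm[measurable]: "(\<lambda>w. If (U n w) (DU n w) (aU n w) w) \<in> borel_measurable borel"
    "(\<lambda>w. If (u w) (D w) (a w) w) \<in> borel_measurable borel"
    "(\<lambda>w. Vf (U n w) (DU n w) w) \<in> borel_measurable borel" "(\<lambda>w. Vf (u w) (D w) w) \<in> borel_measurable borel" for n
    unfolding If_def Vf_def by measurable
  have c\<Gamma>: "integrable lborel (\<lambda>w. c * \<Gamma> w)" "(\<lambda>n. \<integral>\<^sup>+w. ennreal \<bar>c * \<Gamma>U n w - c * \<Gamma> w\<bar> \<partial>lborel) \<longlonglongrightarrow> 0"
    "AE w in lborel. (\<lambda>n. c * \<Gamma>U n w) \<longlonglongrightarrow> c * \<Gamma> w" if c: "0 < c" for c
  proof -
    show "integrable lborel (\<lambda>w. c * \<Gamma> w)" using \<Gamma> by simp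
    have "(\<integral>\<^sup>+w. ennreal \<bar>c * \<Gamma>U n w - c * \<Gamma> w\<bar> \<partial>lborel) = ennreal c * (\<integral>\<^sup>+w. ennreal \<bar>\<Gamma>U n w - \<Gamma> w\<bar> \<partial>lborel)" for n
    proof -
      have "ennreal \<bar>c * \<Gamma>U n w - c * \<Gamma> w\<bar> = ennreal c * ennreal \<bar>\<Gamma>U n w - \<Gamma> w\<bar>" for w
        using c by (simp add: right_diff_distrib[symmetric] abs_mult ennreal_mult)
      then show ?thesis by (simp add: nn_integral_cmult)
    qed
    moreover have "(\<lambda>n. ennreal c * (\<integral>\<^sup>+w. ennreal \<bar>\<Gamma>U n w - \<Gamma> w\<bar> \<partial>lborel)) \<longlonglongrightarrow> ennreal c * 0"
      by (rule ennreal_tendsto_cmult[OF _ \<Gamma>L]) simp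
    ultimately show "(\<lambda>n. \<integral>\<^sup>+w. ennreal \<bar>c * \<Gamma>U n w - c * \<Gamma> w\<bar> \<partial>lborel) \<longlonglongrightarrow> 0" by simp
    show "AE w in lborel. (\<lambda>n. c * \<Gamma>U n w) \<longlonglongrightarrow> c * \<Gamma> w"
      using lim(4) by eventually_elim (intro tendsto_intros)
  qed
  have "(\<lambda>n. \<integral>\<^sup>+w. ennreal \<bar>If (U n w) (DU n w) (aU n w) w - If (u w) (D w) (a w) w\<bar> \<partial>lborel) \<longlonglongrightarrow> 0"
    and Ii: "integrable lborel (\<lambda>w. If (u w) (D w) (a w) w)"
  proof -
    have l: "AE w in lborel. (\<lambda>n. If (U n w) (DU n w) (aU n w) w) \<longlonglongrightarrow> If (u w) (D w) (a w) w"
      using lim(1,2,3)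
    proof eventually_elim
      case (elim w)
      show ?case unfolding If_def by (intro tendsto_intros clim elim)
    qed
    note * = generalized_dominated_convergence[where G="\<lambda>n w. cI * \<Gamma>U n w", OF _ _ _ c\<Gamma>(1)[OF cI] AE_I2[OF If_dom] c\<Gamma>(2,3)[OF cI] l]
    show "(\<lambda>n. \<integral>\<^sup>+w. ennreal \<bar>If (U n w) (DU n w) (aU n w) w - If (u w) (D w) (a w) w\<bar> \<partial>lborel) \<longlonglongrightarrow> 0"
      by (rule *(1)) measurable
    show "integrable lborel (\<lambda>w. If (u w) (D w) (a w) w)" by (rule *(2)) measurable
  qed
  then have errI: "(\<lambda>n. \<integral>\<^sup>+w. ennreal \<bar>If (U n w) (DU n w) (aU n w) w - If (u w) (D w) (a w) w\<bar> \<partial>lborel) \<longlonglongrightarrow> 0" by simp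
  define cV where "cV = 2 powr p * (1 + (M * L1) powr p)"
  have cV: "0 < cV" by (simp add: cV_def add_pos_nonneg)
  have V_dom: "norm (Vf (U n w) (DU n w) w) powr p \<le> cV * \<Gamma>U n w" for n w
  proof -
    have "norm (Vf (U n w) (DU n w) w) powr p \<le> (norm (DU n w) + M * L1 * \<bar>U n w\<bar>) powr p"
      using p by (intro powr_mono2 Vn) auto
    also have "\<dots> \<le> 2 powr p * (norm (DU n w) powr p + (M * L1 * \<bar>U n w\<bar>) powr p)"
      using p M1 L12 by (intro powr_add_le) auto
    also have "(M * L1 * \<bar>U n w\<bar>) powr p = (M * L1) powr p * \<bar>U n w\<bar> powr p"
      by (rule powr_mult)
    also have "2 powr p * (norm (DU n w) powr p + (M * L1) powr p * \<bar>U n w\<bar> powr p) \<le> 2 powr p * (\<Gamma>U n w + (M * L1) powr p * \<Gamma>U n w)"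
      by (intro mult_left_mono add_mono dom) auto
    finally show ?thesis by (simp add: cV_def algebra_simps)
  qed
  have errV: "(\<lambda>n. \<integral>\<^sup>+w. ennreal \<bar>norm (Vf (U n w) (DU n w) w) powr p - norm (Vf (u w) (D w) w) powr p\<bar> \<partial>lborel) \<longlonglongrightarrow> 0"
    and Vi: "integrable lborel (\<lambda>w. norm (Vf (u w) (D w) w) powr p)"
  proof -
    have l: "AE w in lborel. (\<lambda>n. norm (Vf (U n w) (DU n w) w) powr p) \<longlonglongrightarrow> norm (Vf (u w) (D w) w) powr p"
      using lim(1,2)
    proof eventually_elim
      case (elim w)
      show ?case using p by (intro tendsto_powr' tendsto_norm clim elim tendsto_const) auto
    qed
    have dm: "AE w in lborel. \<bar>norm (Vf (U n w) (DU n w) w) powr p\<bar> \<le> cV * \<Gamma>U n w" for n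
      using V_dom by simp
    note * = generalized_dominated_convergence[where G="\<lambda>n w. cV * \<Gamma>U n w", OF _ _ _ c\<Gamma>(1)[OF cV] dm c\<Gamma>(2,3)[OF cV] l]
    show "(\<lambda>n. \<integral>\<^sup>+w. ennreal \<bar>norm (Vf (U n w) (DU n w) w) powr p - norm (Vf (u w) (D w) w) powr p\<bar> \<partial>lborel) \<longlonglongrightarrow> 0"
      by (rule *(1)) measurable
    show "integrable lborel (\<lambda>w. norm (Vf (u w) (D w) w) powr p)" by (rule *(2)) measurable
  qed
  define C1 where "C1 = energy_const m p \<Lambda>\<^sub>0 \<Lambda>\<^sub>1"
  have C1: "0 < C1" using energy_const_pos[OF L(2)] by (simp add: C1_def)
  \<comment> \<open>an upper bound for the terms that involve derivatives of the cutoff, and the coercive term\<close>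
  define ev where "ev w = indicator (cylinder R S) w * ((L1 * max (u w - k) 0) powr p + L2 * (max (u w - k) 0)\<^sup>2)" for w
  define W where "W w = \<zeta> w ^ Suc m * trunc_deriv k d (u w) * norm (D w) powr p" for w
  have [measurable]: "(cylinder R S :: ((real ^ 'n) \<times> real) set) \<in> sets borel" "(cylinder r s :: ((real ^ 'n) \<times> real) set) \<in> sets borel"
    by (rule cylinder_facts)+
  have [measurable]: "ev \<in> borel_measurable borel" "W \<in> borel_measurable borel"
    unfolding ev_def[abs_def] W_def[abs_def] by measurable
  have ev0: "0 \<le> ev w" for w using L12 by (simp add: ev_def)
  have W0: "0 \<le> W w" for w
    unfolding W_def by (intro mult_nonneg_nonneg z01 trunc_bounds(1) d powr_ge_zero)
  have evE: "(\<integral>\<^sup>+w. ennreal (ev w) \<partial>lborel) \<le> ennreal E" using E(1) by (simp add: ev_def L1_def L2_def)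
  have evi: "integrable lborel ev"
    by (rule integrableI_nonneg) (use ev0 evE in \<open>auto intro: le_less_trans\<close>)
  have evE': "(\<integral>w. ev w \<partial>lborel) \<le> E"
    using evE E(2) ev0 by (subst (asm) nn_integral_eq_integral[OF evi]) auto
  have Wi: "integrable lborel W"
  proof (rule Bochner_Integration.integrable_bound[OF Dp])
    have "W w \<le> norm (D w) powr p" for w
    proof -
      have "\<zeta> w ^ Suc m * trunc_deriv k d (u w) \<le> 1" by (intro mult_le_one z01 trunc_bounds d)
      moreover have "0 \<le> \<zeta> w ^ Suc m * trunc_deriv k d (u w)" by (intro mult_nonneg_nonneg z01 trunc_bounds d)
      ultimately show ?thesis unfolding W_def by (intro mult_left_le_one_le powr_ge_zero)
    qed
    then show "AE w in lborel. norm (W w) \<le> norm (norm (D w) powr p)" using W0 by simp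
  qed measurable
  have ev_ge: "(norm (D\<zeta> w) * max (u w - k) 0) powr p + \<bar>\<zeta>t w\<bar> * (max (u w - k) 0)\<^sup>2 \<le> ev w" for w
  proof (cases "w \<in> cylinder R S")
    case True
    have "(norm (D\<zeta> w) * max (u w - k) 0) powr p \<le> (L1 * max (u w - k) 0) powr p"
      using p \<zeta>(6) by (intro powr_mono2 mult_right_mono) auto
    moreover have "\<bar>\<zeta>t w\<bar> * (max (u w - k) 0)\<^sup>2 \<le> L2 * (max (u w - k) 0)\<^sup>2"
      using \<zeta>(7) by (intro mult_right_mono) auto
    ultimately show ?thesis using True by (simp add: ev_def)
  next
    case False
    then have "R \<le> norm (fst w) \<or> S \<le> \<bar>snd w\<bar>" using cylinder_facts(3)[of "fst w" "snd w" R S] by auto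
    then show ?thesis using \<zeta>(8)[of w] ev0[of w] by simp
  qed
  have dens: "AE w in lborel. If (u w) (D w) (a w) w \<le> C1 * ev w - (\<Lambda>\<^sub>0 / 2) * W w"
    using str
  proof eventually_elim
    case (elim w)
    have "If (u w) (D w) (a w) w \<le> C1 * ((norm (D\<zeta> w) * max (u w - k) 0) powr p + \<bar>\<zeta>t w\<bar> * (max (u w - k) 0)\<^sup>2) - (\<Lambda>\<^sub>0 / 2) * W w"
      unfolding If_def Vf_def W_def C1_def M_def
      by (rule energy_density_bound) (use p L elim \<zeta>(4,5) trunc_bounds[OF d] in auto)
    also have "\<dots> \<le> C1 * ev w - (\<Lambda>\<^sub>0 / 2) * W w"
      using mult_left_mono[OF ev_ge[of w], of C1] C1 by simp
    finally show ?case .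
  qed
  have \<Gamma>Ui: "integrable lborel (\<Gamma>U n)" for n
    unfolding \<Gamma>U_def by (rule integrable_mollify[OF \<Gamma> K err(4)])
  have Ini: "integrable lborel (\<lambda>w. If (U n w) (DU n w) (aU n w) w)" for n
  proof (rule Bochner_Integration.integrable_bound[OF integrable_mult_right[OF \<Gamma>Ui, of cI]])
    show "AE w in lborel. norm (If (U n w) (DU n w) (aU n w) w) \<le> norm (cI * \<Gamma>U n w)"
      using If_dom by (intro AE_I2) (simp add: order_trans[OF _ abs_ge_self])
  qed measurable
  have Vni: "integrable lborel (\<lambda>w. norm (Vf (U n w) (DU n w) w) powr p)" for n
  proof (rule Bochner_Integration.integrable_bound[OF integrable_mult_right[OF \<Gamma>Ui, of cV]])
    show "AE w in lborel. norm (norm (Vf (U n w) (DU n w) w) powr p) \<le> norm (cV * \<Gamma>U n w)"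
      using V_dom by (intro AE_I2) (simp add: order_trans[OF _ abs_ge_self])
  qed measurable
  define er where "er n = (\<integral>w. \<bar>If (U n w) (DU n w) (aU n w) w - If (u w) (D w) (a w) w\<bar> \<partial>lborel)" for n
  have er: "er \<longlonglongrightarrow> 0" using integral_tendsto_of_L1(1)[OF Ini Ii errI] by (simp add: er_def[abs_def])
  have er0: "0 \<le> er n" for n by (simp add: er_def)
  have ms: "mollified_solution \<rho> \<theta> u D a (e n) R S L1 L2 \<zeta> \<zeta>t D\<zeta>" for n
    using sol e R S cut by (auto simp: mollified_solution_def L1_def L2_def)
  have Im: "(\<lambda>w. indicator {..\<tau>} (snd w)) \<in> borel_measurable (borel :: ((real ^ 'n) \<times> real) measure)" for \<tau> :: real
    unfolding borel_prod[symmetric] by measurable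
  have ind: "integrable lborel (\<lambda>w. indicator {..\<tau>} (snd w) * f w)" if "integrable lborel f" for f :: "(real ^ 'n) \<times> real \<Rightarrow> real" and \<tau>
    using integrable_bounded_scaleR[OF that Im[of \<tau>], where M=1] by (simp add: indicator_le_1)
  have energy: "(\<integral>x. trunc_prim k d (U n (x, \<tau>)) * \<zeta> (x, \<tau>) ^ Suc m \<partial>lborel) + (\<Lambda>\<^sub>0 / 2) * (\<integral>w. indicator {..\<tau>} (snd w) * W w \<partial>lborel) \<le> C1 * E + er n" for n \<tau>
  proof -
    have "(\<integral>x. trunc_prim k d (U n (x, \<tau>)) * \<zeta> (x, \<tau>) ^ Suc m \<partial>lborel) = (\<integral>w. indicator {..\<tau>} (snd w) * If (U n w) (DU n w) (aU n w) w \<partial>lborel)"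
      using mollified_solution.energy_identity_mollify[OF ms[of n] has_real_derivative_trunc[OF d] continuous_on_trunc(1) has_real_derivative_trunc_prim[OF d], of k \<tau> m]
      by (simp only: If_def Vf_def M_def U_def DU_def aU_def)
    also have "\<dots> \<le> (\<integral>w. (C1 * ev w - (\<Lambda>\<^sub>0 / 2) * (indicator {..\<tau>} (snd w) * W w)) + \<bar>If (U n w) (DU n w) (aU n w) w - If (u w) (D w) (a w) w\<bar> \<partial>lborel)"
    proof (rule integral_mono_AE)
      show "integrable lborel (\<lambda>w. indicator {..\<tau>} (snd w) * If (U n w) (DU n w) (aU n w) w)" by (rule ind[OF Ini])
      show "integrable lborel (\<lambda>w. (C1 * ev w - (\<Lambda>\<^sub>0 / 2) * (indicator {..\<tau>} (snd w) * W w)) + \<bar>If (U n w) (DU n w) (aU n w) w - If (u w) (D w) (a w) w\<bar>)"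
        using ind[OF Wi, of \<tau>] evi Ini[of n] Ii by auto
      show "AE w in lborel. indicator {..\<tau>} (snd w) * If (U n w) (DU n w) (aU n w) w \<le> (C1 * ev w - (\<Lambda>\<^sub>0 / 2) * (indicator {..\<tau>} (snd w) * W w)) + \<bar>If (U n w) (DU n w) (aU n w) w - If (u w) (D w) (a w) w\<bar>"
        using dens
      proof eventually_elim
        case (elim w)
        have "0 \<le> C1 * ev w" using C1 ev0 by simp
        then show ?case using elim by (cases "snd w \<le> \<tau>") auto
      qed
    qed
    also have "\<dots> = C1 * (\<integral>w. ev w \<partial>lborel) - (\<Lambda>\<^sub>0 / 2) * (\<integral>w. indicator {..\<tau>} (snd w) * W w \<partial>lborel) + er n"
      using ind[OF Wi, of \<tau>] evi Ini[of n] Ii by (simp add: er_def)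
    also have "C1 * (\<integral>w. ev w \<partial>lborel) \<le> C1 * E" using evE' C1 by simp
    finally show ?thesis by simp
  qed
  have cU: "continuous_on UNIV (U n)" "continuous_on UNIV (DU n)" for n
  proof -
    obtain B where "\<And>w::(real ^ 'n) \<times> real. \<bar>st_kernel (e n) w\<bar> \<le> B" using mollifier_bounded[OF K] by blast
    then show "continuous_on UNIV (U n)" "continuous_on UNIV (DU n)"
      unfolding U_def DU_def using K[of n] by (auto intro!: mollify_continuous int simp: mollifier_def)
  qed
  have G_nonneg: "0 \<le> trunc_prim k d (U n w) * \<zeta> w ^ Suc m" for n w
    by (intro mult_nonneg_nonneg trunc_bounds(8) d z01)
  have Wind: "0 \<le> (\<integral>w. indicator {..\<tau>} (snd w) * W w \<partial>lborel)" for \<tau> :: real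
    by (intro integral_nonneg_AE AE_I2) (simp add: W0)
  have Gle: "(\<integral>x. trunc_prim k d (U n (x, \<tau>)) * \<zeta> (x, \<tau>) ^ Suc m \<partial>lborel) \<le> C1 * E + er n" for n \<tau>
    using energy[of n \<tau>] Wind[of \<tau>] L by (smt (verit) mult_nonneg_nonneg half_gt_zero)
  have WE: "(\<integral>w. W w \<partial>lborel) \<le> 2 / \<Lambda>\<^sub>0 * C1 * E"
  proof -
    have WS: "(\<lambda>w. indicator {..S} (snd w) * W w) = W"
    proof
      fix w show "indicator {..S} (snd w) * W w = W w"
      proof (cases "snd w \<le> S")
        case False
        then have "S \<le> \<bar>snd w\<bar>" by linarith
        then have "\<zeta> w = 0" using \<zeta>(8)[of w] by blast
        then show ?thesis by (simp add: W_def)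
      qed simp
    qed
    have G0: "0 \<le> (\<integral>x. trunc_prim k d (U n (x, S)) * \<zeta> (x, S) ^ Suc m \<partial>lborel)" for n
      by (intro integral_nonneg_AE AE_I2 G_nonneg)
    have "(\<Lambda>\<^sub>0 / 2) * (\<integral>w. W w \<partial>lborel) \<le> C1 * E + er n" for n
      using energy[of n S] G0[of n] unfolding WS by linarith
    then have "(\<Lambda>\<^sub>0 / 2) * (\<integral>w. W w \<partial>lborel) \<le> C1 * E + 0"
      by (intro LIMSEQ_le_const[OF tendsto_add[OF tendsto_const er]]) auto
    then show ?thesis using L by (simp add: field_simps)
  qed
  \<comment> \<open>the square of \<open>v\<close> is at most twice the energy since \<open>\<zeta> \<le> 1\<close>, and its gradient is \<open>Vf\<close>\<close>
  define v where "v n w = trunc k d (U n w) * \<zeta> w ^ Suc m" for n w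
  define \<omega> where "\<omega> = unit_ball_vol N"
  have \<omega>: "0 < \<omega>" using N by (simp add: \<omega>_def)
  define c where "c x = 2 * (2 / l) powr p * (8 * (2 * (C1 * E + x)) / (l\<^sup>2 * \<omega>)) powr (p / N)" for x
  have v0: "0 \<le> v n w" for n w
    unfolding v_def by (intro mult_nonneg_nonneg trunc_bounds(3) d z01)
  have vm[measurable]: "v n \<in> borel_measurable borel" for n unfolding v_def[abs_def] by measurable
  have sl: "continuous_on UNIV (\<lambda>x. f (x, t))" if "continuous_on UNIV f" for f :: "(real ^ 'n) \<times> real \<Rightarrow> 'b::topological_space" and t
    by (rule continuous_on_compose2[OF that]) (auto intro!: continuous_intros)
  have slice: "emeasure lborel {x. l < \<bar>v n (x, t)\<bar>} \<le> ennreal (c (er n)) * (\<integral>\<^sup>+x. ennreal (norm (Vf (U n (x, t)) (DU n (x, t)) (x, t)) powr p) \<partial>lborel)" for n t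
  proof -
    have cf: "continuous_on UNIV (\<lambda>w. trunc_prim k d (U n w) * \<zeta> w ^ Suc m)"
      by (intro continuous_intros \<zeta> continuous_on_compose2[OF continuous_on_trunc(3)[OF d] cU(1)]) auto
    have i: "integrable lborel (\<lambda>x. trunc_prim k d (U n (x, t)) * \<zeta> (x, t) ^ Suc m)"
      by (rule integrable_of_compact_support[OF sl[OF cf], of R]) (use \<zeta>(8)[of "(_, t)"] in auto)
    have A: "(\<integral>\<^sup>+x. ennreal ((v n (x, t))\<^sup>2) \<partial>lborel) \<le> ennreal (2 * (C1 * E + er n))"
    proof -
      have "(\<integral>\<^sup>+x. ennreal ((v n (x, t))\<^sup>2) \<partial>lborel) \<le> (\<integral>\<^sup>+x. ennreal (2 * (trunc_prim k d (U n (x, t)) * \<zeta> (x, t) ^ Suc m)) \<partial>lborel)"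
      proof (intro nn_integral_mono ennreal_leI)
        fix x
        have "(v n (x, t))\<^sup>2 = (trunc k d (U n (x, t)))\<^sup>2 * (\<zeta> (x, t) ^ Suc m * \<zeta> (x, t) ^ Suc m)"
          by (simp only: v_def power2_eq_square mult_ac)
        also have "\<dots> \<le> (2 * trunc_prim k d (U n (x, t))) * (\<zeta> (x, t) ^ Suc m * 1)"
          using z01[of "(x, t)" "Suc m"] trunc_bounds(5,8)[OF d, of k "U n (x, t)"] by (intro mult_mono mult_left_mono) auto
        finally show "(v n (x, t))\<^sup>2 \<le> 2 * (trunc_prim k d (U n (x, t)) * \<zeta> (x, t) ^ Suc m)" by simp
      qed
      also have "\<dots> = ennreal (\<integral>x. 2 * (trunc_prim k d (U n (x, t)) * \<zeta> (x, t) ^ Suc m) \<partial>lborel)"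
        using i G_nonneg[of n "(_, t)"] by (intro nn_integral_eq_integral) auto
      also have "\<dots> \<le> ennreal (2 * (C1 * E + er n))"
        using Gle[of n t] by (intro ennreal_leI) simp
      finally show ?thesis .
    qed
    have pos: "0 < 2 * (C1 * E + er n)" using C1 E er0[of n] by (simp add: add_pos_nonneg)
    have dv: "((\<lambda>x. v n (x, t)) has_derivative (\<lambda>h. Vf (U n (x, t)) (DU n (x, t)) (x, t) \<bullet> h)) (at x)" for x
      using mollified_solution.slice_has_derivative_mollify[OF ms[of n] has_real_derivative_trunc[OF d] continuous_on_trunc(1), of k t m x]
      by (simp only: Vf_def v_def M_def U_def DU_def)
    have cv: "continuous_on UNIV (\<lambda>w. Vf (U n w) (DU n w) w)"
      unfolding Vf_def by (intro continuous_intros \<zeta> cU continuous_on_compose2[OF continuous_on_trunc(1) cU(1)]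
          continuous_on_compose2[OF continuous_on_trunc(2)[OF d] cU(1)]) auto
    show ?thesis
      using weak_gagliardo_nirenberg[OF p(1) dv sl[OF cv] A pos l] by (simp add: c_def \<omega>_def N_def)
  qed
  define BV where "BV n = (\<integral>w. norm (Vf (U n w) (DU n w) w) powr p \<partial>lborel)" for n
  define BV0 where "BV0 = (\<integral>w. norm (Vf (u w) (D w) w) powr p \<partial>lborel)"
  have BV: "BV \<longlonglongrightarrow> BV0" using integral_tendsto_of_L1(2)[OF Vni Vi errV] by (simp add: BV_def[abs_def] BV0_def)
  have c0: "0 \<le> c x" for x by (simp add: c_def)
  have level: "emeasure lborel {w \<in> space lborel. l < v n w} \<le> ennreal (c (er n) * BV n)" for n
  proof -
    have "emeasure lborel {w \<in> space lborel. l < v n w} = (\<integral>\<^sup>+w. indicator {w \<in> space lborel. l < v n w} w \<partial>lborel)" by simp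
    also have "\<dots> = (\<integral>\<^sup>+t. (\<integral>\<^sup>+x. indicator {w \<in> space lborel. l < v n w} (x, t) \<partial>lborel) \<partial>lborel)"
      by (rule nn_integral_lborel_snd) measurable
    also have "\<dots> \<le> (\<integral>\<^sup>+t. ennreal (c (er n)) * (\<integral>\<^sup>+x. ennreal (norm (Vf (U n (x, t)) (DU n (x, t)) (x, t)) powr p) \<partial>lborel) \<partial>lborel)"
    proof (intro nn_integral_mono)
      fix t
      have [measurable]: "(\<lambda>x. v n (x, t)) \<in> borel_measurable borel"
        by (rule measurable_compose[OF _ vm]) (intro borel_measurable_continuous_onI continuous_intros)
      have "(\<integral>\<^sup>+x. indicator {w \<in> space lborel. l < v n w} (x, t) \<partial>lborel) = (\<integral>\<^sup>+x. indicator {x. l < \<bar>v n (x, t)\<bar>} x \<partial>lborel)"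
        using v0 by (intro nn_integral_cong) (simp add: indicator_def)
      also have "\<dots> = emeasure lborel {x. l < \<bar>v n (x, t)\<bar>}" by (rule nn_integral_indicator) measurable
      also note slice[of n t]
      finally show "(\<integral>\<^sup>+x. indicator {w \<in> space lborel. l < v n w} (x, t) \<partial>lborel) \<le> ennreal (c (er n)) * (\<integral>\<^sup>+x. ennreal (norm (Vf (U n (x, t)) (DU n (x, t)) (x, t)) powr p) \<partial>lborel)" .
    qed
    also have "\<dots> = ennreal (c (er n)) * (\<integral>\<^sup>+t. (\<integral>\<^sup>+x. ennreal (norm (Vf (U n (x, t)) (DU n (x, t)) (x, t)) powr p) \<partial>lborel) \<partial>lborel)"
    proof (rule nn_integral_cmult)
      have "(\<lambda>w. ennreal (norm (Vf (U n w) (DU n w) w) powr p)) \<in> borel_measurable (lborel \<Otimes>\<^sub>M lborel)"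
        unfolding lborel_prod by measurable
      from lborel.borel_measurable_nn_integral_fst[OF measurable_pair_swap[OF this]]
      show "(\<lambda>t. \<integral>\<^sup>+x. ennreal (norm (Vf (U n (x, t)) (DU n (x, t)) (x, t)) powr p) \<partial>lborel) \<in> borel_measurable lborel"
        by simp
    qed
    also have "(\<integral>\<^sup>+t. (\<integral>\<^sup>+x. ennreal (norm (Vf (U n (x, t)) (DU n (x, t)) (x, t)) powr p) \<partial>lborel) \<partial>lborel)
        = (\<integral>\<^sup>+w. ennreal (norm (Vf (U n w) (DU n w) w) powr p) \<partial>lborel)"
      by (rule nn_integral_lborel_snd[symmetric]) measurable
    also have "\<dots> = ennreal (BV n)" unfolding BV_def by (rule nn_integral_eq_integral[OF Vni]) simp
    finally show ?thesis using c0 by (simp add: ennreal_mult' ennreal_mult)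
  qed
  have lim_c: "(\<lambda>n. ennreal (c (er n) * BV n)) \<longlonglongrightarrow> ennreal (c 0 * BV0)"
  proof (intro tendsto_ennrealI tendsto_mult BV)
    show "(\<lambda>n. c (er n)) \<longlonglongrightarrow> c 0"
      unfolding c_def using p N C1 E \<omega> l
      by (intro tendsto_intros er tendsto_powr') (auto intro!: tendsto_eq_intros er)
  qed
  have lim_v: "AE w in lborel. (\<lambda>n. v n w) \<longlonglongrightarrow> trunc k d (u w) * \<zeta> w ^ Suc m"
    using lim(1,2) by eventually_elim (unfold v_def, intro tendsto_intros clim)
  have "emeasure lborel {w \<in> cylinder r s. l < trunc k d (u w)} \<le> emeasure lborel {w \<in> space lborel. l < trunc k d (u w) * \<zeta> w ^ Suc m}"
  proof (rule emeasure_mono)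
    show "{w \<in> cylinder r s. l < trunc k d (u w)} \<subseteq> {w \<in> space lborel. l < trunc k d (u w) * \<zeta> w ^ Suc m}"
    proof
      fix w assume w: "w \<in> {w \<in> cylinder r s. l < trunc k d (u w)}"
      then have "\<zeta> w = 1" using \<zeta>1[of w] cylinder_facts(3)[of "fst w" "snd w" r s] by simp
      then show "w \<in> {w \<in> space lborel. l < trunc k d (u w) * \<zeta> w ^ Suc m}" using w by simp
    qed
  qed measurable
  also have "\<dots> \<le> ennreal (c 0 * BV0)"
    by (rule emeasure_liminf_superlevel[OF _ _ lim_v level lim_c]) measurable
  also have "\<dots> \<le> ennreal (level_const CARD('n) m p \<Lambda>\<^sub>0 \<Lambda>\<^sub>1 * E powr (1 + p / CARD('n)) / l powr (p + 2 * p / CARD('n)))"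
  proof (rule ennreal_leI)
    define C2 where "C2 = 2 powr p * (2 / \<Lambda>\<^sub>0 * C1 + M powr p)"
    have "BV0 \<le> (\<integral>w. 2 powr p * (W w + M powr p * ev w) \<partial>lborel)"
      unfolding BV0_def
    proof (rule integral_mono[OF Vi])
      show "integrable lborel (\<lambda>w. 2 powr p * (W w + M powr p * ev w))" using Wi evi by auto
      fix w
      have "norm (Vf (u w) (D w) w) powr p \<le> 2 powr p * (W w + M powr p * (norm (D\<zeta> w) * max (u w - k) 0) powr p)"
        unfolding Vf_def W_def M_def
        by (rule truncation_gradient_powr_bound) (use p \<zeta>(4,5) trunc_bounds[OF d] trunc_le(1)[OF d k] in auto)
      also have "\<dots> \<le> 2 powr p * (W w + M powr p * ev w)"
      proof (intro mult_left_mono add_left_mono)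
        have "0 \<le> \<bar>\<zeta>t w\<bar> * (max (u w - k) 0)\<^sup>2" by simp
        then show "(norm (D\<zeta> w) * max (u w - k) 0) powr p \<le> ev w" using ev_ge[of w] by linarith
      qed auto
      finally show "norm (Vf (u w) (D w) w) powr p \<le> 2 powr p * (W w + M powr p * ev w)" .
    qed
    also have "\<dots> = 2 powr p * ((\<integral>w. W w \<partial>lborel) + M powr p * (\<integral>w. ev w \<partial>lborel))" using Wi evi by simp
    also have "\<dots> \<le> 2 powr p * (2 / \<Lambda>\<^sub>0 * C1 * E + M powr p * E)"
      by (intro mult_left_mono add_mono WE evE') auto
    finally have B: "BV0 \<le> C2 * E" by (simp add: C2_def algebra_simps)
    have le: "c 0 * BV0 \<le> c 0 * (C2 * E)" by (intro mult_left_mono B c0)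
    have c_eq: "c 0 = 2 * 2 powr p * (16 * C1 / \<omega>) powr (p / N) * (E powr (p / N) / (l powr p * l powr (2 * p / N)))"
    proof -
      have e1: "8 * (2 * (C1 * E + 0)) / (l\<^sup>2 * \<omega>) = (16 * C1 / \<omega>) * E / l powr 2" using l by (simp add: mult_ac)
      have pl: "(l powr 2) powr (p / N) = l powr (2 * p / N)"
        by (simp only: powr_powr times_divide_eq_right)
      have e2: "((16 * C1 / \<omega>) * E / l powr 2) powr (p / N) = (16 * C1 / \<omega>) powr (p / N) * E powr (p / N) / l powr (2 * p / N)"
        using C1 E(2) \<omega> l by (simp add: powr_mult powr_divide pl del: powr_numeral)
      have e3: "(2 / l) powr p = 2 powr p / l powr p" using l by (simp add: powr_divide)
      have "c 0 = 2 * (2 powr p / l powr p) * ((16 * C1 / \<omega>) powr (p / N) * E powr (p / N) / l powr (2 * p / N))"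
        unfolding c_def by (simp only: e1 e2 e3)
      then show ?thesis by (simp add: field_simps)
    qed
    have "c 0 * (C2 * E)
        = level_const CARD('n) m p \<Lambda>\<^sub>0 \<Lambda>\<^sub>1 * E powr (1 + p / CARD('n)) / l powr (p + 2 * p / CARD('n))"
    proof -
      have "E powr (1 + p / N) = E powr (p / N) * E" using E by (simp add: powr_add)
      moreover have "l powr (p + 2 * p / N) = l powr p * l powr (2 * p / N)" by (simp add: powr_add)
      moreover have "level_const CARD('n) m p \<Lambda>\<^sub>0 \<Lambda>\<^sub>1 = 2 * 2 powr p * (16 * C1 / \<omega>) powr (p / N) * C2"
        by (simp add: level_const_def C1_def \<omega>_def N_def C2_def M_def)
      ultimately show ?thesis unfolding c_eq by (simp add: N_def mult_ac)
    qed
    with le show "c 0 * BV0 \<le> level_const CARD('n) m p \<Lambda>\<^sub>0 \<Lambda>\<^sub>1 * E powr (1 + p / CARD('n)) / l powr (p + 2 * p / CARD('n))" by (rule ord_le_eq_trans)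
  qed
  finally show ?thesis .
qed

section \<open>One step of the iteration\<close>

text \<open>The levels above \<open>l = (W / m) powr (1 / q)\<close> are decomposed dyadically and summed as a geometric
  series, which converges since \<open>r < q\<close>; below \<open>l\<close> only the measure of the support is used. The choice
  of \<open>l\<close> balances the two contributions.\<close>

lemma powr_integral_of_weak_type:
  fixes f :: "'a \<Rightarrow> real"
  assumes [measurable]: "f \<in> borel_measurable M" and f0: "\<And>x. 0 \<le> f x"
    and r: "0 < r" "r < q" and pos: "0 < m" "0 < W"
    and supp: "emeasure M {x\<in>space M. 0 < f x} \<le> ennreal m"
    and weak: "\<And>l. 0 < l \<Longrightarrow> emeasure M {x\<in>space M. l < f x} \<le> ennreal (W / l powr q)"
  shows "(\<integral>\<^sup>+x. ennreal (f x powr r) \<partial>M) \<le> ennreal ((1 + 2 powr r / (1 - 2 powr (r - q))) * m powr (1 - r / q) * W powr (r / q))"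
proof -
  \<comment> \<open>at this level the trivial and the weak type bound for the measure agree\<close>
  define l where "l = (W / m) powr (1 / q)"
  have l: "0 < l" using pos by (simp add: l_def)
  have q: "0 < q" using r by simp
  have g: "0 < 2 powr (r - q)" "2 powr (r - q) < (1::real)" using r by (auto simp: powr_less_one)
  have pt: "ennreal (f x powr r) \<le> ennreal (l powr r) * indicator {x\<in>space M. 0 < f x} x +
      (\<Sum>j. ennreal ((2 ^ Suc j * l) powr r) * indicator {x\<in>space M. 2 ^ j * l < f x} x)" if x: "x \<in> space M" for x
  proof (cases "f x \<le> l")
    case True
    then have "ennreal (f x powr r) \<le> ennreal (l powr r) * indicator {x\<in>space M. 0 < f x} x"
      using f0[of x] r x by (cases "f x = 0") (auto intro!: ennreal_leI powr_mono2)
    then show ?thesis by (rule order_trans) simp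
  next
    case False
    define P where "P j \<longleftrightarrow> f x \<le> 2 ^ Suc j * l" for j :: nat
    obtain i where "f x / l < 2 ^ i" using real_arch_pow[of 2 "f x / l"] by auto
    then have "f x < 2 ^ i * l" using l by (simp add: divide_less_eq)
    also have "\<dots> \<le> 2 ^ Suc i * l" using l by simp
    finally have "P i" by (simp add: P_def)
    define j where "j = (LEAST j. P j)"
    have Pj: "P j" unfolding j_def by (rule LeastI[of P i]) fact
    have lj: "2 ^ j * l < f x"
    proof (cases j)
      case 0 then show ?thesis using False by simp
    next
      case (Suc j')
      then have "\<not> P j'" using not_less_Least[of j' P] by (simp add: j_def)
      then show ?thesis using Suc by (simp add: P_def)
    qed
    have "ennreal (f x powr r) \<le> ennreal ((2 ^ Suc j * l) powr r) * indicator {x\<in>space M. 2 ^ j * l < f x} x"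
      using Pj lj x f0[of x] r by (auto simp: P_def intro!: ennreal_leI powr_mono2)
    also have "\<dots> \<le> (\<Sum>j. ennreal ((2 ^ Suc j * l) powr r) * indicator {x\<in>space M. 2 ^ j * l < f x} x)"
    proof -
      have "F j \<le> (\<Sum>j. F j)" for F :: "nat \<Rightarrow> ennreal" using sum_le_suminf[of F "{j}"] by simp
      then show ?thesis .
    qed
    finally show ?thesis by (rule order_trans) simp
  qed
  have "(\<integral>\<^sup>+x. ennreal (f x powr r) \<partial>M) \<le> (\<integral>\<^sup>+x. ennreal (l powr r) * indicator {x\<in>space M. 0 < f x} x +
      (\<Sum>j. ennreal ((2 ^ Suc j * l) powr r) * indicator {x\<in>space M. 2 ^ j * l < f x} x) \<partial>M)"
    by (intro nn_integral_mono pt)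
  also have "\<dots> = ennreal (l powr r) * emeasure M {x\<in>space M. 0 < f x} +
      (\<Sum>j. ennreal ((2 ^ Suc j * l) powr r) * emeasure M {x\<in>space M. 2 ^ j * l < f x})"
    by (subst nn_integral_add, measurable, subst nn_integral_suminf, measurable) (simp add: nn_integral_cmult_indicator)
  also have "\<dots> \<le> ennreal (l powr r) * ennreal m + (\<Sum>j. ennreal (2 powr r * (l powr (r - q) * W) * (2 powr (r - q)) ^ j))"
  proof (intro add_mono mult_left_mono supp suminf_le)
    fix j
    have "ennreal ((2 ^ Suc j * l) powr r) * emeasure M {x\<in>space M. 2 ^ j * l < f x} \<le> ennreal ((2 ^ Suc j * l) powr r) * ennreal (W / (2 ^ j * l) powr q)"
      using l by (intro mult_left_mono weak) auto
    also have "\<dots> = ennreal ((2 ^ Suc j * l) powr r * (W / (2 ^ j * l) powr q))"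
      by (rule ennreal_mult[symmetric]) (use pos in auto)
    also have "(2 ^ Suc j * l) powr r * (W / (2 ^ j * l) powr q) = 2 powr r * (l powr (r - q) * W) * (2 powr (r - q)) ^ j"
    proof -
      have e1: "(2 ^ Suc j * l) powr r = 2 powr r * ((2 ^ j * l) powr r)" using l by (simp add: powr_mult mult.assoc)
      have e2: "(2 ^ j * l) powr r / (2 ^ j * l) powr q = (2 ^ j * l) powr (r - q)" by (simp add: powr_diff)
      have e3: "(2 ^ j * l) powr (r - q) = (2 powr (r - q)) ^ j * l powr (r - q)"
        using l by (simp add: powr_mult powr_powr powr_realpow[symmetric] mult.commute)
      have "(2 ^ Suc j * l) powr r * (W / (2 ^ j * l) powr q) = (2 powr r * W) * ((2 ^ j * l) powr r / (2 ^ j * l) powr q)"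
        unfolding e1 by simp
      then show ?thesis unfolding e2 e3 by (simp only: mult_ac)
    qed
    finally show "ennreal ((2 ^ Suc j * l) powr r) * emeasure M {x\<in>space M. 2 ^ j * l < f x} \<le> ennreal (2 powr r * (l powr (r - q) * W) * (2 powr (r - q)) ^ j)" .
  qed auto
  also have "(\<Sum>j. ennreal (2 powr r * (l powr (r - q) * W) * (2 powr (r - q)) ^ j)) = ennreal (2 powr r * (l powr (r - q) * W) * (1 / (1 - 2 powr (r - q))))"
  proof (rule suminf_ennreal_eq)
    show "(\<lambda>j. 2 powr r * (l powr (r - q) * W) * (2 powr (r - q)) ^ j) sums (2 powr r * (l powr (r - q) * W) * (1 / (1 - 2 powr (r - q))))"
      using g by (intro sums_mult geometric_sums) auto
  qed (use pos in auto)
  also have "ennreal (l powr r) * ennreal m + \<dots> = ennreal (l powr r * m + 2 powr r * (l powr (r - q) * W) * (1 / (1 - 2 powr (r - q))))"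
    using pos g by (simp add: ennreal_mult[symmetric] ennreal_plus[symmetric] del: ennreal_plus)
  also have "l powr r * m + 2 powr r * (l powr (r - q) * W) * (1 / (1 - 2 powr (r - q))) = (1 + 2 powr r / (1 - 2 powr (r - q))) * m powr (1 - r / q) * W powr (r / q)"
  proof -
    have mr: "m powr (1 - r / q) = m / m powr (r / q)" using pos by (simp add: powr_diff)
    have 1: "l powr r * m = m powr (1 - r / q) * W powr (r / q)"
      using pos q unfolding mr by (simp add: l_def powr_powr powr_divide)
    have "l powr (r - q) * W = (W / m) powr (r / q) * m"
    proof -
      have "l powr (r - q) = (W / m) powr (r / q - 1)" using q by (simp add: l_def powr_powr diff_divide_distrib)
      also have "\<dots> = (W / m) powr (r / q) / (W / m)" using pos by (simp add: powr_diff)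
      finally show ?thesis using pos by simp
    qed
    then have 2: "l powr (r - q) * W = m powr (1 - r / q) * W powr (r / q)"
      using pos unfolding mr by (simp add: powr_divide)
    show ?thesis unfolding 1 2 by (simp add: algebra_simps)
  qed
  finally show ?thesis .
qed

definition iter_const :: "nat \<Rightarrow> nat \<Rightarrow> real \<Rightarrow> real \<Rightarrow> real \<Rightarrow> real" where
  "iter_const N m p \<Lambda>\<^sub>0 \<Lambda>\<^sub>1 =
    (let r = p + 4 / (real N + 2); q = p + 2 * p / real N; \<beta> = r / (real N + 2) in
      (1 + 2 powr r / (1 - 2 powr (r - q))) * level_const N m p \<Lambda>\<^sub>0 \<Lambda>\<^sub>1 powr (r / q)
        * (4 powr p) powr ((1 + p / real N) * (r / q)) * 4 powr (r * (1 + \<beta>)))"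

lemma level_const_pos: "0 < N \<Longrightarrow> 0 < \<Lambda>\<^sub>0 \<Longrightarrow> 0 < \<Lambda>\<^sub>1 \<Longrightarrow> 0 < level_const N m p \<Lambda>\<^sub>0 \<Lambda>\<^sub>1"
proof -
  assume "0 < N" and L: "0 < \<Lambda>\<^sub>0" "0 < \<Lambda>\<^sub>1"
  have "unit_ball_vol (real N) \<noteq> 0" using unit_ball_vol_pos[of "real N"] by linarith
  moreover have "0 < energy_const m p \<Lambda>\<^sub>0 \<Lambda>\<^sub>1" using L by (intro energy_const_pos) auto
  ultimately show ?thesis using L unfolding level_const_def by (intro mult_pos_pos add_pos_pos) auto
qed

text \<open>The number \<open>\<beta>\<close> is the gain in the exponent in one step. The last but one identity determines the
  power of the level \<open>k\<close> that is gained at the same time.\<close>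

lemma iteration_exponents:
  fixes N p :: real
  assumes N: "1 \<le> N" and p: "1 < p" "2 * N / (N + 2) < p"
    and r: "r = p + 4 / (N + 2)" and q: "q = p + 2 * p / N" and \<beta>: "\<beta> = r / (N + 2)"
  shows "2 < r" "p < r" "r < q" "0 < \<beta>" "(1 + p / N) * (r / q) = \<beta> * ((N + p) / p)"
    "1 - r / q + (1 + p / N) * (r / q) = 1 + \<beta>"
    "r * (1 - r / q) = \<beta> * (2 * (p * (N + 2) - 2 * N) / (p * (N + 2)))" "0 < p * (N + 2) - 2 * N"
proof -
  define K where "K = N + 2"
  have K: "0 < K" "K - N = 2" using N by (auto simp: K_def)
  have N0: "0 < N" and p0: "0 < p" using N p by auto
  have d: "2 * N < p * K" using p(2) K by (simp add: pos_divide_less_eq K_def)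
  then show "0 < p * (N + 2) - 2 * N" by (simp add: K_def)
  have r': "r = p + 4 / K" and \<beta>': "\<beta> = r / K" by (simp_all add: r \<beta> K_def)
  have rK: "r * K = p * K + 4" using K by (simp add: r' field_simps)
  have q': "q = p * K / N" using N0 by (simp add: q K_def field_simps)
  show "2 < r"
  proof (rule mult_right_less_imp_less[where c=K])
    have "2 * K = 2 * N + 4" by (simp add: K_def)
    then show "2 * K < r * K" unfolding rK using d by linarith
  qed (use K in simp)
  show pr: "p < r" using K by (simp add: r')
  then show "0 < \<beta>" using K p0 by (simp add: \<beta>')
  show "r < q"
  proof -
    have "4 * N < 2 * p * K" using d by (simp only: mult.assoc)
    then have "4 / K < 2 * p / N" using N0 K by (simp add: field_simps)
    then show ?thesis by (simp add: r' q)
  qed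
  have rq: "r / q = r * N / (p * K)" unfolding q' by simp
  show 1: "(1 + p / N) * (r / q) = \<beta> * ((N + p) / p)"
    unfolding rq \<beta>' using N0 p0 K(1) by (simp add: field_simps)
  have \<beta>2: "\<beta> * ((N + p) / p) = r / q + \<beta>" unfolding rq \<beta>' using N0 p0 K(1) by (simp add: field_simps)
  show "1 - r / q + (1 + p / N) * (r / q) = 1 + \<beta>" unfolding 1 \<beta>2 by simp
  have "(p * K - r * N) * K = p * K * K - (r * K) * N" by (simp add: algebra_simps)
  also have "\<dots> = p * K * (K - N) - 4 * N" unfolding rK by (simp add: algebra_simps)
  also have "\<dots> = 2 * (p * K - 2 * N)" unfolding K(2) by simp
  finally have "p * K - r * N = 2 * (p * K - 2 * N) / K" using K(1) by (simp add: field_simps)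
  moreover have "1 - r / q = (p * K - r * N) / (p * K)" unfolding rq using p0 K(1) by (simp add: field_simps)
  ultimately have "r * (1 - r / q) = r * (2 * (p * K - 2 * N) / K / (p * K))" by simp
  then show "r * (1 - r / q) = \<beta> * (2 * (p * (N + 2) - 2 * N) / (p * (N + 2)))"
    unfolding \<beta>' K_def[symmetric] by simp
qed

lemma level_power_le:
  fixes t b r s :: real
  assumes "0 < b" "1 / b \<le> t" "s \<le> r" shows "t powr s \<le> b powr (r - s) * t powr r"
proof -
  have t: "0 < t" using assms by (smt (verit) divide_pos_pos)
  have "1 \<le> b * t" using assms by (simp add: divide_le_eq mult.commute)
  then have "1 powr (r - s) \<le> (b * t) powr (r - s)" using assms by (intro powr_mono2) auto
  also have "\<dots> = b powr (r - s) * t powr (r - s)" using assms t by (simp add: powr_mult)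
  finally have "t powr s * 1 \<le> t powr s * (b powr (r - s) * t powr (r - s))" by (intro mult_left_mono) auto
  also have "\<dots> = b powr (r - s) * t powr r" by (simp add: powr_add[symmetric] mult.left_commute)
  finally show ?thesis by simp
qed

text \<open>The gap between the levels is split in the middle by \<open>\<kappa>\<close>. Above \<open>\<kappa>\<close> the difference \<open>u - k0\<close> is at
  least \<open>k / b\<close>. As \<open>k \<ge> 1\<close>, powers of it below \<open>r\<close> can be raised to \<open>r\<close>, which bounds the energy, and
  Chebyshev's inequality bounds the measure of the set where \<open>u > \<kappa>\<close>, which contributes the negative
  power of \<open>k\<close>. The upper half of the gap is the transition zone of the differentiable truncation.
  The cylinders are halved in the same way, to keep the cutoff strictly inside the larger one.\<close>

proposition de_giorgi_step:
  fixes u :: "(real ^ 'n::finite) \<times> real \<Rightarrow> real" and D a :: "(real ^ 'n) \<times> real \<Rightarrow> real ^ 'n"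
  assumes sol: "local_solution \<rho> \<theta> u D a"
    and p: "1 < p" "2 * real CARD('n) / (real CARD('n) + 2) < p" "p \<le> real (Suc m)" and L: "0 < \<Lambda>\<^sub>0" "0 < \<Lambda>\<^sub>1"
    and str: "AE w in lborel. \<Lambda>\<^sub>0 * norm (D w) powr p \<le> a w \<bullet> D w \<and> norm (a w) \<le> \<Lambda>\<^sub>1 * norm (D w) powr (p - 1)"
    and Dp: "integrable lborel (\<lambda>w. norm (D w) powr p)"
    and up: "integrable lborel (\<lambda>w. \<bar>u w\<bar> powr p)" and u2: "integrable lborel (\<lambda>w. \<bar>u w\<bar> powr 2)"
    and r: "r = p + 4 / (real CARD('n) + 2)" and \<beta>: "\<beta> = r / (real CARD('n) + 2)"
    and pos: "0 < \<rho>" "0 < \<theta>" "0 < \<sigma>" "\<sigma> < 1" and k: "1 \<le> k"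
    and rad: "0 < R1" "R1 < R0" "R0 \<le> \<rho>" "R0 - R1 = (1 - \<sigma>) * \<rho> * 2 / b" "0 < S1" "S1 < S0" "S0 \<le> \<theta>" "S0 - S1 = (1 - \<sigma>) * \<theta> * 2 / b"
    and b: "1 \<le> b" and lev: "0 \<le> k0" "k1 - k0 = 2 * k / b"
    and Y: "(\<integral>\<^sup>+w. ennreal (indicator (cylinder R0 S0) w * (max (u w - k0) 0) powr r) \<partial>lborel) \<le> ennreal Y" "0 < Y"
  shows "(\<integral>\<^sup>+w. ennreal (indicator (cylinder R1 S1) w * (max (u w - k1) 0) powr r) \<partial>lborel)
    \<le> ennreal (iter_const CARD('n) m p \<Lambda>\<^sub>0 \<Lambda>\<^sub>1 * (b / 4) powr (r * (1 + \<beta>)) *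
        (k powr (- \<beta> * (2 * (p * (real CARD('n) + 2) - 2 * real CARD('n)) / (p * (real CARD('n) + 2))))
          * ((1 - \<sigma>) powr (- p) * (\<rho> powr (- p) + 1 / \<theta>)) powr (\<beta> * ((real CARD('n) + p) / p))) * Y powr (1 + \<beta>))"
proof -
  define N where "N = real CARD('n)"
  have N: "1 \<le> N" by (simp add: N_def Suc_leI)
  define q where "q = p + 2 * p / N"
  note ex = iteration_exponents[OF N p(1) p(2)[folded N_def] r[folded N_def] q_def \<beta>[folded N_def]]
  have [measurable]: "u \<in> borel_measurable borel" using sol by (auto simp: local_solution_def)
  have cyl[measurable]: "(cylinder x y :: ((real ^ 'n) \<times> real) set) \<in> sets borel" for x y by (rule cylinder_facts)
  define R where "R = (R0 + R1) / 2"
  define S where "S = (S0 + S1) / 2"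
  have RR: "R1 < R" "R < R0" "R - R1 = (1 - \<sigma>) * \<rho> / b" and SS: "S1 < S" "S < S0" "S - S1 = (1 - \<sigma>) * \<theta> / b"
  proof -
    have h: "R - R1 = (R0 - R1) / 2" "R0 - R = (R0 - R1) / 2" "S - S1 = (S0 - S1) / 2" "S0 - S = (S0 - S1) / 2"
      by (simp_all add: R_def S_def field_simps)
    show "R1 < R" "R < R0" "S1 < S" "S < S0" using h rad(2,6) by linarith+
    show "R - R1 = (1 - \<sigma>) * \<rho> / b" "S - S1 = (1 - \<sigma>) * \<theta> / b" unfolding h rad(4,8) by simp_all
  qed
  define d where "d = k / b"
  have d: "0 < d" "1 / b \<le> d" using k b by (auto simp: d_def divide_right_mono)
  define \<kappa> where "\<kappa> = k0 + d"
  have \<kappa>: "0 \<le> \<kappa>" "\<kappa> + d = k1" using lev d by (auto simp: \<kappa>_def d_def)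
  define H where "H = (1 - \<sigma>) powr (- p) * (\<rho> powr (- p) + 1 / \<theta>)"
  have H: "0 < H" using pos by (simp add: H_def add_pos_pos)
  define E where "E = 4 powr p * b powr r * H * Y"
  have E0: "0 < E" using H Y b by (simp add: E_def)
  have sub: "w \<in> cylinder R S \<Longrightarrow> w \<in> cylinder R0 S0" for w :: "(real ^ 'n) \<times> real"
    using RR SS cylinder_facts(3)[of "fst w" "snd w" R S] cylinder_facts(3)[of "fst w" "snd w" R0 S0] by simp
  have sub1: "w \<in> cylinder R1 S1 \<Longrightarrow> w \<in> cylinder R0 S0" for w :: "(real ^ 'n) \<times> real"
    using rad cylinder_facts(3)[of "fst w" "snd w" R1 S1] cylinder_facts(3)[of "fst w" "snd w" R0 S0] by simp
  \<comment> \<open>above the intermediate level all lower powers are controlled by the power \<open>r\<close> of the lower truncation\<close>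
  have lower_power: "(max (x - \<kappa>) 0) powr s \<le> b powr (r - s) * (max (x - k0) 0) powr r" if s: "0 < s" "s \<le> r" for x s
  proof (cases "\<kappa> < x")
    case True
    then have "1 / b \<le> x - k0" using d by (simp add: \<kappa>_def)
    then have "(x - k0) powr s \<le> b powr (r - s) * (x - k0) powr r" using b s by (intro level_power_le) auto
    moreover have "(x - \<kappa>) powr s \<le> (x - k0) powr s" using True d s by (intro powr_mono2) (auto simp: \<kappa>_def)
    moreover have "max (x - \<kappa>) 0 = x - \<kappa>" "max (x - k0) 0 = x - k0" using True d by (auto simp: \<kappa>_def)
    ultimately show ?thesis by simp
  qed (use s in simp)
  have EE: "(\<integral>\<^sup>+w. ennreal (indicator (cylinder R S) w * ((4 / (R - R1) * max (u w - \<kappa>) 0) powr p + 4 / (S - S1) * (max (u w - \<kappa>) 0)\<^sup>2)) \<partial>lborel) \<le> ennreal E"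
  proof -
    have c1: "(4 / (R - R1)) powr p = 4 powr p * b powr p * ((1 - \<sigma>) powr (- p) * \<rho> powr (- p))"
    proof -
      have "4 / (R - R1) = 4 * b * (1 / (1 - \<sigma>) * (1 / \<rho>))" by (simp add: RR(3))
      then show ?thesis by (simp add: powr_mult powr_divide powr_minus_divide)
    qed
    have c2: "4 / (S - S1) \<le> 4 powr p * b * ((1 - \<sigma>) powr (- p) * (1 / \<theta>))"
    proof -
      have "4 / (S - S1) = 4 powr 1 * b * ((1 - \<sigma>) powr (- 1) * (1 / \<theta>))"
        using pos b by (simp add: SS(3) powr_minus divide_inverse mult_ac)
      also have "\<dots> \<le> 4 powr p * b * ((1 - \<sigma>) powr (- p) * (1 / \<theta>))"
        using p pos b by (intro mult_mono powr_mono powr_mono') auto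
      finally show ?thesis .
    qed
    have "indicator (cylinder R S) w * ((4 / (R - R1) * max (u w - \<kappa>) 0) powr p + 4 / (S - S1) * (max (u w - \<kappa>) 0)\<^sup>2)
      \<le> (4 powr p * b powr r * H) * (indicator (cylinder R0 S0) w * (max (u w - k0) 0) powr r)" for w
    proof (cases "w \<in> cylinder R S")
      case True
      have "(4 / (R - R1) * max (u w - \<kappa>) 0) powr p = (4 / (R - R1)) powr p * (max (u w - \<kappa>) 0) powr p"
        by (rule powr_mult)
      also have "\<dots> \<le> (4 powr p * b powr p * ((1 - \<sigma>) powr (- p) * \<rho> powr (- p))) * (b powr (r - p) * (max (u w - k0) 0) powr r)"
        unfolding c1 using p ex by (intro mult_left_mono lower_power) auto
      also have "\<dots> = 4 powr p * b powr r * ((1 - \<sigma>) powr (- p) * \<rho> powr (- p)) * (max (u w - k0) 0) powr r"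
        by (simp add: powr_add[symmetric] mult_ac)
      finally have 1: "(4 / (R - R1) * max (u w - \<kappa>) 0) powr p \<le> 4 powr p * b powr r * ((1 - \<sigma>) powr (- p) * \<rho> powr (- p)) * (max (u w - k0) 0) powr r" .
      have "4 / (S - S1) * (max (u w - \<kappa>) 0)\<^sup>2 = 4 / (S - S1) * (max (u w - \<kappa>) 0) powr 2" by simp
      also have "\<dots> \<le> (4 powr p * b * ((1 - \<sigma>) powr (- p) * (1 / \<theta>))) * (b powr (r - 2) * (max (u w - k0) 0) powr r)"
        using ex SS pos b by (intro mult_mono c2 lower_power) auto
      also have "\<dots> = 4 powr p * (b powr 1 * b powr (r - 2)) * ((1 - \<sigma>) powr (- p) * (1 / \<theta>)) * (max (u w - k0) 0) powr r"
        using b by (simp add: mult_ac)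
      also have "\<dots> \<le> 4 powr p * b powr r * ((1 - \<sigma>) powr (- p) * (1 / \<theta>)) * (max (u w - k0) 0) powr r"
      proof (intro mult_right_mono mult_left_mono)
        have "b powr 1 * b powr (r - 2) = b powr (r - 1)" unfolding powr_add[symmetric] by simp
        also have "\<dots> \<le> b powr r" using b by (intro powr_mono) auto
        finally show "b powr 1 * b powr (r - 2) \<le> b powr r" .
      qed (use pos in auto)
      finally have 2: "4 / (S - S1) * (max (u w - \<kappa>) 0)\<^sup>2 \<le> 4 powr p * b powr r * ((1 - \<sigma>) powr (- p) * (1 / \<theta>)) * (max (u w - k0) 0) powr r" .
      have "(4 / (R - R1) * max (u w - \<kappa>) 0) powr p + 4 / (S - S1) * (max (u w - \<kappa>) 0)\<^sup>2 \<le> (4 powr p * b powr r * H) * (max (u w - k0) 0) powr r"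
        using add_mono[OF 1 2] by (simp add: H_def algebra_simps)
      then show ?thesis using True sub[OF True] by simp
    next
      case False
      then show ?thesis using H b by simp
    qed
    then have "(\<integral>\<^sup>+w. ennreal (indicator (cylinder R S) w * ((4 / (R - R1) * max (u w - \<kappa>) 0) powr p + 4 / (S - S1) * (max (u w - \<kappa>) 0)\<^sup>2)) \<partial>lborel)
      \<le> (\<integral>\<^sup>+w. ennreal (4 powr p * b powr r * H) * ennreal (indicator (cylinder R0 S0) w * (max (u w - k0) 0) powr r) \<partial>lborel)"
      using H b by (intro nn_integral_mono) (simp add: ennreal_mult[symmetric] ennreal_leI)
    also have "\<dots> = ennreal (4 powr p * b powr r * H) * (\<integral>\<^sup>+w. ennreal (indicator (cylinder R0 S0) w * (max (u w - k0) 0) powr r) \<partial>lborel)"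
      by (rule nn_integral_cmult) measurable
    also have "\<dots> \<le> ennreal (4 powr p * b powr r * H) * ennreal Y" by (intro mult_left_mono Y) auto
    also have "\<dots> = ennreal E" using H Y b by (simp add: E_def ennreal_mult)
    finally show ?thesis .
  qed
  define W where "W = level_const CARD('n) m p \<Lambda>\<^sub>0 \<Lambda>\<^sub>1 * E powr (1 + p / N)"
  have LC: "0 < level_const CARD('n) m p \<Lambda>\<^sub>0 \<Lambda>\<^sub>1" using L by (intro level_const_pos) auto
  have W0: "0 < W" using LC E0 by (simp add: W_def)
  define f where "f w = indicator (cylinder R1 S1) w * trunc \<kappa> d (u w)" for w
  have [measurable]: "trunc \<kappa> d \<in> borel_measurable borel"
    using d by (auto intro!: borel_measurable_continuous_onI continuous_on_trunc)
  have fm[measurable]: "f \<in> borel_measurable borel" unfolding f_def[abs_def] by measurable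
  have f0: "0 \<le> f w" for w using trunc_bounds(3)[OF d(1)] by (simp add: f_def)
  have weak: "emeasure lborel {w \<in> space lborel. l < f w} \<le> ennreal (W / l powr q)" if l: "0 < l" for l
  proof -
    have "{w \<in> space lborel. l < f w} = {w \<in> cylinder R1 S1. l < trunc \<kappa> d (u w)}"
      using l by (auto simp: f_def indicator_def split: if_splits)
    then show ?thesis
      using level_set_estimate[OF sol p(1,3) L str Dp up u2 \<kappa>(1) d(1) rad(1) RR(1) _ rad(5) SS(1) _ EE E0 l] RR SS rad
      by (simp add: W_def q_def N_def)
  qed
  define \<mu> where "\<mu> = (b / k) powr r * Y"
  have \<mu>: "0 < \<mu>" using b k Y by (simp add: \<mu>_def)
  have supp: "emeasure lborel {w \<in> space lborel. 0 < f w} \<le> ennreal \<mu>"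
  proof -
    have "emeasure lborel {w \<in> space lborel. 0 < f w} = (\<integral>\<^sup>+w. indicator {w \<in> space lborel. 0 < f w} w \<partial>lborel)" by simp
    also have "\<dots> \<le> (\<integral>\<^sup>+w. ennreal ((b / k) powr r) * ennreal (indicator (cylinder R0 S0) w * (max (u w - k0) 0) powr r) \<partial>lborel)"
    proof (intro nn_integral_mono)
      fix w
      show "indicator {w \<in> space lborel. 0 < f w} w \<le> ennreal ((b / k) powr r) * ennreal (indicator (cylinder R0 S0) w * (max (u w - k0) 0) powr r)"
      proof (cases "0 < f w")
        case True
        then have w: "w \<in> cylinder R1 S1" "0 < trunc \<kappa> d (u w)" using f0 by (cases "w \<in> cylinder R1 S1"; simp add: f_def)+
        have "0 < max (u w - \<kappa>) 0" using w(2) trunc_le(1)[OF d(1) \<kappa>(1), of "u w"] by linarith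
        then have "d \<le> max (u w - k0) 0" by (auto simp: \<kappa>_def)
        then have "d powr r \<le> (max (u w - k0) 0) powr r" using d ex by (intro powr_mono2) auto
        then have "(b / k) powr r * d powr r \<le> (b / k) powr r * (max (u w - k0) 0) powr r" by (intro mult_left_mono) auto
        moreover have "(b / k) powr r * d powr r = 1" using b k by (simp add: d_def powr_divide)
        ultimately have "ennreal 1 \<le> ennreal ((b / k) powr r * (max (u w - k0) 0) powr r)" by (intro ennreal_leI) simp
        then show ?thesis using sub1[OF w(1)] by (simp add: ennreal_mult indicator_def)
      qed simp
    qed
    also have "\<dots> = ennreal ((b / k) powr r) * (\<integral>\<^sup>+w. ennreal (indicator (cylinder R0 S0) w * (max (u w - k0) 0) powr r) \<partial>lborel)"
      by (rule nn_integral_cmult) measurable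
    also have "\<dots> \<le> ennreal ((b / k) powr r) * ennreal Y" by (intro mult_left_mono Y) auto
    also have "\<dots> = ennreal \<mu>" using Y by (simp add: \<mu>_def ennreal_mult)
    finally show ?thesis .
  qed
  have "(\<integral>\<^sup>+w. ennreal (indicator (cylinder R1 S1) w * (max (u w - k1) 0) powr r) \<partial>lborel) \<le> (\<integral>\<^sup>+w. ennreal (f w powr r) \<partial>lborel)"
  proof (intro nn_integral_mono ennreal_leI)
    fix w
    show "indicator (cylinder R1 S1) w * (max (u w - k1) 0) powr r \<le> f w powr r"
    proof (cases "w \<in> cylinder R1 S1")
      case True
      have "max (u w - k1) 0 \<le> f w" using trunc_bounds(3)[OF d(1), of \<kappa> "u w"] trunc_bounds(7)[OF d(1), of "u w" \<kappa>] True \<kappa> by (simp add: f_def)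
      then show ?thesis using True ex by (simp add: powr_mono2)
    qed simp
  qed
  also have "\<dots> \<le> ennreal ((1 + 2 powr r / (1 - 2 powr (r - q))) * \<mu> powr (1 - r / q) * W powr (r / q))"
    by (rule powr_integral_of_weak_type[OF _ f0 _ ex(3) \<mu> W0 supp weak]) (use ex in auto)
  also have "(1 + 2 powr r / (1 - 2 powr (r - q))) * \<mu> powr (1 - r / q) * W powr (r / q)
     = iter_const CARD('n) m p \<Lambda>\<^sub>0 \<Lambda>\<^sub>1 * (b / 4) powr (r * (1 + \<beta>)) *
        (k powr (- \<beta> * (2 * (p * (N + 2) - 2 * N) / (p * (N + 2)))) * H powr (\<beta> * ((N + p) / p))) * Y powr (1 + \<beta>)"
  proof -
    define \<gamma> where "\<gamma> = (1 + p / N) * (r / q)"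
    have 1: "\<mu> powr (1 - r / q) = b powr (r * (1 - r / q)) * k powr (- (r * (1 - r / q))) * Y powr (1 - r / q)"
      using b k Y by (simp add: \<mu>_def powr_mult powr_divide powr_powr powr_minus_divide)
    have "W powr (r / q) = level_const CARD('n) m p \<Lambda>\<^sub>0 \<Lambda>\<^sub>1 powr (r / q) * E powr \<gamma>"
      using LC E0 by (simp add: W_def powr_mult powr_powr \<gamma>_def)
    also have "E powr \<gamma> = (4 powr p) powr \<gamma> * b powr (r * \<gamma>) * H powr \<gamma> * Y powr \<gamma>"
      using b H Y by (simp add: E_def powr_mult powr_powr)
    finally have 2: "W powr (r / q) = level_const CARD('n) m p \<Lambda>\<^sub>0 \<Lambda>\<^sub>1 powr (r / q) * ((4 powr p) powr \<gamma> * b powr (r * \<gamma>) * H powr \<gamma> * Y powr \<gamma>)" .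
    have 3: "b powr (r * (1 - r / q)) * b powr (r * \<gamma>) = b powr (r * (1 + \<beta>))"
      unfolding powr_add[symmetric] \<gamma>_def distrib_left[symmetric] ex(6) ..
    have 4: "Y powr (1 - r / q) * Y powr \<gamma> = Y powr (1 + \<beta>)"
      unfolding powr_add[symmetric] \<gamma>_def ex(6) ..
    have 5: "b powr (r * (1 + \<beta>)) = 4 powr (r * (1 + \<beta>)) * (b / 4) powr (r * (1 + \<beta>))"
      using b by (simp add: powr_divide)
    have 6: "k powr (- (r * (1 - r / q))) = k powr (- \<beta> * (2 * (p * (N + 2) - 2 * N) / (p * (N + 2))))"
      using ex(7) by simp
    have 7: "H powr \<gamma> = H powr (\<beta> * ((N + p) / p))" using ex(5) by (simp add: \<gamma>_def)
    have 8: "iter_const CARD('n) m p \<Lambda>\<^sub>0 \<Lambda>\<^sub>1 = (1 + 2 powr r / (1 - 2 powr (r - q))) * level_const CARD('n) m p \<Lambda>\<^sub>0 \<Lambda>\<^sub>1 powr (r / q)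
        * (4 powr p) powr \<gamma> * 4 powr (r * (1 + \<beta>))"
      by (simp add: iter_const_def Let_def r \<beta> q_def \<gamma>_def N_def)
    have "(1 + 2 powr r / (1 - 2 powr (r - q))) * \<mu> powr (1 - r / q) * W powr (r / q)
      = (1 + 2 powr r / (1 - 2 powr (r - q))) * level_const CARD('n) m p \<Lambda>\<^sub>0 \<Lambda>\<^sub>1 powr (r / q) * (4 powr p) powr \<gamma>
        * (b powr (r * (1 - r / q)) * b powr (r * \<gamma>)) * (k powr (- (r * (1 - r / q))) * H powr \<gamma>) * (Y powr (1 - r / q) * Y powr \<gamma>)"
      unfolding 1 2 by (simp only: mult_ac)
    also have "\<dots> = (1 + 2 powr r / (1 - 2 powr (r - q))) * level_const CARD('n) m p \<Lambda>\<^sub>0 \<Lambda>\<^sub>1 powr (r / q) * (4 powr p) powr \<gamma>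
        * (4 powr (r * (1 + \<beta>)) * (b / 4) powr (r * (1 + \<beta>)))
        * (k powr (- \<beta> * (2 * (p * (N + 2) - 2 * N) / (p * (N + 2)))) * H powr (\<beta> * ((N + p) / p))) * Y powr (1 + \<beta>)"
      by (simp only: 3 4 5 6 7)
    also have "\<dots> = iter_const CARD('n) m p \<Lambda>\<^sub>0 \<Lambda>\<^sub>1 * (b / 4) powr (r * (1 + \<beta>)) *
        (k powr (- \<beta> * (2 * (p * (N + 2) - 2 * N) / (p * (N + 2)))) * H powr (\<beta> * ((N + p) / p))) * Y powr (1 + \<beta>)"
      unfolding 8 by (simp only: mult_ac)
    finally show ?thesis .
  qed
  finally show ?thesis by (simp only: N_def H_def)
qed

section \<open>The iteration and the supremum bound\<close>

text \<open>Fast geometric convergence. If \<open>Y\<^sub>n\<^sub>+\<^sub>1 \<le> G B\<^sup>n Y\<^sub>n powr (1 + \<beta>)\<close>, then the bound \<open>Y * B powr (- n / \<beta>)\<close>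
  reproduces itself exactly when \<open>G * Y powr \<beta> \<le> B powr (- 1 / \<beta>)\<close>.\<close>

proposition de_giorgi_iteration:
  fixes u :: "(real ^ 'n::finite) \<times> real \<Rightarrow> real" and D a :: "(real ^ 'n) \<times> real \<Rightarrow> real ^ 'n"
  assumes sol: "local_solution \<rho> \<theta> u D a"
    and p: "1 < p" "2 * real CARD('n) / (real CARD('n) + 2) < p" "p \<le> real (Suc m)" and L: "0 < \<Lambda>\<^sub>0" "0 < \<Lambda>\<^sub>1"
    and str: "AE w in lborel. \<Lambda>\<^sub>0 * norm (D w) powr p \<le> a w \<bullet> D w \<and> norm (a w) \<le> \<Lambda>\<^sub>1 * norm (D w) powr (p - 1)"
    and Dp: "integrable lborel (\<lambda>w. norm (D w) powr p)"
    and up: "integrable lborel (\<lambda>w. \<bar>u w\<bar> powr p)" and u2: "integrable lborel (\<lambda>w. \<bar>u w\<bar> powr 2)"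
    and r: "r = p + 4 / (real CARD('n) + 2)" and \<beta>: "\<beta> = r / (real CARD('n) + 2)"
    and pos: "0 < \<rho>" "0 < \<theta>" "0 < \<sigma>" "\<sigma> < 1" and k: "1 \<le> k"
    and Y: "(\<integral>\<^sup>+w. ennreal (indicator (cylinder \<rho> \<theta>) w * (max (u w) 0) powr r) \<partial>lborel) \<le> ennreal Y" "0 < Y"
    and small: "iter_const CARD('n) m p \<Lambda>\<^sub>0 \<Lambda>\<^sub>1 *
        (k powr (- \<beta> * (2 * (p * (real CARD('n) + 2) - 2 * real CARD('n)) / (p * (real CARD('n) + 2))))
          * ((1 - \<sigma>) powr (- p) * (\<rho> powr (- p) + 1 / \<theta>)) powr (\<beta> * ((real CARD('n) + p) / p))) * Y powr \<beta>
      \<le> (2 powr (r * (1 + \<beta>))) powr (- 1 / \<beta>)"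
  shows "AE w in lborel. w \<in> cylinder (\<sigma> * \<rho>) (\<sigma> * \<theta>) \<longrightarrow> u w \<le> k"
proof -
  have N: "1 \<le> real CARD('n)" by (simp add: Suc_leI)
  note ex = iteration_exponents[OF N p(1,2) r refl \<beta>]
  have [measurable]: "u \<in> borel_measurable borel" using sol by (auto simp: local_solution_def)
  have cyl[measurable]: "(cylinder x y :: ((real ^ 'n) \<times> real) set) \<in> sets borel" for x y by (rule cylinder_facts)
  define B where "B = 2 powr (r * (1 + \<beta>))"
  have B: "1 < B" using ex by (simp add: B_def)
  \<comment> \<open>with \<open>b = 2 ^ (n + 2)\<close> the differences of consecutive radii and levels are those required by one step\<close>
  define R where "R n = \<sigma> * \<rho> + (1 - \<sigma>) * \<rho> / 2 ^ n" for n :: nat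
  define S where "S n = \<sigma> * \<theta> + (1 - \<sigma>) * \<theta> / 2 ^ n" for n :: nat
  define \<kappa> where "\<kappa> n = k * (1 - 1 / 2 ^ n)" for n :: nat
  define X where "X n = (\<integral>\<^sup>+w. ennreal (indicator (cylinder (R n) (S n)) w * (max (u w - \<kappa> n) 0) powr r) \<partial>lborel)" for n
  define G where "G = iter_const CARD('n) m p \<Lambda>\<^sub>0 \<Lambda>\<^sub>1 *
        (k powr (- \<beta> * (2 * (p * (real CARD('n) + 2) - 2 * real CARD('n)) / (p * (real CARD('n) + 2))))
          * ((1 - \<sigma>) powr (- p) * (\<rho> powr (- p) + 1 / \<theta>)) powr (\<beta> * ((real CARD('n) + p) / p)))"
  have small': "G * Y powr \<beta> \<le> B powr (- 1 / \<beta>)" using small by (simp only: G_def B_def)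
  define y where "y n = Y * B powr (- (real n / \<beta>))" for n :: nat
  have y0: "0 < y n" for n using Y B by (simp add: y_def)
  have two: "1 \<le> (2::real) ^ n" for n by simp
  have main: "X n \<le> ennreal (y n)" for n
  proof (induction n)
    case 0
    then show ?case using Y B by (simp add: X_def y_def R_def S_def \<kappa>_def algebra_simps)
  next
    case (Suc n)
    have st: "X (Suc n) \<le> ennreal (iter_const CARD('n) m p \<Lambda>\<^sub>0 \<Lambda>\<^sub>1 * (2 ^ (n + 2) / 4) powr (r * (1 + \<beta>)) *
        (k powr (- \<beta> * (2 * (p * (real CARD('n) + 2) - 2 * real CARD('n)) / (p * (real CARD('n) + 2))))
          * ((1 - \<sigma>) powr (- p) * (\<rho> powr (- p) + 1 / \<theta>)) powr (\<beta> * ((real CARD('n) + p) / p))) * y n powr (1 + \<beta>))"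
      unfolding X_def
    proof (rule de_giorgi_step[OF sol p L str Dp up u2 r \<beta> pos k])
      have half: "c / 2 ^ Suc n < c / 2 ^ n" if "0 < c" for c :: real using that by (simp add: field_simps)
      have small: "c / 2 ^ n \<le> c" if "0 < c" for c :: real using that two[of n] by (simp add: divide_le_eq)
      have diff: "c / 2 ^ n - c / 2 ^ Suc n = c * 2 / 2 ^ (n + 2)" for c :: real by (simp add: field_simps)
      show "0 < R (Suc n)" "0 < S (Suc n)" using pos by (auto simp: R_def S_def intro!: add_pos_nonneg)
      show "R (Suc n) < R n" "S (Suc n) < S n" unfolding R_def S_def using pos half by auto
      show "R n \<le> \<rho>" "S n \<le> \<theta>"
        using small[of "(1 - \<sigma>) * \<rho>"] small[of "(1 - \<sigma>) * \<theta>"] pos by (auto simp: R_def S_def algebra_simps)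
      show "R n - R (Suc n) = (1 - \<sigma>) * \<rho> * 2 / 2 ^ (n + 2)" "S n - S (Suc n) = (1 - \<sigma>) * \<theta> * 2 / 2 ^ (n + 2)"
        using diff[of "(1 - \<sigma>) * \<rho>"] diff[of "(1 - \<sigma>) * \<theta>"] by (simp_all only: R_def S_def add_diff_cancel_left)
      show "(1::real) \<le> 2 ^ (n + 2)" by (rule two)
      show "0 \<le> \<kappa> n" using k two[of n] by (simp add: \<kappa>_def)
      show "\<kappa> (Suc n) - \<kappa> n = 2 * k / 2 ^ (n + 2)" by (simp add: \<kappa>_def field_simps)
      show "(\<integral>\<^sup>+w. ennreal (indicator (cylinder (R n) (S n)) w * (max (u w - \<kappa> n) 0) powr r) \<partial>lborel) \<le> ennreal (y n)"
        using Suc by (simp only: X_def)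
    qed (fact y0)
    have b4: "((2::real) ^ (n + 2) / 4) powr (r * (1 + \<beta>)) = B powr real n"
    proof -
      have "(2::real) ^ (n + 2) / 4 = 2 powr real n" by (simp add: powr_realpow)
      then show ?thesis by (simp add: B_def powr_powr mult.commute)
    qed
    have yb: "y n powr (1 + \<beta>) = y n * (Y powr \<beta> * B powr (- real n))"
    proof -
      have "y n powr \<beta> = Y powr \<beta> * B powr (- real n)"
        using ex(4) by (simp add: y_def powr_mult powr_powr)
      then show ?thesis using y0[of n] by (simp add: powr_add)
    qed
    have Bn: "B powr real n * B powr (- real n) = 1" using B by (simp add: powr_add[symmetric])
    have "iter_const CARD('n) m p \<Lambda>\<^sub>0 \<Lambda>\<^sub>1 * (2 ^ (n + 2) / 4) powr (r * (1 + \<beta>)) *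
        (k powr (- \<beta> * (2 * (p * (real CARD('n) + 2) - 2 * real CARD('n)) / (p * (real CARD('n) + 2))))
          * ((1 - \<sigma>) powr (- p) * (\<rho> powr (- p) + 1 / \<theta>)) powr (\<beta> * ((real CARD('n) + p) / p))) * y n powr (1 + \<beta>)
      = G * Y powr \<beta> * (B powr real n * B powr (- real n)) * y n"
      unfolding b4 yb G_def by (simp only: mult_ac)
    also have "\<dots> = G * Y powr \<beta> * y n" unfolding Bn by simp
    also have "\<dots> \<le> B powr (- 1 / \<beta>) * y n" by (rule mult_right_mono[OF small' less_imp_le[OF y0]])
    also have "\<dots> = y (Suc n)"
      by (simp add: y_def powr_add[symmetric] add_divide_distrib mult.left_commute)
    finally show ?case using st by (meson ennreal_leI order_trans)
  qed
  define Z where "Z = (\<integral>\<^sup>+w. ennreal (indicator (cylinder (\<sigma> * \<rho>) (\<sigma> * \<theta>)) w * (max (u w - k) 0) powr r) \<partial>lborel)"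
  have "Z \<le> ennreal (y n)" for n
  proof -
    have "Z \<le> X n" unfolding Z_def X_def
    proof (intro nn_integral_mono ennreal_leI mult_mono)
      fix w :: "(real ^ 'n) \<times> real"
      have "\<sigma> * \<rho> \<le> R n" "\<sigma> * \<theta> \<le> S n" using pos by (auto simp: R_def S_def)
      then show "indicator (cylinder (\<sigma> * \<rho>) (\<sigma> * \<theta>)) w \<le> (indicator (cylinder (R n) (S n)) w :: real)"
        using cylinder_facts(3)[of "fst w" "snd w" "\<sigma> * \<rho>" "\<sigma> * \<theta>"] cylinder_facts(3)[of "fst w" "snd w" "R n" "S n"]
        by (auto simp: indicator_def)
      have "\<kappa> n \<le> k" using k by (simp add: \<kappa>_def mult_left_le)
      then show "(max (u w - k) 0) powr r \<le> (max (u w - \<kappa> n) 0) powr r" using ex by (intro powr_mono2) auto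
    qed auto
    then show ?thesis using main[of n] by (rule order_trans)
  qed
  moreover have "(\<lambda>n. ennreal (y n)) \<longlonglongrightarrow> ennreal 0"
  proof (rule tendsto_ennrealI)
    have "B powr (- 1 / \<beta>) < B powr 0" using B ex(4) by (intro powr_less_mono) (auto simp: divide_neg_pos)
    then have "(\<lambda>n. (B powr (- 1 / \<beta>)) ^ n) \<longlonglongrightarrow> 0" using B by (intro LIMSEQ_realpow_zero) auto
    then have "(\<lambda>n. Y * (B powr (- 1 / \<beta>)) ^ n) \<longlonglongrightarrow> Y * 0" by (intro tendsto_mult tendsto_const)
    moreover have "(B powr (- 1 / \<beta>)) ^ n = B powr (- (real n / \<beta>))" for n
      using B by (simp add: powr_realpow[symmetric] powr_powr)
    ultimately show "y \<longlonglongrightarrow> 0" by (simp add: y_def[abs_def])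
  qed
  ultimately have "Z \<le> ennreal 0" by (intro LIMSEQ_le_const) auto
  then have "Z = 0" by simp
  then have "AE w in lborel. ennreal (indicator (cylinder (\<sigma> * \<rho>) (\<sigma> * \<theta>)) w * (max (u w - k) 0) powr r) = 0"
    unfolding Z_def by (subst (asm) nn_integral_0_iff_AE) measurable
  then show ?thesis
  proof eventually_elim
    case (elim w)
    show ?case
    proof (intro impI, rule ccontr)
      assume w: "w \<in> cylinder (\<sigma> * \<rho>) (\<sigma> * \<theta>)" and "\<not> u w \<le> k"
      then have "0 < (max (u w - k) 0) powr r" by (simp add: powr_gt_zero)
      then show False using elim w by (simp add: ennreal_eq_0_iff)
    qed
  qed
qed

text \<open>In the sum on the left the larger of \<open>\<rho> powr (- p)\<close> and \<open>1 / \<theta>\<close> decides; the two cases lead to the two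
  terms on the right.\<close>

lemma intrinsic_factor_le:
  fixes \<rho> \<theta> p N :: real
  assumes "0 < \<rho>" "0 < \<theta>" "1 < p" "0 < N"
  shows "(\<rho> powr (- p) + 1 / \<theta>) powr ((N + p) / p) * (\<rho> powr N * \<theta>)
    \<le> 2 powr ((N + p) / p) * (\<theta> / \<rho> powr p + (\<rho> powr p / \<theta>) powr (N / p))"
proof (cases "\<rho> powr p \<le> \<theta>")
  case True
  have "\<rho> powr (- p) + 1 / \<theta> \<le> 2 * \<rho> powr (- p)"
    using True assms by (simp add: powr_minus divide_inverse le_imp_inverse_le)
  then have "(\<rho> powr (- p) + 1 / \<theta>) powr ((N + p) / p) \<le> (2 * \<rho> powr (- p)) powr ((N + p) / p)"
    using assms by (intro powr_mono2) auto
  also have "\<dots> = 2 powr ((N + p) / p) * \<rho> powr (- (N + p))"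
    using assms by (simp add: powr_mult powr_powr)
  finally have "(\<rho> powr (- p) + 1 / \<theta>) powr ((N + p) / p) * (\<rho> powr N * \<theta>)
     \<le> 2 powr ((N + p) / p) * \<rho> powr (- (N + p)) * (\<rho> powr N * \<theta>)"
    using assms by (intro mult_right_mono) auto
  also have "\<dots> = 2 powr ((N + p) / p) * (\<theta> * (\<rho> powr (- (N + p)) * \<rho> powr N))" by (simp only: mult_ac)
  also have "\<rho> powr (- (N + p)) * \<rho> powr N = 1 / \<rho> powr p"
    using assms by (simp add: powr_add[symmetric] powr_minus divide_inverse)
  finally have "(\<rho> powr (- p) + 1 / \<theta>) powr ((N + p) / p) * (\<rho> powr N * \<theta>) \<le> 2 powr ((N + p) / p) * (\<theta> / \<rho> powr p)" by simp
  also have "\<dots> \<le> 2 powr ((N + p) / p) * (\<theta> / \<rho> powr p + (\<rho> powr p / \<theta>) powr (N / p))"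
    by (intro mult_left_mono) auto
  finally show ?thesis .
next
  case False
  have "\<rho> powr (- p) + 1 / \<theta> \<le> 2 * (1 / \<theta>)"
    using False assms by (simp add: powr_minus divide_inverse le_imp_inverse_le)
  then have "(\<rho> powr (- p) + 1 / \<theta>) powr ((N + p) / p) \<le> (2 * (1 / \<theta>)) powr ((N + p) / p)"
    using assms by (intro powr_mono2) auto
  also have "\<dots> = 2 powr ((N + p) / p) * (1 / \<theta>) powr (N / p + 1)"
    using assms by (simp only: powr_mult) (simp add: add_divide_distrib)
  also have "(1 / \<theta>) powr (N / p + 1) = (1 / \<theta>) powr (N / p) * (1 / \<theta>)"
    using assms by (simp add: powr_add)
  finally have "(\<rho> powr (- p) + 1 / \<theta>) powr ((N + p) / p) * (\<rho> powr N * \<theta>)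
     \<le> 2 powr ((N + p) / p) * ((1 / \<theta>) powr (N / p) * (1 / \<theta>)) * (\<rho> powr N * \<theta>)"
    using assms by (intro mult_right_mono) auto
  also have "\<dots> = 2 powr ((N + p) / p) * (\<rho> powr N * (1 / \<theta>) powr (N / p))" using assms by simp
  also have "\<rho> powr N * (1 / \<theta>) powr (N / p) = (\<rho> powr p / \<theta>) powr (N / p)"
    using assms by (simp add: powr_divide powr_powr)
  also have "2 powr ((N + p) / p) * (\<rho> powr p / \<theta>) powr (N / p) \<le> 2 powr ((N + p) / p) * (\<theta> / \<rho> powr p + (\<rho> powr p / \<theta>) powr (N / p))"
    using assms by (intro mult_left_mono) auto
  finally show ?thesis .
qed

lemma emeasure_cylinder:
  assumes "0 < \<rho>" "0 < \<theta>"
  shows "emeasure lebesgue (cylinder \<rho> \<theta> :: ((real ^ 'n::finite) \<times> real) set) = ennreal (unit_ball_vol (real CARD('n)) * \<rho> powr real CARD('n) * (2 * \<theta>))"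
proof -
  have "emeasure lebesgue (cylinder \<rho> \<theta> :: ((real ^ 'n) \<times> real) set) = emeasure (lborel \<Otimes>\<^sub>M lborel) (ball (0 :: real ^ 'n) \<rho> \<times> {-\<theta>..\<theta>})"
    using cylinder_facts(1)[of \<rho> \<theta>, where 'a="real ^ 'n"] by (simp add: lborel_prod cylinder_def)
  also have "\<dots> = emeasure lborel (ball (0 :: real ^ 'n) \<rho>) * emeasure lborel {-\<theta>..\<theta>}"
    by (rule lborel.emeasure_pair_measure_Times) auto
  also have "\<dots> = ennreal (unit_ball_vol (real CARD('n)) * \<rho> ^ CARD('n)) * ennreal (2 * \<theta>)"
    using assms by (simp add: emeasure_ball)
  finally show ?thesis using assms by (simp add: ennreal_mult powr_realpow)
qed

lemma integrable_powr_smaller: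
  fixes u :: "'a::euclidean_space \<Rightarrow> real"
  assumes [measurable]: "u \<in> borel_measurable borel" "Q \<in> sets borel" and Q: "emeasure lborel Q < \<infinity>" "\<And>w. w \<notin> Q \<Longrightarrow> u w = 0"
    and s: "0 < s" "s \<le> r" and ir: "integrable lborel (\<lambda>w. \<bar>u w\<bar> powr r)"
  shows "integrable lborel (\<lambda>w. \<bar>u w\<bar> powr s)"
proof -
  have iQ: "integrable lborel (indicator Q :: 'a \<Rightarrow> real)" using Q by (intro integrable_real_indicator) auto
  show ?thesis
  proof (rule Bochner_Integration.integrable_bound[OF Bochner_Integration.integrable_add[OF iQ ir]])
    have "\<bar>u w\<bar> powr s \<le> indicator Q w + \<bar>u w\<bar> powr r" for w
    proof (cases "1 \<le> \<bar>u w\<bar>")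
      case True
      then have "\<bar>u w\<bar> powr s \<le> \<bar>u w\<bar> powr r" using s by (intro powr_mono) auto
      then show ?thesis by (simp add: indicator_def)
    next
      case False
      then have "\<bar>u w\<bar> powr s \<le> 1 powr s" using s by (intro powr_mono2) auto
      then show ?thesis using Q(2)[of w] s by (cases "w \<in> Q") (auto simp: indicator_def intro!: add_increasing2)
    qed
    then show "AE w in lborel. norm (\<bar>u w\<bar> powr s) \<le> norm (indicator Q w + \<bar>u w\<bar> powr r)"
      by (intro AE_I2) (simp add: order_trans[OF _ abs_ge_self])
  qed measurable
qed

theorem theorem1p3:
  fixes N :: nat and p \<Lambda>\<^sub>0 \<Lambda>\<^sub>1 \<epsilon>\<^sub>0 :: real
  assumes "N = CARD('n::finite)"
    and "1 < p" and "2 * real N / (real N + 2) < p"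
    and "0 < \<Lambda>\<^sub>0" and "\<Lambda>\<^sub>0 \<le> \<Lambda>\<^sub>1"
    and "\<epsilon>\<^sub>0 = 4 / (real N + 2)"
  shows "\<exists>C > 0. \<forall>(\<Omega> :: (real ^ 'n) set) (T :: real)
           (A :: real ^ 'n \<Rightarrow> real \<Rightarrow> real ^ 'n \<Rightarrow> real ^ 'n)
           (u :: real ^ 'n \<Rightarrow> real \<Rightarrow> real) (Du :: real ^ 'n \<Rightarrow> real \<Rightarrow> real ^ 'n)
           (\<sigma> :: real) (\<rho> :: real) (\<theta> :: real).
      open \<Omega> \<and> 0 < T \<and>
      weak_solution \<Omega> T p A u Du \<and>
      structure_conditions \<Omega> T p \<Lambda>\<^sub>0 \<Lambda>\<^sub>1 A Du \<and>
      (AE (x, t) in lebesgue_on (\<Omega> \<times> {-T<..<T}). u x t \<ge> 0) \<and>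
      0 < \<sigma> \<and> \<sigma> < 1 \<and> 0 < \<rho> \<and> 0 < \<theta> \<and>
      closure (ball 0 \<rho>) \<times> {-\<theta>..\<theta>} \<subseteq> \<Omega> \<times> {-T<..<T} \<longrightarrow>
      (let \<A> = \<theta> / \<rho> powr p + (\<rho> powr p / \<theta>) powr (real N / p);
           Q = (cylinder \<rho> \<theta> :: ((real ^ 'n) \<times> real) set)
       in esssup (lebesgue_on (cylinder (\<sigma> * \<rho>) (\<sigma> * \<theta>))) (\<lambda>(x, t). ennreal (u x t))
          \<le> max (ennreal (C *
                    (\<A> powr (p * (real N + 2) / (2 * (p * (real N + 2) - 2 * real N)))
                     / (1 - \<sigma>) powr (p * (real N + p) * (real N + 2) / (2 * (p * (real N + 2) - 2 * real N)))))
                  * ennpowr ((\<integral>\<^sup>+ (x, t). ennreal (\<bar>u x t\<bar> powr (p + \<epsilon>\<^sub>0)) \<partial>lebesgue_on Q) / emeasure lebesgue Q)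
                      (p * (real N + 2) / (2 * (p * (real N + 2) - 2 * real N))))
                1)"
proof -
  define n where "n = real CARD('n)"
  have Nn: "real N = n" by (simp add: assms(1) n_def)
  have n: "1 \<le> n" by (simp add: n_def Suc_leI)
  have p: "1 < p" "2 * n / (n + 2) < p" using assms(2,3) unfolding Nn by auto
  have L: "0 < \<Lambda>\<^sub>0" "0 < \<Lambda>\<^sub>1" using assms by auto
  \<comment> \<open>the cutoffs enter with the power \<open>Suc m \<ge> p\<close>\<close>
  define m where "m = nat \<lceil>p\<rceil>"
  have pm: "p \<le> real (Suc m)" unfolding m_def by linarith
  define r where "r = p + 4 / (n + 2)"
  define \<beta> where "\<beta> = r / (n + 2)"
  note ex = iteration_exponents[OF n p r_def refl \<beta>_def]
  define \<alpha> where "\<alpha> = p * (n + 2) / (2 * (p * (n + 2) - 2 * n))"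
  have \<alpha>: "0 < \<alpha>" using ex(8) p n by (simp add: \<alpha>_def)
  have \<alpha>inv: "2 * (p * (n + 2) - 2 * n) / (p * (n + 2)) = 1 / \<alpha>" by (simp add: \<alpha>_def)
  define E where "E = (n + p) / p"
  define IC where "IC = iter_const CARD('n) m p \<Lambda>\<^sub>0 \<Lambda>\<^sub>1"
  have IC: "0 < IC"
  proof -
    have "0 < level_const CARD('n) m p \<Lambda>\<^sub>0 \<Lambda>\<^sub>1" using L by (intro level_const_pos) auto
    moreover have "2 powr (r - (p + 2 * p / n)) < (1::real)" using ex(3) by (simp add: powr_less_one)
    ultimately show ?thesis
      unfolding IC_def iter_const_def Let_def n_def[symmetric] r_def[symmetric]
      by (intro mult_pos_pos add_pos_nonneg divide_nonneg_pos) auto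
  qed
  define B where "B = 2 powr (r * (1 + \<beta>))"
  have B: "0 < B" by (simp add: B_def)
  \<comment> \<open>with this constant, \<open>k powr (1 / \<alpha>) \<ge> C5 * h powr E * Y\<close> is the smallness condition of the iteration\<close>
  define C5 where "C5 = (IC * B powr (1 / \<beta>)) powr (1 / \<beta>)"
  have C5: "0 < C5" using IC B by (simp add: C5_def)
  have C5\<beta>: "C5 powr \<beta> = IC * B powr (1 / \<beta>)" using ex(4) IC B by (simp add: C5_def powr_powr)
  define \<omega> where "\<omega> = unit_ball_vol n"
  have \<omega>: "0 < \<omega>" using n by (simp add: \<omega>_def)
  define C6 where "C6 = C5 * 2 powr E * (2 * \<omega>)"
  have C6: "0 < C6" using C5 \<omega> by (simp add: C6_def)
  show ?thesis
  proof (rule exI[of _ "C6 powr \<alpha>"], intro conjI allI impI)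
    show "0 < C6 powr \<alpha>" using C6 by simp
    fix \<Omega> :: "(real ^ 'n) set" and T :: real and A :: "real ^ 'n \<Rightarrow> real \<Rightarrow> real ^ 'n \<Rightarrow> real ^ 'n"
      and u :: "real ^ 'n \<Rightarrow> real \<Rightarrow> real" and Du :: "real ^ 'n \<Rightarrow> real \<Rightarrow> real ^ 'n" and \<sigma> \<rho> \<theta> :: real
    assume H: "open \<Omega> \<and> 0 < T \<and>
      weak_solution \<Omega> T p A u Du \<and>
      structure_conditions \<Omega> T p \<Lambda>\<^sub>0 \<Lambda>\<^sub>1 A Du \<and>
      (AE (x, t) in lebesgue_on (\<Omega> \<times> {-T<..<T}). u x t \<ge> 0) \<and>
      0 < \<sigma> \<and> \<sigma> < 1 \<and> 0 < \<rho> \<and> 0 < \<theta> \<and>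
      closure (ball 0 \<rho>) \<times> {-\<theta>..\<theta>} \<subseteq> \<Omega> \<times> {-T<..<T}"
    then have op: "open \<Omega>" and ws: "weak_solution \<Omega> T p A u Du" and sc: "structure_conditions \<Omega> T p \<Lambda>\<^sub>0 \<Lambda>\<^sub>1 A Du"
      and pos: "0 < \<rho>" "0 < \<theta>" "0 < \<sigma>" "\<sigma> < 1"
      and sub: "closure (ball 0 \<rho>) \<times> {-\<theta>..\<theta>} \<subseteq> \<Omega> \<times> {-T<..<T}" by blast+
    obtain u0 D0 a0 where sol: "local_solution \<rho> \<theta> u0 D0 a0"
      and ae: "AE w in lborel. w \<in> cylinder \<rho> \<theta> \<longrightarrow> u0 w = u (fst w) (snd w)"
      and str: "AE w in lborel. \<Lambda>\<^sub>0 * norm (D0 w) powr p \<le> a0 w \<bullet> D0 w \<and> norm (a0 w) \<le> \<Lambda>\<^sub>1 * norm (D0 w) powr (p - 1)"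
      and Dp: "integrable lborel (\<lambda>w. norm (D0 w) powr p)"
      using weak_solution_local_representative[OF op ws sc p(1) L(2) pos(1,2) sub] by blast
    define Q where "Q = (cylinder \<rho> \<theta> :: ((real ^ 'n) \<times> real) set)"
    define Q' where "Q' = (cylinder (\<sigma> * \<rho>) (\<sigma> * \<theta>) :: ((real ^ 'n) \<times> real) set)"
    have Qm[measurable]: "Q \<in> sets borel" "Q' \<in> sets borel" unfolding Q_def Q'_def by (rule cylinder_facts)+
    have u0m[measurable]: "u0 \<in> borel_measurable borel" using sol by (auto simp: local_solution_def)
    have u0z: "u0 w = 0" if "w \<notin> Q" for w using sol that unfolding local_solution_def Q_def by blast
    define I where "I = (\<integral>\<^sup>+ (x, t). ennreal (\<bar>u x t\<bar> powr (p + \<epsilon>\<^sub>0)) \<partial>lebesgue_on Q)"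
    have pe: "p + \<epsilon>\<^sub>0 = r" by (simp add: assms(6) r_def Nn)
    have I: "I = (\<integral>\<^sup>+w. ennreal (\<bar>u0 w\<bar> powr r) \<partial>lborel)"
      unfolding I_def pe nn_integral_lebesgue_on[OF Qm(1)]
    proof (rule nn_integral_cong_AE, use ae in eventually_elim)
      case (elim w)
      then show ?case using u0z[of w] ex(1) by (cases "w \<in> Q") (auto simp: Q_def[symmetric] case_prod_unfold)
    qed
    define V where "V = \<omega> * \<rho> powr n * (2 * \<theta>)"
    have V: "0 < V" "emeasure lebesgue Q = ennreal V"
      using \<omega> pos emeasure_cylinder[OF pos(1,2), where 'n='n] by (auto simp: V_def Q_def \<omega>_def n_def)
    define \<A> where "\<A> = \<theta> / \<rho> powr p + (\<rho> powr p / \<theta>) powr (n / p)"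
    have \<A>: "0 < \<A>" using pos by (simp add: \<A>_def add_pos_nonneg)
    define C where "C = C6 powr \<alpha> * (\<A> powr \<alpha> / (1 - \<sigma>) powr ((n + p) * \<alpha>))"
    have C: "0 < C" using C6 \<A> pos by (simp add: C_def)
    have "esssup (lebesgue_on Q') (\<lambda>(x, t). ennreal (u x t)) \<le> max (ennreal C * ennpowr (I / ennreal V) \<alpha>) 1"
    proof (cases "I = top")
      case True
      then show ?thesis using C by (simp add: ennpowr_def ennreal_top_divide ennreal_mult_top)
    next
      case False
      define i where "i = enn2real I"
      have i: "I = ennreal i" "0 \<le> i" using False by (auto simp: i_def less_top)
      have ir: "integrable lborel (\<lambda>w. \<bar>u0 w\<bar> powr r)"
        by (rule integrableI_bounded) (use i in \<open>auto simp: I[symmetric]\<close>)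
      have Qfin: "emeasure lborel Q < \<infinity>" unfolding Q_def by (rule cylinder_facts)
      have up: "integrable lborel (\<lambda>w. \<bar>u0 w\<bar> powr p)" and u2: "integrable lborel (\<lambda>w. \<bar>u0 w\<bar> powr 2)"
        by (rule integrable_powr_smaller[OF u0m Qm(1) Qfin u0z _ _ ir]; use ex(1,2) p in simp)+
      define h where "h = (1 - \<sigma>) powr (- p) * (\<rho> powr (- p) + 1 / \<theta>)"
      have h: "0 < h" using pos by (simp add: h_def add_pos_pos)
      define c where "c = C5 * h powr E"
      have c: "0 < c" using C5 h by (simp add: c_def)
      \<comment> \<open>the iteration needs a positive bound; if the integral vanishes, \<open>1 / c\<close> makes \<open>k = 1\<close> admissible\<close>
      define Y where "Y = (if i = 0 then 1 / c else i)"
      have Y: "0 < Y" "i \<le> Y" using i c by (auto simp: Y_def)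
      define k where "k = max 1 ((c * Y) powr \<alpha>)"
      have k: "1 \<le> k" by (simp add: k_def)
      have "AE w in lborel. w \<in> cylinder (\<sigma> * \<rho>) (\<sigma> * \<theta>) \<longrightarrow> u0 w \<le> k"
      proof (rule de_giorgi_iteration[OF sol p(1) p(2)[unfolded n_def] pm L str Dp up u2 r_def[unfolded n_def] \<beta>_def[unfolded n_def] pos k _ Y(1)])
        have "(\<integral>\<^sup>+w. ennreal (indicator (cylinder \<rho> \<theta>) w * (max (u0 w) 0) powr r) \<partial>lborel) \<le> I"
          unfolding I using ex(1) by (intro nn_integral_mono ennreal_leI) (auto simp: indicator_def intro!: powr_mono2)
        also have "\<dots> \<le> ennreal Y" using Y i by (simp add: ennreal_leI)
        finally show "(\<integral>\<^sup>+w. ennreal (indicator (cylinder \<rho> \<theta>) w * (max (u0 w) 0) powr r) \<partial>lborel) \<le> ennreal Y" .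
        have "k powr (- \<beta> * (1 / \<alpha>)) \<le> ((c * Y) powr \<alpha>) powr (- \<beta> * (1 / \<alpha>))"
          using c Y ex(4) \<alpha> by (intro powr_mono2') (auto simp: k_def)
        also have "\<dots> = (c * Y) powr (- \<beta>)" using \<alpha> by (simp add: powr_powr)
        also have "\<dots> = 1 / (IC * B powr (1 / \<beta>) * h powr (\<beta> * E) * Y powr \<beta>)"
          using C5\<beta> by (simp add: c_def powr_minus powr_mult powr_powr divide_inverse mult.commute[of \<beta>])
        finally have "IC * (k powr (- \<beta> * (1 / \<alpha>)) * h powr (\<beta> * E)) * Y powr \<beta>
            \<le> IC * ((1 / (IC * B powr (1 / \<beta>) * h powr (\<beta> * E) * Y powr \<beta>)) * h powr (\<beta> * E)) * Y powr \<beta>"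
          using IC by (intro mult_right_mono mult_left_mono) auto
        also have "\<dots> = B powr (- 1 / \<beta>)"
        proof -
          have cancel: "IC * ((1 / (IC * x * y * z)) * y) * z = 1 / x" if "y \<noteq> 0" "z \<noteq> 0" for x y z
            using that IC by (simp add: field_simps)
          have "B powr (- 1 / \<beta>) = 1 / B powr (1 / \<beta>)" by (simp add: powr_minus_divide[symmetric])
          then show ?thesis using h Y by (simp only: cancel powr_eq_0_iff)
        qed
        finally show "iter_const CARD('n) m p \<Lambda>\<^sub>0 \<Lambda>\<^sub>1 *
          (k powr (- \<beta> * (2 * (p * (real CARD('n) + 2) - 2 * real CARD('n)) / (p * (real CARD('n) + 2))))
            * ((1 - \<sigma>) powr (- p) * (\<rho> powr (- p) + 1 / \<theta>)) powr (\<beta> * ((real CARD('n) + p) / p))) * Y powr \<beta>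
          \<le> (2 powr (r * (1 + \<beta>))) powr (- 1 / \<beta>)"
          by (simp only: IC_def B_def h_def E_def \<alpha>inv n_def[symmetric])
      qed
      then have uk: "AE w in lborel. w \<in> Q' \<longrightarrow> u (fst w) (snd w) \<le> k"
        using ae
      proof eventually_elim
        case (elim w)
        have "w \<in> cylinder \<rho> \<theta>" if "w \<in> Q'"
        proof -
          have "\<sigma> * \<rho> \<le> \<rho>" "\<sigma> * \<theta> \<le> \<theta>" using pos by (auto simp: mult_left_le_one_le)
          then show ?thesis
            using that cylinder_facts(3)[of "fst w" "snd w" "\<sigma> * \<rho>" "\<sigma> * \<theta>"] cylinder_facts(3)[of "fst w" "snd w" \<rho> \<theta>]
            by (simp add: Q'_def)
        qed
        then show ?case using elim by (auto simp: Q'_def)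
      qed
      have Q'sub: "Q' \<subseteq> \<Omega> \<times> {-T<..<T}"
      proof
        fix w assume "w \<in> Q'"
        then have "norm (fst w) < \<sigma> * \<rho>" "\<bar>snd w\<bar> \<le> \<sigma> * \<theta>"
          using cylinder_facts(3)[of "fst w" "snd w" "\<sigma> * \<rho>" "\<sigma> * \<theta>"] by (auto simp: Q'_def)
        moreover have "\<sigma> * \<rho> \<le> \<rho>" "\<sigma> * \<theta> \<le> \<theta>" using pos by (auto simp: mult_left_le_one_le)
        ultimately have "fst w \<in> ball 0 \<rho>" "snd w \<in> {-\<theta>..\<theta>}" by auto
        then have "(fst w, snd w) \<in> closure (ball 0 \<rho>) \<times> {-\<theta>..\<theta>}" using closure_subset by blast
        from subsetD[OF sub this] show "w \<in> \<Omega> \<times> {-T<..<T}" by simp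
      qed
      have um: "(\<lambda>(x, t). ennreal (u x t)) \<in> borel_measurable (lebesgue_on Q')"
      proof -
        have "(\<lambda>(x, t). u x t) \<in> borel_measurable (lebesgue_on (\<Omega> \<times> {-T<..<T}))"
          using ws by (simp add: weak_solution_def)
        from measurable_restrict_mono[OF this Q'sub]
        have "(\<lambda>w. ennreal ((\<lambda>(x, t). u x t) w)) \<in> borel_measurable (lebesgue_on Q')" by measurable
        then show ?thesis by (simp add: case_prod_unfold)
      qed
      have "AE w in lebesgue_on Q'. (\<lambda>(x, t). ennreal (u x t)) w \<le> ennreal k"
        unfolding AE_lebesgue_on_iff[OF Qm(2)] using uk
        by eventually_elim (auto simp: case_prod_unfold intro: ennreal_leI)
      then have "esssup (lebesgue_on Q') (\<lambda>(x, t). ennreal (u x t)) \<le> ennreal k"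
        by (intro esssup_I um)
      also have "ennreal k \<le> max (ennreal C * ennpowr (I / ennreal V) \<alpha>) 1"
      proof (cases "i = 0")
        case True
        then have "k = 1" using c by (simp add: k_def Y_def)
        then show ?thesis by simp
      next
        case False
        then have Yi: "Y = i" by (simp add: Y_def)
        have "h powr E * V = (1 - \<sigma>) powr (- (n + p)) * ((\<rho> powr (- p) + 1 / \<theta>) powr E * (\<rho> powr n * \<theta>)) * (2 * \<omega>)"
          using p pos by (simp add: h_def V_def powr_mult powr_powr E_def)
        also have "\<dots> \<le> (1 - \<sigma>) powr (- (n + p)) * (2 powr E * \<A>) * (2 * \<omega>)"
          unfolding E_def \<A>_def using pos p n \<omega> by (intro mult_right_mono mult_left_mono intrinsic_factor_le) auto
        finally have hV: "h powr E * V \<le> (1 - \<sigma>) powr (- (n + p)) * (2 powr E * \<A>) * (2 * \<omega>)" .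
        have "c * Y = C5 * (h powr E * V) * (i / V)" using V by (simp add: c_def Yi)
        also have "\<dots> \<le> C5 * ((1 - \<sigma>) powr (- (n + p)) * (2 powr E * \<A>) * (2 * \<omega>)) * (i / V)"
          using C5 i V by (intro mult_right_mono mult_left_mono hV) auto
        also have "\<dots> = C6 * \<A> * (1 - \<sigma>) powr (- (n + p)) * (i / V)" by (simp add: C6_def mult_ac)
        finally have "(c * Y) powr \<alpha> \<le> (C6 * \<A> * (1 - \<sigma>) powr (- (n + p)) * (i / V)) powr \<alpha>"
          using c Y \<alpha> by (intro powr_mono2) auto
        also have "\<dots> = C * (i / V) powr \<alpha>"
          unfolding powr_minus_divide using pos by (simp add: C_def powr_mult powr_divide powr_powr)
        finally have 1: "(c * Y) powr \<alpha> \<le> C * (i / V) powr \<alpha>" .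
        have "ennpowr (I / ennreal V) \<alpha> = ennreal ((i / V) powr \<alpha>)"
          using i V by (simp add: ennpowr_def divide_ennreal)
        then have eC: "ennreal C * ennpowr (I / ennreal V) \<alpha> = ennreal (C * (i / V) powr \<alpha>)"
          using C by (simp add: ennreal_mult)
        have ek: "ennreal k = max 1 (ennreal ((c * Y) powr \<alpha>))"
          unfolding k_def by (simp add: ennreal_max_0 max_def ennreal_le_iff2 flip: ennreal_1)
        show ?thesis unfolding eC ek max.commute[of 1 "ennreal ((c * Y) powr \<alpha>)"]
          by (rule max.mono[OF ennreal_leI[OF 1] order_refl])
      qed
      finally show ?thesis .
    qed
    moreover have "p * (n + p) * (n + 2) / (2 * (p * (n + 2) - 2 * n)) = (n + p) * \<alpha>" by (simp add: \<alpha>_def)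
    ultimately show "let \<A> = \<theta> / \<rho> powr p + (\<rho> powr p / \<theta>) powr (real N / p);
           Q = (cylinder \<rho> \<theta> :: ((real ^ 'n) \<times> real) set)
       in esssup (lebesgue_on (cylinder (\<sigma> * \<rho>) (\<sigma> * \<theta>))) (\<lambda>(x, t). ennreal (u x t))
          \<le> max (ennreal (C6 powr \<alpha> *
                    (\<A> powr (p * (real N + 2) / (2 * (p * (real N + 2) - 2 * real N)))
                     / (1 - \<sigma>) powr (p * (real N + p) * (real N + 2) / (2 * (p * (real N + 2) - 2 * real N)))))
                  * ennpowr ((\<integral>\<^sup>+ (x, t). ennreal (\<bar>u x t\<bar> powr (p + \<epsilon>\<^sub>0)) \<partial>lebesgue_on Q) / emeasure lebesgue Q)
                      (p * (real N + 2) / (2 * (p * (real N + 2) - 2 * real N))))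
                1"
      unfolding Let_def Nn V(2)[unfolded Q_def] by (simp only: C_def \<A>_def I_def Q_def Q'_def \<alpha>_def[symmetric])
  qed
qed

end
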